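(* (i) Let $\theta\in(0,\pi)$ and $n\ge2$. Given a star-shaped $\theta$-capillary hypersurface $\Sigma\subset\overline{\mathbb{R}^{n+1}_+}$ with $K=\widehat\Sigma$ and a capillary convex body $L\in\mathcal{K}_\theta$, we have $$\int_\Sigma\ell(\nu(X))\,d\mu_g\ \ge\ (n+1)\,\mathrm{Vol}(K)^{\frac n{n+1}}\,\mathrm{Vol}(L)^{\frac1{n+1}},$$ where $\ell$ is the support function of $L$. Equality holds if and only if there exist a constant $c>0$ and a constant vector $b\in\partial\overline{\mathbb{R}^{n+1}_+}$ such that $K=cL+b$. (ii) Let $\theta\in(0,\frac\pi2]$ and $n\ge2$. Given two capillary convex bodies $K,L\in\mathcal{K}_\theta$, we have $$V\big(\underbrace{K,\dots,K}_{n-k\text{ copies}},\underbrace{L,\dots,L}_{k+1\text{ copies}}\big)\ \ge\ \mathrm{Vol}(K)^{\frac{n-k}{n+1}}\,\mathrm{Vol}(L)^{\frac{k+1}{n+1}},\qquad k=0,\dots,n-1.$$ Equality holds if and only if there exist a constant $c>0$ and a constant vector $b\in\partial\overline{\mathbb{R}^{n+1}_+}$ such that $K=cL+b$.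
   Context: $E_{n+1}$ is the $(n+1)$-th coordinate unit vector, $\mathbb{R}^{n+1}_+=\{x:\langle x,E_{n+1}\rangle>0\}$. Hypersurfaces $\Sigma\subset\overline{\mathbb{R}^{n+1}_+}$ are smooth, compact, embedded, orientable, with $\mathrm{int}(\Sigma)\subset\mathbb{R}^{n+1}_+$ and $\partial\Sigma\subset\partial\mathbb{R}^{n+1}_+$; $\widehat\Sigma$ is the bounded domain enclosed by $\Sigma$ and $\partial\mathbb{R}^{n+1}_+$, $\nu$ is the unit normal of $\Sigma$ pointing outward of $\widehat\Sigma$, and $d\mu_g$ the Euclidean induced area element. $\Sigma$ is a $\theta$-capillary hypersurface if $\langle\nu,E_{n+1}\rangle=\cos\theta$ along $\partial\Sigma$. Star-shaped (with respect to the origin) means that $\Sigma$ is a radial graph over the closed upper hemisphere, i.e. $\langle X,\nu\rangle>0$ on $\Sigma$. $\widehat\Sigma$ is a capillary convex body if it is a convex body (compact convex set with nonempty interior) and $\Sigma$ is a $\theta$-capillary hypersurface (convex bodies in the paper are understood to have strictly convex boundary hypersurface $\Sigma$); $\mathcal{K}_\theta$ is the class of these bodies. The support function of $L$ is $\ell(z)=\sup_{x\in L}\langle x,z\rangle$, $z\in\mathbb{S}^n$. The mixed volume $V(K_1,\dots,K_{n+1})$ of bodies in $\mathcal{K}_\theta$ is the symmetric function determined by $$\Big|\sum_{i=1}^m\lambda_iK_i\Big|=\sum_{i_1,\dots,i_{n+1}=1}^m\lambda_{i_1}\cdots\lambda_{i_{n+1}}V(K_{i_1},\dots,K_{i_{n+1}}),\qquad\lambda_i\ge0,$$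 with Minkowski sums. Equivalently, with $\mathcal{C}_\theta=\{\xi\in\overline{\mathbb{R}^{n+1}_+}:|\xi+\cos\theta E_{n+1}|=1\}$ with its round metric $\sigma$, the capillary support functions $h_i(\xi)=u_i(\nu_i^{-1}(\xi+\cos\theta E_{n+1}))$ ($u_i=\langle X,\nu_i\rangle$ the support function on the hypersurface bounding $K_i$, $\nu_i$ its Gauss map), and $A[h]=\nabla^\sigma\nabla^\sigma h+h\sigma$, one has $V(K_1,\dots,K_{n+1})=\frac1{n+1}\int_{\mathcal{C}_\theta}h_1\,\mathcal{D}(A[h_2],\dots,A[h_{n+1}])\,d\mu_\sigma$, where $\mathcal{D}$ is the mixed discriminant, i.e. $\det(\sum_i\lambda_iA_i)=\sum\lambda_{i_1}\cdots\lambda_{i_n}\mathcal{D}(A_{i_1},\dots,A_{i_n})$. *)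

theory Defs
  imports "HOL-Analysis.Analysis"
begin

text \<open>
  The ambient space of dimension n + 1 is \<open>(real^'n) \<times> real\<close>, with \<open>n = CARD('n)\<close> and the
  second component in the role of the last coordinate.
\<close>

definition e_last :: "(real^'n) \<times> real" where
  "e_last = (0, 1)"

definition upper_half_space :: "((real^'n) \<times> real) set" where
  "upper_half_space = {x. x \<bullet> e_last > 0}"

definition wall :: "((real^'n) \<times> real) set" where
  "wall = frontier upper_half_space"


subsection \<open>Smooth hypersurfaces with boundary\<close>

primrec Ck_on :: "nat \<Rightarrow> 'a::real_normed_vector set \<Rightarrow> ('a \<Rightarrow> 'b::real_normed_vector) \<Rightarrow> bool" where
  "Ck_on 0 U f \<longleftrightarrow> continuous_on U f"
| "Ck_on (Suc k) U f \<longleftrightarrow> (\<forall>x\<in>U. f differentiable (at x)) \<and>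
     (\<forall>v. Ck_on k U (\<lambda>x. frechet_derivative f (at x) v))"

definition smooth_on :: "'a::real_normed_vector set \<Rightarrow> ('a \<Rightarrow> 'b::real_normed_vector) \<Rightarrow> bool" where
  "smooth_on U f \<longleftrightarrow> (\<forall>k. Ck_on k U f)"

text \<open>
  Local parametrizations are restrictions of immersions of an open set \<open>U\<close> to the part of \<open>U\<close>
  lying in \<open>{u. 0 \<le> a \<bullet> u}\<close>. For \<open>a = 0\<close> this part is all of \<open>U\<close>, which gives the
  parametrizations without boundary; for \<open>a \<noteq> 0\<close> it is the part of \<open>U\<close> in a closed half-space,
  and the points with \<open>a \<bullet> u = 0\<close> are mapped to the manifold boundary.
\<close>

definition chart_domain :: "(real^'n) set \<Rightarrow> real^'n \<Rightarrow> (real^'n) set" where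
  "chart_domain U a = {u \<in> U. 0 \<le> a \<bullet> u}"

definition local_param ::
  "((real^'n) \<times> real) set \<Rightarrow> (real^'n \<Rightarrow> (real^'n) \<times> real) \<Rightarrow> (real^'n) set \<Rightarrow> real^'n \<Rightarrow> bool" where
  "local_param \<Sigma> \<psi> U a \<longleftrightarrow>
     open U \<and> smooth_on U \<psi> \<and> (\<forall>u\<in>U. inj (frechet_derivative \<psi> (at u))) \<and>
     openin (top_of_set \<Sigma>) (\<psi> ` chart_domain U a) \<and>
     (\<exists>\<phi>. homeomorphism (chart_domain U a) (\<psi> ` chart_domain U a) \<psi> \<phi>)"

definition mfd_interior :: "((real^'n) \<times> real) set \<Rightarrow> ((real^'n) \<times> real) set" where
  "mfd_interior \<Sigma> = {\<psi> u |\<psi> U u. local_param \<Sigma> \<psi> U 0 \<and> u \<in> U}"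

definition mfd_boundary :: "((real^'n) \<times> real) set \<Rightarrow> ((real^'n) \<times> real) set" where
  "mfd_boundary \<Sigma> = {\<psi> u |\<psi> U a u. local_param \<Sigma> \<psi> U a \<and> a \<noteq> 0 \<and> u \<in> U \<and> a \<bullet> u = 0}"

text \<open>
  The boundary of \<open>\<Sigma>\<close> is required to be nonempty: a closed hypersurface floating in the open
  half-space would satisfy every contact angle condition vacuously.
\<close>

definition hypersurface_in_half_space :: "((real^'n) \<times> real) set \<Rightarrow> bool" where
  "hypersurface_in_half_space \<Sigma> \<longleftrightarrow>
     compact \<Sigma> \<and> \<Sigma> = mfd_interior \<Sigma> \<union> mfd_boundary \<Sigma> \<and>
     mfd_interior \<Sigma> \<subseteq> upper_half_space \<and> mfd_boundary \<Sigma> \<subseteq> wall \<and> mfd_boundary \<Sigma> \<noteq> {}"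

text \<open>
  The bounded components of the complement of \<open>\<Sigma> \<union> wall\<close> form the domain enclosed by \<open>\<Sigma>\<close>
  and the wall; the body is the closure of this domain, so that it can be compared with
  compact convex sets.
\<close>

definition enclosed_domain :: "((real^'n) \<times> real) set \<Rightarrow> ((real^'n) \<times> real) set" where
  "enclosed_domain \<Sigma> = inside (\<Sigma> \<union> wall)"

definition enclosed_body :: "((real^'n) \<times> real) set \<Rightarrow> ((real^'n) \<times> real) set" where
  "enclosed_body \<Sigma> = closure (enclosed_domain \<Sigma>)"

text \<open>
  At a boundary point of \<open>\<Sigma>\<close> the normal line need not enter the enclosed domain (it may leave
  the half-space), so the normal is required to point outward at interior points and is
  determined at boundary points by continuity.
\<close>

definition is_outward_normal ::
  "((real^'n) \<times> real) set \<Rightarrow> ((real^'n) \<times> real \<Rightarrow> (real^'n) \<times> real) \<Rightarrow> bool" where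
  "is_outward_normal \<Sigma> \<nu> \<longleftrightarrow>
     continuous_on \<Sigma> \<nu> \<and> (\<forall>x\<in>\<Sigma>. norm (\<nu> x) = 1) \<and>
     (\<forall>\<psi> U a u v. local_param \<Sigma> \<psi> U a \<longrightarrow> u \<in> chart_domain U a \<longrightarrow>
        frechet_derivative \<psi> (at u) v \<bullet> \<nu> (\<psi> u) = 0) \<and>
     (\<forall>x \<in> mfd_interior \<Sigma>. \<forall>\<^sub>F t in at_right 0.
        x - t *\<^sub>R \<nu> x \<in> enclosed_domain \<Sigma> \<and> x + t *\<^sub>R \<nu> x \<notin> enclosed_body \<Sigma>)"

text \<open>The defining property of \<open>outward_normal \<Sigma>\<close> determines its values on \<open>\<Sigma>\<close>.\<close>

definition outward_normal :: "((real^'n) \<times> real) set \<Rightarrow> (real^'n) \<times> real \<Rightarrow> (real^'n) \<times> real" where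
  "outward_normal \<Sigma> = (SOME \<nu>. is_outward_normal \<Sigma> \<nu>)"

definition capillary_hypersurface :: "real \<Rightarrow> ((real^'n) \<times> real) set \<Rightarrow> bool" where
  "capillary_hypersurface \<theta> \<Sigma> \<longleftrightarrow>
     hypersurface_in_half_space \<Sigma> \<and> (\<exists>\<nu>. is_outward_normal \<Sigma> \<nu>) \<and>
     (\<forall>x \<in> mfd_boundary \<Sigma>. outward_normal \<Sigma> x \<bullet> e_last = cos \<theta>)"

definition star_shaped_hypersurface :: "((real^'n) \<times> real) set \<Rightarrow> bool" where
  "star_shaped_hypersurface \<Sigma> \<longleftrightarrow>
     (\<exists>\<rho>. (\<forall>z \<in> sphere 0 1 \<inter> closure upper_half_space. \<rho> z > 0) \<and>
          \<Sigma> = (\<lambda>z. \<rho> z *\<^sub>R z) ` (sphere 0 1 \<inter> closure upper_half_space)) \<and>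
     (\<forall>x\<in>\<Sigma>. x \<bullet> outward_normal \<Sigma> x > 0)"


subsection \<open>The induced area element\<close>

definition first_fundamental_form ::
  "(real^'n \<Rightarrow> (real^'n) \<times> real) \<Rightarrow> real^'n \<Rightarrow> real^'n^'n" where
  "first_fundamental_form \<psi> u =
     (\<chi> i j. frechet_derivative \<psi> (at u) (axis i 1) \<bullet> frechet_derivative \<psi> (at u) (axis j 1))"

definition local_area ::
  "((real^'n) \<times> real) set \<Rightarrow> (real^'n \<Rightarrow> (real^'n) \<times> real) \<Rightarrow> (real^'n) set \<Rightarrow> real^'n
     \<Rightarrow> ((real^'n) \<times> real) measure" where
  "local_area \<Sigma> \<psi> U a =
     distr (density (restrict_space lborel (chart_domain U a))
              (\<lambda>u. ennreal (sqrt (det (first_fundamental_form \<psi> u)))))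
           (restrict_space borel \<Sigma>) \<psi>"

text \<open>
  \<open>local_area \<Sigma> \<psi> U a\<close> is the area element in the parametrization \<open>\<psi>\<close>, pushed forward to \<open>\<Sigma>\<close>;
  it vanishes outside the image of \<open>\<psi>\<close>. By the change of variables formula any two of these
  measures agree on the overlap of the images, so the least upper bound of all of them in the
  lattice of measures is the Borel measure on \<open>\<Sigma>\<close> that restricts to each of them.
\<close>

definition area_measure :: "((real^'n) \<times> real) set \<Rightarrow> ((real^'n) \<times> real) measure" where
  "area_measure \<Sigma> = (SUP (\<psi>, U, a) \<in> {(\<psi>, U, a). local_param \<Sigma> \<psi> U a}. local_area \<Sigma> \<psi> U a)"

lemma local_param_empty: "local_param \<Sigma> (\<lambda>_. 0) {} 0"
proof -
  have "Ck_on k {} f" for k and f :: "real^'n \<Rightarrow> (real^'n) \<times> real"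
    by (induction k arbitrary: f) auto
  then show ?thesis
    by (auto simp: local_param_def smooth_on_def chart_domain_def homeomorphism_def)
qed

lemma sets_area_measure: "sets (area_measure \<Sigma>) = sets (restrict_space borel \<Sigma>)"
  unfolding area_measure_def using local_param_empty[of \<Sigma>]
  by (intro sets_SUP) (auto simp: local_area_def)


subsection \<open>Capillary convex bodies\<close>

definition second_fundamental_form ::
  "((real^'n) \<times> real) set \<Rightarrow> (real^'n \<Rightarrow> (real^'n) \<times> real) \<Rightarrow> real^'n \<Rightarrow> real^'n \<Rightarrow> real^'n \<Rightarrow> real" where
  "second_fundamental_form \<Sigma> \<psi> u v w =
     - (frechet_derivative (\<lambda>y. frechet_derivative \<psi> (at y) v) (at u) w \<bullet> outward_normal \<Sigma> (\<psi> u))"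

definition strictly_convex_hypersurface :: "((real^'n) \<times> real) set \<Rightarrow> bool" where
  "strictly_convex_hypersurface \<Sigma> \<longleftrightarrow>
     (\<forall>\<psi> U a u v. local_param \<Sigma> \<psi> U a \<longrightarrow> u \<in> chart_domain U a \<longrightarrow> v \<noteq> 0 \<longrightarrow>
        second_fundamental_form \<Sigma> \<psi> u v v > 0)"

definition capillary_convex_bodies :: "real \<Rightarrow> ((real^'n) \<times> real) set set" where
  "capillary_convex_bodies \<theta> =
     {enclosed_body \<Sigma> |\<Sigma>. capillary_hypersurface \<theta> \<Sigma> \<and> strictly_convex_hypersurface \<Sigma> \<and>
        compact (enclosed_body \<Sigma>) \<and> convex (enclosed_body \<Sigma>) \<and> interior (enclosed_body \<Sigma>) \<noteq> {}}"

definition support_fun :: "'a::euclidean_space set \<Rightarrow> 'a \<Rightarrow> real" where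
  "support_fun L z = (SUP x\<in>L. x \<bullet> z)"


subsection \<open>Mixed volumes\<close>

abbreviation Vol :: "((real^'n) \<times> real) set \<Rightarrow> real" where
  "Vol \<equiv> measure lborel"

definition minkowski_combination ::
  "nat \<Rightarrow> (nat \<Rightarrow> real) \<Rightarrow> (nat \<Rightarrow> 'a::real_vector set) \<Rightarrow> 'a set" where
  "minkowski_combination m c K = {\<Sum>i<m. c i *\<^sub>R x i |x. \<forall>i<m. x i \<in> K i}"

text \<open>The (n + 1)-tuples of bodies are lists of length \<open>CARD('n) + 1\<close>.\<close>

definition is_mixed_volume :: "real \<Rightarrow> (((real^'n) \<times> real) set list \<Rightarrow> real) \<Rightarrow> bool" where
  "is_mixed_volume \<theta> V \<longleftrightarrow>
     (\<forall>Ks Ks'. length Ks = CARD('n) + 1 \<longrightarrow> set Ks \<subseteq> capillary_convex_bodies \<theta> \<longrightarrow>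
        mset Ks = mset Ks' \<longrightarrow> V Ks = V Ks') \<and>
     (\<forall>m K c. (\<forall>i<m. K i \<in> capillary_convex_bodies \<theta> \<and> 0 \<le> c i) \<longrightarrow>
        Vol (minkowski_combination m c K) =
        (\<Sum>I | set I \<subseteq> {..<m} \<and> length I = CARD('n) + 1. (\<Prod>i\<leftarrow>I. c i) * V (map K I)))"

text \<open>
  By comparison of coefficients, \<open>is_mixed_volume \<theta>\<close> determines the values on tuples of bodies
  in \<open>capillary_convex_bodies \<theta>\<close>.
\<close>

definition mixed_volume :: "real \<Rightarrow> ((real^'n) \<times> real) set list \<Rightarrow> real" where
  "mixed_volume \<theta> = (SOME V. is_mixed_volume \<theta> V)"

end

theory Submission
 imports Defs "HOL-Computational_Algebra.Fundamental_Theorem_Algebra"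
begin

text \<open>
 For convex bodies \<open>K\<^sub>i\<close> with weights, the sum of the gradients of their log-Laplace transforms maps the space onto
 the interior of the Minkowski sum (Gromov), so \<open>\<bar>K + t L\<bar>\<close> is the integral of the determinant of \<open>C\<^sub>K + t C\<^sub>L\<close>,
 where \<open>C\<^sub>K\<close>, \<open>C\<^sub>L\<close> are positive definite covariance matrices. Its coefficients in \<open>t\<close> have nonnegative integrands, and
 letting the weights concentrate on a hyperplane shows that the mixed coefficients are superadditive under cuts of \<open>K\<close> and
 \<open>L\<close> by parallel hyperplanes. Cutting with matched volume ratios down to boxes yields Minkowski's inequalities from the
 AM-GM inequality. Equality is inherited by the pieces, hence all edge ratios of the resulting thin boxes agree; this makes the
 marginals of \<open>K\<close> and \<open>L\<close> in every direction affinely related, so \<open>K\<close> and \<open>L\<close> are homothetic.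

 For part (i), the same cutting argument proves the first-order Brunn-Minkowski inequality, with its equality case, for
 compact \<open>K\<close> with negligible frontier. The area measure of a star-shaped hypersurface is the radial projection of a weighted
 Lebesgue measure on \<open>K\<close>, and a one-sided tangent estimate bounds the upper derivative of \<open>\<bar>K + t L\<bar>\<close> at \<open>t = 0\<close>
 by the anisotropic area. As \<open>K\<close> and \<open>L\<close> both rest on the wall, the translation is parallel to it.
\<close>

section \<open>Gromov's map and determinant pencils\<close>

text \<open>Volumes of Minkowski combinations do not depend on the weights, so one mixed coefficient
  has many integral representations. Their integrands are nonnegative because
  \<open>det_pencil A B\<close> has only real, nonpositive roots for positive definite matrices.
  Fatou's lemma therefore turns any degeneration of the weights into an inequality, and
  superadditivity is what the degeneration to a hyperplane yields: two translates running off in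
  opposite directions each see one half of both bodies. The bounds \<open>minkb\<close> and
  \<open>bmf\<close> are linear in the first volume once the ratio of the volumes is fixed. Hence a
  cut with matched ratios splits them exactly, and equality cannot get lost on either half. In part
  (i) the body need not be convex, so neither mixed coefficients nor supporting hyperplanes are at
  hand. Only the first order in t is used, with a lower bound from finite unions of boxes and an
  upper bound from tangency. For the converse of the equality case the flux of a vector of the wall
  through the hypersurface must vanish; this is read off from the inequality itself, applied to
  translates of L in both directions.\<close>

definition pos_semidef :: "real^'k^'k \<Rightarrow> bool" where
 "pos_semidef A \<longleftrightarrow> transpose A = A \<and> (\<forall>v. 0 \<le> v \<bullet> (A *v v))"

definition pos_def :: "real^'k^'k \<Rightarrow> bool" where
 "pos_def A \<longleftrightarrow> transpose A = A \<and> (\<forall>v. v \<noteq> 0 \<longrightarrow> 0 < v \<bullet> (A *v v))"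

lemma pos_def_imp_semidef: "pos_def A \<Longrightarrow> pos_semidef A"
 unfolding pos_def_def pos_semidef_def by (metis inner_zero_left less_eq_real_def)

text \<open>Kept as a polynomial in t instead of the function det (A + t B): the later integrands
  are its single coefficients, and their signs come from its complex roots.\<close>

definition det_pencil :: "real^'k^'k \<Rightarrow> real^'k^'k \<Rightarrow> real poly" where
 "det_pencil A B = det (\<chi> i j. [:A $ i $ j, B $ i $ j:])"

lemma poly_det: "poly (det M) z = det (\<chi> i j. poly (M $ i $ j) z)"
 for M :: "'a::comm_ring_1 poly^'k^'k"
 by (simp add: det_def poly_sum poly_prod of_int_poly)

lemma poly_det_pencil: "poly (det_pencil A B) t = det (A + t *\<^sub>R B)"
 by (simp add: det_pencil_def poly_det) (intro arg_cong[where f=det], simp add: vec_eq_iff)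

lemma degree_linear_le: "degree [:a, b:] \<le> Suc 0"
 by simp

lemma degree_det_pencil: "degree (det_pencil A B) \<le> CARD('k)"
 for A :: "real^'k^'k"
proof -
 have "degree (prod (\<lambda>i. [:A $ i $ p i, B $ i $ p i:]) (UNIV::'k set)) \<le> CARD('k)" for p
  using degree_prod_sum_le[of "UNIV::'k set" "\<lambda>i. [:A $ i $ p i, B $ i $ p i:]"]
   sum_bounded_above[of "UNIV::'k set" "\<lambda>i. degree [:A $ i $ p i, B $ i $ p i:]" 1] by (auto simp del: degree_pCons_eq_if intro: order_trans simp: degree_linear_le)
 moreover have "degree (of_int c * q) \<le> degree q" for c and q :: "real poly"
  by (simp add: of_int_poly)
 ultimately show ?thesis
  unfolding det_pencil_def det_def
  by (intro degree_sum_le) (auto intro: order_trans)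
qed

text \<open>If w is a complex kernel vector of A + z B, pairing with its conjugate gives a + z b =
  0, where a > 0 and b \<ge> 0 are the values of the two Hermitian forms at w; hence z = - a /
  b.\<close>

lemma pencil_roots:
 fixes A B :: "real^'k^'k"
 assumes A: "pos_def A" and B: "pos_semidef B"
  and z: "poly (map_poly complex_of_real (det_pencil A B)) z = 0"
 shows "z \<in> \<real> \<and> Re z \<le> 0"
proof -
 let ?c = "complex_of_real"
 define M where "M = (\<chi> i j. ?c (A $ i $ j) + z * ?c (B $ i $ j))"
 have "poly (map_poly ?c (det_pencil A B)) z = det M"
 proof -
  have mp: "map_poly ?c (p + q) = map_poly ?c p + map_poly ?c q" for p q
   by (rule poly_eqI) (simp add: coeff_map_poly)
  have mm: "map_poly ?c (p * q) = map_poly ?c p * map_poly ?c q" for p q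
   by (rule poly_eqI) (simp add: coeff_map_poly coeff_mult)
  have ms: "map_poly ?c (sum f S) = (\<Sum>i\<in>S. map_poly ?c (f i))" for f and S :: "('k\<Rightarrow>'k) set"
   by (induction S rule: infinite_finite_induct) (auto simp: mp)
  have mpr: "map_poly ?c (prod f S) = (\<Prod>i\<in>S. map_poly ?c (f i))" for f and S :: "'k set"
   by (induction S rule: infinite_finite_induct) (auto simp: mm)
  have mi: "map_poly ?c (of_int n) = of_int n" for n
   by (simp add: of_int_poly map_poly_pCons)
  show ?thesis
   unfolding det_pencil_def det_def ms mm mpr mi
   by (simp add: poly_sum poly_prod of_int_poly map_poly_pCons M_def)
 qed
 with z have "det M = 0" by simp
 then obtain w where w: "w \<noteq> 0" "M *v w = 0"
  using invertible_det_nz[of M] matrix_left_invertible_ker[of M] invertible_left_inverse[of M] by blast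
 define u v where "u = (\<chi> i. Re (w $ i))" and "v = (\<chi> i. Im (w $ i))"
 have uv: "u \<noteq> 0 \<or> v \<noteq> 0"
  using w(1) by (auto simp: u_def v_def vec_eq_iff complex_eq_iff)
 \<comment> \<open>For a real symmetric matrix the Hermitian form at w = u + i v is real and splits
   into the values at u and at v.\<close>
 have qf: "(\<Sum>i\<in>UNIV. \<Sum>j\<in>UNIV. cnj (w $ i) * ?c (C $ i $ j) * w $ j) = ?c (u \<bullet> (C *v u) + v \<bullet> (C *v v))"
  if C: "transpose C = C" for C :: "real^'k^'k"
 proof (rule complex_eqI)
  have sym: "C $ i $ j = C $ j $ i" for i j
   using C by (metis transpose_def vec_lambda_beta)
  show "Re (\<Sum>i\<in>UNIV. \<Sum>j\<in>UNIV. cnj (w $ i) * ?c (C $ i $ j) * w $ j) = Re (?c (u \<bullet> (C *v u) + v \<bullet> (C *v v)))"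
   by (simp add: inner_vec_def matrix_vector_mult_def u_def v_def sum_distrib_left sum.distrib[symmetric] algebra_simps)
  have "Im (\<Sum>i\<in>UNIV. \<Sum>j\<in>UNIV. cnj (w $ i) * ?c (C $ i $ j) * w $ j)
    = (\<Sum>i\<in>UNIV. \<Sum>j\<in>UNIV. Re (w $ i) * C $ i $ j * Im (w $ j)) - (\<Sum>i\<in>UNIV. \<Sum>j\<in>UNIV. Im (w $ i) * C $ i $ j * Re (w $ j))"
   by (simp add: sum_subtractf[symmetric] algebra_simps)
  also have "(\<Sum>i\<in>UNIV. \<Sum>j\<in>UNIV. Im (w $ i) * C $ i $ j * Re (w $ j)) = (\<Sum>i\<in>UNIV. \<Sum>j\<in>UNIV. Re (w $ i) * C $ i $ j * Im (w $ j))"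
   by (subst sum.swap) (simp add: sym mult_ac)
  finally show "Im (\<Sum>i\<in>UNIV. \<Sum>j\<in>UNIV. cnj (w $ i) * ?c (C $ i $ j) * w $ j) = Im (?c (u \<bullet> (C *v u) + v \<bullet> (C *v v)))"
   by simp
 qed
 define a b where "a = u \<bullet> (A *v u) + v \<bullet> (A *v v)" and "b = u \<bullet> (B *v u) + v \<bullet> (B *v v)"
 have "0 = (\<Sum>i\<in>UNIV. cnj (w $ i) * (M *v w) $ i)" by (simp add: w)
 also have "\<dots> = (\<Sum>i\<in>UNIV. \<Sum>j\<in>UNIV. cnj (w $ i) * ?c (A $ i $ j) * w $ j)
   + z * (\<Sum>i\<in>UNIV. \<Sum>j\<in>UNIV. cnj (w $ i) * ?c (B $ i $ j) * w $ j)"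
  by (simp add: M_def matrix_vector_mult_def sum_distrib_left sum.distrib[symmetric] algebra_simps)
 also have "\<dots> = ?c a + z * ?c b"
  using A B by (simp add: qf pos_def_def pos_semidef_def a_def b_def)
 finally have eq: "?c a + z * ?c b = 0" by simp
 have a: "a > 0" using uv A unfolding a_def pos_def_def
  by (metis add_nonneg_pos add_pos_nonneg inner_zero_left less_eq_real_def)
 have b: "b \<ge> 0" using B unfolding b_def pos_semidef_def by simp
 have "b \<noteq> 0" using eq a by auto
 have "z * ?c b = - ?c a" using eq by (simp add: add_eq_0_iff)
 then have "z = ?c (- a / b)" using \<open>b \<noteq> 0\<close> by (simp add: field_simps)
 then show ?thesis using a b by (auto simp: divide_nonneg_pos)
qed

lemma coeffs_nonneg_mult:
 fixes p q :: "'a::linordered_idom poly"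
 assumes "\<And>i. coeff p i \<ge> 0" "\<And>i. coeff q i \<ge> 0"
 shows "coeff (p * q) i \<ge> 0"
 by (auto simp: coeff_mult assms intro!: sum_nonneg mult_nonneg_nonneg)

text \<open>Splitting off one root after the other writes the polynomial as a nonnegative constant
  times factors t + c with c \<ge> 0, and products of polynomials with nonnegative coefficients keep
  that property.\<close>

lemma real_rooted_coeffs_nonneg:
 fixes p :: "real poly"
 assumes "\<And>z. poly (map_poly complex_of_real p) z = 0 \<Longrightarrow> z \<in> \<real> \<and> Re z \<le> 0" "lead_coeff p \<ge> 0"
 shows "coeff p i \<ge> 0"
 using assms
proof (induction "degree p" arbitrary: p i)
 case 0
 then show ?case
  by (metis coeff_eq_0 le_refl not_gr0 order_refl)
next
 case (Suc n)
 let ?c = complex_of_real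
 have "\<not> constant (poly (map_poly ?c p))"
  using Suc.hyps(2) by (simp add: constant_degree degree_map_poly)
 then obtain z where z: "poly (map_poly ?c p) z = 0"
  using fundamental_theorem_of_algebra by blast
 with Suc.prems(1) obtain x where x: "z = ?c x" "x \<le> 0"
  by (metis Re_complex_of_real Reals_cases)
 have "poly (map_poly ?c p) (?c x) = ?c (poly p x)"
  by (simp add: poly_altdef degree_map_poly coeff_map_poly)
 then have "poly p x = 0" using z x by simp
 then obtain q where q: "p = [:-x, 1:] * q"
  by (metis poly_eq_0_iff_dvd dvdE)
 have "p \<noteq> 0" using Suc.hyps(2) by auto
 then have "q \<noteq> 0" using q by auto
 have dq: "degree q = n" using Suc.hyps(2) \<open>q \<noteq> 0\<close> unfolding q by (subst (asm) degree_mult_eq) auto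
 have lq: "lead_coeff q \<ge> 0" using Suc.prems(2) unfolding q by (simp add: lead_coeff_mult del: mult_pCons_left)
 have mm: "map_poly ?c p = map_poly ?c [:-x,1:] * map_poly ?c q" unfolding q
  by (rule poly_eqI) (simp add: coeff_map_poly coeff_mult del: mult_pCons_left)
 have "coeff q j \<ge> 0" for j
  using Suc.hyps(1)[of q j] dq lq Suc.prems(1) by (simp add: mm)
 then show ?case unfolding q
  by (intro coeffs_nonneg_mult) (auto simp: coeff_pCons x split: nat.split)
qed

lemma pos_def_det_nonneg_aux:
 fixes A :: "real^'k^'k"
 assumes "pos_def A" shows "det A \<noteq> 0"
proof
 assume "det A = 0"
 then obtain w where "w \<noteq> 0" "A *v w = 0"
  using invertible_det_nz[of A] matrix_left_invertible_ker[of A] invertible_left_inverse[of A] by blast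
 then show False using assms unfolding pos_def_def by force
qed

lemma pos_def_mat1: "pos_def (mat 1)"
 by (auto simp: pos_def_def transpose_mat)

lemma pos_def_add:
 "pos_def A \<Longrightarrow> pos_semidef B \<Longrightarrow> pos_def (A + B)"
 by (auto simp: pos_def_def pos_semidef_def transpose_def vec_eq_iff matrix_vector_mult_add_rdistrib inner_add_right
   intro!: add_pos_nonneg)

lemma pos_semidef_scale:
 "pos_semidef A \<Longrightarrow> c \<ge> 0 \<Longrightarrow> pos_semidef (c *\<^sub>R A)"
 by (auto simp: pos_semidef_def transpose_def vec_eq_iff scaleR_matrix_vector_assoc[symmetric])

lemma pos_def_scale:
 "pos_def A \<Longrightarrow> c > 0 \<Longrightarrow> pos_def (c *\<^sub>R A)"
 by (auto simp: pos_def_def transpose_def vec_eq_iff scaleR_matrix_vector_assoc[symmetric])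

text \<open>The segment from the identity to \<open>A\<close> stays positive definite, so the
  determinant cannot vanish on it and keeps the sign it has at the identity.\<close>

lemma pos_def_det_pos:
 fixes A :: "real^'k^'k"
 assumes "pos_def A" shows "det A > 0"
proof (rule ccontr)
 assume "\<not> det A > 0"
 define f where "f t = det ((1 - t) *\<^sub>R mat 1 + t *\<^sub>R A)" for t
 have "continuous_on {0..1} f"
  unfolding f_def det_def by (intro continuous_intros)
 moreover have "f 0 = 1" "f 1 \<le> 0" using \<open>\<not> det A > 0\<close> by (auto simp: f_def)
 ultimately obtain t where t: "0 \<le> t" "t \<le> 1" "f t = 0"
  using IVT2'[of f 1 0 0] by auto
 have "pos_def ((1 - t) *\<^sub>R mat 1 + t *\<^sub>R A)"
 proof (cases "t = 1")
  case False
  then show ?thesis using t assms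
   by (intro pos_def_add pos_def_scale pos_semidef_scale pos_def_mat1 pos_def_imp_semidef) auto
 qed (use assms in auto)
 then show False using pos_def_det_nonneg_aux t f_def by metis
qed

lemma det_pencil_coeff_nonneg:
 assumes A: "pos_def A" and B: "pos_semidef B"
 shows "coeff (det_pencil A B) i \<ge> 0"
proof (rule real_rooted_coeffs_nonneg)
 let ?p = "det_pencil A B"
 have pos: "poly ?p t > 0" if "t \<ge> 0" for t
  unfolding poly_det_pencil using assms that
  by (intro pos_def_det_pos pos_def_add pos_semidef_scale) auto
 show "lead_coeff ?p \<ge> 0"
 proof (rule ccontr)
  assume "\<not> lead_coeff ?p \<ge> 0"
  then obtain n where "\<forall>x\<ge>n. poly (- ?p) x \<ge> lead_coeff (- ?p)"
   using poly_pinfty_gt_lc[of "- ?p"] by (auto simp: )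
  then have "poly (- ?p) (max n 0) > 0"
   using \<open>\<not> lead_coeff ?p \<ge> 0\<close> by (smt (verit) degree_minus lead_coeff_minus max.cobounded1)
  then show False using pos[of "max n 0"] by simp
 qed
qed (use pencil_roots[OF assms] in auto)

section \<open>Exponentially tilted measures: moments, means and covariances\<close>

definition convex_body :: "'a::euclidean_space set \<Rightarrow> bool" where
 "convex_body K \<longleftrightarrow> compact K \<and> convex K \<and> interior K \<noteq> {}"

text \<open>Unnormalised moment of \<open>g\<close> under \<open>\<mu>\<close> tilted by exp (x
  \<bullet> y). For g = 1 it is the Laplace transform, whose logarithm has gradient
  \<open>ebar\<close> and Hessian \<open>ecov\<close>.\<close>

definition emom :: "'a::euclidean_space measure \<Rightarrow> ('a \<Rightarrow> real) \<Rightarrow> 'a \<Rightarrow> real" where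
 "emom \<mu> g x = (\<integral>y. exp (x \<bullet> y) * g y \<partial>\<mu>)"

definition ebar :: "(real^'k) measure \<Rightarrow> real^'k \<Rightarrow> real^'k" where
 "ebar \<mu> x = (\<chi> i. emom \<mu> (\<lambda>y. y $ i) x / emom \<mu> (\<lambda>_. 1) x)"

definition ecov :: "(real^'k) measure \<Rightarrow> real^'k \<Rightarrow> real^'k^'k" where
 "ecov \<mu> x = (\<chi> i j. emom \<mu> (\<lambda>y. y $ j * y $ i) x / emom \<mu> (\<lambda>_. 1) x - ebar \<mu> x $ i * ebar \<mu> x $ j)"

text \<open>The lower density bound gives every open part of \<open>K\<close> a positive mass. It
  makes the covariances definite, and it keeps the Laplace transform close to the exponential of the
  support function, which yields the surjectivity of Gromov's map.\<close>

locale weighted_body =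
 fixes K :: "(real^'k) set" and \<mu> :: "(real^'k) measure"
 assumes body: "convex_body K"
  and sets_mu: "sets \<mu> = sets borel"
  and finite_mu: "emeasure \<mu> UNIV < \<infinity>"
  and concentrated: "emeasure \<mu> (- K) = 0"
  and density_bound: "\<exists>c>0. \<forall>S\<in>sets borel. S \<subseteq> K \<longrightarrow> c * measure lborel S \<le> measure \<mu> S"
begin

lemma space_mu [simp]: "space \<mu> = UNIV"
 using sets_eq_imp_space_eq[OF sets_mu] by simp

sublocale finite_measure \<mu>
 by standard (use finite_mu in auto)

lemma borel_mu [measurable_cong]: "sets \<mu> = sets borel"
 by (rule sets_mu)

lemma AE_K: "AE y in \<mu>. y \<in> K"
proof (rule AE_I)
 have "closed K" using body compact_imp_closed convex_body_def by blast
 then show "- K \<in> sets \<mu>" by (auto simp: sets_mu)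
qed (use concentrated in auto)

lemma bounded_on_K:
 assumes "continuous_on UNIV (h :: _ \<Rightarrow> real)"
 obtains B where "B > 0" "\<And>y. y \<in> K \<Longrightarrow> \<bar>h y\<bar> \<le> B"
proof -
 have "compact (h ` K)"
  using body assms by (intro compact_continuous_image) (auto simp: convex_body_def intro: continuous_on_subset)
 then have "bounded (h ` K)" by (rule compact_imp_bounded)
 then obtain B where "B > 0" "\<And>z. z \<in> h ` K \<Longrightarrow> norm z \<le> B"
  using bounded_pos by (metis (no_types))
 then show ?thesis using that by auto
qed

lemma measurable_cont: "continuous_on UNIV (h :: _ \<Rightarrow> real) \<Longrightarrow> h \<in> borel_measurable \<mu>"
 using borel_measurable_continuous_onI measurable_cong_sets[OF sets_mu refl] by blast

lemma integrable_cont: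
 assumes "continuous_on UNIV (h :: _ \<Rightarrow> real)"
 shows "integrable \<mu> h"
proof -
 obtain B where "\<And>y. y \<in> K \<Longrightarrow> \<bar>h y\<bar> \<le> B"
  using bounded_on_K[OF assms] by blast
 then show ?thesis
  by (intro integrable_const_bound[where B=B]) (use AE_K measurable_cont[OF assms] in \<open>auto elim: eventually_mono\<close>)
qed

lemma integral_pos:
 fixes h :: "real^'k \<Rightarrow> real"
 assumes h: "continuous_on UNIV h" and nn: "\<And>y. y \<in> K \<Longrightarrow> 0 \<le> h y"
  and U: "open U" "U \<noteq> {}" "U \<subseteq> K" "\<And>y. y \<in> U \<Longrightarrow> 0 < h y"
 shows "0 < (\<integral>y. h y \<partial>\<mu>)"
proof -
 have AEnn: "AE y in \<mu>. 0 \<le> h y" using AE_K nn by (auto elim: eventually_mono)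
 have "(\<integral>y. h y \<partial>\<mu>) \<noteq> 0"
 proof
  assume "(\<integral>y. h y \<partial>\<mu>) = 0"
  then have "AE y in \<mu>. h y = 0"
   using integral_nonneg_eq_0_iff_AE[OF integrable_cont[OF h] AEnn] by simp
  then have "AE y in \<mu>. y \<notin> U" by (rule eventually_mono) (use U(4) in force)
  moreover have "U \<in> sets \<mu>" using U(1) by (auto simp: sets_mu)
  ultimately have "emeasure \<mu> U = 0"
   by (auto dest!: AE_iff_measurable[THEN iffD1, rotated 2, of _ _ U])
  then have "measure \<mu> U = 0" by (simp add: measure_def)
  moreover obtain c where "c > 0" "c * measure lborel U \<le> measure \<mu> U"
   using density_bound U(1,3) by (metis borel_open)
  moreover have "measure lborel U > 0"
  proof -
   have "bounded U" using U(3) body bounded_subset compact_imp_bounded convex_body_def by blast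
   then have "emeasure lborel U < \<infinity>" using emeasure_bounded_finite by blast
   moreover have "emeasure lborel U \<noteq> 0"
   proof
    assume "emeasure lborel U = 0"
    then have "negligible U"
     using U(1) by (simp add: negligible_iff_emeasure0)
    then show False using U open_not_negligible by blast
   qed
   ultimately show ?thesis
    by (simp add: measure_def enn2real_positive_iff zero_less_iff_neq_zero)
  qed
  ultimately show False by (simp add: mult_le_0_iff not_less[symmetric])
 qed
 moreover have "(\<integral>y. h y \<partial>\<mu>) \<ge> 0" using AEnn by (rule integral_nonneg_AE)
 ultimately show ?thesis by linarith
qed

lemma interior_minus_hyperplane:
 fixes v :: "real^'k"
 assumes "v \<noteq> 0" shows "interior K - {y. v \<bullet> y = s} \<noteq> {}" "open (interior K - {y. v \<bullet> y = s})"
proof -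
 show "open (interior K - {y. v \<bullet> y = s})"
  by (intro open_Diff open_interior closed_hyperplane)
 have "\<not> interior K \<subseteq> {y. v \<bullet> y = s}"
  using interior_hyperplane[OF assms, of s] interior_maximal[of "interior K" "{y. v \<bullet> y = s}"] body
  by (auto simp: convex_body_def)
 then show "interior K - {y. v \<bullet> y = s} \<noteq> {}" by auto
qed

lemma emom1_pos: "emom \<mu> (\<lambda>_. 1) x > 0"
 unfolding emom_def
 by (rule integral_pos[of _ "interior K"])
   (use body interior_subset in \<open>auto simp: convex_body_def intro!: continuous_intros\<close>)

text \<open>Differentiation under the integral by hand: on the bounded set \<open>K\<close> the
  second-order Taylor remainder of the exponential is at most a constant times the square of the
  increment.\<close>

lemma emom_has_derivative:
 fixes g :: "real^'k \<Rightarrow> real"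
 assumes g: "continuous_on UNIV g"
 shows "(emom \<mu> g has_derivative (\<lambda>v. \<Sum>j\<in>UNIV. v $ j * emom \<mu> (\<lambda>y. y $ j * g y) x)) (at x)"
proof -
 obtain R where R: "R > 0" "\<And>y. y \<in> K \<Longrightarrow> norm y \<le> R"
  using bounded_on_K[of norm] by (auto intro: continuous_intros)
 obtain G where G: "G > 0" "\<And>y. y \<in> K \<Longrightarrow> \<bar>g y\<bar> \<le> G"
  using bounded_on_K[OF g] by blast
 let ?D = "\<lambda>v. \<Sum>j\<in>UNIV. v $ j * emom \<mu> (\<lambda>y. y $ j * g y) x"
 have D: "?D v = (\<integral>y. exp (x \<bullet> y) * (v \<bullet> y) * g y \<partial>\<mu>)" for v
 proof -
  have "(\<integral>y. exp (x \<bullet> y) * (v \<bullet> y) * g y \<partial>\<mu>) = (\<integral>y. (\<Sum>j\<in>UNIV. v $ j * (exp (x \<bullet> y) * (y $ j * g y))) \<partial>\<mu>)"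
   by (simp add: inner_vec_def sum_distrib_left sum_distrib_right mult_ac)
  also have "\<dots> = ?D v"
   unfolding emom_def
   by (subst Bochner_Integration.integral_sum) (auto intro!: integrable_cont continuous_intros g)
  finally show ?thesis by simp
 qed
 have expb: "\<bar>exp b - 1 - b\<bar> \<le> b\<^sup>2 * exp \<bar>b\<bar>" for b :: real
 proof -
  have e1: "1 + b \<le> exp b" by (rule exp_ge_add_one_self)
  have "1 + (-b) \<le> exp (-b)" by (rule exp_ge_add_one_self)
  then have "(1 - b) * exp b \<le> exp (-b) * exp b" by (intro mult_right_mono) auto
  then have e2: "exp b - 1 \<le> b * exp b" by (simp add: exp_minus field_simps)
  have "exp b - 1 - b \<le> b * (exp b - 1)" using e2 by (simp add: algebra_simps)
  also have "\<dots> \<le> b\<^sup>2 * exp \<bar>b\<bar>"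
  proof (cases "b \<ge> 0")
   case True
   then have "b * (exp b - 1) \<le> b * (b * exp b)" using e2 by (intro mult_left_mono)
   then show ?thesis using True by (simp add: power2_eq_square mult_ac)
  next
   case False
   then have "b * (exp b - 1) \<le> b * b" using e1 by (intro mult_left_mono_neg) linarith+
   also have "\<dots> \<le> b * b * exp \<bar>b\<bar>" by (simp add: mult_le_cancel_left1)
   finally show ?thesis by (simp add: power2_eq_square)
  qed
  finally show ?thesis using e1 by (simp add: abs_le_iff algebra_simps)
 qed
 let ?C0 = "exp ((norm x + 1) * R) * R\<^sup>2 * G"
 \<comment> \<open>The summand 1 keeps \<open>C\<close> positive, so that e / C is a legitimate
   radius below.\<close>
 define C where "C = ?C0 * measure \<mu> UNIV + 1"
 have C: "C > 0" unfolding C_def using G R by (intro add_nonneg_pos mult_nonneg_nonneg) auto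
 have key: "norm (emom \<mu> g y - emom \<mu> g x - ?D (y - x)) \<le> C * (norm (y - x))\<^sup>2" if "norm (y - x) \<le> 1" for y
 proof -
  define v where "v = y - x"
  define J where "J z = exp (y \<bullet> z) * g z - exp (x \<bullet> z) * g z - exp (x \<bullet> z) * (v \<bullet> z) * g z" for z
  have eq: "emom \<mu> g y - emom \<mu> g x - ?D v
   = (\<integral>z. J z \<partial>\<mu>)"
   unfolding D unfolding emom_def J_def
   by (subst Bochner_Integration.integral_diff; (subst Bochner_Integration.integral_diff)?)
     (auto intro!: integrable_cont Bochner_Integration.integrable_diff continuous_intros g)
  have le1: "norm (\<integral>z. J z \<partial>\<mu>) \<le> (\<integral>z. norm (J z) \<partial>\<mu>)"
   by (rule integral_norm_bound)
  have le2: "(\<integral>z. norm (J z) \<partial>\<mu>) \<le> (\<integral>z. ?C0 * (norm v)\<^sup>2 \<partial>\<mu>)"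
  proof (rule integral_mono_AE)
   show "AE z in \<mu>. norm (J z) \<le> ?C0 * (norm v)\<^sup>2"
    using AE_K
   proof (rule eventually_mono)
    fix z assume z: "z \<in> K"
    have vz: "\<bar>v \<bullet> z\<bar> \<le> norm v * R"
     using Cauchy_Schwarz_ineq2[of v z] R z by (meson mult_left_mono norm_ge_zero order_trans)
    have "exp (y \<bullet> z) * g z - exp (x \<bullet> z) * g z - exp (x \<bullet> z) * (v \<bullet> z) * g z
      = exp (x \<bullet> z) * (exp (v \<bullet> z) - 1 - v \<bullet> z) * g z"
     by (simp add: v_def inner_diff_left exp_diff algebra_simps)
    then have "norm (J z)
      = exp (x \<bullet> z) * \<bar>exp (v \<bullet> z) - 1 - v \<bullet> z\<bar> * \<bar>g z\<bar>"
     by (simp add: abs_mult J_def)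
    also have "\<dots> \<le> exp (x \<bullet> z) * ((v \<bullet> z)\<^sup>2 * exp \<bar>v \<bullet> z\<bar>) * G"
     using G z by (intro mult_mono expb) auto
    also have "\<dots> = (exp (x \<bullet> z) * exp \<bar>v \<bullet> z\<bar>) * (v \<bullet> z)\<^sup>2 * G" by simp
    also have "\<dots> \<le> exp ((norm x + 1) * R) * (norm v * R)\<^sup>2 * G"
    proof (intro mult_mono)
     have "x \<bullet> z \<le> norm x * R"
      using norm_cauchy_schwarz[of x z] R z by (meson mult_left_mono norm_ge_zero order_trans)
     moreover have "\<bar>v \<bullet> z\<bar> \<le> 1 * R"
      using vz mult_right_mono[of "norm v" 1 R] that R(1) unfolding v_def by linarith
     ultimately have "x \<bullet> z + \<bar>v \<bullet> z\<bar> \<le> (norm x + 1) * R" by (simp add: algebra_simps)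
     then show "exp (x \<bullet> z) * exp \<bar>v \<bullet> z\<bar> \<le> exp ((norm x + 1) * R)"
      by (simp add: exp_add[symmetric])
     show "(v \<bullet> z)\<^sup>2 \<le> (norm v * R)\<^sup>2"
      using power_mono[OF vz, of 2] by simp
    qed (use G in auto)
    finally show "norm (J z) \<le> ?C0 * (norm v)\<^sup>2"
     by (simp add: power_mult_distrib mult_ac)
   qed
  qed (auto intro!: integrable_cont continuous_intros g simp: J_def)
  have le3: "(\<integral>z. ?C0 * (norm v)\<^sup>2 \<partial>\<mu>) = exp ((norm x + 1) * R) * R\<^sup>2 * G * measure \<mu> UNIV * (norm v)\<^sup>2" by simp
  have "\<dots> \<le> C * (norm v)\<^sup>2" unfolding C_def by (intro mult_right_mono) auto
  then have "norm (\<integral>z. J z \<partial>\<mu>) \<le> C * (norm v)\<^sup>2" using le1 le2 le3 by linarith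
  then show ?thesis using eq by (simp only: v_def)
 qed
 show ?thesis
  unfolding has_derivative_at_alt
 proof (intro conjI allI impI)
  show "bounded_linear ?D"
   by (intro bounded_linear_sum bounded_linear_mult_const[OF bounded_linear_vec_nth])
  fix e :: real assume e: "e > 0"
  show "\<exists>d>0. \<forall>y. norm (y - x) < d \<longrightarrow> norm (emom \<mu> g y - emom \<mu> g x - ?D (y - x)) \<le> e * norm (y - x)"
  proof (intro exI[of _ "min 1 (e / C)"] conjI allI impI)
   fix y assume y: "norm (y - x) < min 1 (e / C)"
   then have "C * norm (y - x) \<le> e" using C by (simp add: field_simps)
   then have "C * (norm (y - x))\<^sup>2 \<le> e * norm (y - x)"
    by (simp add: power2_eq_square mult.assoc[symmetric] mult_right_mono)
   then show "norm (emom \<mu> g y - emom \<mu> g x - ?D (y - x)) \<le> e * norm (y - x)"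
    using key[of y] y by simp
  qed (use e C in auto)
 qed
qed

lemma emom_continuous:
 "continuous_on UNIV g \<Longrightarrow> continuous_on S (emom \<mu> g)"
 by (rule continuous_at_imp_continuous_on, intro ballI, rule has_derivative_continuous, rule emom_has_derivative)

lemma ebar_has_derivative: "(ebar \<mu> has_derivative (\<lambda>v. ecov \<mu> x *v v)) (at x)"
proof -
 let ?Z = "emom \<mu> (\<lambda>_. 1)"
 have "((\<lambda>x. ebar \<mu> x $ i) has_derivative (\<lambda>v. (ecov \<mu> x *v v) $ i)) (at x)" for i
 proof -
  have z: "?Z x \<noteq> 0" using emom1_pos[of x] by simp
  let ?D = "\<lambda>g v. \<Sum>j\<in>UNIV. v $ j * emom \<mu> (\<lambda>y. y $ j * g y) x" and ?M = "emom \<mu> (\<lambda>y. y $ i)"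
  let ?q = "\<lambda>v. (?D (\<lambda>y. y $ i) v * ?Z x - ?M x * ?D (\<lambda>_. 1) v) / (?Z x * ?Z x)"
  have "((\<lambda>x. ?M x / ?Z x) has_derivative ?q) (at x)"
   by (intro has_derivative_divide' emom_has_derivative z continuous_intros)
  also have "?q = (\<lambda>v. (ecov \<mu> x *v v) $ i)"
  proof
   fix v :: "real^'k"
   have "?q v = ?D (\<lambda>y. y $ i) v / ?Z x - (\<Sum>j\<in>UNIV. v $ j * emom \<mu> (\<lambda>y. y $ j) x) / ?Z x * (?M x / ?Z x)"
    using z by (simp add: field_simps)
   also have "\<dots> = (ecov \<mu> x *v v) $ i"
    by (simp add: matrix_vector_mult_def ecov_def ebar_def sum_divide_distrib sum_distrib_right
      sum_subtractf left_diff_distrib) (simp add: mult_ac)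
   finally show "?q v = (ecov \<mu> x *v v) $ i" .
  qed
  finally show ?thesis by (simp add: ebar_def)
 qed
 then show ?thesis
  by (subst has_derivative_componentwise_within) (auto simp: Basis_vec_def inner_axis)
qed

lemma ecov_continuous: "continuous_on S (\<lambda>x. ecov \<mu> x $ i $ j)"
proof -
 have "emom \<mu> (\<lambda>_. 1) x \<noteq> 0" for x using emom1_pos[of x] by simp
 then show ?thesis
  unfolding ecov_def ebar_def
  by (auto intro!: continuous_intros emom_continuous)
qed

lemma emom1_inner_ebar:
 "emom \<mu> (\<lambda>_. 1) x * (v \<bullet> ebar \<mu> x) = emom \<mu> (\<lambda>y. v \<bullet> y) x"
proof -
 have z: "emom \<mu> (\<lambda>_. 1) x \<noteq> 0" using emom1_pos[of x] by simp
 have "emom \<mu> (\<lambda>y. v \<bullet> y) x = (\<integral>y. (\<Sum>j\<in>UNIV. v $ j * (exp (x \<bullet> y) * y $ j)) \<partial>\<mu>)"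
  unfolding emom_def inner_vec_def[of v] by (simp add: sum_distrib_left mult.left_commute)
 also have "\<dots> = (\<Sum>j\<in>UNIV. v $ j * emom \<mu> (\<lambda>y. y $ j) x)"
  unfolding emom_def
  by (subst Bochner_Integration.integral_sum) (auto intro!: integrable_cont continuous_intros)
 finally show ?thesis using z
  by (simp add: inner_vec_def ebar_def sum_distrib_left field_simps)
qed

text \<open>The interior of \<open>K\<close> minus the hyperplane v \<bullet> y = s is open and
  nonempty, hence carries mass, and s - v \<bullet> y is positive there; averaging then gives a
  strict inequality.\<close>

lemma ebar_less:
 assumes v: "v \<noteq> 0" and s: "\<And>y. y \<in> K \<Longrightarrow> v \<bullet> y \<le> s"
 shows "v \<bullet> ebar \<mu> x < s"
proof -
 have "0 < (\<integral>y. exp (x \<bullet> y) * (s - v \<bullet> y) \<partial>\<mu>)"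
 proof (rule integral_pos[of _ "interior K - {y. v \<bullet> y = s}"])
  fix y assume "y \<in> interior K - {y. v \<bullet> y = s}"
  then have "y \<in> K" "v \<bullet> y \<noteq> s" using interior_subset by auto
  then show "0 < exp (x \<bullet> y) * (s - v \<bullet> y)" using s[of y] by simp
 next
  show "interior K - {y. v \<bullet> y = s} \<subseteq> K" using interior_subset by auto
 next
  show "\<And>y. y \<in> K \<Longrightarrow> 0 \<le> exp (x \<bullet> y) * (s - v \<bullet> y)" using s by simp
 qed (use interior_minus_hyperplane[OF v, of s] in \<open>auto intro!: continuous_intros\<close>)
 also have "(\<lambda>y. exp (x \<bullet> y) * (s - v \<bullet> y)) = (\<lambda>y. s * (exp (x \<bullet> y) * 1) - exp (x \<bullet> y) * (v \<bullet> y))"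
  by (simp add: algebra_simps)
 also have "(\<integral>y. s * (exp (x \<bullet> y) * 1) - exp (x \<bullet> y) * (v \<bullet> y) \<partial>\<mu>) = s * emom \<mu> (\<lambda>_. 1) x - emom \<mu> (\<lambda>y. v \<bullet> y) x"
  unfolding emom_def
  by (subst Bochner_Integration.integral_diff) (auto intro!: integrable_cont continuous_intros)
 also have "\<dots> = emom \<mu> (\<lambda>_. 1) x * (s - v \<bullet> ebar \<mu> x)"
  unfolding emom1_inner_ebar[symmetric] by (simp add: right_diff_distrib mult.commute)
 finally show ?thesis using emom1_pos[of x] by (simp add: zero_less_mult_iff)
qed

text \<open>The quadratic form at v is the variance of v \<bullet> y under the tilted measure, which
  could vanish only if the mass sat in a hyperplane; the interior of \<open>K\<close> excludes
  that.\<close>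

lemma ecov_pos_def: "pos_def (ecov \<mu> x)"
 unfolding pos_def_def
proof (intro conjI allI impI)
 show "transpose (ecov \<mu> x) = ecov \<mu> x"
  by (simp add: transpose_def ecov_def mult.commute)
 fix v :: "real^'k" assume v: "v \<noteq> 0"
 let ?Z = "emom \<mu> (\<lambda>_. 1) x"
 define b where "b = v \<bullet> ebar \<mu> x"
 have z: "?Z > 0" by (rule emom1_pos)
 have "0 < (\<integral>y. exp (x \<bullet> y) * (v \<bullet> y - b)\<^sup>2 \<partial>\<mu>)"
 proof (rule integral_pos[of _ "interior K - {y. v \<bullet> y = b}"])
  show "interior K - {y. v \<bullet> y = b} \<subseteq> K" using interior_subset by auto
 qed (use interior_minus_hyperplane[OF v, of b] in \<open>auto intro!: continuous_intros\<close>)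
 also have "(\<lambda>y. exp (x \<bullet> y) * (v \<bullet> y - b)\<^sup>2) = (\<lambda>y. exp (x \<bullet> y) * (v \<bullet> y)\<^sup>2 - (2 * b * (exp (x \<bullet> y) * (v \<bullet> y)) - b\<^sup>2 * (exp (x \<bullet> y) * 1)))"
  by (simp add: power2_eq_square algebra_simps)
 also have "(\<integral>y. exp (x \<bullet> y) * (v \<bullet> y)\<^sup>2 - (2 * b * (exp (x \<bullet> y) * (v \<bullet> y)) - b\<^sup>2 * (exp (x \<bullet> y) * 1)) \<partial>\<mu>) = (\<integral>y. exp (x \<bullet> y) * (v \<bullet> y)\<^sup>2 \<partial>\<mu>) - (2 * b * emom \<mu> (\<lambda>y. v \<bullet> y) x - b\<^sup>2 * ?Z)"
  unfolding emom_def
  by (subst Bochner_Integration.integral_diff; (subst Bochner_Integration.integral_diff)?)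
    (auto intro!: integrable_cont Bochner_Integration.integrable_diff continuous_intros)
 also have "(\<integral>y. exp (x \<bullet> y) * (v \<bullet> y)\<^sup>2 \<partial>\<mu>)
   = (\<integral>y. (\<Sum>i\<in>UNIV. \<Sum>j\<in>UNIV. v $ i * v $ j * (exp (x \<bullet> y) * (y $ j * y $ i))) \<partial>\<mu>)"
  unfolding inner_vec_def[of v] by (simp add: power2_eq_square sum_product sum_distrib_left mult_ac)
 also have "\<dots> = (\<Sum>i\<in>UNIV. \<Sum>j\<in>UNIV. v $ i * v $ j * emom \<mu> (\<lambda>y. y $ j * y $ i) x)"
  unfolding emom_def
  by (subst Bochner_Integration.integral_sum; (subst Bochner_Integration.integral_sum)?)
    (auto intro!: integrable_cont continuous_intros Bochner_Integration.integrable_sum)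
 also have "\<dots> = ?Z * (\<Sum>i\<in>UNIV. \<Sum>j\<in>UNIV. v $ i * v $ j * (ecov \<mu> x $ i $ j + ebar \<mu> x $ i * ebar \<mu> x $ j))"
  using z by (simp add: ecov_def sum_distrib_left)
 also have "\<dots> = ?Z * (v \<bullet> (ecov \<mu> x *v v) + b\<^sup>2)"
  by (simp add: b_def inner_vec_def matrix_vector_mult_def power2_eq_square sum_product
    sum_distrib_left sum.distrib[symmetric] algebra_simps)
 finally have "0 < ?Z * (v \<bullet> (ecov \<mu> x *v v) + b\<^sup>2) - (2 * b * (?Z * b) - b\<^sup>2 * ?Z)"
  unfolding emom1_inner_ebar[symmetric] b_def .
 then have "0 < ?Z * (v \<bullet> (ecov \<mu> x *v v))"
  by (simp add: power2_eq_square algebra_simps)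
 then show "0 < v \<bullet> (ecov \<mu> x *v v)" using z by (simp add: zero_less_mult_iff)
qed

lemma ln_emom1_has_derivative:
 "((\<lambda>x. ln (emom \<mu> (\<lambda>_. 1) x)) has_derivative (\<lambda>v. v \<bullet> ebar \<mu> x)) (at x)"
proof -
 have z: "emom \<mu> (\<lambda>_. 1) x > 0" by (rule emom1_pos)
 have "((\<lambda>x. ln (emom \<mu> (\<lambda>_. 1) x)) has_derivative
   (\<lambda>v. (\<Sum>j\<in>UNIV. v $ j * emom \<mu> (\<lambda>y. y $ j * 1) x) * inverse (emom \<mu> (\<lambda>_. 1) x))) (at x)"
  by (rule DERIV_compose_FDERIV[OF DERIV_ln[OF z] emom_has_derivative]) (auto intro: continuous_intros)
 moreover have "(\<lambda>v. (\<Sum>j\<in>UNIV. v $ j * emom \<mu> (\<lambda>y. y $ j * 1) x) * inverse (emom \<mu> (\<lambda>_. 1) x)) = (\<lambda>v. v \<bullet> ebar \<mu> x)"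
  by (auto simp: ebar_def inner_vec_def sum_distrib_right divide_inverse mult.assoc)
 ultimately show ?thesis by simp
qed

text \<open>The copy of \<open>K\<close> shrunk towards y by a small factor has a fixed positive
  mass, and x \<bullet> z \<ge> x \<bullet> y - e |x| on it. So the log-Laplace transform dominates
  the support function of \<open>K\<close> up to a constant and e |x|; this drives the coercivity in
  \<open>gmap_surj\<close>.\<close>

lemma emom1_lower:
 assumes e: "e > 0"
 shows "\<exists>C. \<forall>x. \<forall>y\<in>K. C + x \<bullet> y - e * norm x \<le> ln (emom \<mu> (\<lambda>_. 1) x)"
proof -
 obtain R where R: "R > 0" "\<And>y. y \<in> K \<Longrightarrow> norm y \<le> R"
  using bounded_on_K[of norm] by (auto intro: continuous_intros)
 obtain c where c: "c > 0" "\<And>S. S \<in> sets borel \<Longrightarrow> S \<subseteq> K \<Longrightarrow> c * measure lborel S \<le> measure \<mu> S"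
  using density_bound by auto
 \<comment> \<open>As 2 R bounds the diameter of \<open>K\<close>, this factor changes x \<bullet> y
   by at most e |x| on the shrunken copy.\<close>
 define t where "t = min 1 (e / (2 * R))"
 have t: "0 < t" "t \<le> 1" "t * (2 * R) \<le> e" using e R by (auto simp: t_def min_def field_simps)
 have cK: "compact K" and vK: "convex K" using body by (auto simp: convex_body_def)
 define V where "V = measure lborel K"
 have V: "V > 0"
 proof -
  have "\<not> negligible (interior K)" using body by (simp add: convex_body_def open_not_negligible)
  then have "\<not> negligible K" using negligible_subset interior_subset by blast
  then have "measure lebesgue K \<noteq> 0"
   using cK lmeasurable_compact negligible_iff_measure by blast
  then show ?thesis using cK unfolding V_def
   by (simp add: borel_compact measure_completion zero_less_measure_iff)
 qed
 define C where "C = ln (c * (t ^ CARD('k) * V))"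
 show ?thesis
 proof (intro exI[of _ C] allI ballI)
  fix x y assume y: "y \<in> K"
  define S where "S = (\<lambda>z. (1 - t) *\<^sub>R y + t *\<^sub>R z) ` K"
  have S: "compact S" unfolding S_def by (intro compact_continuous_image cK continuous_intros)
  have SK: "S \<subseteq> K" using vK y t unfolding S_def by (auto intro: convexD)
  have mS: "measure lborel S = t ^ CARD('k) * V"
   using measure_lebesgue_affine[of t "(1 - t) *\<^sub>R y" K] S cK t unfolding S_def V_def
   by (simp add: borel_compact add.commute)
  have "exp (C + x \<bullet> y - e * norm x) = exp (x \<bullet> y - e * norm x) * (c * (t ^ CARD('k) * V))"
   using c V t by (simp add: C_def exp_add exp_diff)
  also have "\<dots> \<le> exp (x \<bullet> y - e * norm x) * measure \<mu> S"
   using c(2)[of S] S SK mS by (intro mult_left_mono) (auto simp: borel_compact)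
  also have "\<dots> = (\<integral>z. exp (x \<bullet> y - e * norm x) * indicat_real S z \<partial>\<mu>)"
   using S by (simp add: borel_compact sets_mu)
  also have "\<dots> \<le> emom \<mu> (\<lambda>_. 1) x"
   unfolding emom_def
  proof (rule integral_mono)
   show "integrable \<mu> (\<lambda>z. exp (x \<bullet> y - e * norm x) * indicat_real S z)"
    using S by (intro integrable_mult_right integrable_real_indicator)
     (auto simp: borel_compact sets_mu emeasure_eq_measure)
   fix z
   show "exp (x \<bullet> y - e * norm x) * indicat_real S z \<le> exp (x \<bullet> z) * 1"
   proof (cases "z \<in> S")
    case True
    then obtain w where w: "w \<in> K" "z = (1 - t) *\<^sub>R y + t *\<^sub>R w" unfolding S_def by auto
    have "x \<bullet> y - x \<bullet> z = t * (x \<bullet> (y - w))" by (simp add: w inner_add_right inner_diff_right algebra_simps)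
    also have "\<dots> \<le> t * (norm x * (2 * R))"
    proof (intro mult_left_mono)
     have "norm (y - w) \<le> 2 * R" using R(2)[OF y] R(2)[OF w(1)] norm_triangle_ineq4[of y w] by simp
     then show "x \<bullet> (y - w) \<le> norm x * (2 * R)"
      using norm_cauchy_schwarz[of x "y - w"] by (meson mult_left_mono norm_ge_zero order_trans)
    qed (use t in auto)
    also have "\<dots> = (t * (2 * R)) * norm x" by simp
    also have "\<dots> \<le> e * norm x" using t by (intro mult_right_mono) auto
    finally show ?thesis using True by simp
   qed auto
  qed (auto intro!: integrable_cont continuous_intros)
  finally have "exp (C + x \<bullet> y - e * norm x) \<le> emom \<mu> (\<lambda>_. 1) x" .
  then show "C + x \<bullet> y - e * norm x \<le> ln (emom \<mu> (\<lambda>_. 1) x)"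
   using emom1_pos[of x] by (simp add: ln_ge_iff)
 qed
qed

end

section \<open>Minkowski combinations and Gromov's map for a family of bodies\<close>

definition msum :: "'i set \<Rightarrow> ('i \<Rightarrow> real) \<Rightarrow> ('i \<Rightarrow> 'a::real_vector set) \<Rightarrow> 'a set" where
 "msum I c K = {\<Sum>i\<in>I. c i *\<^sub>R x i |x. \<forall>i\<in>I. x i \<in> K i}"

lemma msum_empty: "msum {} c K = {0}"
 by (auto simp: msum_def)

lemma msum_insert:
 assumes "finite I" "i \<notin> I"
 shows "msum (insert i I) c K = {c i *\<^sub>R a + b |a b. a \<in> K i \<and> b \<in> msum I c K}"
proof (intro equalityI subsetI)
 fix z assume "z \<in> msum (insert i I) c K"
 then show "z \<in> {c i *\<^sub>R a + b |a b. a \<in> K i \<and> b \<in> msum I c K}"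
  using assms by (fastforce simp: msum_def)
next
 fix z assume "z \<in> {c i *\<^sub>R a + b |a b. a \<in> K i \<and> b \<in> msum I c K}"
 then obtain a x where a: "a \<in> K i" and x: "\<forall>j\<in>I. x j \<in> K j" and z: "z = c i *\<^sub>R a + (\<Sum>j\<in>I. c j *\<^sub>R x j)"
  by (auto simp: msum_def)
 have "z = (\<Sum>j\<in>insert i I. c j *\<^sub>R (x(i := a)) j)"
  using assms z by (auto intro!: sum.cong)
 moreover have "\<forall>j\<in>insert i I. (x(i := a)) j \<in> K j" using a x by auto
 ultimately show "z \<in> msum (insert i I) c K" unfolding msum_def by blast
qed

lemma msum_compact:
 fixes K :: "'i \<Rightarrow> 'a::real_normed_vector set"
 assumes "finite I" "\<And>i. i \<in> I \<Longrightarrow> compact (K i)"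
 shows "compact (msum I c K)"
 using assms
proof (induction I)
 case (insert i I)
 have "msum (insert i I) c K = (\<lambda>(a, b). c i *\<^sub>R a + b) ` (K i \<times> msum I c K)"
  using insert.hyps by (force simp: msum_insert)
 then show ?case
  using insert by (auto simp: case_prod_unfold intro!: compact_continuous_image compact_Times continuous_intros)
qed (simp add: msum_empty)

lemma msum_convex:
 assumes "finite I" "\<And>i. i \<in> I \<Longrightarrow> convex (K i)"
 shows "convex (msum I c K)"
 using assms
proof (induction I)
 case (insert i I)
 have "msum (insert i I) c K = (\<Union>x\<in>(\<lambda>a. c i *\<^sub>R a) ` K i. \<Union>y\<in>msum I c K. {x + y})"
  using insert.hyps by (force simp: msum_insert)
 then show ?case
  using insert by (simp only:) (intro convex_sums convex_scaling, auto)
qed (simp add: msum_empty)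

lemma msum_ne: "(\<And>i. i \<in> I \<Longrightarrow> K i \<noteq> {}) \<Longrightarrow> msum I c K \<noteq> {}"
 unfolding msum_def by (auto intro!: exI[of _ "\<lambda>i. SOME y. y \<in> K i"] simp: some_in_eq)

lemma msum_interior_ne:
 fixes K :: "'i \<Rightarrow> 'a::real_normed_vector set"
 assumes fin: "finite I" and ne: "\<And>i. i \<in> I \<Longrightarrow> K i \<noteq> {}" and i: "i \<in> I" "c i \<noteq> 0" "interior (K i) \<noteq> {}"
 shows "interior (msum I c K) \<noteq> {}"
proof -
 have I: "I = insert i (I - {i})" using i by auto
 obtain b where b: "b \<in> msum (I - {i}) c K" using msum_ne[of "I - {i}" K c] ne by blast
 have "(\<lambda>x. b + c i *\<^sub>R x) ` interior (K i) \<subseteq> msum I c K"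
  using b interior_subset[of "K i"] fin
  by (subst I, subst msum_insert) (auto simp: add.commute)
 moreover have "open ((\<lambda>x. b + c i *\<^sub>R x) ` interior (K i))"
  using i by (intro open_affinity) auto
 ultimately have "(\<lambda>x. b + c i *\<^sub>R x) ` interior (K i) \<subseteq> interior (msum I c K)"
  by (rule interior_maximal)
 then show ?thesis using i by blast
qed

lemma msum_convex_body:
 assumes "finite I" "\<And>i. i \<in> I \<Longrightarrow> convex_body (K i)" "i \<in> I" "c i \<noteq> 0"
 shows "convex_body (msum I c K)"
proof -
 have "K j \<noteq> {}" if "j \<in> I" for j using assms(2)[OF that] interior_subset[of "K j"] by (auto simp: convex_body_def)
 then have "interior (msum I c K) \<noteq> {}"
  using assms by (intro msum_interior_ne[of I K i c]) (auto simp: convex_body_def)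
 then show ?thesis
  using assms unfolding convex_body_def by (auto intro!: msum_compact msum_convex)
qed

text \<open>A point outside the interior can be separated from it by a hyperplane. As the set lies
  in the closure of its interior, the separating direction contradicts the hypothesis.\<close>

lemma in_interior_convexI:
 fixes S :: "'a::euclidean_space set"
 assumes S: "convex S" "interior S \<noteq> {}"
  and p: "\<And>v. v \<noteq> 0 \<Longrightarrow> \<exists>y\<in>S. v \<bullet> p < v \<bullet> y"
 shows "p \<in> interior S"
proof (rule ccontr)
 assume "p \<notin> interior S"
 then obtain a b where ab: "a \<noteq> 0" "\<forall>x\<in>interior S. a \<bullet> x \<le> b" "\<forall>x\<in>{p}. b \<le> a \<bullet> x"
  using separating_hyperplane_sets[of "interior S" "{p}"] S by auto
 have "S \<subseteq> closure (interior S)"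
  using S closure_subset convex_closure_interior by blast
 also have "\<dots> \<subseteq> {x. a \<bullet> x \<le> b}"
  by (rule closure_minimal) (use ab closed_halfspace_le in auto)
 finally show False using p[OF ab(1)] ab(3) by force
qed

text \<open>Along the segment from x to y = x + w the function w \<bullet> f has a derivative of the
  form w \<bullet> (A w) > 0, so f x and f y differ.\<close>

lemma pos_def_derivative_inj:
 fixes f :: "real^'k \<Rightarrow> real^'k"
 assumes f: "\<And>x. (f has_derivative (\<lambda>v. A x *v v)) (at x)" and A: "\<And>x. pos_def (A x)"
 shows "inj f"
proof (rule injI, rule ccontr)
 fix x y assume eq: "f x = f y" and ne: "x \<noteq> y"
 define w where "w = y - x"
 define g where "g t = w \<bullet> f (x + t *\<^sub>R w)" for t
 have "(g has_derivative (\<lambda>h. w \<bullet> (A (x + t *\<^sub>R w) *v (h *\<^sub>R w)))) (at t)" for t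
  unfolding g_def
  by (rule has_derivative_inner_right[OF has_derivative_compose[OF _ f]])
    (auto intro!: derivative_eq_intros)
 then have D: "(g has_real_derivative (w \<bullet> (A (x + t *\<^sub>R w) *v w))) (at t)" for t
  by (simp add: has_field_derivative_def matrix_vector_mult_scaleR mult.commute[of _ "w \<bullet> _"])
 have "g 0 < g 1"
  by (rule DERIV_pos_imp_increasing[OF zero_less_one])
    (use D A ne in \<open>auto simp: pos_def_def w_def intro!: exI\<close>)
 then show False using eq by (simp add: g_def w_def)
qed

lemma measure_interior_convex_body:
 "convex_body S \<Longrightarrow> measure lebesgue (interior S) = measure lebesgue S"
 unfolding convex_body_def
 by (intro measure_interior compact_imp_bounded negligible_convex_frontier) auto

locale body_family =
 fixes I :: "'i set" and c :: "'i \<Rightarrow> real" and K :: "'i \<Rightarrow> (real^'k::{finite,wellorder}) set"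
  and \<mu> :: "'i \<Rightarrow> (real^'k::{finite,wellorder}) measure"
 assumes finI: "finite I" and Ine: "I \<noteq> {}" and cpos: "\<And>i. i \<in> I \<Longrightarrow> 0 < c i"
  and bodies: "\<And>i. i \<in> I \<Longrightarrow> weighted_body (K i) (\<mu> i)"
begin

text \<open>Gradient of the weighted sum of the log-Laplace transforms; \<open>gder\<close> is the
  Hessian of that sum.\<close>

definition "gmap x = (\<Sum>i\<in>I. c i *\<^sub>R ebar (\<mu> i) x)"
definition "gder x = (\<Sum>i\<in>I. c i *\<^sub>R ecov (\<mu> i) x)"

lemma convex_bodies: "i \<in> I \<Longrightarrow> convex_body (K i)"
 using bodies weighted_body.body by blast

lemma gder_pos_def: "pos_def (gder x)"
proof -
 have "pos_def (\<Sum>i\<in>J. c i *\<^sub>R ecov (\<mu> i) x)" if "J \<subseteq> I" "J \<noteq> {}" for J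
  using finite_subset[OF that(1) finI] that(2,1)
 proof (induction J rule: finite_ne_induct)
  case (singleton i)
  then show ?case using cpos weighted_body.ecov_pos_def[OF bodies] by (auto intro: pos_def_scale)
 next
  case (insert i J)
  then show ?case using cpos weighted_body.ecov_pos_def[OF bodies]
   by (auto intro!: pos_def_add pos_def_imp_semidef[OF insert.IH] intro: pos_def_scale)
 qed
 then show ?thesis using Ine by (simp add: gder_def)
qed

lemma gmap_has_derivative: "(gmap has_derivative (\<lambda>v. gder x *v v)) (at x)"
proof -
 have "(gmap has_derivative (\<lambda>v. \<Sum>i\<in>I. c i *\<^sub>R (ecov (\<mu> i) x *v v))) (at x)"
  unfolding gmap_def[abs_def]
  by (intro has_derivative_sum has_derivative_scaleR_right weighted_body.ebar_has_derivative[OF bodies])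
 moreover have "(\<Sum>i\<in>J. c i *\<^sub>R ecov (\<mu> i) x) *v v = (\<Sum>i\<in>J. c i *\<^sub>R (ecov (\<mu> i) x *v v))" for J v
 proof (induction J rule: infinite_finite_induct)
  case (insert i J)
  then show ?case by (simp add: matrix_vector_mult_add_rdistrib scaleR_matrix_vector_assoc[symmetric])
 qed (simp_all add: vec_eq_iff matrix_vector_mult_def)
 ultimately show ?thesis by (simp add: gder_def)
qed

lemma inner_msum_bound:
 obtains s where "\<And>i y. i \<in> I \<Longrightarrow> y \<in> K i \<Longrightarrow> v \<bullet> y \<le> v \<bullet> s i" "\<And>i. i \<in> I \<Longrightarrow> s i \<in> K i"
proof -
 have "\<exists>s\<in>K i. \<forall>y\<in>K i. v \<bullet> y \<le> v \<bullet> s" if "i \<in> I" for i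
 proof (rule continuous_attains_sup)
  show "compact (K i)" "K i \<noteq> {}" using convex_bodies[OF that] interior_subset[of "K i"] by (auto simp: convex_body_def)
 qed (intro continuous_intros)
 then show ?thesis using that by metis
qed

lemma msum_body: "convex_body (msum I c K)"
proof -
 obtain i where "i \<in> I" using Ine by auto
 then show ?thesis using cpos[of i] by (intro msum_convex_body finI convex_bodies) auto
qed

lemma gmap_in_interior: "gmap x \<in> interior (msum I c K)"
proof (rule in_interior_convexI)
 fix v :: "(real,'k) vec" assume v: "v \<noteq> 0"
 obtain s where s: "\<And>i y. i \<in> I \<Longrightarrow> y \<in> K i \<Longrightarrow> v \<bullet> y \<le> v \<bullet> s i" "\<And>i. i \<in> I \<Longrightarrow> s i \<in> K i"
  using inner_msum_bound by blast
 have "v \<bullet> gmap x = (\<Sum>i\<in>I. c i * (v \<bullet> ebar (\<mu> i) x))"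
  by (simp add: gmap_def inner_sum_right)
 also have "\<dots> < (\<Sum>i\<in>I. c i * (v \<bullet> s i))"
  by (intro sum_strict_mono finI Ine mult_strict_left_mono cpos weighted_body.ebar_less[OF bodies v]) (use s in auto)
 also have "\<dots> = v \<bullet> (\<Sum>i\<in>I. c i *\<^sub>R s i)" by (simp add: inner_sum_right)
 finally show "\<exists>y\<in>msum I c K. v \<bullet> gmap x < v \<bullet> y"
  using s(2) by (auto simp: msum_def)
qed (use msum_body in \<open>auto simp: convex_body_def\<close>)

text \<open>A preimage of p is a critical point of \<Psi>, the weighted sum of the log-Laplace
  transforms minus x \<bullet> p. A minimum exists because \<Psi> grows linearly: the ball of radius
  e about p inside the sum gains e |x|, and the errors in \<open>emom1_lower\<close> cost half of
  it.\<close>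

lemma gmap_surj:
 assumes p: "p \<in> interior (msum I c K)"
 shows "\<exists>x. gmap x = p"
proof -
 obtain e where e: "e > 0" "cball p e \<subseteq> msum I c K"
  using p mem_interior_cball by blast
 define C0 where "C0 = (\<Sum>i\<in>I. c i)"
 have C0: "C0 > 0" unfolding C0_def by (intro sum_pos finI Ine cpos)
 \<comment> \<open>The errors d |x| enter with total weight \<open>C0\<close>, so this choice makes
   them add up to e / 2 * |x|.\<close>
 define d where "d = e / (2 * C0)"
 have d: "d > 0" using e C0 by (simp add: d_def)
 have "\<forall>i\<in>I. \<exists>C. \<forall>x. \<forall>y\<in>K i. C + x \<bullet> y - d * norm x \<le> ln (emom (\<mu> i) (\<lambda>_. 1) x)"
  using weighted_body.emom1_lower[OF bodies d] by blast
 then obtain C where C: "\<And>i x y. i \<in> I \<Longrightarrow> y \<in> K i \<Longrightarrow> C i + x \<bullet> y - d * norm x \<le> ln (emom (\<mu> i) (\<lambda>_. 1) x)"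
  by metis
 define \<Psi> where "\<Psi> x = (\<Sum>i\<in>I. c i * ln (emom (\<mu> i) (\<lambda>_. 1) x)) - x \<bullet> p" for x
 define C1 where "C1 = (\<Sum>i\<in>I. c i * C i)"
 have low: "C1 + (e / 2) * norm x \<le> \<Psi> x" for x
 proof -
  define q where "q = p + e *\<^sub>R sgn x"
  have "q \<in> cball p e" using e by (simp add: q_def dist_norm norm_sgn)
  then obtain y where y: "\<forall>i\<in>I. y i \<in> K i" "q = (\<Sum>i\<in>I. c i *\<^sub>R y i)"
   using e(2) by (auto simp: msum_def)
  have "x \<bullet> sgn x = norm x"
   by (cases "x = 0") (simp_all add: sgn_div_norm power2_norm_eq_inner[symmetric] power2_eq_square)
  then have "x \<bullet> q = x \<bullet> p + e * norm x"
   by (simp add: q_def inner_add_right)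
  moreover have "x \<bullet> q = (\<Sum>i\<in>I. c i * (x \<bullet> y i))" by (simp add: y inner_sum_right)
  ultimately have xq: "(\<Sum>i\<in>I. c i * (x \<bullet> y i)) = x \<bullet> p + e * norm x" by simp
  have "(\<Sum>i\<in>I. c i * (C i + x \<bullet> y i - d * norm x)) \<le> (\<Sum>i\<in>I. c i * ln (emom (\<mu> i) (\<lambda>_. 1) x))"
   using y C cpos by (intro sum_mono mult_left_mono) (auto intro: less_imp_le)
  moreover have "(\<Sum>i\<in>I. c i * (C i + x \<bullet> y i - d * norm x)) = C1 + (x \<bullet> p + e * norm x) - C0 * d * norm x"
   unfolding xq[symmetric] C1_def C0_def by (simp add: sum.distrib sum_subtractf sum_distrib_left sum_distrib_right algebra_simps)
  moreover have "C0 * d = e / 2" using C0 by (simp add: d_def)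
  ultimately show ?thesis by (simp add: \<Psi>_def algebra_simps)
 qed
 have D: "(\<Psi> has_derivative (\<lambda>v. v \<bullet> (gmap x - p))) (at x)" for x
 proof -
  have "(\<Psi> has_derivative (\<lambda>v. (\<Sum>i\<in>I. c i * (v \<bullet> ebar (\<mu> i) x)) - v \<bullet> p)) (at x)"
   unfolding \<Psi>_def[abs_def]
   by (intro has_derivative_diff has_derivative_sum has_derivative_mult_right
     weighted_body.ln_emom1_has_derivative[OF bodies] has_derivative_inner_left has_derivative_ident)
  then show ?thesis
   by (simp add: gmap_def inner_diff_right inner_sum_right)
 qed
 \<comment> \<open>Outside this ball \<open>low\<close> gives \<Psi> x \<ge> \<Psi> 0, so a minimum
   over the ball is a global one.\<close>
 define r where "r = max 0 ((\<Psi> 0 - C1) / (e / 2))"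
 have "continuous_on (cball 0 r) \<Psi>"
  by (intro continuous_at_imp_continuous_on ballI has_derivative_continuous[OF D])
 then obtain x0 where x0: "x0 \<in> cball 0 r" "\<And>x. x \<in> cball 0 r \<Longrightarrow> \<Psi> x0 \<le> \<Psi> x"
  using continuous_attains_inf[of "cball 0 r" \<Psi>] by (auto simp: r_def)
 have min: "\<Psi> x0 \<le> \<Psi> x" for x
 proof (cases "x \<in> cball 0 r")
  case False
  then have "(\<Psi> 0 - C1) / (e / 2) \<le> norm x" by (auto simp: r_def)
  then have "\<Psi> 0 - C1 \<le> (e / 2) * norm x" using e by (simp add: field_simps)
  then have "\<Psi> 0 \<le> \<Psi> x" using low[of x] by linarith
  moreover have "\<Psi> x0 \<le> \<Psi> 0" by (rule x0) (simp add: r_def)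
  ultimately show ?thesis by simp
 qed (use x0 in auto)
 have "(\<lambda>v. v \<bullet> (gmap x0 - p)) = (\<lambda>v. 0)"
  by (rule differential_zero_maxmin[OF _ open_UNIV D]) (use min in auto)
 then have "(gmap x0 - p) \<bullet> (gmap x0 - p) = 0" by meson
 then show ?thesis by auto
qed

lemma range_gmap: "range gmap = interior (msum I c K)"
 using gmap_in_interior gmap_surj by blast

text \<open>Change of variables for the injective map \<open>gmap\<close>, whose image is the
  interior of the Minkowski sum; the frontier of a convex body is negligible.\<close>

theorem det_integral: "((\<lambda>x. det (gder x)) has_integral measure lebesgue (msum I c K)) UNIV"
proof -
 have "range gmap \<in> lmeasurable \<and> measure lebesgue (range gmap) = measure lebesgue (msum I c K)"
  unfolding range_gmap using measure_interior_convex_body[OF msum_body] msum_body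
  by (auto simp: convex_body_def intro: lmeasurable_interior compact_imp_bounded)
 then have "((\<lambda>x. \<bar>det (matrix (\<lambda>v. gder x *v v))\<bar>) has_integral measure lebesgue (msum I c K)) UNIV"
  by (subst (asm) has_measure_differentiable_image[of UNIV gmap "\<lambda>x v. gder x *v v"])
    (auto intro: gmap_has_derivative pos_def_derivative_inj gder_pos_def)
 moreover have "\<bar>det (gder x)\<bar> = det (gder x)" for x
  using pos_def_det_pos[OF gder_pos_def, of x] by simp
 ultimately show ?thesis by simp
qed

end

section \<open>Mixed coefficients of two bodies under hyperplane cuts\<close>

definition dsum :: "'a::real_vector set \<Rightarrow> real \<Rightarrow> 'a set \<Rightarrow> 'a set" where
 "dsum A t B = {x + t *\<^sub>R y |x y. x \<in> A \<and> y \<in> B}"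

text \<open>Coefficient of t^j in vol (A + t B): a binomial coefficient times the mixed volume with
  j copies of \<open>B\<close>, the remaining ones being \<open>A\<close>. The values at t > 0
  already determine the coefficients.\<close>

definition mixcoef :: "'a::euclidean_space set \<Rightarrow> 'a set \<Rightarrow> nat \<Rightarrow> real" where
 "mixcoef A B = (SOME a. \<forall>t>0. measure lebesgue (dsum A t B) = (\<Sum>j\<le>DIM('a). a j * t ^ j))"

lemma coeffs_unique_pos:
 fixes a b :: "nat \<Rightarrow> real"
 assumes "\<And>t. t > 0 \<Longrightarrow> (\<Sum>j\<le>m. a j * t ^ j) = (\<Sum>j\<le>m. b j * t ^ j)" "j \<le> m"
 shows "a j = b j"
proof -
 define p where "p = (\<Sum>j\<le>m. monom (a j - b j) j)"
 have "poly p t = 0" if "t > 0" for t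
  using assms(1)[OF that] by (simp add: p_def poly_sum poly_monom sum_subtractf left_diff_distrib)
 then have "{0<..} \<subseteq> {t. poly p t = 0}" by auto
 then have "infinite {t. poly p t = 0}"
  using infinite_Ioi finite_subset by blast
 then have "p = 0" using poly_roots_finite by blast
 then have "coeff p j = 0" by simp
 then show ?thesis using assms(2) by (simp add: p_def coeff_sum)
qed

lemma mixcoef_unique:
 fixes A B :: "'a::euclidean_space set"
 assumes "\<And>t. t > 0 \<Longrightarrow> measure lebesgue (dsum A t B) = (\<Sum>j\<le>DIM('a). a j * t ^ j)" "j \<le> DIM('a)"
 shows "mixcoef A B j = a j"
proof -
 have "\<forall>t>0. measure lebesgue (dsum A t B) = (\<Sum>j\<le>DIM('a). mixcoef A B j * t ^ j)"
  unfolding mixcoef_def by (rule someI[of _ a]) (use assms in auto)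
 then have "(\<Sum>j\<le>DIM('a). mixcoef A B j * t ^ j) = (\<Sum>j\<le>DIM('a). a j * t ^ j)" if "t > 0" for t
  using assms(1)[OF that] that by simp
 then show ?thesis using assms(2) by (rule coeffs_unique_pos)
qed

lemma tendsto_coeff_prod:
 fixes p :: "'b \<Rightarrow> 'i \<Rightarrow> real poly"
 assumes "finite I" "\<And>i j. i \<in> I \<Longrightarrow> ((\<lambda>x. coeff (p x i) j) \<longlongrightarrow> coeff (q i) j) F"
 shows "((\<lambda>x. coeff (\<Prod>i\<in>I. p x i) j) \<longlongrightarrow> coeff (\<Prod>i\<in>I. q i) j) F"
 using assms
proof (induction I arbitrary: j)
 case (insert i I)
 then show ?case
  by (simp add: coeff_mult) (intro tendsto_intros, auto)
qed auto

lemma tendsto_coeff_det_pencil: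
 fixes A :: "'b \<Rightarrow> real^'k^'k"
 assumes "\<And>i j. ((\<lambda>x. A x $ i $ j) \<longlongrightarrow> A' $ i $ j) F" "\<And>i j. ((\<lambda>x. B x $ i $ j) \<longlongrightarrow> B' $ i $ j) F"
 shows "((\<lambda>x. coeff (det_pencil (A x) (B x)) j) \<longlongrightarrow> coeff (det_pencil A' B') j) F"
 unfolding det_pencil_def det_def coeff_sum of_int_poly
 by (intro tendsto_sum) (auto intro!: tendsto_intros tendsto_coeff_prod assms simp: coeff_pCons split: nat.split)

lemma dsum_msum: "dsum A t B = msum {0, 1::nat} (\<lambda>i. if i = 0 then 1 else t) (\<lambda>i. if i = 0 then A else B)"
 by (auto simp: msum_insert msum_empty dsum_def)

lemma dsum_compact:
 fixes A B :: "'a::real_normed_vector set"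
 shows "compact A \<Longrightarrow> compact B \<Longrightarrow> compact (dsum A t B)"
 unfolding dsum_msum by (rule msum_compact) auto

context
 fixes A B :: "(real^'k::{finite,wellorder}) set" and \<mu> \<nu> :: "(real^'k::{finite,wellorder}) measure"
 assumes A: "weighted_body A \<mu>" and B: "weighted_body B \<nu>"
begin

abbreviation (input) "pencil x \<equiv> det_pencil (ecov \<mu> x) (ecov \<nu> x)"

lemma pencil_integral:
 assumes t: "t > 0"
 shows "((\<lambda>x. poly (pencil x) t) has_integral measure lebesgue (dsum A t B)) UNIV"
proof -
 interpret body_family "{0, 1::nat}" "\<lambda>i. if i = 0 then 1 else t" "\<lambda>i. if i = 0 then A else B" "\<lambda>i. if i = 0 then \<mu> else \<nu>"
  by (rule body_family.intro) (use t A B in auto)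
 show ?thesis
  using det_integral unfolding gder_def by (simp add: dsum_msum poly_det_pencil)
qed

lemma pencil_coeff_nonneg: "coeff (pencil x) j \<ge> 0"
 by (intro det_pencil_coeff_nonneg pos_def_imp_semidef weighted_body.ecov_pos_def[OF A] weighted_body.ecov_pos_def[OF B])

lemma pencil_coeff_measurable [measurable]: "(\<lambda>x. coeff (pencil x) j) \<in> borel_measurable borel"
proof (rule borel_measurable_continuous_onI)
 have "continuous_on UNIV (\<lambda>x. ecov \<mu> x $ i $ j)" "continuous_on UNIV (\<lambda>x. ecov \<nu> x $ i $ j)" for i j
  by (rule weighted_body.ecov_continuous[OF A] weighted_body.ecov_continuous[OF B])+
 then show "continuous_on UNIV (\<lambda>x. coeff (pencil x) j)"
  unfolding continuous_on_def by (auto intro: tendsto_coeff_det_pencil)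
qed

lemma poly_pencil: "poly (pencil x) t = (\<Sum>j\<le>CARD('k). coeff (pencil x) j * t ^ j)"
proof -
 have "degree (pencil x) \<le> CARD('k)" by (rule degree_det_pencil)
 then show ?thesis unfolding poly_altdef
  by (intro sum.mono_neutral_left) (auto simp: coeff_eq_0)
qed

text \<open>All coefficients are nonnegative, so each one is dominated by the value of the pencil at
  t = 1, whose integral is a volume.\<close>

lemma pencil_coeff_integrable: "integrable lborel (\<lambda>x. coeff (pencil x) j)"
proof -
 have nn: "0 \<le> poly (pencil x) 1" for x
  unfolding poly_pencil by (intro sum_nonneg mult_nonneg_nonneg pencil_coeff_nonneg) auto
 have meas: "(\<lambda>x. poly (pencil x) 1) \<in> borel_measurable lborel"
  unfolding poly_pencil by measurable
 have "(\<integral>\<^sup>+x. ennreal (poly (pencil x) 1) \<partial>lborel) = ennreal (measure lebesgue (dsum A 1 B))"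
  using meas nn pencil_integral[of 1] by (intro nn_integral_has_integral_lborel) auto
 then have "integrable lborel (\<lambda>x. poly (pencil x) 1)" using meas nn by (intro integrableI_nonneg) auto
 then show ?thesis
 proof (rule Bochner_Integration.integrable_bound)
  show "AE x in lborel. norm (coeff (pencil x) j) \<le> norm (poly (pencil x) 1)"
  proof (rule AE_I2)
   fix x
   show "norm (coeff (pencil x) j) \<le> norm (poly (pencil x) 1)"
   proof (cases "j \<le> CARD('k)")
    case True
    have "coeff (pencil x) j \<le> (\<Sum>j\<le>CARD('k). coeff (pencil x) j)"
     by (rule member_le_sum) (use True pencil_coeff_nonneg in auto)
    then show ?thesis using nn[of x] pencil_coeff_nonneg[of x j] by (simp add: poly_pencil)
   next
    case False
    then show ?thesis
     using degree_det_pencil[of "ecov \<mu> x" "ecov \<nu> x"] by (simp add: coeff_eq_0)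
   qed
  qed
 qed measurable
qed

lemma measure_dsum_coeffs:
 assumes "t > 0"
 shows "measure lebesgue (dsum A t B) = (\<Sum>j\<le>CARD('k). (\<integral>x. coeff (pencil x) j \<partial>lborel) * t ^ j)"
proof -
 have "((\<lambda>x. \<Sum>j\<le>CARD('k). coeff (pencil x) j * t ^ j) has_integral
   (\<Sum>j\<le>CARD('k). (\<integral>x. coeff (pencil x) j \<partial>lborel) * t ^ j)) UNIV"
  by (intro has_integral_sum has_integral_mult_left has_integral_integral_lborel pencil_coeff_integrable) auto
 moreover have "((\<lambda>x. \<Sum>j\<le>CARD('k). coeff (pencil x) j * t ^ j) has_integral
   measure lebesgue (dsum A t B)) UNIV"
  using pencil_integral[OF assms] by (simp add: poly_pencil)
 ultimately show ?thesis by (rule has_integral_unique[rotated])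
qed

text \<open>The left-hand side does not involve \<open>\<mu>\<close> and \<open>\<nu>\<close>: every
  choice of weights represents the same coefficient. The cutting argument rests on this
  freedom.\<close>

lemma mixcoef_integral:
 assumes "j \<le> CARD('k)"
 shows "mixcoef A B j = (\<integral>x. coeff (pencil x) j \<partial>lborel)"
 using measure_dsum_coeffs assms by (intro mixcoef_unique) auto

lemma mixcoef_nn_integral:
 assumes "j \<le> CARD('k)"
 shows "ennreal (mixcoef A B j) = (\<integral>\<^sup>+x. ennreal (coeff (pencil x) j) \<partial>lborel)"
 unfolding mixcoef_integral[OF assms]
 by (rule nn_integral_eq_integral[symmetric]) (auto intro: pencil_coeff_integrable pencil_coeff_nonneg)

end

section \<open>Weights concentrating on a hyperplane\<close>

definition wmeas :: "'a::euclidean_space set \<Rightarrow> ('a \<Rightarrow> real) \<Rightarrow> 'a measure" where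
 "wmeas A w = density lborel (\<lambda>y. ennreal (indicator A y * w y))"

lemma weighted_body_wmeas:
 fixes A :: "(real^'k) set"
 assumes A: "convex_body A" and w: "continuous_on UNIV w" "\<And>y. 0 < w y"
 shows "weighted_body A (wmeas A w)"
proof
 have cA: "compact A" and Ab[measurable]: "A \<in> sets borel"
  using A by (auto simp: convex_body_def borel_compact)
 have wm[measurable]: "w \<in> borel_measurable borel" using w by (intro borel_measurable_continuous_onI)
 have int: "integrable lborel (\<lambda>y. indicator A y * w y)"
  using borel_integrable_compact[OF cA, of w] continuous_on_subset[OF w(1)] by (simp add: mult.commute)
 show "sets (wmeas A w) = sets borel" by (simp add: wmeas_def)
 have fin: "emeasure (wmeas A w) UNIV < \<infinity>"
 proof -
  have "emeasure (wmeas A w) UNIV = (\<integral>\<^sup>+y. ennreal (indicator A y * w y) \<partial>lborel)"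
   by (simp add: wmeas_def emeasure_density)
  also have "\<dots> = ennreal (\<integral>y. indicator A y * w y \<partial>lborel)"
   by (rule nn_integral_eq_integral[OF int]) (use w in \<open>auto simp: less_imp_le\<close>)
  finally show ?thesis by simp
 qed
 then show "emeasure (wmeas A w) UNIV < \<infinity>" .
 show "emeasure (wmeas A w) (- A) = 0"
 proof -
  have "emeasure (wmeas A w) (- A) = (\<integral>\<^sup>+y. ennreal (indicator A y * w y) * indicator (- A) y \<partial>lborel)"
   by (simp add: wmeas_def emeasure_density)
  also have "\<dots> = (\<integral>\<^sup>+y. 0 \<partial>(lborel :: (real^'k) measure))"
   by (intro nn_integral_cong) (auto simp: indicator_def)
  finally show ?thesis by simp
 qed
 have "A \<noteq> {}" using A interior_subset[of A] by (auto simp: convex_body_def)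
 then obtain y0 where y0: "y0 \<in> A" "\<And>y. y \<in> A \<Longrightarrow> w y0 \<le> w y"
  using continuous_attains_inf[OF cA, of w] w continuous_on_subset by blast
 show "\<exists>c>0. \<forall>S\<in>sets borel. S \<subseteq> A \<longrightarrow> c * measure lborel S \<le> measure (wmeas A w) S"
 proof (intro exI[of _ "w y0"] conjI ballI impI w)
  fix S :: "(real^'k) set" assume S[measurable]: "S \<in> sets borel" and SA: "S \<subseteq> A"
  have "ennreal (w y0) * emeasure lborel S = (\<integral>\<^sup>+y. ennreal (w y0) * indicator S y \<partial>lborel)"
   by (subst nn_integral_cmult_indicator) auto
  also have "\<dots> \<le> (\<integral>\<^sup>+y. ennreal (indicator A y * w y) * indicator S y \<partial>lborel)"
   using y0 SA by (intro nn_integral_mono) (auto simp: indicator_def ennreal_leI)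
  also have "\<dots> = emeasure (wmeas A w) S" by (simp add: wmeas_def emeasure_density)
  finally have le: "ennreal (w y0) * emeasure lborel S \<le> emeasure (wmeas A w) S" .
  have "emeasure (wmeas A w) S \<le> emeasure (wmeas A w) UNIV" by (rule emeasure_mono) (auto simp: wmeas_def)
  then have "emeasure (wmeas A w) S < \<infinity>" using fin by (simp add: order_le_less_trans)
  then have "enn2real (ennreal (w y0) * emeasure lborel S) \<le> measure (wmeas A w) S"
   unfolding measure_def using le by (intro enn2real_mono) auto
  then show "w y0 * measure lborel S \<le> measure (wmeas A w) S"
   using w(2)[of y0] by (simp add: enn2real_mult measure_def)
 qed
qed (use A in auto)

lemma emom_wmeas:
 assumes A: "compact A" and w: "continuous_on UNIV w" "\<And>y. 0 < w y" and g: "continuous_on UNIV g"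
 shows "emom (wmeas A w) g x = (\<integral>y. indicator A y * w y * (exp (x \<bullet> y) * g y) \<partial>lborel)"
proof -
 have [measurable]: "A \<in> sets borel" "w \<in> borel_measurable borel" "g \<in> borel_measurable borel"
  using assms by (auto simp: borel_compact intro: borel_measurable_continuous_onI)
 show ?thesis
  unfolding emom_def wmeas_def
  by (subst integral_density) (use w in \<open>auto simp: less_imp_le\<close>)
qed

text \<open>These weights concentrate on the hyperplane \<open>y $ i = s\<close>; tilting by \<open>exp (\<plusminus> n * y $ i)\<close>
 leaves in the limit Lebesgue measure on one of the two halves of the body.\<close>

definition "cutw (i::'k) s n (y::real^'k) = exp (- real n * \<bar>y $ i - s\<bar>)"

lemma cutw_pos: "0 < cutw i s n y" by (simp add: cutw_def)
lemma cutw_cont: "continuous_on UNIV (cutw i s n)"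
 unfolding cutw_def[abs_def] by (intro continuous_intros)

text \<open>Together with the prefactor, weight and tilt combine to exp (n * r) with r = sig * (y $
  i - s) - |y $ i - s|. This r is 0 on the chosen half and negative on the other, so dominated
  convergence removes the other half.\<close>

lemma emom_shift_tendsto:
 fixes A :: "(real^'k) set" and g :: "real^'k \<Rightarrow> real"
 assumes A: "compact A" and g: "continuous_on UNIV g" and sig: "sig \<in> {1, -1::real}"
 shows "(\<lambda>n. exp (- real n * sig * s) * emom (wmeas A (cutw i s n)) g (x + (real n * sig) *\<^sub>R axis i 1))
   \<longlonglongrightarrow> emom (wmeas (A \<inter> {y. 0 \<le> sig * (y $ i - s)}) (\<lambda>_. 1)) g x"
proof -
 let ?A = "A \<inter> {y. 0 \<le> sig * (y $ i - s)}"
 have cA: "compact ?A"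
  by (intro compact_Int_closed A closed_Collect_le continuous_intros)
 have m[measurable]: "A \<in> sets borel" "?A \<in> sets borel" "g \<in> borel_measurable borel"
  using A cA g by (auto simp: borel_compact intro: borel_measurable_continuous_onI)
 let ?x = "\<lambda>n. x + (real n * sig) *\<^sub>R axis i 1 :: real^'k" and ?c = "\<lambda>n. exp (- real n * sig * s)"
  and ?r = "\<lambda>y::real^'k. sig * (y $ i - s) - \<bar>y $ i - s\<bar>"
 let ?f = "\<lambda>n y. indicator A y * exp (real n * ?r y) * (exp (x \<bullet> y) * g y)"
 have eq: "?c n * emom (wmeas A (cutw i s n)) g (?x n)
   = (\<integral>y. ?f n y \<partial>lborel)" for n
 proof -
  have "?c n * emom (wmeas A (cutw i s n)) g (?x n)
   = (\<integral>y. ?c n * (indicator A y * cutw i s n y * (exp (?x n \<bullet> y) * g y)) \<partial>lborel)"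
   by (subst emom_wmeas) (auto intro: A g cutw_pos cutw_cont)
  also have "\<dots> = (\<integral>y. ?f n y \<partial>lborel)"
  proof (rule Bochner_Integration.integral_cong[OF refl])
   fix y :: "real^'k"
   have "?x n \<bullet> y = x \<bullet> y + real n * sig * y $ i"
    by (simp add: inner_add_left inner_axis' )
   moreover have "?c n * (exp (- real n * \<bar>y $ i - s\<bar>) * exp (x \<bullet> y + real n * sig * y $ i))
     = exp (real n * ?r y) * exp (x \<bullet> y)"
    by (simp add: exp_add[symmetric] algebra_simps)
   ultimately show "?c n * (indicator A y * cutw i s n y * (exp (?x n \<bullet> y) * g y))
     = ?f n y" by (simp add: cutw_def mult_ac)
  qed
  finally show ?thesis .
 qed
 have lim: "(\<lambda>n. \<integral>y. ?f n y \<partial>lborel) \<longlonglongrightarrow> (\<integral>y. indicator ?A y * (exp (x \<bullet> y) * g y) \<partial>lborel)"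
 proof (rule integral_dominated_convergence[where w="\<lambda>y. indicator A y * \<bar>exp (x \<bullet> y) * g y\<bar>"])
  show "integrable lborel (\<lambda>y. indicator A y * \<bar>exp (x \<bullet> y) * g y\<bar>)"
  proof -
   have "continuous_on A (\<lambda>y. \<bar>exp (x \<bullet> y) * g y\<bar>)"
    by (intro continuous_intros continuous_on_subset[OF g]) auto
   from borel_integrable_compact[OF A this] show ?thesis by simp
  qed
  show "AE y in lborel. (\<lambda>n. ?f n y) \<longlonglongrightarrow> indicator ?A y * (exp (x \<bullet> y) * g y)"
  proof (rule AE_I2)
   fix y :: "real^'k"
   show "(\<lambda>n. ?f n y) \<longlonglongrightarrow> indicator ?A y * (exp (x \<bullet> y) * g y)"
   proof (cases "0 \<le> sig * (y $ i - s)")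
    case True
    then have "?r y = 0" using sig by auto
    then show ?thesis using True by (simp add: indicator_def)
   next
    case False
    then have neg: "?r y < 0" using sig by auto
    have "(\<lambda>n. exp (?r y) ^ n) \<longlonglongrightarrow> 0"
     by (rule LIMSEQ_realpow_zero) (use neg in auto)
    then have "(\<lambda>n. indicator A y * exp (real n * ?r y) * (exp (x \<bullet> y) * g y))
      \<longlonglongrightarrow> indicator A y * 0 * (exp (x \<bullet> y) * g y)"
     by (intro tendsto_intros) (simp add: exp_of_nat_mult)
    then show ?thesis using False by (simp add: indicator_def)
   qed
  qed
  show "AE y in lborel. norm (?f n y) \<le> indicator A y * \<bar>exp (x \<bullet> y) * g y\<bar>" for n
  proof (rule AE_I2)
   fix y :: "real^'k"
   have "?r y \<le> 0" using sig by auto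
   then have "exp (real n * ?r y) \<le> 1"
    by (simp add: mult_nonneg_nonpos)
   then show "norm (?f n y) \<le> indicator A y * \<bar>exp (x \<bullet> y) * g y\<bar>"
    by (auto simp: indicator_def abs_mult mult_left_le_one_le)
  qed
 qed measurable
 moreover have "emom (wmeas ?A (\<lambda>_. 1)) g x = (\<integral>y. indicator ?A y * (exp (x \<bullet> y) * g y) \<partial>lborel)"
  by (subst emom_wmeas) (auto intro: cA g)
 ultimately show ?thesis unfolding eq by simp
qed

text \<open>The exponential prefactor is common to all moments and cancels in their quotients, so
  the covariances converge without rescaling.\<close>

lemma ecov_shift_tendsto:
 fixes A :: "(real^'k) set"
 assumes A: "compact A" and A': "convex_body (A \<inter> {y. 0 \<le> sig * (y $ i - s)})" and sig: "sig \<in> {1, -1::real}"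
 shows "(\<lambda>n. ecov (wmeas A (cutw i s n)) (x + (real n * sig) *\<^sub>R axis i 1) $ a $ b)
   \<longlonglongrightarrow> ecov (wmeas (A \<inter> {y. 0 \<le> sig * (y $ i - s)}) (\<lambda>_. 1)) x $ a $ b"
proof -
 let ?\<mu> = "wmeas (A \<inter> {y. 0 \<le> sig * (y $ i - s)}) (\<lambda>_. 1)"
 interpret weighted_body "A \<inter> {y. 0 \<le> sig * (y $ i - s)}" ?\<mu>
  by (rule weighted_body_wmeas[OF A']) auto
 let ?e = "\<lambda>n. exp (- real n * sig * s)" and ?x = "\<lambda>n. x + (real n * sig) *\<^sub>R axis i 1" and ?m = "\<lambda>n. wmeas A (cutw i s n)"
 have z: "emom ?\<mu> (\<lambda>_. 1) x \<noteq> 0" using emom1_pos[of x] by simp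
 have q: "(\<lambda>n. emom (?m n) g (?x n) / emom (?m n) (\<lambda>_. 1) (?x n)) \<longlonglongrightarrow> emom ?\<mu> g x / emom ?\<mu> (\<lambda>_. 1) x"
  if g: "continuous_on UNIV g" for g
 proof -
  have "(\<lambda>n. (?e n * emom (?m n) g (?x n)) / (?e n * emom (?m n) (\<lambda>_. 1) (?x n))) \<longlonglongrightarrow> emom ?\<mu> g x / emom ?\<mu> (\<lambda>_. 1) x"
   by (intro tendsto_divide emom_shift_tendsto A sig g z continuous_intros)
  then show ?thesis by simp
 qed
 show ?thesis
  unfolding ecov_def ebar_def vec_lambda_beta
  by (intro tendsto_diff tendsto_mult q continuous_intros)
qed

lemma mixcoef_nonneg:
 fixes A B :: "(real^'k::{finite,wellorder}) set"
 assumes "convex_body A" "convex_body B" "j \<le> CARD('k)"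
 shows "0 \<le> mixcoef A B j"
proof -
 have w: "weighted_body A (wmeas A (\<lambda>_. 1))" "weighted_body B (wmeas B (\<lambda>_. 1))"
  using assms by (auto intro: weighted_body_wmeas)
 show ?thesis unfolding mixcoef_integral[OF w assms(3)]
  by (intro integral_nonneg_AE AE_I2 pencil_coeff_nonneg[OF w])
qed

lemma less_add_iff_neg: "0 < a + b \<longleftrightarrow> - b < a" for a b :: real
 by linarith

text \<open>With concentrating weights the coefficient of \<open>A\<close> and \<open>B\<close> is
  an integral over the whole space. The half-space x $ i > 0, seen from a point moving off by n, and
  the half-space x $ i < 0, seen from one moving off by -n, both grow to the whole space, and the
  integrand on them tends to that of the upper and of the lower pieces. Fatou's lemma gives the
  inequality. The heights s and s' are independent of each other.\<close>

theorem mixcoef_superadditive: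
 fixes A B :: "(real^'k::{finite,wellorder}) set"
 assumes A: "convex_body A" and B: "convex_body B"
  and A1: "convex_body (A \<inter> {y. y $ i \<le> s})" and A2: "convex_body (A \<inter> {y. s \<le> y $ i})"
  and B1: "convex_body (B \<inter> {y. y $ i \<le> s'})" and B2: "convex_body (B \<inter> {y. s' \<le> y $ i})"
  and j: "j \<le> CARD('k)"
 shows "mixcoef (A \<inter> {y. y $ i \<le> s}) (B \<inter> {y. y $ i \<le> s'}) j + mixcoef (A \<inter> {y. s \<le> y $ i}) (B \<inter> {y. s' \<le> y $ i}) j
   \<le> mixcoef A B j"
proof -
 define Ac where "Ac sig = A \<inter> {y. 0 \<le> sig * (y $ i - s)}" for sig
 define Bc where "Bc sig = B \<inter> {y. 0 \<le> sig * (y $ i - s')}" for sig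
 have Ac: "Ac 1 = A \<inter> {y. s \<le> y $ i}" "Ac (-1) = A \<inter> {y. y $ i \<le> s}" by (auto simp: Ac_def)
 have Bc: "Bc 1 = B \<inter> {y. s' \<le> y $ i}" "Bc (-1) = B \<inter> {y. y $ i \<le> s'}" by (auto simp: Bc_def)
 have cb: "convex_body (Ac sig)" "convex_body (Bc sig)" if "sig \<in> {1, -1}" for sig
  using that A1 A2 B1 B2 Ac Bc by auto
 define u where "u n = wmeas A (cutw i s n)" for n
 define v where "v n = wmeas B (cutw i s' n)" for n
 have wu: "weighted_body A (u n)" for n unfolding u_def by (intro weighted_body_wmeas A cutw_cont cutw_pos)
 have wv: "weighted_body B (v n)" for n unfolding v_def by (intro weighted_body_wmeas B cutw_cont cutw_pos)
 have wA: "weighted_body (Ac sig) (wmeas (Ac sig) (\<lambda>_. 1))" "weighted_body (Bc sig) (wmeas (Bc sig) (\<lambda>_. 1))" if "sig \<in> {1, -1}" for sig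
  using cb[OF that] by (auto intro!: weighted_body_wmeas)
 define D where "D n x = ennreal (coeff (det_pencil (ecov (u n) x) (ecov (v n) x)) j)" for n x
 define E where "E sig x = ennreal (coeff (det_pencil (ecov (wmeas (Ac sig) (\<lambda>_. 1)) x) (ecov (wmeas (Bc sig) (\<lambda>_. 1)) x)) j)" for sig x
 have Dm[measurable]: "D n \<in> borel_measurable borel" for n
  using pencil_coeff_measurable[OF wu wv] unfolding D_def[abs_def] by measurable
 have Em[measurable]: "E sig \<in> borel_measurable borel" if "sig \<in> {1, -1}" for sig
  using pencil_coeff_measurable[OF wA[OF that]] unfolding E_def[abs_def] by measurable
 let ?e = "axis i 1 :: (real,'k) vec"
 have lim: "(\<lambda>n. D n (x + (real n * sig) *\<^sub>R ?e)) \<longlonglongrightarrow> E sig x" if sig: "sig \<in> {1, -1}" for sig x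
  unfolding D_def E_def u_def v_def Ac_def Bc_def
  by (intro tendsto_ennrealI tendsto_coeff_det_pencil ecov_shift_tendsto sig cb[OF sig, unfolded Ac_def Bc_def])
    (use A B in \<open>auto simp: convex_body_def\<close>)
 let ?D1 = "\<lambda>n x. D n (x + real n *\<^sub>R ?e)" and ?D2 = "\<lambda>n x. D n (x + (- real n) *\<^sub>R ?e)"
 \<comment> \<open>The indicators are those of the translated open half-spaces; each of them
   eventually contains any given point.\<close>
 define U where "U n x = ?D1 n x * indicator {x. - real n < x $ i} x
   + ?D2 n x * indicator {x. x $ i < real n} x" for n x
 have Um[measurable]: "U n \<in> borel_measurable borel" for n
  unfolding U_def[abs_def] by measurable
 have liminf: "liminf (\<lambda>n. U n x) = E 1 x + E (-1) x" for x
 proof -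
  have ev: "\<forall>\<^sub>F n in sequentially. \<bar>x $ i\<bar> < real n"
   using filterlim_real_sequentially unfolding filterlim_at_top_dense by blast
  have "(\<lambda>n. ?D1 n x + ?D2 n x) \<longlonglongrightarrow> E 1 x + E (-1) x"
   using lim[of 1 x] lim[of "-1" x] by (auto intro: tendsto_add)
  moreover have "\<forall>\<^sub>F n in sequentially. ?D1 n x + ?D2 n x = U n x"
   using ev by eventually_elim (auto simp: U_def indicator_def)
  ultimately have "(\<lambda>n. U n x) \<longlonglongrightarrow> E 1 x + E (-1) x"
   by (rule Lim_transform_eventually)
  then show ?thesis by (rule lim_imp_Liminf[rotated]) simp
 qed
 \<comment> \<open>Undoing the translations leaves the integrand on two disjoint half-spaces, so the
   integral of \<open>U\<close> stays below the full coefficient.\<close>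
 have bound: "(\<integral>\<^sup>+x. U n x \<partial>lborel) \<le> ennreal (mixcoef A B j)" for n
 proof -
  have shift: "(\<integral>\<^sup>+x. f (x + h) \<partial>lborel) = (\<integral>\<^sup>+x. f x \<partial>lborel)" if [measurable]: "f \<in> borel_measurable borel" for f and h :: "(real,'k) vec"
  proof -
   have "(\<integral>\<^sup>+x. f x \<partial>lborel) = (\<integral>\<^sup>+x. f x \<partial>(distr lborel borel ((+) h)))"
    by (simp only: lborel_distr_plus)
   also have "\<dots> = (\<integral>\<^sup>+x. f (h + x) \<partial>lborel)"
    by (subst nn_integral_distr) auto
   finally show ?thesis by (simp add: add.commute)
  qed
  have 1: "(\<integral>\<^sup>+x. ?D1 n x * indicator {x. - real n < x $ i} x \<partial>lborel) = (\<integral>\<^sup>+x. D n x * indicator {x. 0 < x $ i} x \<partial>lborel)"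
  proof -
   have "(\<lambda>x. D n x * indicator {x. 0 < x $ i} x) \<in> borel_measurable borel" by measurable
   from shift[OF this, of "real n *\<^sub>R ?e"] show ?thesis
    by (simp add: indicator_def less_add_iff_neg)
  qed
  have 2: "(\<integral>\<^sup>+x. ?D2 n x * indicator {x. x $ i < real n} x \<partial>lborel) = (\<integral>\<^sup>+x. D n x * indicator {x. x $ i < 0} x \<partial>lborel)"
  proof -
   have "(\<lambda>x. D n x * indicator {x. x $ i < 0} x) \<in> borel_measurable borel" by measurable
   from shift[OF this, of "(- real n) *\<^sub>R ?e"] show ?thesis
    by (simp add: indicator_def)
  qed
  have "(\<integral>\<^sup>+x. U n x \<partial>lborel) = (\<integral>\<^sup>+x. D n x * indicator {x. 0 < x $ i} x \<partial>lborel) + (\<integral>\<^sup>+x. D n x * indicator {x. x $ i < 0} x \<partial>lborel)"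
   unfolding U_def 1[symmetric] 2[symmetric] by (rule nn_integral_add) measurable
  also have "\<dots> = (\<integral>\<^sup>+x. D n x * indicator {x. 0 < x $ i} x + D n x * indicator {x. x $ i < 0} x \<partial>lborel)"
   by (rule nn_integral_add[symmetric]) measurable
  also have "\<dots> \<le> (\<integral>\<^sup>+x. D n x \<partial>lborel)"
   by (intro nn_integral_mono) (auto simp: indicator_def)
  also have "\<dots> = ennreal (mixcoef A B j)"
   unfolding D_def using mixcoef_nn_integral[OF wu wv j] by simp
  finally show ?thesis .
 qed
 have "ennreal (mixcoef (Ac 1) (Bc 1) j) + ennreal (mixcoef (Ac (-1)) (Bc (-1)) j) = (\<integral>\<^sup>+x. E 1 x + E (-1) x \<partial>lborel)"
 proof -
  have E: "ennreal (mixcoef (Ac sig) (Bc sig) j) = (\<integral>\<^sup>+x. E sig x \<partial>lborel)" if "sig \<in> {1, -1}" for sig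
   unfolding E_def by (rule mixcoef_nn_integral[OF wA[OF that] j])
  show ?thesis
   using Em[of 1] Em[of "-1"] E[of 1] E[of "-1"] by (simp add: nn_integral_add)
 qed
 also have "\<dots> = (\<integral>\<^sup>+x. liminf (\<lambda>n. U n x) \<partial>lborel)" by (simp add: liminf)
 also have "\<dots> \<le> liminf (\<lambda>n. \<integral>\<^sup>+x. U n x \<partial>lborel)" by (rule nn_integral_liminf) simp
 also have "\<dots> \<le> ennreal (mixcoef A B j)"
  using Liminf_mono[of "\<lambda>n. \<integral>\<^sup>+x. U n x \<partial>lborel" "\<lambda>_. ennreal (mixcoef A B j)" sequentially] bound
  by (simp add: Liminf_const)
 finally have *: "ennreal (mixcoef (Ac 1) (Bc 1) j) + ennreal (mixcoef (Ac (-1)) (Bc (-1)) j) \<le> ennreal (mixcoef A B j)" .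
 have nn: "0 \<le> mixcoef (Ac 1) (Bc 1) j" "0 \<le> mixcoef (Ac (-1)) (Bc (-1)) j" "0 \<le> mixcoef A B j"
  by (simp_all add: mixcoef_nonneg A B cb j)
 show ?thesis using * nn by (simp add: ennreal_plus[symmetric] Ac Bc del: ennreal_plus)
qed

lemma measure_dsum_mixcoef:
 fixes A B :: "(real^'k::{finite,wellorder}) set"
 assumes "convex_body A" "convex_body B" "t > 0"
 shows "measure lebesgue (dsum A t B) = (\<Sum>j\<le>CARD('k). mixcoef A B j * t ^ j)"
proof -
 have w: "weighted_body A (wmeas A (\<lambda>_. 1))" "weighted_body B (wmeas B (\<lambda>_. 1))"
  using assms by (auto intro: weighted_body_wmeas)
 show ?thesis using measure_dsum_coeffs[OF w assms(3)] by (simp add: mixcoef_integral[OF w])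
qed

section \<open>Volumes of cuts by coordinate hyperplanes\<close>

abbreviation vol :: "'a::euclidean_space set \<Rightarrow> real" where "vol \<equiv> measure lebesgue"

abbreviation hlo :: "'k \<Rightarrow> real \<Rightarrow> (real^'k) set" where "hlo i s \<equiv> {y. y $ i \<le> s}"
abbreviation hhi :: "'k \<Rightarrow> real \<Rightarrow> (real^'k) set" where "hhi i s \<equiv> {y. s \<le> y $ i}"

lemma closed_hlo: "closed (hlo i s)" and closed_hhi: "closed (hhi i s)"
 by (auto intro!: closed_Collect_le continuous_intros)

lemma convex_hlo: "convex (hlo i s)" and convex_hhi: "convex (hhi i s)"
proof -
 have "hlo i s = {y. axis i 1 \<bullet> y \<le> s}" "hhi i s = {y. axis i 1 \<bullet> y \<ge> s}" by (auto simp: inner_axis')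
 then show "convex (hlo i s)" "convex (hhi i s)" by (simp_all add: convex_halfspace_le convex_halfspace_ge)
qed

lemma compact_cut: "compact A \<Longrightarrow> compact (A \<inter> hlo i s)" "compact A \<Longrightarrow> compact (A \<inter> hhi i s)"
 by (auto intro: compact_Int_closed closed_hlo closed_hhi)

lemma vol_mono: "A \<subseteq> B \<Longrightarrow> compact A \<Longrightarrow> compact B \<Longrightarrow> vol A \<le> vol B"
 by (intro measure_mono_fmeasurable) (auto intro: lmeasurable_compact fmeasurableD)

lemma vol_cut:
 assumes "compact A" shows "vol (A \<inter> hlo i s) + vol (A \<inter> hhi i s) = vol A"
proof -
 have "negligible ((A \<inter> hlo i s) \<inter> (A \<inter> hhi i s))"
  by (rule negligible_subset[OF negligible_hyperplane[of "axis i 1" s]]) (auto simp: inner_axis' axis_eq_0_iff)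
 then have "vol ((A \<inter> hlo i s) \<inter> (A \<inter> hhi i s)) = 0" by (rule negligible_imp_measure0)
 moreover have "A \<inter> hlo i s \<union> A \<inter> hhi i s = A" by auto
 moreover have 1: "A \<inter> hlo i s \<in> lmeasurable" and 2: "A \<inter> hhi i s \<in> lmeasurable"
  by (simp_all add: compact_cut[OF assms] lmeasurable_compact)
 ultimately show ?thesis
  using measure_Un3[OF 1 2] by simp
qed

lemma convex_body_if_vol_pos:
 "compact C \<Longrightarrow> convex C \<Longrightarrow> 0 < vol C \<Longrightarrow> convex_body C"
 using negligible_convex_interior negligible_imp_measure0 by (fastforce simp: convex_body_def)

lemma convex_body_cut:
 assumes "convex_body A"
 shows "0 < vol (A \<inter> hlo i s) \<Longrightarrow> convex_body (A \<inter> hlo i s)"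
  and "0 < vol (A \<inter> hhi i s) \<Longrightarrow> convex_body (A \<inter> hhi i s)"
proof -
 have "compact A" "convex A" using assms by (auto simp: convex_body_def)
 then show "0 < vol (A \<inter> hlo i s) \<Longrightarrow> convex_body (A \<inter> hlo i s)" "0 < vol (A \<inter> hhi i s) \<Longrightarrow> convex_body (A \<inter> hhi i s)"
  by (simp_all add: convex_body_if_vol_pos compact_cut convex_Int convex_hlo convex_hhi)
qed

lemma vol_pos_interior:
 assumes "interior A \<noteq> {}" "A \<in> lmeasurable" shows "0 < vol A"
proof -
 have "\<not> negligible (interior A)" using assms by (simp add: open_not_negligible)
 then have "\<not> negligible A" using negligible_subset interior_subset by blast
 then show ?thesis using assms negligible_iff_measure zero_less_measure_iff by blast
qed

lemma convex_body_vol_pos: "convex_body A \<Longrightarrow> 0 < vol A"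
 by (auto simp: convex_body_def intro: vol_pos_interior lmeasurable_compact)

lemma vol_cbox_cart: "(\<And>i. a $ i \<le> b $ i) \<Longrightarrow> vol (cbox a b) = (\<Prod>i\<in>UNIV. b $ i - a $ i)" for a b :: "real^'k"
 by (simp add: content_cbox_cart interval_ne_empty_cart)

text \<open>The slab part of \<open>A\<close> fits into a box of side 2 M in the other directions.
  One constant serves all slabs, which makes cut volumes Lipschitz in the height.\<close>

lemma slab_vol_le:
 fixes A :: "(real^'k) set"
 assumes "bounded A"
 obtains C where "C \<ge> 0" "\<And>i s s'. s \<le> s' \<Longrightarrow> compact A \<Longrightarrow> vol (A \<inter> hhi i s \<inter> hlo i s') \<le> C * (s' - s)"
proof -
 obtain M where M: "M > 0" "\<And>x. x \<in> A \<Longrightarrow> norm x \<le> M" using assms bounded_pos by blast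
 show thesis
 proof (rule that[of "(2 * M) ^ (CARD('k) - 1)"])
  fix i :: 'k and s s' :: real assume s: "s \<le> s'" and A: "compact A"
  let ?a = "(\<chi> k. if k = i then s else - M) :: real^'k" and ?b = "(\<chi> k. if k = i then s' else M) :: real^'k"
  have sub: "A \<inter> hhi i s \<inter> hlo i s' \<subseteq> cbox ?a ?b"
  proof
   fix x assume x: "x \<in> A \<inter> hhi i s \<inter> hlo i s'"
   then have "\<bar>x $ k\<bar> \<le> M" for k using M(2)[of x] component_le_norm_cart[of x k] by auto
   then show "x \<in> cbox ?a ?b" using x by (auto simp: mem_box_cart abs_le_iff) (metis minus_le_iff)
  qed
  have "vol (A \<inter> hhi i s \<inter> hlo i s') \<le> vol (cbox ?a ?b)"
   by (rule vol_mono[OF sub]) (auto intro!: compact_cut A)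
  also have "\<dots> = (\<Prod>k\<in>UNIV. ?b $ k - ?a $ k)"
   using s M(1) by (intro vol_cbox_cart) auto
  also have "\<dots> = (s' - s) * (\<Prod>k\<in>UNIV - {i}. ?b $ k - ?a $ k)"
   by (subst prod.remove[of _ i]) auto
  also have "(\<Prod>k\<in>UNIV - {i}. ?b $ k - ?a $ k) = (\<Prod>k\<in>UNIV - {i}. 2 * M)"
   by (rule prod.cong) auto
  also have "\<dots> = (2 * M) ^ (CARD('k) - 1)" by simp
  finally show "vol (A \<inter> hhi i s \<inter> hlo i s') \<le> (2 * M) ^ (CARD('k) - 1) * (s' - s)" by (simp add: mult.commute)
 qed (use M in auto)
qed

lemma vol_hlo_diff:
 assumes "compact A" "s \<le> s'"
 shows "vol (A \<inter> hlo i s') - vol (A \<inter> hlo i s) = vol (A \<inter> hhi i s \<inter> hlo i s')"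
proof -
 have "vol (A \<inter> hlo i s' \<inter> hlo i s) + vol (A \<inter> hlo i s' \<inter> hhi i s) = vol (A \<inter> hlo i s')"
  by (rule vol_cut) (simp add: compact_cut assms)
 moreover have "A \<inter> hlo i s' \<inter> hlo i s = A \<inter> hlo i s" using assms by auto
 moreover have "A \<inter> hlo i s' \<inter> hhi i s = A \<inter> hhi i s \<inter> hlo i s'" by auto
 ultimately show ?thesis by simp
qed

lemma continuous_vol_hlo:
 fixes A :: "(real^'k) set"
 assumes A: "compact A"
 shows "continuous_on S (\<lambda>s. vol (A \<inter> hlo i s))"
proof -
 obtain C where C: "C \<ge> 0" "\<And>s s'. s \<le> s' \<Longrightarrow> vol (A \<inter> hhi i s \<inter> hlo i s') \<le> C * (s' - s)"
  using slab_vol_le[OF compact_imp_bounded[OF A]] A by metis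
 have b: "\<bar>vol (A \<inter> hlo i s') - vol (A \<inter> hlo i s)\<bar> \<le> C * \<bar>s' - s\<bar>" for s s'
 proof (cases "s \<le> s'")
  case True
  then show ?thesis using C(2)[OF True] vol_hlo_diff[OF A True, of i] by simp
 next
  case False
  then have "s' \<le> s" by simp
  then have "vol (A \<inter> hlo i s) - vol (A \<inter> hlo i s') \<le> C * (s - s')" "0 \<le> vol (A \<inter> hlo i s) - vol (A \<inter> hlo i s')"
   using C(2)[of s' s] vol_hlo_diff[OF A, of s' s i] by simp_all
  then show ?thesis using \<open>s' \<le> s\<close> by (simp add: abs_minus_commute[of s'] abs_minus_commute[of "vol (A \<inter> hlo i s')"])
 qed
 have "C-lipschitz_on S (\<lambda>s. vol (A \<inter> hlo i s))"
  by (rule lipschitz_onI) (use b C in \<open>auto simp: dist_real_def abs_minus_commute\<close>)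
 then show ?thesis by (rule lipschitz_on_continuous_on)
qed

lemma bounded_component:
 assumes "bounded (A::(real^'k) set)" obtains M where "M > 0" "\<And>x i. x \<in> A \<Longrightarrow> \<bar>x $ i\<bar> \<le> M"
proof -
 obtain M where "M > 0" "\<And>x. x \<in> A \<Longrightarrow> norm x \<le> M" using assms bounded_pos by blast
 then show thesis using that[of M] component_le_norm_cart by (meson order_trans)
qed

lemma cut_exists:
 fixes A :: "(real^'k) set"
 assumes A: "compact A" and v: "0 \<le> v" "v \<le> vol A"
 obtains s where "vol (A \<inter> hlo i s) = v" "vol (A \<inter> hhi i s) = vol A - v"
proof -
 obtain M where M: "M > 0" "\<And>x i. x \<in> A \<Longrightarrow> \<bar>x $ i\<bar> \<le> M"
  using bounded_component[OF compact_imp_bounded[OF A]] by blast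
 have "A \<inter> hlo i (-M - 1) = {}"
 proof -
  have "- M \<le> y $ i" if "y \<in> A" for y using M(2)[OF that, of i] by linarith
  then show ?thesis by force
 qed
 moreover have "A \<inter> hlo i M = A" using M(2) by (auto simp: abs_le_iff)
 ultimately have "\<exists>s\<ge>-M - 1. s \<le> M \<and> vol (A \<inter> hlo i s) = v"
  using v M by (intro IVT' continuous_vol_hlo A) auto
 then obtain s where s: "vol (A \<inter> hlo i s) = v" by blast
 then show thesis using that[of s] vol_cut[OF A, of i s] by simp
qed

text \<open>Erosion of \<open>K\<close> by a ball. A piece of diameter at most \<open>dlt\<close>
  around such a deep point does not feel the boundary of \<open>K\<close>.\<close>

definition inner_set :: "'a::euclidean_space set \<Rightarrow> real \<Rightarrow> 'a set" where
 "inner_set K dlt = {x. cball x dlt \<subseteq> K}"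

lemma closed_inner_set: "closed K \<Longrightarrow> closed (inner_set K dlt)"
proof -
 assume K: "closed K"
 have "inner_set K dlt = (\<Inter>h\<in>cball 0 dlt. (\<lambda>x. x + h) -` K)"
 proof (intro set_eqI iffI)
  fix x assume "x \<in> (\<Inter>h\<in>cball 0 dlt. (\<lambda>x. x + h) -` K)"
  then have *: "x + h \<in> K" if "h \<in> cball 0 dlt" for h using that by auto
  have "y \<in> K" if "y \<in> cball x dlt" for y
   using *[of "y - x"] that by (auto simp: dist_norm norm_minus_commute)
  then show "x \<in> inner_set K dlt" by (auto simp: inner_set_def)
 qed (auto simp: inner_set_def dist_norm)
 moreover have "closed ((\<lambda>x. x + h) -` K)" for h
  by (rule closed_vimage[OF K]) (intro continuous_intros)
 ultimately show ?thesis by auto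
qed

lemma inner_set_subset: "dlt \<ge> 0 \<Longrightarrow> inner_set K dlt \<subseteq> K"
 by (auto simp: inner_set_def)

lemma inner_set_mono: "dlt \<le> dlt' \<Longrightarrow> inner_set K dlt' \<subseteq> inner_set K dlt"
 by (auto simp: inner_set_def)

text \<open>The convex mixture of x with the whole ball about z is a ball of radius \<theta> * rho
  about the contracted point, and it lies in \<open>K\<close>.\<close>

lemma contract_inner_set:
 assumes K: "convex K" and z: "cball z rho \<subseteq> K" and \<theta>: "0 < \<theta>" "\<theta> \<le> 1" and x: "x \<in> K"
 shows "(1 - \<theta>) *\<^sub>R x + \<theta> *\<^sub>R z \<in> inner_set K (\<theta> * rho)"
 unfolding inner_set_def
proof (rule CollectI, rule subsetI)
 fix y assume y: "y \<in> cball ((1 - \<theta>) *\<^sub>R x + \<theta> *\<^sub>R z) (\<theta> * rho)"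
 define w where "w = z + (1 / \<theta>) *\<^sub>R (y - ((1 - \<theta>) *\<^sub>R x + \<theta> *\<^sub>R z))"
 have "norm (w - z) = (1 / \<theta>) * norm (y - ((1 - \<theta>) *\<^sub>R x + \<theta> *\<^sub>R z))" using \<theta> by (simp add: w_def)
 also have "\<dots> \<le> rho" using y \<theta> by (simp add: dist_norm norm_minus_commute field_simps)
 finally have "w \<in> K" using z by (auto simp: dist_norm norm_minus_commute)
 moreover have "y = (1 - \<theta>) *\<^sub>R x + \<theta> *\<^sub>R w" using \<theta> by (simp add: w_def algebra_simps)
 ultimately show "y \<in> K" using K x \<theta> by (simp add: convexD)
qed

lemma vol_affine: "vol ((\<lambda>x. m *\<^sub>R x + c) ` S) = \<bar>m\<bar> ^ DIM('a) * vol S" for S :: "'a::euclidean_space set"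
 by (rule measure_lebesgue_affine)

lemma vol_inner_set:
 fixes K :: "'a::euclidean_space set"
 assumes K: "convex_body K" and \<theta>: "0 < \<theta>" "\<theta> < 1"
 obtains dlt where "dlt > 0" "\<And>dlt'. 0 \<le> dlt' \<Longrightarrow> dlt' \<le> dlt \<Longrightarrow> (1 - \<theta>) ^ DIM('a) * vol K \<le> vol (inner_set K dlt')"
proof -
 obtain z rho where z: "rho > 0" "cball z rho \<subseteq> K"
  using K unfolding convex_body_def by (meson ex_in_conv mem_interior_cball)
 show thesis
 proof (rule that[of "\<theta> * rho"])
  fix dlt' :: real assume d: "0 \<le> dlt'" "dlt' \<le> \<theta> * rho"
  let ?f = "\<lambda>x. (1 - \<theta>) *\<^sub>R x + \<theta> *\<^sub>R z"
  have cK: "compact K" using K by (simp add: convex_body_def)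
  have ci: "compact (inner_set K dlt')"
   using closed_inner_set[of K dlt'] inner_set_subset[OF d(1), of K] cK compact_imp_closed
    compact_imp_bounded bounded_subset compact_eq_bounded_closed by blast
  have "(1 - \<theta>) ^ DIM('a) * vol K = vol (?f ` K)" using \<theta> by (simp add: vol_affine)
  also have "\<dots> \<le> vol (inner_set K dlt')"
  proof (rule vol_mono[OF _ _ ci])
   have "?f ` K \<subseteq> inner_set K (\<theta> * rho)"
    using K z \<theta> by (auto simp: convex_body_def intro!: contract_inner_set)
   also have "\<dots> \<subseteq> inner_set K dlt'" by (rule inner_set_mono[OF d(2)])
   finally show "?f ` K \<subseteq> inner_set K dlt'" .
   show "compact (?f ` K)" by (intro compact_continuous_image continuous_intros cK)
  qed
  finally show "(1 - \<theta>) ^ DIM('a) * vol K \<le> vol (inner_set K dlt')" .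
 qed (use z \<theta> in auto)
qed

section \<open>Boxes: elementary symmetric functions of edge ratios and AM-GM\<close>

definition esym :: "('k::finite \<Rightarrow> real) \<Rightarrow> nat \<Rightarrow> real" where
 "esym tau j = (\<Sum>S | card S = j. \<Prod>i\<in>S. tau i)"

lemma card_subsets_with: "card {S. card S = j \<and> (i::'k::finite) \<in> S} = (CARD('k) choose j) - ((CARD('k) - 1) choose j)"
proof -
 have "{S. card S = j \<and> i \<in> S} = {S. S \<subseteq> UNIV \<and> card S = j} - {S. S \<subseteq> UNIV - {i} \<and> card S = j}" by auto
 also have "card \<dots> = card {S. S \<subseteq> (UNIV::'k set) \<and> card S = j} - card {S. S \<subseteq> UNIV - {i} \<and> card S = j}"
  by (rule card_Diff_subset) auto
 also have "card {S. S \<subseteq> (UNIV::'k set) \<and> card S = j} = (CARD('k) choose j)" by (rule n_subsets) simp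
 also have "card {S. S \<subseteq> UNIV - {i} \<and> card S = j} = (card (UNIV - {i}) choose j)" by (rule n_subsets) simp
 finally show ?thesis by (simp add: card_Diff_singleton)
qed

text \<open>Dividing by the geometric mean a makes the logarithms sum to zero, hence also the
  logarithms of all products over j-element sets, as every index occurs in equally many of them.
  Then x \<ge> 1 + ln x is summed over these products. Equality forces each product to be 1, and
  exchanging one index for another gives equal entries.\<close>

lemma esym_amgm:
 fixes tau :: "'k::finite \<Rightarrow> real" and j :: nat
 assumes pos: "\<And>i. tau i > 0"
 defines "G \<equiv> (\<Prod>i\<in>UNIV. tau i) powr (real j / real CARD('k))"
 shows "real (CARD('k) choose j) * G \<le> esym tau j"
  and "esym tau j = real (CARD('k) choose j) * G \<Longrightarrow> 0 < j \<Longrightarrow> j < CARD('k) \<Longrightarrow> tau i = tau k"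
proof -
 let ?m = "real CARD('k)"
 define a where "a = (\<Prod>i\<in>UNIV. tau i) powr (1 / ?m)"
 have Ppos: "(\<Prod>i\<in>UNIV. tau i) > 0" using pos by (simp add: prod_pos)
 have apos: "a > 0" using Ppos unfolding a_def powr_gt_zero by linarith
 have am: "a ^ j = G"
  unfolding powr_realpow[OF apos, symmetric] by (simp add: a_def G_def powr_powr)
 define x where "x S = (\<Prod>i\<in>S. tau i / a)" for S
 have xpos: "x S > 0" for S unfolding x_def using pos apos by (intro prod_pos) auto
 have sumln: "(\<Sum>i\<in>UNIV. ln (tau i / a)) = 0"
 proof -
  have "(\<Sum>i\<in>UNIV. ln (tau i / a)) = (\<Sum>i\<in>UNIV. ln (tau i)) - ?m * ln a"
  proof -
   have "ln (tau i / a) = ln (tau i) - ln a" for i using pos[of i] apos by (metis ln_divide_pos)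
   then show ?thesis by (simp add: sum_subtractf)
  qed
  also have "?m * ln a = ln (\<Prod>i\<in>UNIV. tau i)" using Ppos by (simp add: a_def ln_powr)
  also have "\<dots> = (\<Sum>i\<in>UNIV. ln (tau i))" by (intro ln_prod) (simp, metis pos less_irrefl)
  finally show ?thesis by simp
 qed
 have "(\<Sum>S | card S = j. ln (x S)) = (\<Sum>S | card S = j. \<Sum>i\<in>S. ln (tau i / a))"
 proof -
  have "tau i / a \<noteq> 0" for i using pos[of i] apos by simp
  then show ?thesis unfolding x_def by (intro sum.cong refl ln_prod) auto
 qed
 also have "\<dots> = (\<Sum>S | card S = j. \<Sum>i | i \<in> UNIV \<and> i \<in> S. ln (tau i / a))" by simp
 also have "\<dots> = (\<Sum>i\<in>UNIV. \<Sum>S | S \<in> {S. card S = j} \<and> i \<in> S. ln (tau i / a))"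
  by (rule sum.swap_restrict) auto
 also have "\<dots> = (\<Sum>i\<in>UNIV. ((CARD('k) choose j) - ((CARD('k) - 1) choose j)) * ln (tau i / a))"
  by (simp add: card_subsets_with)
 also have "\<dots> = 0" by (simp add: sum_distrib_left[symmetric] sumln)
 finally have ln0: "(\<Sum>S | card S = j. ln (x S)) = 0" .
 have es: "esym tau j = G * (\<Sum>S | card S = j. x S)"
  unfolding esym_def sum_distrib_left
 proof (rule sum.cong[OF refl])
  fix S :: "'k set" assume "S \<in> {S. card S = j}"
  then have "(\<Prod>i\<in>S. tau i / a) = (\<Prod>i\<in>S. tau i) / a ^ j" by (simp add: prod_dividef)
  then show "(\<Prod>i\<in>S. tau i) = G * x S" using apos by (simp add: x_def am[symmetric])
 qed
 have cnt: "card {S::'k set. card S = j} = (CARD('k) choose j)"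
  using n_subsets[of "UNIV :: 'k set" j] by simp
 have le: "1 + ln (x S) \<le> x S" for S using ln_le_minus_one[OF xpos[of S]] by simp
 have "(\<Sum>S | card S = j. 1 + ln (x S)) \<le> (\<Sum>S | card S = j. x S)" by (rule sum_mono) (rule le)
 then have "real (CARD('k) choose j) \<le> (\<Sum>S | card S = j. x S)" by (simp add: sum.distrib ln0 cnt)
 then have "G * real (CARD('k) choose j) \<le> G * (\<Sum>S | card S = j. x S)"
  using apos by (intro mult_left_mono) (auto simp: am[symmetric])
 then show "real (CARD('k) choose j) * G \<le> esym tau j" by (simp add: es mult.commute)
 assume eq: "esym tau j = real (CARD('k) choose j) * G" and j: "0 < j" "j < CARD('k)"
 have G: "G > 0" using apos by (simp add: am[symmetric])
 have "(\<Sum>S | card S = j. x S) = (CARD('k) choose j)" using eq G by (simp add: es)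
 then have "(\<Sum>S | card S = j. x S - (1 + ln (x S))) = 0"
  by (simp add: sum_subtractf sum.distrib ln0 cnt)
 then have z: "x S - (1 + ln (x S)) = 0" if "card S = j" for S
  using le that by (subst (asm) sum_nonneg_eq_0_iff) auto
 have x1: "x S = 1" if "card S = j" for S
  using z[OF that] ln_eq_minus_one[OF xpos[of S]] by simp
 show "tau i = tau k"
 proof (cases "i = k")
  case False
  \<comment> \<open>Here j < CARD('k) leaves room for a set that avoids both indices.\<close>
  have "j - 1 \<le> card (UNIV - {i, k})" using False j by (simp add: card_Diff_subset)
  then obtain T where T: "T \<subseteq> UNIV - {i, k}" "card T = j - 1" by (metis obtain_subset_with_card_n)
  have "card (insert i T) = j" "card (insert k T) = j" using T j finite_subset[OF T(1)] by (auto simp: card_insert_if)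
  then have "x (insert i T) = x (insert k T)" by (simp add: x1)
  then have "tau i / a * x T = tau k / a * x T" unfolding x_def using T by (subst (asm) (1 2) prod.insert) auto
  then show ?thesis using xpos[of T] apos by simp
 qed simp
qed

lemma dsum_cbox:
 fixes a b c d :: "real^'k"
 assumes "\<And>i. a $ i \<le> b $ i" "\<And>i. c $ i \<le> d $ i" "t > 0"
 shows "dsum (cbox a b) t (cbox c d) = cbox (a + t *\<^sub>R c) (b + t *\<^sub>R d)"
proof (intro equalityI subsetI)
 fix z assume "z \<in> dsum (cbox a b) t (cbox c d)"
 then show "z \<in> cbox (a + t *\<^sub>R c) (b + t *\<^sub>R d)"
  using assms by (auto simp: dsum_def mem_box_cart intro!: add_mono mult_left_mono)
next
 fix z assume z: "z \<in> cbox (a + t *\<^sub>R c) (b + t *\<^sub>R d)"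
 have "\<exists>x y. a $ i \<le> x \<and> x \<le> b $ i \<and> c $ i \<le> y \<and> y \<le> d $ i \<and> z $ i = x + t * y" for i
 proof (cases "z $ i \<le> b $ i + t * c $ i")
  case True
  then show ?thesis using z assms by (intro exI[of _ "z $ i - t * c $ i"] exI[of _ "c $ i"]) (auto simp: mem_box_cart algebra_simps)
 next
  case False
  then show ?thesis using z assms
   by (intro exI[of _ "b $ i"] exI[of _ "(z $ i - b $ i) / t"]) (auto simp: mem_box_cart field_simps)
 qed
 then obtain X Y where "\<And>i. a $ i \<le> X i \<and> X i \<le> b $ i \<and> c $ i \<le> Y i \<and> Y i \<le> d $ i \<and> z $ i = X i + t * Y i" by metis
 then show "z \<in> dsum (cbox a b) t (cbox c d)"
  unfolding dsum_def by (intro CollectI exI[of _ "\<chi> i. X i"] exI[of _ "\<chi> i. Y i"]) (auto simp: mem_box_cart vec_eq_iff)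
qed

text \<open>The sum of two boxes is a box; expanding the product of the factors 1 + t * tau i over
  subsets collects the elementary symmetric functions of the edge ratios.\<close>

lemma mixcoef_cbox:
 fixes a b c d :: "real^'k"
 assumes ab: "\<And>i. a $ i < b $ i" and cd: "\<And>i. c $ i < d $ i" and j: "j \<le> CARD('k)"
 shows "mixcoef (cbox a b) (cbox c d) j = vol (cbox a b) * esym (\<lambda>i. (d $ i - c $ i) / (b $ i - a $ i)) j"
proof (rule mixcoef_unique)
 fix t :: real assume t: "t > 0"
 let ?tau = "\<lambda>i. (d $ i - c $ i) / (b $ i - a $ i)"
 have "vol (dsum (cbox a b) t (cbox c d)) = (\<Prod>i\<in>UNIV. (b + t *\<^sub>R d) $ i - (a + t *\<^sub>R c) $ i)"
  unfolding dsum_cbox[OF less_imp_le[OF ab] less_imp_le[OF cd] t]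
  by (rule vol_cbox_cart) (use t in \<open>simp add: add_mono mult_left_mono less_imp_le[OF ab] less_imp_le[OF cd]\<close>)
 also have "\<dots> = (\<Prod>i\<in>UNIV. (b $ i - a $ i) * (t * ?tau i + 1))"
 proof (rule prod.cong[OF refl])
  fix i
  have "b $ i - a $ i \<noteq> 0" using ab[of i] by simp
  then show "(b + t *\<^sub>R d) $ i - (a + t *\<^sub>R c) $ i = (b $ i - a $ i) * (t * ?tau i + 1)" by (simp add: field_simps)
 qed
 also have "\<dots> = vol (cbox a b) * (\<Prod>i\<in>UNIV. t * ?tau i + 1)"
  unfolding prod.distrib by (subst vol_cbox_cart) (use ab in \<open>auto intro: less_imp_le\<close>)
 also have "(\<Prod>i\<in>UNIV. t * ?tau i + 1) = (\<Sum>S\<in>Pow UNIV. (\<Prod>i\<in>S. t * ?tau i) * (\<Prod>i\<in>UNIV - S. 1))"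
  by (rule prod_add) simp
 also have "\<dots> = (\<Sum>S\<in>UNIV. t ^ card S * (\<Prod>i\<in>S. ?tau i))"
  by (simp only: prod.distrib prod_constant power_one mult_1_right Pow_UNIV)
 also have "\<dots> = (\<Sum>l\<le>CARD('k). \<Sum>S | S \<in> UNIV \<and> card S = l. t ^ card S * (\<Prod>i\<in>S. ?tau i))"
  by (rule sum.group[symmetric]) (auto intro: card_mono)
 also have "\<dots> = (\<Sum>l\<le>CARD('k). esym ?tau l * t ^ l)"
  by (intro sum.cong refl) (simp add: esym_def sum_distrib_right sum_distrib_left mult.commute)
 finally show "vol (dsum (cbox a b) t (cbox c d)) = (\<Sum>l\<le>DIM(real^'k). vol (cbox a b) * esym ?tau l * t ^ l)"
  by (simp add: sum_distrib_left mult.assoc)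
qed (use j in simp)

text \<open>Let u be the distance of p in D from the cutting hyperplane. The contraction towards p
  by the factor u / w maps C into D, so the power of u / w with the dimension as exponent is at most
  1 / 2. Halving the volume thus improves the width bound in the cut direction by a fixed factor;
  \<open>sig\<close> selects the side.\<close>

lemma cut_width:
 fixes C :: "(real^'k) set"
 assumes C: "compact C" "convex C" "0 < vol C" and w: "\<And>y y'. y \<in> C \<Longrightarrow> y' \<in> C \<Longrightarrow> \<bar>y $ d - y' $ d\<bar> \<le> w"
  and sig: "sig = 1 \<or> sig = (-1::real)"
  and D: "D = C \<inter> {y. sig * y $ d \<le> sig * s}" "vol D \<le> vol C / 2" and y: "y \<in> D" "y' \<in> D"
 shows "\<bar>y $ d - y' $ d\<bar> \<le> w / 2 powr (1 / CARD('k))"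
proof -
 have cD: "compact D" unfolding D(1) by (intro compact_Int_closed C closed_Collect_le continuous_intros)
 have w0: "w \<ge> 0" using w[of y y] y D by auto
 have key: "sig * (s - p $ d) \<le> w / 2 powr (1 / CARD('k))" if p: "p \<in> D" for p
 proof -
  define u where "u = sig * (s - p $ d)"
  have u: "u \<ge> 0" using p D by (simp add: u_def right_diff_distrib)
  have pC: "p \<in> C" using p D by auto
  \<comment> \<open>The first case, which includes w = 0, would put all of C into D and is excluded
    below by the volumes.\<close>
  define \<theta> where "\<theta> = (if w \<le> u then 1 else u / w)"
  have \<theta>: "0 \<le> \<theta>" "\<theta> \<le> 1" "\<theta> * w \<le> u" using u w0 by (auto simp: \<theta>_def divide_simps)
  let ?f = "\<lambda>y. \<theta> *\<^sub>R y + (1 - \<theta>) *\<^sub>R p"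
  have "?f ` C \<subseteq> D"
  proof (rule image_subsetI)
   fix z assume z: "z \<in> C"
   have "sig * (z $ d - p $ d) \<le> w" using w[OF z pC] sig by auto
   then have "\<theta> * (sig * (z $ d - p $ d)) \<le> u" using \<theta> by (meson mult_left_mono order_trans)
   then have "sig * (?f z) $ d \<le> sig * s" by (simp add: u_def algebra_simps)
   moreover have "?f z \<in> C" using C(2) z pC \<theta> by (simp add: convexD)
   ultimately show "?f z \<in> D" by (simp add: D)
  qed
  then have "vol (?f ` C) \<le> vol D" by (rule vol_mono) (auto intro!: cD compact_continuous_image continuous_intros C)
  then have "\<theta> ^ CARD('k) * vol C \<le> vol C / 2" using D(2) \<theta> vol_affine[of \<theta> "(1 - \<theta>) *\<^sub>R p" C] by simp
  then have "\<theta> ^ CARD('k) \<le> 1 / 2" using C(3) by (simp add: field_simps)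
  then have th: "\<theta> ^ CARD('k) * 2 \<le> 1" by simp
  then have "\<theta> \<noteq> 1" by auto
  then have "u = \<theta> * w" "w > 0" using u w0 by (auto simp: \<theta>_def split: if_splits)
  have "(\<theta> * 2 powr (1 / CARD('k))) ^ CARD('k) = \<theta> ^ CARD('k) * 2"
   by (simp add: power_mult_distrib powr_realpow[symmetric] powr_powr)
  then have "(\<theta> * 2 powr (1 / CARD('k))) ^ CARD('k) \<le> 1 ^ CARD('k)" using th by simp
  then have "\<theta> * 2 powr (1 / CARD('k)) \<le> 1"
   using power_mono_iff[of "\<theta> * 2 powr (1 / CARD('k))" 1 "CARD('k)"] \<theta> by simp
  then have "\<theta> \<le> 1 / 2 powr (1 / CARD('k))" by (simp add: field_simps)
  then have "\<theta> * w \<le> (1 / 2 powr (1 / CARD('k))) * w" using w0 by (rule mult_right_mono)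
  then show ?thesis using \<open>u = \<theta> * w\<close> by (simp add: u_def)
 qed
 show ?thesis using key[OF y(1)] key[OF y(2)] y sig D(1) by auto
qed

section \<open>Minkowski's inequalities\<close>

text \<open>Minkowski's bound for \<open>mixcoef A B j\<close>, a binomial coefficient times a
  weighted geometric mean of the volumes. In this form it is visibly linear in vol A once vol B /
  vol A is fixed, hence additive under matched cuts.\<close>

definition minkb :: "'a::euclidean_space set \<Rightarrow> 'a set \<Rightarrow> nat \<Rightarrow> real" where
 "minkb A B j = real (DIM('a) choose j) * vol A * (vol B / vol A) powr (real j / real DIM('a))"

lemma bounding_box:
 fixes A :: "(real^'k) set"
 assumes "compact A" "A \<noteq> {}"
 obtains a b where "A \<subseteq> cbox a b" "\<And>i. \<exists>x\<in>A. x $ i = a $ i" "\<And>i. \<exists>x\<in>A. x $ i = b $ i"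
proof -
 have "\<exists>x\<in>A. \<forall>y\<in>A. x $ i \<le> y $ i" for i
  by (rule continuous_attains_inf[OF assms]) (intro continuous_intros)
 then obtain a where a: "\<And>i. a i \<in> A" "\<And>i y. y \<in> A \<Longrightarrow> a i $ i \<le> y $ i" by metis
 have "\<exists>x\<in>A. \<forall>y\<in>A. y $ i \<le> x $ i" for i
  by (rule continuous_attains_sup[OF assms]) (intro continuous_intros)
 then obtain b where b: "\<And>i. b i \<in> A" "\<And>i y. y \<in> A \<Longrightarrow> y $ i \<le> b i $ i" by metis
 show thesis
  by (rule that[of "\<chi> i. a i $ i" "\<chi> i. b i $ i"]) (use a b in \<open>auto simp: mem_box_cart\<close>)
qed

lemma vol_cbox_pos_imp: "0 < vol (cbox a b) \<Longrightarrow> a $ i < b $ i" for a b :: "real^'k"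
proof -
 assume v: "0 < vol (cbox a b)"
 then have "interior (cbox a b) \<noteq> {}"
  using negligible_convex_interior[of "cbox a b"] negligible_imp_measure0[of "cbox a b"] by (auto simp: convex_box)
 then show ?thesis by (auto simp: interval_ne_empty_cart)
qed

text \<open>The whole bounding box of the piece is within l1-distance sum omega of x, hence inside
  \<open>K\<close> because x lies that deep. So only the coordinate box p, q constrains the
  piece.\<close>

lemma piece_is_box:
 fixes K :: "(real^'k) set"
 assumes A: "compact A" "A = K \<inter> cbox p q" and w: "\<And>y y' i. y \<in> A \<Longrightarrow> y' \<in> A \<Longrightarrow> \<bar>y $ i - y' $ i\<bar> \<le> omega i"
  and x: "x \<in> A" "x \<in> inner_set K (\<Sum>i\<in>UNIV. omega i)" and v: "0 < vol A"
 obtains a b where "A = cbox a b" "\<And>i. a $ i < b $ i"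
proof -
 obtain a b where ab: "A \<subseteq> cbox a b" "\<And>i. \<exists>x\<in>A. x $ i = a $ i" "\<And>i. \<exists>x\<in>A. x $ i = b $ i"
  using bounding_box[OF A(1)] x by blast
 have "cbox a b \<subseteq> A"
 proof
  fix z assume z: "z \<in> cbox a b"
  have "\<bar>x $ i - z $ i\<bar> \<le> omega i" for i
  proof -
   obtain y y' where "y \<in> A" "y $ i = a $ i" "y' \<in> A" "y' $ i = b $ i" using ab(2,3)[of i] by auto
   moreover from this have "\<bar>x $ i - y $ i\<bar> \<le> omega i" "\<bar>x $ i - y' $ i\<bar> \<le> omega i"
    using w[OF x(1), of y i] w[OF x(1), of y' i] by blast+
   moreover have "a $ i \<le> z $ i" "z $ i \<le> b $ i" using z by (auto simp: mem_box_cart)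
   ultimately show ?thesis by linarith
  qed
  then have "norm (x - z) \<le> (\<Sum>i\<in>UNIV. omega i)"
   using norm_le_l1_cart[of "x - z"] by (simp add: sum_mono order_trans)
  then have "z \<in> K" using x(2) by (auto simp: inner_set_def dist_norm)
  moreover have "z \<in> cbox p q"
   unfolding mem_box_cart
  proof
   fix i
   obtain y y' where "y \<in> A" "y $ i = a $ i" "y' \<in> A" "y' $ i = b $ i" using ab(2,3)[of i] by auto
   then have "p $ i \<le> a $ i" "b $ i \<le> q $ i" using A(2) by (auto simp: mem_box_cart) (metis)+
   then show "p $ i \<le> z $ i \<and> z $ i \<le> q $ i" using z by (auto simp: mem_box_cart intro: order_trans)
  qed
  ultimately show "z \<in> A" using A(2) by simp
 qed
 then have eq: "A = cbox a b" using ab(1) by auto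
 moreover have "a $ i < b $ i" for i using v unfolding eq by (rule vol_cbox_pos_imp)
 ultimately show thesis using that by blast
qed

lemma minkb_cbox:
 fixes a b c d :: "real^'k"
 assumes ab: "\<And>i. a $ i < b $ i" and cd: "\<And>i. c $ i < d $ i" and j: "j \<le> CARD('k)"
 shows "minkb (cbox a b) (cbox c d) j \<le> mixcoef (cbox a b) (cbox c d) j"
  and "mixcoef (cbox a b) (cbox c d) j = minkb (cbox a b) (cbox c d) j \<Longrightarrow> 0 < j \<Longrightarrow> j < CARD('k) \<Longrightarrow>
   (d $ i - c $ i) / (b $ i - a $ i) = (d $ l - c $ l) / (b $ l - a $ l)"
proof -
 let ?tau = "\<lambda>i. (d $ i - c $ i) / (b $ i - a $ i)"
 have tau: "?tau i > 0" for i using ab[of i] cd[of i] by simp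
 have v: "vol (cbox a b) > 0" using ab by (subst vol_cbox_cart) (auto intro: less_imp_le prod_pos)
 have "vol (cbox c d) / vol (cbox a b) = (\<Prod>i\<in>UNIV. ?tau i)"
  using vol_cbox_cart[of a b, OF less_imp_le[OF ab]] vol_cbox_cart[of c d, OF less_imp_le[OF cd]] by (simp add: prod_dividef)
 then have eq: "minkb (cbox a b) (cbox c d) j = vol (cbox a b) * (real (CARD('k) choose j) * (\<Prod>i\<in>UNIV. ?tau i) powr (real j / real CARD('k)))"
  by (simp add: minkb_def)
 show "minkb (cbox a b) (cbox c d) j \<le> mixcoef (cbox a b) (cbox c d) j"
  unfolding mixcoef_cbox[OF ab cd j] eq by (rule mult_left_mono[OF esym_amgm(1)[OF tau]]) simp
 assume "mixcoef (cbox a b) (cbox c d) j = minkb (cbox a b) (cbox c d) j" "0 < j" "j < CARD('k)"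
 then show "?tau i = ?tau l"
  unfolding mixcoef_cbox[OF ab cd j] eq using v by (intro esym_amgm(2)[OF tau]) auto
qed

lemma hlo_cbox: "cbox p q \<inter> hlo i s = cbox p (\<chi> l. if l = i then min (q $ l) s else q $ l)"
 and hhi_cbox: "cbox p q \<inter> hhi i s = cbox (\<chi> l. if l = i then max (p $ l) s else p $ l) q"
 by (auto simp: mem_box_cart split: if_splits) (metis+)?

text \<open>\<open>ds\<close> lists the cuts still to be made; the exponent
  \<open>count_list ds i\<close> anticipates the gain in width from each cut in direction i, so that
  final pieces have widths at most eta. The left-hand side is additive under matched cuts. For a
  final pair it is at most c * vol A, the bound for boxes, if both pieces meet the deep parts
  \<open>gK\<close> and \<open>gL\<close>, and nonpositive otherwise.\<close>

lemma mixcoef_bisect: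
 fixes K L :: "(real^'k::{finite,wellorder}) set"
 assumes K: "convex_body K" and L: "convex_body L" and r: "r > 0" and eta: "eta > 0" and j: "j \<le> CARD('k)"
 defines "c \<equiv> real (CARD('k) choose j) * r powr (real j / real CARD('k))"
  and "gK \<equiv> inner_set K (eta * real CARD('k))" and "gL \<equiv> inner_set L (eta * real CARD('k))"
 assumes "convex_body A" "convex_body B" "vol B = r * vol A" "A = K \<inter> cbox p q" "B = L \<inter> cbox p' q'"
  and "\<And>i y y'. y \<in> A \<Longrightarrow> y' \<in> A \<Longrightarrow> \<bar>y $ i - y' $ i\<bar> \<le> eta * (2 powr (1 / CARD('k))) ^ count_list ds i"
  and "\<And>i y y'. y \<in> B \<Longrightarrow> y' \<in> B \<Longrightarrow> \<bar>y $ i - y' $ i\<bar> \<le> eta * (2 powr (1 / CARD('k))) ^ count_list ds i"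
 shows "c * (vol (A \<inter> gK) + vol (B \<inter> gL) / r - vol A) \<le> mixcoef A B j"
 using assms(9-)
proof (induction ds arbitrary: A B p q p' q')
 case Nil
 have cA: "compact A" and cB: "compact B" using Nil by (auto simp: convex_body_def)
 have gc: "closed gK" "closed gL" unfolding gK_def gL_def using K L
  by (auto intro: closed_inner_set[OF compact_imp_closed] simp: convex_body_def)
 have nn: "0 \<le> mixcoef A B j" by (intro mixcoef_nonneg Nil j)
 have c0: "c > 0" using r j by (simp add: c_def)
 have vA: "vol A > 0" "vol B > 0" by (rule convex_body_vol_pos[OF Nil(1)], rule convex_body_vol_pos[OF Nil(2)])
 have leA: "vol (A \<inter> gK) \<le> vol A" by (rule vol_mono) (auto intro: cA compact_Int_closed gc)
 have leB: "vol (B \<inter> gL) / r \<le> vol A"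
 proof -
  have "vol (B \<inter> gL) \<le> vol B" by (rule vol_mono) (auto intro: cB compact_Int_closed gc)
  then show ?thesis using r Nil(3) by (simp add: field_simps)
 qed
 show ?case
 proof (cases "A \<inter> gK = {} \<or> B \<inter> gL = {}")
  case True
  \<comment> \<open>If one piece misses its deep part, that term vanishes and the other one is at
    most vol A.\<close>
  then have "vol (A \<inter> gK) + vol (B \<inter> gL) / r - vol A \<le> 0" using leA leB by auto
  then show ?thesis using nn c0 by (meson less_imp_le mult_nonneg_nonpos order_trans)
 next
  case False
  then obtain x y where x: "x \<in> A" "x \<in> gK" and y: "y \<in> B" "y \<in> gL" by auto
  have s: "(\<Sum>i\<in>(UNIV::'k set). eta) = eta * real CARD('k)" by simp
  obtain a b where ab: "A = cbox a b" "\<And>i. a $ i < b $ i"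
   by (rule piece_is_box[OF cA Nil(4), of "\<lambda>_. eta" x]) (use Nil(6) x vA in \<open>auto simp: gK_def mult.commute\<close>)
  obtain a' b' where ab': "B = cbox a' b'" "\<And>i. a' $ i < b' $ i"
   by (rule piece_is_box[OF cB Nil(5), of "\<lambda>_. eta" y]) (use Nil(7) y vA in \<open>auto simp: gL_def mult.commute\<close>)
  have "c * (vol (A \<inter> gK) + vol (B \<inter> gL) / r - vol A) \<le> c * vol A"
   using leA leB c0 by (intro mult_left_mono) auto
  also have "\<dots> = minkb A B j" using Nil(3) vA by (simp add: minkb_def c_def)
  also have "\<dots> \<le> mixcoef A B j" unfolding ab(1) ab'(1) by (rule minkb_cbox(1)[OF ab(2) ab'(2) j])
  finally show ?thesis .
 qed
next
 case (Cons d ds)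
 have cA: "compact A" "convex A" and cB: "compact B" "convex B" using Cons.prems by (auto simp: convex_body_def)
 have gc: "closed gK" "closed gL" unfolding gK_def gL_def using K L
  by (auto intro: closed_inner_set[OF compact_imp_closed] simp: convex_body_def)
 have vA: "vol A > 0" "vol B > 0" by (rule convex_body_vol_pos[OF Cons.prems(1)], rule convex_body_vol_pos[OF Cons.prems(2)])
 obtain s where s: "vol (A \<inter> hlo d s) = vol A / 2" "vol (A \<inter> hhi d s) = vol A - vol A / 2"
  using cut_exists[OF cA(1), of "vol A / 2"] vA by auto
 obtain s' where s': "vol (B \<inter> hlo d s') = vol B / 2" "vol (B \<inter> hhi d s') = vol B - vol B / 2"
  using cut_exists[OF cB(1), of "vol B / 2"] vA by auto
 let ?A1 = "A \<inter> hlo d s" and ?A2 = "A \<inter> hhi d s" and ?B1 = "B \<inter> hlo d s'" and ?B2 = "B \<inter> hhi d s'"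
 have cb: "convex_body ?A1" "convex_body ?A2" "convex_body ?B1" "convex_body ?B2"
  using s s' vA Cons.prems by (auto intro!: convex_body_cut)
 let ?q = "2 powr (1 / real CARD('k))"
 have width: "\<bar>y $ i - y' $ i\<bar> \<le> eta * ?q ^ count_list ds i"
  if C: "compact C" "convex C" "0 < vol C" and w: "\<And>i y y'. y \<in> C \<Longrightarrow> y' \<in> C \<Longrightarrow> \<bar>y $ i - y' $ i\<bar> \<le> eta * ?q ^ count_list (d # ds) i"
   and sig: "sig = 1 \<or> sig = (-1::real)" and D: "D = C \<inter> {y. sig * y $ d \<le> sig * s}" "vol D \<le> vol C / 2" and y: "y \<in> D" "y' \<in> D"
  for C D sig s y y' i
 proof (cases "i = d")
  case True
  have "\<bar>y $ d - y' $ d\<bar> \<le> (eta * ?q ^ count_list (d # ds) d) / ?q"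
   by (rule cut_width[OF C w sig D y])
  then show ?thesis using True by simp
 next
  case False
  then show ?thesis using w[of y y' i] D y by auto
 qed
 have IHlo: "c * (vol (?A1 \<inter> gK) + vol (?B1 \<inter> gL) / r - vol ?A1) \<le> mixcoef ?A1 ?B1 j"
 proof (rule Cons.IH[OF cb(1,3)])
  show "vol ?B1 = r * vol ?A1" unfolding s s' Cons.prems(3) by (simp add: algebra_simps)
  show "?A1 = K \<inter> cbox p (\<chi> l. if l = d then min (q $ l) s else q $ l)"
   unfolding hlo_cbox[symmetric] Cons.prems(4) by auto
  show "?B1 = L \<inter> cbox p' (\<chi> l. if l = d then min (q' $ l) s' else q' $ l)"
   unfolding hlo_cbox[symmetric] Cons.prems(5) by auto
  show "\<bar>y $ i - y' $ i\<bar> \<le> eta * ?q ^ count_list ds i" if "y \<in> ?A1" "y' \<in> ?A1" for i y y'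
   by (rule width[OF cA vA(1) Cons.prems(6), of 1 _ s]) (use that s in auto)
  show "\<bar>y $ i - y' $ i\<bar> \<le> eta * ?q ^ count_list ds i" if "y \<in> ?B1" "y' \<in> ?B1" for i y y'
   by (rule width[OF cB vA(2) Cons.prems(7), of 1 _ s']) (use that s' in auto)
 qed
 have IHhi: "c * (vol (?A2 \<inter> gK) + vol (?B2 \<inter> gL) / r - vol ?A2) \<le> mixcoef ?A2 ?B2 j"
 proof (rule Cons.IH[OF cb(2,4)])
  show "vol ?B2 = r * vol ?A2" unfolding s s' Cons.prems(3) by (simp add: algebra_simps)
  show "?A2 = K \<inter> cbox (\<chi> l. if l = d then max (p $ l) s else p $ l) q"
   unfolding hhi_cbox[symmetric] Cons.prems(4) by auto
  show "?B2 = L \<inter> cbox (\<chi> l. if l = d then max (p' $ l) s' else p' $ l) q'"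
   unfolding hhi_cbox[symmetric] Cons.prems(5) by auto
  show "\<bar>y $ i - y' $ i\<bar> \<le> eta * ?q ^ count_list ds i" if "y \<in> ?A2" "y' \<in> ?A2" for i y y'
   by (rule width[OF cA vA(1) Cons.prems(6), of "-1" _ s]) (use that s in auto)
  show "\<bar>y $ i - y' $ i\<bar> \<le> eta * ?q ^ count_list ds i" if "y \<in> ?B2" "y' \<in> ?B2" for i y y'
   by (rule width[OF cB vA(2) Cons.prems(7), of "-1" _ s']) (use that s' in auto)
 qed
 have addA: "vol (?A1 \<inter> gK) + vol (?A2 \<inter> gK) = vol (A \<inter> gK)"
  using vol_cut[of "A \<inter> gK" d s] cA gc by (simp add: compact_Int_closed Int_ac)
 have addB: "vol (?B1 \<inter> gL) + vol (?B2 \<inter> gL) = vol (B \<inter> gL)"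
  using vol_cut[of "B \<inter> gL" d s'] cB gc by (simp add: compact_Int_closed Int_ac)
 have "c * (vol (A \<inter> gK) + vol (B \<inter> gL) / r - vol A)
   = c * (vol (?A1 \<inter> gK) + vol (?B1 \<inter> gL) / r - vol ?A1)
   + c * (vol (?A2 \<inter> gK) + vol (?B2 \<inter> gL) / r - vol ?A2)"
  using s by (simp add: addA[symmetric] addB[symmetric] add_divide_distrib distrib_left[symmetric])
 also have "\<dots> \<le> mixcoef ?A1 ?B1 j + mixcoef ?A2 ?B2 j"
  using IHlo IHhi by (rule add_mono)
 also have "\<dots> \<le> mixcoef A B j"
  by (rule mixcoef_superadditive[OF Cons.prems(1,2) cb j])
 finally show ?case .
qed

lemma distinct_count_list: "distinct xs \<Longrightarrow> x \<in> set xs \<Longrightarrow> count_list xs x = 1"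
 by (induction xs) (auto simp: count_list_0_iff)

lemma count_list_concat_replicate:
 assumes "count_list xs x = 1" shows "count_list (concat (replicate N xs)) x = N"
 using assms by (induction N) auto

text \<open>N cuts in every direction bring the initial widths 2 M and 2 M' below eta. As eta
  shrinks, the deep parts exhaust both bodies and the bound of \<open>mixcoef_bisect\<close>
  approaches c * vol A, which is \<open>minkb A B j\<close>.\<close>

theorem minkowski_mixcoef:
 fixes A B :: "(real^'k::{finite,wellorder}) set"
 assumes A: "convex_body A" and B: "convex_body B" and j: "j \<le> CARD('k)"
 shows "minkb A B j \<le> mixcoef A B j"
proof -
 define r where "r = vol B / vol A"
 have vA: "vol A > 0" "vol B > 0" using A B convex_body_vol_pos by auto
 have r: "r > 0" "vol B = r * vol A" using vA by (auto simp: r_def)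
 define c where "c = real (CARD('k) choose j) * r powr (real j / real CARD('k))"
 have c: "c > 0" using r j by (simp add: c_def)
 have cA: "compact A" and cB: "compact B" using A B by (auto simp: convex_body_def)
 obtain M where M: "\<And>x i. x \<in> A \<Longrightarrow> \<bar>x $ i\<bar> \<le> M" using bounded_component[OF compact_imp_bounded[OF cA]] by metis
 obtain M' where M': "\<And>x i. x \<in> B \<Longrightarrow> \<bar>x $ i\<bar> \<le> M'" using bounded_component[OF compact_imp_bounded[OF cB]] by metis
 have main: "c * (vol (A \<inter> inner_set A (eta * real CARD('k))) + vol (B \<inter> inner_set B (eta * real CARD('k))) / r - vol A) \<le> mixcoef A B j"
  if eta: "eta > 0" for eta
 proof -
  obtain us :: "'k list" where us: "set us = UNIV" "distinct us" using finite_distinct_list[OF finite] by blast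
  have "1 < 2 powr (1 / real CARD('k))" by (rule gr_one_powr) auto
  then obtain N where N: "max (2 * M) (2 * M') / eta < (2 powr (1 / real CARD('k))) ^ N"
   using real_arch_pow by blast
  define ds where "ds = concat (replicate N us)"
  have "count_list us i = 1" for i using us by (intro distinct_count_list) auto
  then have ds: "count_list ds i = N" for i unfolding ds_def by (rule count_list_concat_replicate)
  have N': "2 * M \<le> eta * (2 powr (1 / real CARD('k))) ^ N" "2 * M' \<le> eta * (2 powr (1 / real CARD('k))) ^ N"
   using N eta by (auto simp: field_simps)
  show ?thesis unfolding c_def
  proof (rule mixcoef_bisect[OF A B r(1) eta j A B r(2), where p="\<chi> i. -M" and q="\<chi> i. M" and p'="\<chi> i. -M'" and q'="\<chi> i. M'" and ds=ds])
   show "A = A \<inter> cbox (\<chi> i. -M) (\<chi> i. M)" using M by (auto simp: mem_box_cart abs_le_iff) (metis minus_le_iff)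
   show "B = B \<inter> cbox (\<chi> i. -M') (\<chi> i. M')" using M' by (auto simp: mem_box_cart abs_le_iff) (metis minus_le_iff)
   show "\<bar>y $ i - y' $ i\<bar> \<le> eta * (2 powr (1 / real CARD('k))) ^ count_list ds i" if "y \<in> A" "y' \<in> A" for i y y'
    unfolding ds using M[OF that(1), of i] M[OF that(2), of i] N' by linarith
   show "\<bar>y $ i - y' $ i\<bar> \<le> eta * (2 powr (1 / real CARD('k))) ^ count_list ds i" if "y \<in> B" "y' \<in> B" for i y y'
    unfolding ds using M'[OF that(1), of i] M'[OF that(2), of i] N' by linarith
  qed
 qed
 have bound: "c * vol A * (2 * (1 - \<theta>) ^ CARD('k) - 1) \<le> mixcoef A B j" if \<theta>: "0 < \<theta>" "\<theta> < 1" for \<theta>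
 proof -
  obtain dlt where dlt: "dlt > 0" "\<And>dlt'. 0 \<le> dlt' \<Longrightarrow> dlt' \<le> dlt \<Longrightarrow> (1 - \<theta>) ^ CARD('k) * vol A \<le> vol (inner_set A dlt')"
   using vol_inner_set[OF A \<theta>] by auto
  obtain dlt2 where dlt2: "dlt2 > 0" "\<And>dlt'. 0 \<le> dlt' \<Longrightarrow> dlt' \<le> dlt2 \<Longrightarrow> (1 - \<theta>) ^ CARD('k) * vol B \<le> vol (inner_set B dlt')"
   using vol_inner_set[OF B \<theta>] by auto
  define eta where "eta = min dlt dlt2 / real CARD('k)"
  have eta: "eta > 0" "eta * real CARD('k) = min dlt dlt2" using dlt dlt2 by (auto simp: eta_def)
  let ?d = "eta * real CARD('k)"
  have d: "0 \<le> ?d" "?d \<le> dlt" "?d \<le> dlt2" unfolding eta(2) using dlt dlt2 by auto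
  have "A \<inter> inner_set A ?d = inner_set A ?d" "B \<inter> inner_set B ?d = inner_set B ?d"
   using inner_set_subset[OF d(1)] by auto
  then have "c * (vol (inner_set A ?d) + vol (inner_set B ?d) / r - vol A) \<le> mixcoef A B j"
   using main[OF eta(1)] by simp
  moreover have "vol A * (2 * (1 - \<theta>) ^ CARD('k) - 1) \<le> vol (inner_set A ?d) + vol (inner_set B ?d) / r - vol A"
  proof -
   have "(1 - \<theta>) ^ CARD('k) * vol A \<le> vol (inner_set A ?d)" by (rule dlt(2)[OF d(1,2)])
   moreover have "(1 - \<theta>) ^ CARD('k) * vol A \<le> vol (inner_set B ?d) / r"
    using dlt2(2)[OF d(1,3)] r by (simp add: field_simps)
   ultimately show ?thesis by (simp add: algebra_simps)
  qed
  ultimately show ?thesis using c by (smt (verit, best) mult.assoc mult_left_mono)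
 qed
 have "((\<lambda>\<theta>. c * vol A * (2 * (1 - \<theta>) ^ CARD('k) - 1)) \<longlongrightarrow> c * vol A * (2 * (1 - 0) ^ CARD('k) - 1)) (at_right 0)"
  by (intro tendsto_intros)
 then have "c * vol A * (2 * (1 - 0) ^ CARD('k) - 1) \<le> mixcoef A B j"
 proof (rule tendsto_upperbound)
  show "\<forall>\<^sub>F \<theta> in at_right 0. c * vol A * (2 * (1 - \<theta>) ^ CARD('k) - 1) \<le> mixcoef A B j"
   using eventually_at_right_less[of 0] eventually_at_right_field[of _ "0::real"] bound
   by (auto simp: eventually_at_right_field intro!: exI[of _ 1])
 qed simp
 then show ?thesis by (simp add: minkb_def c_def r_def mult_ac)
qed

section \<open>The equality case\<close>

lemma vol_cbox_pos: "(\<And>i. a $ i < b $ i) \<Longrightarrow> 0 < vol (cbox a b)" for a b :: "real^'k"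
 by (subst vol_cbox_cart) (auto intro: less_imp_le prod_pos)

abbreviation "slab i u v x k \<equiv> cbox (\<chi> l. if l = i then u else x $ l - k) (\<chi> l. if l = i then v else x $ l + k)"

lemma compact_Int_cbox: "compact A \<Longrightarrow> compact (A \<inter> cbox p q)" for A :: "(real^'k) set"
 by (intro compact_Int_closed closed_cbox)

text \<open>The properties shared by the equality cases of Minkowski's inequalities and of the
 first-order Brunn-Minkowski inequality: equality passes to both halves of a matched cut.\<close>

locale cut_equality =
 fixes E :: "(real^'k::{finite,wellorder}) set \<Rightarrow> (real^'k::{finite,wellorder}) set \<Rightarrow> bool"
 assumes E_reg: "E A B \<Longrightarrow> compact A \<and> 0 < vol A \<and> convex_body B"
  and E_cut: "E A B \<Longrightarrow> 0 < vol (A \<inter> hlo i s) \<Longrightarrow> 0 < vol (A \<inter> hhi i s) \<Longrightarrow>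
    vol (B \<inter> hlo i s') * vol A = vol (A \<inter> hlo i s) * vol B \<Longrightarrow>
    E (A \<inter> hlo i s) (B \<inter> hlo i s') \<and> E (A \<inter> hhi i s) (B \<inter> hhi i s')"
  and E_box: "E (cbox a b) (cbox c d) \<Longrightarrow> (\<And>i. a $ i < b $ i) \<Longrightarrow> (\<And>i. c $ i < d $ i) \<Longrightarrow>
    (d $ i - c $ i) / (b $ i - a $ i) = (d $ l - c $ l) / (b $ l - a $ l)"
  and E_orth: "E A B \<Longrightarrow> orthogonal_transformation f \<Longrightarrow> E (f ` A) (f ` B)"
begin

lemma cut_both:
 assumes E: "E A B" and v: "0 < vol (A \<inter> hlo i s)" "0 < vol (A \<inter> hhi i s)" and r: "vol B = r * vol A"
 obtains s' where "E (A \<inter> hlo i s) (B \<inter> hlo i s')" "vol (B \<inter> hlo i s') = r * vol (A \<inter> hlo i s)"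
  "E (A \<inter> hhi i s) (B \<inter> hhi i s')" "vol (B \<inter> hhi i s') = r * vol (A \<inter> hhi i s)"
proof -
 have reg: "compact A" "0 < vol A" "convex_body B" using E_reg[OF E] by auto
 then have cB: "compact B" "0 < vol B" using convex_body_vol_pos by (auto simp: convex_body_def)
 have rp: "r > 0" using r reg(2) cB(2) by (simp add: zero_less_mult_iff)
 have sA: "vol (A \<inter> hlo i s) + vol (A \<inter> hhi i s) = vol A" by (rule vol_cut[OF reg(1)])
 have "r * vol (A \<inter> hlo i s) \<le> vol B" unfolding r using v sA rp by (intro mult_left_mono) auto
 then obtain s' where s': "vol (B \<inter> hlo i s') = r * vol (A \<inter> hlo i s)" "vol (B \<inter> hhi i s') = vol B - r * vol (A \<inter> hlo i s)"
  using cut_exists[OF cB(1), of "r * vol (A \<inter> hlo i s)" i] v rp by (metis less_imp_le mult_nonneg_nonneg)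
 have "vol (B \<inter> hlo i s') * vol A = vol (A \<inter> hlo i s) * vol B" unfolding s' r by simp
 note EE = E_cut[OF E v this]
 have "vol (B \<inter> hhi i s') = r * vol (A \<inter> hhi i s)"
  unfolding s'(2) r sA[symmetric] by (simp add: algebra_simps)
 then show thesis using that[of s'] s'(1) EE by blast
qed

text \<open>After each matched halving, a half whose part of \<open>L\<close> still meets
  \<open>G\<close> in positive volume is kept. That part becomes thin in all directions but i, while
  the first set stays a box. Direction i is never cut, so the prescribed extents along i
  survive.\<close>

lemma bisect_path:
 assumes "E (cbox a b) (L \<inter> cbox p q)" "vol (L \<inter> cbox p q) = r * vol (cbox a b)"
  and "closed G" "0 < vol (L \<inter> cbox p q \<inter> G)"
  and "\<And>l y y'. l \<noteq> i \<Longrightarrow> y \<in> L \<inter> cbox p q \<Longrightarrow> y' \<in> L \<inter> cbox p q \<Longrightarrow>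
    \<bar>y $ l - y' $ l\<bar> \<le> eta * (2 powr (1 / CARD('k))) ^ count_list ds l"
  and "i \<notin> set ds" "p $ i = t1" "q $ i = t2" "a $ i = s1" "b $ i = s2"
 shows "\<exists>a b p q. E (cbox a b) (L \<inter> cbox p q) \<and> vol (L \<inter> cbox p q) = r * vol (cbox a b) \<and>
   0 < vol (L \<inter> cbox p q \<inter> G) \<and> p $ i = t1 \<and> q $ i = t2 \<and> a $ i = s1 \<and> b $ i = s2 \<and>
   (\<forall>l y y'. l \<noteq> i \<longrightarrow> y \<in> L \<inter> cbox p q \<longrightarrow> y' \<in> L \<inter> cbox p q \<longrightarrow> \<bar>y $ l - y' $ l\<bar> \<le> eta)"
 using assms
proof (induction ds arbitrary: a b p q)
 case Nil
 have "eta * (2 powr (1 / real CARD('k))) ^ count_list [] l = eta" for l :: 'k by simp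
 with Nil show ?case by (intro exI[of _ a] exI[of _ b] exI[of _ p] exI[of _ q]) simp
next
 case (Cons d ds)
 let ?Q = "cbox a b" and ?B = "L \<inter> cbox p q"
 let ?m = "2 powr (1 / real CARD('k))"
 have reg: "compact ?Q" "0 < vol ?Q" "convex_body ?B" using E_reg[OF Cons.prems(1)] by auto
 have cB: "compact ?B" "convex ?B" using reg by (auto simp: convex_body_def)
 have vB: "0 < vol ?B" by (rule convex_body_vol_pos[OF reg(3)])
 obtain s where s: "vol (?Q \<inter> hlo d s) = vol ?Q / 2" "vol (?Q \<inter> hhi d s) = vol ?Q - vol ?Q / 2"
  using cut_exists[OF reg(1), of "vol ?Q / 2" d] reg(2) by auto
 have pos: "0 < vol (?Q \<inter> hlo d s)" "0 < vol (?Q \<inter> hhi d s)" unfolding s using reg(2) by auto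
 obtain s' where s': "E (?Q \<inter> hlo d s) (?B \<inter> hlo d s')" "vol (?B \<inter> hlo d s') = r * vol (?Q \<inter> hlo d s)"
  "E (?Q \<inter> hhi d s) (?B \<inter> hhi d s')" "vol (?B \<inter> hhi d s') = r * vol (?Q \<inter> hhi d s)"
  using cut_both[OF Cons.prems(1) pos Cons.prems(2)] by blast
 have half: "vol (?B \<inter> hlo d s') \<le> vol ?B / 2" "vol (?B \<inter> hhi d s') \<le> vol ?B / 2"
  unfolding s'(2,4) s Cons.prems(2) by (simp_all add: algebra_simps)
 have di: "d \<noteq> i" using Cons.prems(6) by auto
 have cG: "compact (?B \<inter> G)" using cB Cons.prems(3) by (simp add: compact_Int_closed)
 have width: "\<bar>y $ l - y' $ l\<bar> \<le> eta * ?m ^ count_list ds l"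
  if l: "l \<noteq> i" and sig: "sig = 1 \<or> sig = (-1::real)" and D: "D = ?B \<inter> {y. sig * y $ d \<le> sig * s'}" "vol D \<le> vol ?B / 2" and y: "y \<in> D" "y' \<in> D"
  for D sig y y' l
 proof (cases "l = d")
  case True
  have "\<bar>y $ d - y' $ d\<bar> \<le> (eta * ?m ^ count_list (d # ds) d) / ?m"
   by (rule cut_width[OF cB vB Cons.prems(5)[OF di] sig D y])
  then show ?thesis using True by simp
 next
  case False
  then show ?thesis using Cons.prems(5)[OF l, of y y'] D y by auto
 qed
 have "0 < vol (?B \<inter> G \<inter> hlo d s') + vol (?B \<inter> G \<inter> hhi d s')"
  using vol_cut[OF cG, of d s'] Cons.prems(4) by simp
 then consider "0 < vol (?B \<inter> G \<inter> hlo d s')" | "0 < vol (?B \<inter> G \<inter> hhi d s')"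
  by (metis add_nonpos_nonpos not_less)
 then show ?case
 proof cases
  case 1
  define b' where "b' = (\<chi> l. if l = d then min (b $ l) s else b $ l)"
  define q' where "q' = (\<chi> l. if l = d then min (q $ l) s' else q $ l)"
  have eq: "?Q \<inter> hlo d s = cbox a b'" "?B \<inter> hlo d s' = L \<inter> cbox p q'"
   unfolding b'_def q'_def hlo_cbox[symmetric] by auto
  show ?thesis
  proof (rule Cons.IH[of a b' p q'])
   show "E (cbox a b') (L \<inter> cbox p q')" "vol (L \<inter> cbox p q') = r * vol (cbox a b')"
    using s' unfolding eq by auto
   show "0 < vol (L \<inter> cbox p q' \<inter> G)" using 1 unfolding eq(2)[symmetric] by (simp add: Int_ac)
   show "\<bar>y $ l - y' $ l\<bar> \<le> eta * ?m ^ count_list ds l" if "l \<noteq> i" "y \<in> L \<inter> cbox p q'" "y' \<in> L \<inter> cbox p q'" for l y y'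
    using that unfolding eq(2)[symmetric] by (intro width[of l 1 "?B \<inter> hlo d s'"]) (use half in auto)
  qed (use Cons.prems di in \<open>auto simp: b'_def q'_def\<close>)
 next
  case 2
  define a' where "a' = (\<chi> l. if l = d then max (a $ l) s else a $ l)"
  define p' where "p' = (\<chi> l. if l = d then max (p $ l) s' else p $ l)"
  have eq: "?Q \<inter> hhi d s = cbox a' b" "?B \<inter> hhi d s' = L \<inter> cbox p' q"
   unfolding a'_def p'_def hhi_cbox[symmetric] by auto
  show ?thesis
  proof (rule Cons.IH[of a' b p' q])
   show "E (cbox a' b) (L \<inter> cbox p' q)" "vol (L \<inter> cbox p' q) = r * vol (cbox a' b)"
    using s' unfolding eq by auto
   show "0 < vol (L \<inter> cbox p' q \<inter> G)" using 2 unfolding eq(2)[symmetric] by (simp add: Int_ac)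
   show "\<bar>y $ l - y' $ l\<bar> \<le> eta * ?m ^ count_list ds l" if "l \<noteq> i" "y \<in> L \<inter> cbox p' q" "y' \<in> L \<inter> cbox p' q" for l y y'
    using that unfolding eq(2)[symmetric] by (intro width[of l "-1" "?B \<inter> hhi d s'"]) (use half in auto)
  qed (use Cons.prems di in \<open>auto simp: a'_def p'_def\<close>)
 qed
qed

text \<open>Trims the slab of \<open>K\<close> to a cube cross-section about z, one direction at a
  time and from both sides, with matched cuts of \<open>L\<close>. The margin 2 * kk inside
  \<open>K\<close> gives the parts cut off positive volume, as \<open>E_cut\<close> demands.\<close>

lemma cut_to_box:
 assumes E: "E A (L \<inter> cbox p q)" and r: "vol (L \<inter> cbox p q) = r * vol A"
  and kk: "kk > 0" and A: "A = K \<inter> hlo i s2 \<inter> hhi i s1" and s: "s1 < s2"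
  and K: "\<And>y. s1 \<le> y $ i \<Longrightarrow> y $ i \<le> s2 \<Longrightarrow> (\<And>l. l \<noteq> i \<Longrightarrow> \<bar>y $ l - z $ l\<bar> \<le> 2 * kk) \<Longrightarrow> y \<in> K"
 defines "Q \<equiv> \<lambda>S. A \<inter> {y. \<forall>l\<in>S. z $ l - kk \<le> y $ l \<and> y $ l \<le> z $ l + kk}"
 assumes S: "S \<subseteq> UNIV - {i}"
 shows "\<exists>p' q'. E (Q S) (L \<inter> cbox p' q') \<and> vol (L \<inter> cbox p' q') = r * vol (Q S) \<and> p' $ i = p $ i \<and> q' $ i = q $ i"
 using finite_subset[OF S finite] S
proof (induction S rule: finite_induct)
 case empty
 then show ?case using E r by (intro exI[of _ p] exI[of _ q]) (simp add: Q_def)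
next
 case (insert l S)
 then obtain p' q' where IH: "E (Q S) (L \<inter> cbox p' q')" "vol (L \<inter> cbox p' q') = r * vol (Q S)" "p' $ i = p $ i" "q' $ i = q $ i"
  by auto
 have li: "l \<noteq> i" "l \<notin> S" using insert by auto
 have cQ: "compact (Q S)" using E_reg[OF IH(1)] by simp
 have box: "0 < vol D"
  if D: "compact D" and sub: "\<And>y. s1 \<le> y $ i \<Longrightarrow> y $ i \<le> s2 \<Longrightarrow> u \<le> y $ l \<Longrightarrow> y $ l \<le> u + kk \<Longrightarrow>
     (\<And>k. k \<noteq> i \<Longrightarrow> k \<noteq> l \<Longrightarrow> \<bar>y $ k - z $ k\<bar> \<le> kk) \<Longrightarrow> y \<in> D" for D u
 proof -
  let ?a = "\<chi> k. if k = i then s1 else if k = l then u else z $ k - kk"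
  let ?b = "\<chi> k. if k = i then s2 else if k = l then u + kk else z $ k + kk"
  have "0 < vol (cbox ?a ?b)" by (rule vol_cbox_pos) (use s kk in auto)
  also have "\<dots> \<le> vol D"
  proof (rule vol_mono[OF _ compact_cbox D], rule subsetI, rule sub)
   fix y assume y: "y \<in> cbox ?a ?b"
   then have h: "?a $ k \<le> y $ k" "y $ k \<le> ?b $ k" for k by (auto simp: mem_box_cart)
   show "s1 \<le> y $ i" "y $ i \<le> s2" using h[of i] by auto
   show "u \<le> y $ l" "y $ l \<le> u + kk" using h[of l] li by auto
   fix k assume "k \<noteq> i" "k \<noteq> l"
   then show "\<bar>y $ k - z $ k\<bar> \<le> kk" using h[of k] by auto
  qed
  finally show ?thesis .
 qed
 have QI: "y \<in> Q S" if "s1 \<le> y $ i" "y $ i \<le> s2" "\<bar>y $ l - z $ l\<bar> \<le> 2 * kk" "\<And>k. k \<noteq> i \<Longrightarrow> k \<noteq> l \<Longrightarrow> \<bar>y $ k - z $ k\<bar> \<le> kk" for y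
 proof -
  have "\<bar>y $ k - z $ k\<bar> \<le> 2 * kk" if "k \<noteq> i" for k
   using \<open>\<bar>y $ l - z $ l\<bar> \<le> 2 * kk\<close> that(1) kk \<open>\<And>k. k \<noteq> i \<Longrightarrow> k \<noteq> l \<Longrightarrow> \<bar>y $ k - z $ k\<bar> \<le> kk\<close>[of k] by (cases "k = l") auto
  then have "y \<in> K" using K that by blast
  moreover have "z $ k - kk \<le> y $ k \<and> y $ k \<le> z $ k + kk" if "k \<in> S" for k
  proof -
   have "\<bar>y $ k - z $ k\<bar> \<le> kk" using \<open>\<And>k. k \<noteq> i \<Longrightarrow> k \<noteq> l \<Longrightarrow> \<bar>y $ k - z $ k\<bar> \<le> kk\<close>[of k] that insert.prems li by auto
   then show ?thesis by auto
  qed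
  ultimately show ?thesis using that by (auto simp: Q_def A)
 qed
 have v1: "0 < vol (Q S \<inter> hlo l (z $ l + kk))"
  by (rule box[of _ "z $ l"]) (use kk in \<open>auto intro!: compact_cut cQ QI\<close>)
 have v2: "0 < vol (Q S \<inter> hhi l (z $ l + kk))"
  by (rule box[of _ "z $ l + kk"]) (use kk in \<open>auto intro!: compact_cut cQ QI\<close>)
 obtain w where w: "E (Q S \<inter> hlo l (z $ l + kk)) (L \<inter> cbox p' q' \<inter> hlo l w)"
   "vol (L \<inter> cbox p' q' \<inter> hlo l w) = r * vol (Q S \<inter> hlo l (z $ l + kk))"
  using cut_both[OF IH(1) v1 v2 IH(2)] by blast
 have v3: "0 < vol (Q S \<inter> hlo l (z $ l + kk) \<inter> hlo l (z $ l - kk))"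
  by (rule box[of _ "z $ l - 2 * kk"]) (use kk in \<open>auto intro!: compact_cut cQ QI\<close>)
 have v4: "0 < vol (Q S \<inter> hlo l (z $ l + kk) \<inter> hhi l (z $ l - kk))"
  by (rule box[of _ "z $ l - kk"]) (use kk in \<open>auto intro!: compact_cut cQ QI\<close>)
 obtain w' where w': "E (Q S \<inter> hlo l (z $ l + kk) \<inter> hhi l (z $ l - kk)) (L \<inter> cbox p' q' \<inter> hlo l w \<inter> hhi l w')"
   "vol (L \<inter> cbox p' q' \<inter> hlo l w \<inter> hhi l w') = r * vol (Q S \<inter> hlo l (z $ l + kk) \<inter> hhi l (z $ l - kk))"
  using cut_both[OF w(1) v3 v4 w(2)] by blast
 have eqQ: "Q S \<inter> hlo l (z $ l + kk) \<inter> hhi l (z $ l - kk) = Q (insert l S)" by (auto simp: Q_def)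
 have eqL: "L \<inter> cbox p' q' \<inter> hlo l w \<inter> hhi l w'
   = L \<inter> cbox (\<chi> k. if k = l then max (p' $ k) w' else p' $ k) (\<chi> k. if k = l then min (q' $ k) w else q' $ k)"
  unfolding hhi_cbox[symmetric] hlo_cbox[symmetric] by auto
 show ?case using w' unfolding eqQ eqL
  by (intro exI conjI) (assumption, assumption, use IH li in auto)
qed

text \<open>The slab of \<open>K\<close> contains a box with a definite share of its volume. The
  matched part of the slab of \<open>L\<close> has the same share there, and since deep points of
  \<open>L\<close> fill almost all of that slab, it contains some of them. Following them down to a
  thin piece yields a pair of boxes with extents s2 - s1 and t2 - t1 along i. Equal edge ratios
  together with the volume ratio r determine their quotient.\<close>

lemma slope:
 assumes E: "E K L" and r: "vol L = r * vol K" and z: "z \<in> interior K" "z $ i = s0" and zL: "zL \<in> interior L" "zL $ i = t0"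
 shows "\<exists>dlt>0. \<forall>s1 s2 t1 t2. s1 \<le> s0 \<longrightarrow> s0 \<le> s2 \<longrightarrow> s1 < s2 \<longrightarrow> s2 - s1 < dlt \<longrightarrow> t1 \<le> t0 \<longrightarrow> t0 \<le> t2 \<longrightarrow>
   vol (L \<inter> hlo i t1) = r * vol (K \<inter> hlo i s1) \<longrightarrow> vol (L \<inter> hlo i t2) = r * vol (K \<inter> hlo i s2) \<longrightarrow>
   t2 - t1 = r powr (1 / CARD('k)) * (s2 - s1)"
proof -
 let ?m = "CARD('k)"
 have reg: "compact K" "0 < vol K" "convex_body L" using E_reg[OF E] by auto
 have cL: "compact L" "convex L" "0 < vol L" using reg convex_body_vol_pos by (auto simp: convex_body_def)
 have rp: "r > 0" using r reg(2) cL(3) by (simp add: zero_less_mult_iff)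
 obtain CK where CK: "CK \<ge> 0" "\<And>s s'. s \<le> s' \<Longrightarrow> vol (K \<inter> hhi i s \<inter> hlo i s') \<le> CK * (s' - s)"
  using slab_vol_le[OF compact_imp_bounded[OF reg(1)]] reg(1) by metis
 obtain e where e: "e > 0" "cball z e \<subseteq> K" using z mem_interior_cball by blast
 \<comment> \<open>A cube of half-width 2 * kk has l1-radius e, hence lies in the ball inside
   \<open>K\<close>.\<close>
 define kk where "kk = e / (2 * ?m)"
 have kk: "kk > 0" using e by (simp add: kk_def)
 have cubeK: "y \<in> K" if "\<And>l. \<bar>y $ l - z $ l\<bar> \<le> 2 * kk" for y
 proof -
  have "norm (z - y) \<le> (\<Sum>l\<in>UNIV. \<bar>(z - y) $ l\<bar>)" by (rule norm_le_l1_cart)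
  also have "\<dots> \<le> (\<Sum>l\<in>(UNIV::'k set). 2 * kk)" using that by (intro sum_mono) (auto simp: abs_minus_commute)
  also have "\<dots> = e" by (simp add: kk_def)
  finally show ?thesis using e(2) by (auto simp: dist_norm)
 qed
 obtain rho where rho: "rho > 0" "cball zL rho \<subseteq> L" using zL mem_interior_cball by blast
 define kL where "kL = rho / ?m"
 have kL: "kL > 0" using rho by (simp add: kL_def)
 have cubeL: "y \<in> L" if "\<And>l. \<bar>y $ l - zL $ l\<bar> \<le> kL" for y
 proof -
  have "norm (zL - y) \<le> (\<Sum>l\<in>UNIV. \<bar>(zL - y) $ l\<bar>)" by (rule norm_le_l1_cart)
  also have "\<dots> \<le> (\<Sum>l\<in>(UNIV::'k set). kL)" using that by (intro sum_mono) (auto simp: abs_minus_commute)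
  also have "\<dots> = rho" by (simp add: kL_def)
  finally show ?thesis using rho(2) by (auto simp: dist_norm)
 qed
 have prodi: "(\<Prod>l\<in>UNIV. if l = i then x else c) = x * c ^ (?m - 1)" for x c :: real
 proof -
  have "(\<Prod>l\<in>UNIV. if l = i then x else c) = x * (\<Prod>l\<in>UNIV - {i}. if l = i then x else c)" by (subst prod.remove[of _ i]) auto
  also have "(\<Prod>l\<in>UNIV - {i}. if l = i then x else c) = (\<Prod>l\<in>UNIV - {i}. c)" by (rule prod.cong) auto
  finally show ?thesis by simp
 qed
 have volbox: "vol (slab i u v x k) = (v - u) * (2 * k) ^ (?m - 1)"
  if "u \<le> v" "k > 0" for u v k and x :: "real^'k::{finite,wellorder}"
 proof -
  have "vol (slab i u v x k)
    = (\<Prod>l\<in>UNIV. if l = i then v - u else 2 * k)"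
   by (subst vol_cbox_cart) (use that in \<open>auto intro!: prod.cong\<close>)
  then show ?thesis by (simp add: prodi)
 qed
 define g where "g = (2 * kL) ^ (?m - 1)"
 have g: "g > 0" using kL by (simp add: g_def)
 \<comment> \<open>Lower bound for the share of the trimmed box in the slab of \<open>K\<close>,
   whose volume is at most CK * (s2 - s1); the summand 1 avoids a division by zero.\<close>
 define k0 where "k0 = (2 * kk) ^ (?m - 1) / (CK + 1)"
 have k0: "k0 > 0" using kk CK by (simp add: k0_def)
 have "((\<lambda>\<theta>. (1 - \<theta>) ^ ?m) \<longlongrightarrow> (1 - 0) ^ ?m) (at_right (0::real))" by (intro tendsto_intros)
 then have "\<forall>\<^sub>F \<theta> in at_right 0. 1 - k0 < (1 - \<theta>) ^ ?m"
  using k0 by (intro order_tendstoD(1)[of _ "(1 - 0) ^ ?m"]) auto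
 moreover have "\<forall>\<^sub>F \<theta> in at_right (0::real). 0 < \<theta> \<and> \<theta> < 1" by (auto simp: eventually_at_right_field intro!: exI[of _ 1])
 ultimately have "\<forall>\<^sub>F \<theta> in at_right 0. 1 - k0 < (1 - \<theta>) ^ ?m \<and> 0 < \<theta> \<and> \<theta> < 1" by eventually_elim auto
 \<comment> \<open>The contraction by 1 - \<theta> is to keep more than the share 1 - k0 of a slab,
   so that the deep part meets every piece of share k0.\<close>
 then obtain \<theta> :: real where \<theta>: "1 - k0 < (1 - \<theta>) ^ ?m" "0 < \<theta>" "\<theta> < 1"
  using eventually_happens'[of "at_right (0::real)"] by auto
 \<comment> \<open>Half of the depth \<theta> * rho is reserved for the extent along i, the other
   half for all remaining directions together.\<close>
 define h where "h = \<theta> * rho / 2"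
 have h: "h > 0" using \<theta> rho by (simp add: h_def)
 \<comment> \<open>The first bound keeps the slab within the part of \<open>K\<close> controlled by
   \<open>kk\<close>; the second makes vol B so small that t2 - t1 \<le> h.\<close>
 define dlt where "dlt = min kk (min kL h * g / (r * (CK + 1)))"
 have dlt: "dlt > 0" "dlt \<le> kk" "dlt \<le> min kL h * g / (r * (CK + 1))" unfolding dlt_def using kk kL h g rp CK by auto
 show ?thesis
 proof (rule exI[of _ dlt], intro conjI allI impI dlt(1))
  fix s1 s2 t1 t2
  assume s: "s1 \<le> s0" "s0 \<le> s2" "s1 < s2" "s2 - s1 < dlt" and t: "t1 \<le> t0" "t0 \<le> t2"
   and m1: "vol (L \<inter> hlo i t1) = r * vol (K \<inter> hlo i s1)" and m2: "vol (L \<inter> hlo i t2) = r * vol (K \<inter> hlo i s2)"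
  define A where "A = K \<inter> hlo i s2 \<inter> hhi i s1"
  define B where "B = L \<inter> hlo i t2 \<inter> hhi i t1"
  have cA: "compact A" and cB: "compact B" unfolding A_def B_def by (auto intro!: compact_cut reg cL)
  have vA': "vol A = vol (K \<inter> hlo i s2) - vol (K \<inter> hlo i s1)"
   using vol_hlo_diff[OF reg(1), of s1 s2 i] s by (simp add: A_def Int_ac)
  have vB': "vol B = vol (L \<inter> hlo i t2) - vol (L \<inter> hlo i t1)"
   using vol_hlo_diff[OF cL(1), of t1 t2 i] t by (simp add: B_def Int_ac)
  have vAB: "vol B = r * vol A" unfolding vA' vB' m1 m2 by (simp add: algebra_simps)
  have vAle: "vol A \<le> CK * (s2 - s1)" using CK(2)[of s1 s2] s by (simp add: A_def Int_ac)
  have boxA: "0 < vol D" if D: "compact D" "u < v" "\<And>y. u \<le> y $ i \<Longrightarrow> y $ i \<le> v \<Longrightarrow> (\<And>l. l \<noteq> i \<Longrightarrow> \<bar>y $ l - z $ l\<bar> \<le> kk) \<Longrightarrow> y \<in> D" for D u v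
  proof -
   have "0 < (v - u) * (2 * kk) ^ (?m - 1)" using that kk by simp
   also have "\<dots> = vol (slab i u v z kk)"
    by (rule volbox[symmetric]) (use that kk in auto)
   also have "\<dots> \<le> vol D"
   proof (rule vol_mono[OF _ compact_cbox D(1)], rule subsetI, rule D(3))
    fix y assume y: "y \<in> slab i u v z kk"
    then have h: "(if l = i then u else z $ l - kk) \<le> y $ l" "y $ l \<le> (if l = i then v else z $ l + kk)" for l by (auto simp: mem_box_cart)
    show "u \<le> y $ i" "y $ i \<le> v" using h[of i] by auto
    fix l assume "l \<noteq> i"
    then show "\<bar>y $ l - z $ l\<bar> \<le> kk" using h[of l] by auto
   qed
   finally show ?thesis .
  qed
  have inK: "y \<in> K" if "s0 - 2 * kk \<le> y $ i" "y $ i \<le> s0 + 2 * kk" "\<And>l. l \<noteq> i \<Longrightarrow> \<bar>y $ l - z $ l\<bar> \<le> 2 * kk" for y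
  proof (rule cubeK)
   fix l show "\<bar>y $ l - z $ l\<bar> \<le> 2 * kk" using that z(2) by (cases "l = i") auto
  qed
  have inK': "y \<in> K" if "s0 - 2 * kk \<le> y $ i" "y $ i \<le> s0 + 2 * kk" "\<And>l. l \<noteq> i \<Longrightarrow> \<bar>y $ l - z $ l\<bar> \<le> kk" for y
  proof (rule inK)
   fix l assume "l \<noteq> i"
   then show "\<bar>y $ l - z $ l\<bar> \<le> 2 * kk" using that(3)[of l] kk by linarith
  qed (use that in auto)
  have sk: "s2 < s0 + kk" "s0 - kk < s1" using s dlt by auto
  have p1: "0 < vol (K \<inter> hlo i s2)" by (rule boxA[of _ "s0 - 2 * kk" "s0 - kk"]) (use sk s kk in \<open>auto intro!: compact_cut reg inK'\<close>)
  have p2: "0 < vol (K \<inter> hhi i s2)" by (rule boxA[of _ "s0 + kk" "s0 + 2 * kk"]) (use sk s kk in \<open>auto intro!: compact_cut reg inK'\<close>)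
  have p3: "0 < vol (K \<inter> hlo i s2 \<inter> hlo i s1)" by (rule boxA[of _ "s0 - 2 * kk" "s0 - kk"]) (use sk s kk in \<open>auto intro!: compact_cut reg inK'\<close>)
  have p4: "0 < vol A" unfolding A_def by (rule boxA[of _ s1 s2]) (use sk s kk in \<open>auto intro!: compact_cut reg inK'\<close>)
  have E1: "E (K \<inter> hlo i s2) (L \<inter> hlo i t2)"
   using E_cut[OF E p1 p2, of t2] m2 r by (simp add: mult_ac)
  have "L \<inter> hlo i t2 \<inter> hlo i t1 = L \<inter> hlo i t1" "K \<inter> hlo i s2 \<inter> hlo i s1 = K \<inter> hlo i s1" using s t by auto
  then have E2: "E A B"
   using E_cut[OF E1 p3, of t1] p4 m1 m2 unfolding A_def B_def by (simp add: mult_ac)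
  obtain M where M: "M > 0" "\<And>x l. x \<in> L \<Longrightarrow> \<bar>x $ l\<bar> \<le> M" using bounded_component[OF compact_imp_bounded[OF cL(1)]] by blast
  define p where "p = (\<chi> l. if l = i then t1 else -M)"
  define q where "q = (\<chi> l. if l = i then t2 else M)"
  have Bpq: "B = L \<inter> cbox p q"
  proof (intro set_eqI iffI)
   fix y assume y: "y \<in> B"
   then have "\<bar>y $ l\<bar> \<le> M" for l using M(2) by (auto simp: B_def)
   then have "- M \<le> y $ l" "y $ l \<le> M" for l by (simp_all add: abs_le_iff minus_le_iff)
   then show "y \<in> L \<inter> cbox p q" using y by (auto simp: B_def p_def q_def mem_box_cart)
  next
   fix y assume y: "y \<in> L \<inter> cbox p q"
   then have "p $ i \<le> y $ i" "y $ i \<le> q $ i" by (auto simp: mem_box_cart)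
   then show "y \<in> B" using y by (auto simp: B_def p_def q_def)
  qed
  let ?C = "{y. \<forall>l\<in>UNIV - {i}. z $ l - kk \<le> y $ l \<and> y $ l \<le> z $ l + kk}"
  define Q where "Q = slab i s1 s2 z kk"
  have "\<exists>p' q'. E (A \<inter> ?C) (L \<inter> cbox p' q') \<and>
    vol (L \<inter> cbox p' q') = r * vol (A \<inter> ?C) \<and> p' $ i = p $ i \<and> q' $ i = q $ i"
  proof (rule cut_to_box[OF _ _ kk A_def s(3)])
   show "E A (L \<inter> cbox p q)" "vol (L \<inter> cbox p q) = r * vol A" using E2 vAB Bpq by auto
   show "y \<in> K" if "s1 \<le> y $ i" "y $ i \<le> s2" "\<And>l. l \<noteq> i \<Longrightarrow> \<bar>y $ l - z $ l\<bar> \<le> 2 * kk" for y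
    by (rule inK) (use that sk kk in auto)
  qed simp
  moreover have "A \<inter> ?C = Q"
  proof (intro set_eqI iffI)
   fix y assume "y \<in> A \<inter> ?C"
   then show "y \<in> Q" by (auto simp: A_def Q_def mem_box_cart)
  next
   fix y assume "y \<in> Q"
   then have h: "(if l = i then s1 else z $ l - kk) \<le> y $ l" "y $ l \<le> (if l = i then s2 else z $ l + kk)" for l by (auto simp: Q_def mem_box_cart)
   have c: "z $ l - kk \<le> y $ l \<and> y $ l \<le> z $ l + kk" if "l \<noteq> i" for l using h[of l] that by auto
   have "y \<in> K" by (rule inK') (use h[of i] sk kk c in \<open>auto simp: abs_le_iff algebra_simps\<close>)
   then show "y \<in> A \<inter> ?C"
    using h[of i] c by (auto simp: A_def)
  qed
  ultimately obtain p' q' where Q: "E Q (L \<inter> cbox p' q')" "vol (L \<inter> cbox p' q') = r * vol Q" "p' $ i = t1" "q' $ i = t2"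
   by (auto simp: p_def q_def)
  have vQ: "vol Q = (s2 - s1) * (2 * kk) ^ (?m - 1)" unfolding Q_def by (rule volbox) (use s kk in auto)
  have Qkk: "k0 * vol A \<le> vol Q"
  proof -
   have "k0 * vol A \<le> k0 * ((CK + 1) * (s2 - s1))" using vAle s k0 by (intro mult_left_mono) (auto simp: algebra_simps)
   also have "\<dots> = vol Q" using CK by (simp add: k0_def vQ)
   finally show ?thesis .
  qed
  define G where "G = inner_set L (\<theta> * rho)"
  have cG: "closed G" unfolding G_def by (intro closed_inner_set compact_imp_closed cL)
  \<comment> \<open>The centre \<open>zL\<close> lies at level t0 between t1 and t2, so contracting
    towards it preserves the slab.\<close>
  have GB: "(1 - \<theta>) ^ ?m * vol B \<le> vol (B \<inter> G)"
  proof -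
   let ?f = "\<lambda>x. (1 - \<theta>) *\<^sub>R x + \<theta> *\<^sub>R zL"
   have "(1 - \<theta>) ^ ?m * vol B = vol (?f ` B)" using \<theta> by (simp add: vol_affine)
   also have "\<dots> \<le> vol (B \<inter> G)"
   proof (rule vol_mono)
    show "?f ` B \<subseteq> B \<inter> G"
    proof (rule image_subsetI)
     fix x assume x: "x \<in> B"
     have "?f x \<in> G" unfolding G_def using x \<theta> by (intro contract_inner_set[OF cL(2) rho(2)]) (auto simp: B_def)
     moreover have "G \<subseteq> L" unfolding G_def by (rule inner_set_subset) (use \<theta> rho in auto)
     moreover have "t1 \<le> (?f x) $ i" "(?f x) $ i \<le> t2"
      using x t \<theta> zL convex_bound_le[of "x $ i" t2 t0 "1 - \<theta>" \<theta>] convex_bound_le[of "- x $ i" "- t1" "- t0" "1 - \<theta>" \<theta>]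
      by (auto simp: B_def)
     ultimately show "?f x \<in> B \<inter> G" by (auto simp: B_def)
    qed
   qed (auto intro!: compact_continuous_image continuous_intros cB compact_Int_closed cG)
   finally show ?thesis .
  qed
  let ?B' = "L \<inter> cbox p' q'"
  have cB': "compact ?B'" by (intro compact_Int_cbox cL)
  have B'B: "?B' \<subseteq> B"
  proof
   fix y assume y: "y \<in> ?B'"
   then have "p' $ i \<le> y $ i" "y $ i \<le> q' $ i" by (auto simp: mem_box_cart)
   then show "y \<in> B" using y Q by (auto simp: B_def)
  qed
  have vB: "vol B > 0" using vAB rp p4 by simp
  \<comment> \<open>A share of at least k0 and a share of more than 1 - k0 of \<open>B\<close> must
    overlap in positive volume.\<close>
  have vG: "0 < vol (?B' \<inter> G)"
  proof -
   have lm: "?B' \<in> lmeasurable" "B \<inter> G \<in> lmeasurable" using cB' cB cG by (auto intro!: lmeasurable_compact compact_Int_closed)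
   have "vol (?B' \<union> B \<inter> G) = vol ?B' + vol (B \<inter> G) - vol (?B' \<inter> (B \<inter> G))" by (rule measure_Un3[OF lm])
   moreover have "vol (?B' \<union> B \<inter> G) \<le> vol B"
    by (rule vol_mono) (use B'B cB' cB cG in \<open>auto intro!: compact_Un compact_Int_closed\<close>)
   moreover have "?B' \<inter> (B \<inter> G) = ?B' \<inter> G" using B'B by auto
   moreover have "k0 * vol B \<le> vol ?B'" unfolding Q(2) vAB using Qkk rp by (simp add: mult.left_commute)
   moreover have "(1 - k0) * vol B < (1 - \<theta>) ^ ?m * vol B" using \<theta>(1) vB by (rule mult_strict_right_mono)
   ultimately show ?thesis using GB by (simp add: algebra_simps)
  qed
  define eta where "eta = h / ?m"
  have eta: "eta > 0" using h by (simp add: eta_def)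
  obtain us :: "'k list" where us: "set us = UNIV - {i}" "distinct us" using finite_distinct_list[of "UNIV - {i}"] by auto
  have "1 < 2 powr (1 / real ?m)" by (rule gr_one_powr) auto
  then obtain N where N: "2 * M / eta < (2 powr (1 / real ?m)) ^ N" using real_arch_pow by blast
  define ds where "ds = concat (replicate N us)"
  have ds: "count_list ds l = N" if "l \<noteq> i" for l
   unfolding ds_def using us that by (intro count_list_concat_replicate distinct_count_list) auto
  have ids: "i \<notin> set ds" using us by (auto simp: ds_def)
  have "\<exists>a b p q. E (cbox a b) (L \<inter> cbox p q) \<and> vol (L \<inter> cbox p q) = r * vol (cbox a b) \<and>
    0 < vol (L \<inter> cbox p q \<inter> G) \<and> p $ i = t1 \<and> q $ i = t2 \<and> a $ i = s1 \<and> b $ i = s2 \<and>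
    (\<forall>l y y'. l \<noteq> i \<longrightarrow> y \<in> L \<inter> cbox p q \<longrightarrow> y' \<in> L \<inter> cbox p q \<longrightarrow> \<bar>y $ l - y' $ l\<bar> \<le> eta)"
  proof (rule bisect_path[OF Q(1)[unfolded Q_def] _ cG vG _ ids Q(3,4)])
   show "vol (L \<inter> cbox p' q') = r * vol (slab i s1 s2 z kk)"
    using Q(2) by (simp add: Q_def)
   fix l :: 'k and y y' assume l: "l \<noteq> i" and y: "y \<in> L \<inter> cbox p' q'" "y' \<in> L \<inter> cbox p' q'"
   have "\<bar>y $ l\<bar> \<le> M" "\<bar>y' $ l\<bar> \<le> M" using M(2) y by auto
   then have "\<bar>y $ l - y' $ l\<bar> \<le> 2 * M" by linarith
   also have "\<dots> \<le> eta * (2 powr (1 / real ?m)) ^ N" using N eta by (simp add: field_simps)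
   finally show "\<bar>y $ l - y' $ l\<bar> \<le> eta * (2 powr (1 / real ?m)) ^ count_list ds l" using ds[OF l] by simp
  qed auto
  then obtain a b p q where ab: "E (cbox a b) (L \<inter> cbox p q)" "vol (L \<inter> cbox p q) = r * vol (cbox a b)"
    "0 < vol (L \<inter> cbox p q \<inter> G)" "p $ i = t1" "q $ i = t2" "a $ i = s1" "b $ i = s2"
    and wid: "\<And>l y y'. l \<noteq> i \<Longrightarrow> y \<in> L \<inter> cbox p q \<Longrightarrow> y' \<in> L \<inter> cbox p q \<Longrightarrow> \<bar>y $ l - y' $ l\<bar> \<le> eta" by blast
  have "L \<inter> cbox p q \<inter> G \<noteq> {}" using ab(3) by auto
  then obtain x where x: "x \<in> L \<inter> cbox p q" "x \<in> G" by auto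
  have tle: "t2 - t1 \<le> h"
  proof -
   have vBlt: "vol B < min kL h * g"
   proof -
    have "vol B \<le> r * ((CK + 1) * (s2 - s1))" unfolding vAB using vAle s rp by (intro mult_left_mono) (auto simp: algebra_simps)
    also have "\<dots> < r * ((CK + 1) * dlt)" using s rp CK by (intro mult_strict_left_mono) auto
    also have "\<dots> \<le> r * ((CK + 1) * (min kL h * g / (r * (CK + 1))))" using dlt(3) rp CK by (intro mult_left_mono) auto
    also have "\<dots> = min kL h * g" using rp CK by simp
    finally show ?thesis .
   qed
   \<comment> \<open>Levels truncated to the known cube about \<open>zL\<close>. The volume bound
     gives v - u < kL, so the truncation is inactive and u = t1, v = t2.\<close>
   define u v where "u = max t1 (t0 - kL)" and "v = min t2 (t0 + kL)"
   have uv: "u \<le> v" using t kL by (auto simp: u_def v_def)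
   have "(v - u) * g = vol (slab i u v zL kL)"
    unfolding g_def by (rule volbox[symmetric, OF uv kL])
   also have "\<dots> \<le> vol B"
   proof (rule vol_mono[OF _ compact_cbox cB], rule subsetI)
    fix y assume "y \<in> slab i u v zL kL"
    then have h: "(if l = i then u else zL $ l - kL) \<le> y $ l" "y $ l \<le> (if l = i then v else zL $ l + kL)" for l by (auto simp: mem_box_cart)
    have "y \<in> L"
    proof (rule cubeL)
     fix l show "\<bar>y $ l - zL $ l\<bar> \<le> kL"
      using h[of l] h[of i] zL(2) by (cases "l = i") (auto simp: u_def v_def abs_le_iff)
    qed
    then show "y \<in> B" using h[of i] by (auto simp: B_def u_def v_def)
   qed
   finally have "(v - u) * g < min kL h * g" using vBlt by linarith
   then have vu: "v - u < kL" "v - u < h" using g by simp_all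
   have "t0 \<le> v" "u \<le> t0" using t kL by (auto simp: u_def v_def)
   then have "u > t0 - kL" "v < t0 + kL" using vu by linarith+
   then have "u = t1" "v = t2" by (auto simp: u_def v_def)
   then show ?thesis using vu by simp
  qed
  define omega where "omega l = (if l = i then t2 - t1 else eta)" for l
  have omegasum: "(\<Sum>l\<in>UNIV. omega l) \<le> \<theta> * rho"
  proof -
   have "(\<Sum>l\<in>UNIV. omega l) = (t2 - t1) + (\<Sum>l\<in>UNIV - {i}. omega l)" by (subst sum.remove[of _ i]) (auto simp: omega_def)
   also have "(\<Sum>l\<in>UNIV - {i}. omega l) = (\<Sum>l\<in>UNIV - {i}. eta)" by (rule sum.cong) (auto simp: omega_def)
   also have "\<dots> \<le> (\<Sum>l\<in>(UNIV::'k set). eta)" using eta by (intro sum_mono2) auto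
   also have "\<dots> = h" by (simp add: eta_def)
   finally show ?thesis using tle by (simp add: h_def)
  qed
  have rB: "convex_body (L \<inter> cbox p q)" using E_reg[OF ab(1)] by auto
  obtain c d where cd: "L \<inter> cbox p q = cbox c d" "\<And>l. c $ l < d $ l"
  proof (rule piece_is_box[of "L \<inter> cbox p q" L p q omega x])
   show "\<bar>y $ l - y' $ l\<bar> \<le> omega l" if "y \<in> L \<inter> cbox p q" "y' \<in> L \<inter> cbox p q" for y y' l
   proof (cases "l = i")
    case True
    have "p $ i \<le> y $ i" "y $ i \<le> q $ i" "p $ i \<le> y' $ i" "y' $ i \<le> q $ i" using that by (auto simp: mem_box_cart)
    then show ?thesis using True ab by (simp add: omega_def abs_le_iff)
   qed (use wid that omega_def in auto)
   show "x \<in> inner_set L (sum omega UNIV)" using x(2) inner_set_mono[OF omegasum] by (auto simp: G_def)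
  qed (use x rB convex_body_vol_pos[OF rB] in \<open>auto simp: convex_body_def\<close>)
  \<comment> \<open>The piece attains both levels: moving the deep point x along i to t1 or to t2
    does not leave \<open>L\<close>.\<close>
  have ci: "c $ i = t1" "d $ i = t2"
  proof -
   have full: "(\<chi> l. if l = i then u else x $ l) \<in> L \<inter> cbox p q" if u: "t1 \<le> u" "u \<le> t2" for u
   proof -
    let ?y = "\<chi> l. if l = i then u else x $ l"
    have xi: "t1 \<le> x $ i" "x $ i \<le> t2" using x(1) ab by (auto simp: mem_box_cart)
    have "norm (x - ?y) \<le> (\<Sum>l\<in>UNIV. \<bar>(x - ?y) $ l\<bar>)" by (rule norm_le_l1_cart)
    also have "\<dots> \<le> (\<Sum>l\<in>UNIV. omega l)" using xi u eta by (intro sum_mono) (auto simp: omega_def)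
    finally have "?y \<in> cball x (\<theta> * rho)" using omegasum by (simp add: dist_norm)
    then have "?y \<in> L" using x(2) by (auto simp: G_def inner_set_def)
    moreover have "?y \<in> cbox p q" using x(1) ab u by (auto simp: mem_box_cart)
    ultimately show ?thesis by simp
   qed
   have "t1 \<le> t2" using t by simp
   then have "(\<chi> l. if l = i then t1 else x $ l) \<in> cbox c d" "(\<chi> l. if l = i then t2 else x $ l) \<in> cbox c d"
    using full[of t1] full[of t2] unfolding cd(1) by auto
   then have "c $ i \<le> (\<chi> l. if l = i then t1 else x $ l) $ i" "(\<chi> l. if l = i then t2 else x $ l) $ i \<le> d $ i"
    unfolding mem_box_cart by blast+
   then have "c $ i \<le> t1" "t2 \<le> d $ i" by simp_all
   moreover have "p $ i \<le> c $ i" "d $ i \<le> q $ i"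
   proof -
    have "c \<in> cbox c d" "d \<in> cbox c d" using cd(2) by (auto simp: mem_box_cart less_imp_le)
    then have "c \<in> cbox p q" "d \<in> cbox p q" using cd(1) by auto
    then show "p $ i \<le> c $ i" "d $ i \<le> q $ i" by (auto simp: mem_box_cart)
   qed
   ultimately show "c $ i = t1" "d $ i = t2" using ab by auto
  qed
  have ablt: "a $ l < b $ l" for l using E_reg[OF ab(1)] vol_cbox_pos_imp by blast
  define tau where "tau = (t2 - t1) / (s2 - s1)"
  have ratio: "(d $ l - c $ l) / (b $ l - a $ l) = tau" for l
   using E_box[OF ab(1)[unfolded cd(1)] ablt cd(2), of l i] ci ab by (simp add: tau_def)
  have tau0: "tau > 0" using ratio[of i] ablt[of i] cd(2)[of i] by (metis diff_gt_0_iff_gt divide_pos_pos)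
  have "vol (cbox c d) = (\<Prod>l\<in>UNIV. d $ l - c $ l)" by (rule vol_cbox_cart) (use cd(2) in \<open>auto intro: less_imp_le\<close>)
  also have "\<dots> = (\<Prod>l\<in>UNIV. tau * (b $ l - a $ l))"
  proof (rule prod.cong[OF refl])
   fix l show "d $ l - c $ l = tau * (b $ l - a $ l)" using ratio[of l] ablt[of l] by (simp add: field_simps)
  qed
  also have "\<dots> = tau ^ ?m * vol (cbox a b)" by (subst vol_cbox_cart) (use ablt in \<open>auto intro: less_imp_le simp: prod.distrib\<close>)
  finally have "tau ^ ?m * vol (cbox a b) = r * vol (cbox a b)" using ab(2) cd(1) by simp
  moreover have "vol (cbox a b) > 0" using E_reg[OF ab(1)] by simp
  ultimately have "tau ^ ?m = r" by simp
  then have "r = tau powr real ?m" using tau0 by (simp add: powr_realpow)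
  then have "r powr (1 / ?m) = tau powr (real ?m * (1 / ?m))" by (simp only: powr_powr)
  then have "r powr (1 / ?m) = tau" using tau0 by simp
  then show "t2 - t1 = r powr (1 / ?m) * (s2 - s1)" using s by (simp add: tau_def)
 qed
qed

end

lemma vol_pos_open_subset:
 assumes "open U" "U \<noteq> {}" "U \<subseteq> A" "compact A" shows "0 < vol A"
proof (rule vol_pos_interior)
 show "interior A \<noteq> {}" using assms interior_maximal by blast
qed (use assms lmeasurable_compact in auto)

lemma hlo_strict_mono_vol:
 assumes K: "compact K" and z: "z \<in> interior K" "s1 < z $ i" "z $ i < s2"
 shows "vol (K \<inter> hlo i s1) < vol (K \<inter> hlo i s2)"
proof -
 have "0 < vol (K \<inter> hhi i s1 \<inter> hlo i s2)"
 proof (rule vol_pos_open_subset[of "interior K \<inter> {y. s1 < y $ i} \<inter> {y. y $ i < s2}"])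
  show "open (interior K \<inter> {y. s1 < y $ i} \<inter> {y. y $ i < s2})"
   by (intro open_Int open_interior open_Collect_less continuous_intros)
  show "interior K \<inter> {y. s1 < y $ i} \<inter> {y. y $ i < s2} \<subseteq> K \<inter> hhi i s1 \<inter> hlo i s2"
   using interior_subset by auto
 qed (use z K in \<open>auto intro!: compact_cut\<close>)
 then show ?thesis using vol_hlo_diff[OF K, of s1 s2 i] z by simp
qed

lemma convex_body_point_at:
 assumes L: "convex_body L" and v: "0 < vol (L \<inter> hlo i t)" "0 < vol (L \<inter> hhi i t)"
 obtains z where "z \<in> interior L" "z $ i = t"
proof -
 have "convex_body (L \<inter> hlo i t)" "convex_body (L \<inter> hhi i t)" using convex_body_cut[OF L] v by auto
 then obtain x y where "x \<in> interior (L \<inter> hlo i t)" "y \<in> interior (L \<inter> hhi i t)" by (auto simp: convex_body_def)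
 then have "x \<in> interior L" "y \<in> interior L" "x $ i \<le> t" "t \<le> y $ i"
  using interior_mono[of "L \<inter> hlo i t" L] interior_mono[of "L \<inter> hhi i t" L] interior_subset[of "L \<inter> hlo i t"] interior_subset[of "L \<inter> hhi i t"] by auto
 moreover have "connected (interior L)" using L by (simp add: convex_body_def convex_connected convex_interior)
 ultimately show thesis using that connected_ivt_component_cart by blast
qed

section \<open>Marginal volumes in the equality case\<close>

context cut_equality
begin

text \<open>On J, the open interval onto which the interior of \<open>K\<close> projects, the
  matched level T s minus lam * s is locally constant by \<open>slope\<close>, hence constant. For
  levels outside J the volume cut from \<open>K\<close> is 0 or full, and monotonicity together with
  the values at the ends of J settles the volume cut from \<open>L\<close>.\<close>

lemma marginal_axis:
 assumes E: "E K L" and conn: "connected (interior K)" and dense: "K \<subseteq> closure (interior K)"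
 defines "r \<equiv> vol L / vol K"
 shows "\<exists>bt. \<forall>s. vol (L \<inter> hlo i (r powr (1 / CARD('k)) * s + bt)) = r * vol (K \<inter> hlo i s)"
proof -
 define lam where "lam = r powr (1 / CARD('k))"
 have reg: "compact K" "0 < vol K" "convex_body L" using E_reg[OF E] by auto
 have cL: "compact L" "convex L" "0 < vol L" using reg convex_body_vol_pos by (auto simp: convex_body_def)
 have r: "r > 0" "vol L = r * vol K" using reg cL by (auto simp: r_def)
 have lam: "lam > 0" using r by (simp add: lam_def)
 define J where "J = (\<lambda>x. x $ i) ` interior K"
 have lin: "linear (\<lambda>x::(real,'k) vec. x $ i)" by (simp add: linear_iff)
 have "surj (\<lambda>x::(real,'k) vec. x $ i)" by (rule surjI[of _ "\<lambda>c. axis i c"]) simp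
 then have oJ: "open J" unfolding J_def by (intro open_surjective_linear_image open_interior lin)
 have "connected J" unfolding J_def by (intro connected_continuous_image conn continuous_intros)
 then have convJ: "convex J" and ivJ: "is_interval J" using is_interval_connected_1 is_interval_convex_1 by blast+
 have intK: "interior K \<noteq> {}"
 proof
  assume "interior K = {}"
  then have "K = {}" using dense by simp
  then show False using reg by simp
 qed
 then have Jne: "J \<noteq> {}" by (simp add: J_def)
 have pos: "0 < vol (K \<inter> hlo i s)" "0 < vol (K \<inter> hhi i s)" if sJ: "s \<in> J" for s
 proof -
  obtain d where d: "d > 0" "ball s d \<subseteq> J" using oJ sJ openE by blast
  have "s - d / 2 \<in> J" "s + d / 2 \<in> J" using d by (auto simp: dist_real_def intro!: subsetD[OF d(2)])
  then obtain y y' where y: "y \<in> interior K" "y $ i = s - d / 2" "y' \<in> interior K" "y' $ i = s + d / 2" by (auto simp: J_def)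
  show "0 < vol (K \<inter> hlo i s)"
  proof (rule vol_pos_open_subset[of "interior K \<inter> {y. y $ i < s}"])
   show "open (interior K \<inter> {y. y $ i < s})" by (intro open_Int open_interior open_Collect_less continuous_intros)
   show "interior K \<inter> {y. y $ i < s} \<subseteq> K \<inter> hlo i s" using interior_subset by auto
   have "y \<in> interior K \<inter> {y. y $ i < s}" using y d by simp
   then show "interior K \<inter> {y. y $ i < s} \<noteq> {}" by blast
  qed (use reg in \<open>auto intro: compact_cut\<close>)
  show "0 < vol (K \<inter> hhi i s)"
  proof (rule vol_pos_open_subset[of "interior K \<inter> {y. s < y $ i}"])
   show "open (interior K \<inter> {y. s < y $ i})" by (intro open_Int open_interior open_Collect_less continuous_intros)
   show "interior K \<inter> {y. s < y $ i} \<subseteq> K \<inter> hhi i s" using interior_subset by auto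
   have "y' \<in> interior K \<inter> {y. s < y $ i}" using y d by simp
   then show "interior K \<inter> {y. s < y $ i} \<noteq> {}" by blast
  qed (use reg in \<open>auto intro: compact_cut\<close>)
 qed
 define T where "T s = (SOME t. vol (L \<inter> hlo i t) = r * vol (K \<inter> hlo i s))" for s
 have T: "vol (L \<inter> hlo i (T s)) = r * vol (K \<inter> hlo i s)" for s
 proof -
  have "vol (K \<inter> hlo i s) \<le> vol K" using reg by (intro vol_mono) (auto intro: compact_cut)
  then have "r * vol (K \<inter> hlo i s) \<le> vol L" unfolding r(2) using r by (intro mult_left_mono) auto
  then obtain t where "vol (L \<inter> hlo i t) = r * vol (K \<inter> hlo i s)"
   using cut_exists[OF cL(1), of "r * vol (K \<inter> hlo i s)" i] r by (metis measure_nonneg mult_nonneg_nonneg less_imp_le)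
  then show ?thesis unfolding T_def by (rule someI)
 qed
 have monoL: "t \<le> t' \<Longrightarrow> vol (L \<inter> hlo i t) \<le> vol (L \<inter> hlo i t')" for t t'
  by (rule vol_mono) (auto intro!: compact_cut cL)
 have monoT: "T s1 \<le> T s2" if "s1 \<in> J" "s2 \<in> J" "s1 < s2" for s1 s2
 proof (rule ccontr)
  assume "\<not> T s1 \<le> T s2"
  then have "r * vol (K \<inter> hlo i s2) \<le> r * vol (K \<inter> hlo i s1)" using monoL[of "T s2" "T s1"] T by simp
  then have le: "vol (K \<inter> hlo i s2) \<le> vol (K \<inter> hlo i s1)" using r by simp
  have "s1 \<le> (s1 + s2) / 2" "(s1 + s2) / 2 \<le> s2" using that by auto
  then have "(s1 + s2) / 2 \<in> J" using ivJ that unfolding is_interval_1 by blast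
  then obtain z where "z \<in> interior K" "z $ i = (s1 + s2) / 2" by (auto simp: J_def)
  then have "vol (K \<inter> hlo i s1) < vol (K \<inter> hlo i s2)" using that by (intro hlo_strict_mono_vol[OF reg(1), of z]) auto
  then show False using le by simp
 qed
 \<comment> \<open>The function is even constant near s0; a vanishing derivative is the form in
   which this spreads over all of J.\<close>
 have der: "((\<lambda>s. T s - lam * s) has_field_derivative 0) (at s0)" if s0: "s0 \<in> J" for s0
 proof -
  obtain z where z: "z \<in> interior K" "z $ i = s0" using s0 by (auto simp: J_def)
  have "vol (L \<inter> hlo i (T s0)) + vol (L \<inter> hhi i (T s0)) = r * (vol (K \<inter> hlo i s0) + vol (K \<inter> hhi i s0))"
   unfolding vol_cut[OF cL(1)] vol_cut[OF reg(1)] by (rule r)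
  then have "vol (L \<inter> hhi i (T s0)) = r * vol (K \<inter> hhi i s0)" using T[of s0] by (simp add: algebra_simps)
  then have "0 < vol (L \<inter> hlo i (T s0))" "0 < vol (L \<inter> hhi i (T s0))" using T[of s0] pos[OF s0] r by auto
  then obtain zL where zL: "zL \<in> interior L" "zL $ i = T s0" using convex_body_point_at[OF reg(3)] by blast
  obtain dlt where dlt: "dlt > 0" "\<And>s1 s2 t1 t2. s1 \<le> s0 \<Longrightarrow> s0 \<le> s2 \<Longrightarrow> s1 < s2 \<Longrightarrow> s2 - s1 < dlt \<Longrightarrow> t1 \<le> T s0 \<Longrightarrow> T s0 \<le> t2 \<Longrightarrow>
   vol (L \<inter> hlo i t1) = r * vol (K \<inter> hlo i s1) \<Longrightarrow> vol (L \<inter> hlo i t2) = r * vol (K \<inter> hlo i s2) \<Longrightarrow>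
   t2 - t1 = lam * (s2 - s1)" using slope[OF E r(2) z zL] unfolding lam_def by blast
  obtain d where d: "d > 0" "ball s0 d \<subseteq> J" using oJ s0 openE by blast
  have eq: "T s - lam * s = T s0 - lam * s0" if s: "dist s s0 < min d dlt" for s
  proof -
   have sJ: "s \<in> J" using d s by (auto simp: dist_commute)
   consider "s = s0" | "s < s0" | "s0 < s" by linarith
   then show ?thesis
   proof cases
    case 2
    then have "T s0 - T s = lam * (s0 - s)" using monoT[OF sJ s0] s T by (intro dlt(2)) (auto simp: dist_real_def)
    then show ?thesis by (simp add: algebra_simps)
   next
    case 3
    then have "T s - T s0 = lam * (s - s0)" using monoT[OF s0 sJ] s T by (intro dlt(2)) (auto simp: dist_real_def)
    then show ?thesis by (simp add: algebra_simps)
   qed simp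
  qed
  have "((\<lambda>s. T s0 - lam * s0) has_field_derivative 0) (at s0)" by simp
  then show ?thesis
  proof (rule has_field_derivative_transform_within)
   show "0 < min d dlt" using d dlt by simp
   show "T s0 - lam * s0 = T s - lam * s" if "dist s s0 < min d dlt" for s
    using eq[OF that] by (rule sym)
  qed simp
 qed
 have "\<exists>bt. \<forall>s\<in>J. T s - lam * s = bt"
  by (rule has_field_derivative_zero_constant[OF convJ]) (rule has_field_derivative_at_within[OF der])
 then obtain bt where bt: "\<forall>s\<in>J. T s - lam * s = bt" by blast
 have Tl: "T s = lam * s + bt" if "s \<in> J" for s using bspec[OF bt that] by linarith
 then have onJ: "vol (L \<inter> hlo i (lam * s + bt)) = r * vol (K \<inter> hlo i s)" if "s \<in> J" for s
  using T[of s] Tl[OF that] by simp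
 have contK: "continuous_on UNIV (\<lambda>s. vol (K \<inter> hlo i s))" by (rule continuous_vol_hlo[OF reg(1)])
 obtain M where M: "M > 0" "\<And>x l. x \<in> K \<Longrightarrow> \<bar>x $ l\<bar> \<le> M" using bounded_component[OF compact_imp_bounded[OF reg(1)]] by blast
 have "\<bar>s\<bar> \<le> M" if "s \<in> J" for s using that M(2) interior_subset[of K] unfolding J_def by auto
 then have bJ: "bdd_below J" "bdd_above J" by (auto intro!: bdd_belowI[of _ "-M"] bdd_aboveI[of _ M] simp: abs_le_iff minus_le_iff)
 have low: "vol (K \<inter> hlo i s) = 0" if "s \<le> Inf J" for s
 proof -
  have "interior K \<subseteq> hhi i s"
  proof
   fix y assume "y \<in> interior K"
   then have "Inf J \<le> y $ i" using bJ by (auto simp: J_def intro!: cInf_lower)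
   then show "y \<in> hhi i s" using that by simp
  qed
  then have "K \<subseteq> hhi i s" using dense closure_minimal[OF _ closed_hhi] by blast
  then have "K \<inter> hlo i s \<subseteq> {y. axis i 1 \<bullet> y = s}" by (auto simp: inner_axis')
  then have "negligible (K \<inter> hlo i s)" by (rule negligible_subset[OF negligible_hyperplane, rotated]) (simp add: axis_eq_0_iff)
  then show ?thesis by (rule negligible_imp_measure0)
 qed
 have high: "vol (K \<inter> hlo i s) = vol K" if "Sup J \<le> s" for s
 proof -
  have "interior K \<subseteq> hlo i s"
  proof
   fix y assume "y \<in> interior K"
   then have "y $ i \<le> Sup J" using bJ by (auto simp: J_def intro!: cSup_upper)
   then show "y \<in> hlo i s" using that by simp
  qed
  then have "K \<subseteq> hlo i s" using dense closure_minimal[OF _ closed_hlo] by blast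
  then show ?thesis by (simp add: Int_absorb2)
 qed
 have "continuous_on UNIV (\<lambda>s. vol (L \<inter> hlo i (lam * s + bt)))"
  by (rule continuous_on_compose2[OF continuous_vol_hlo[OF cL(1)]]) (auto intro!: continuous_intros)
 then have "closed {s. vol (L \<inter> hlo i (lam * s + bt)) = r * vol (K \<inter> hlo i s)}"
  by (intro closed_Collect_eq continuous_intros contK)
 from closure_minimal[OF _ this, of J] onJ
 have onC: "vol (L \<inter> hlo i (lam * s + bt)) = r * vol (K \<inter> hlo i s)" if "s \<in> closure J" for s using that by blast
 have "vol (L \<inter> hlo i (lam * s + bt)) = r * vol (K \<inter> hlo i s)" for s
 proof (cases "s \<in> J")
  case False
  then have "(\<forall>s'\<in>J. s \<le> s') \<or> (\<forall>s'\<in>J. s' \<le> s)" using ivJ unfolding is_interval_1 by (meson linear)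
  then show ?thesis
  proof
   assume "\<forall>s'\<in>J. s \<le> s'"
   then have s: "s \<le> Inf J" using Jne by (intro cInf_greatest) auto
   then have "vol (L \<inter> hlo i (lam * s + bt)) \<le> vol (L \<inter> hlo i (lam * Inf J + bt))" using lam by (intro monoL) simp
   also have "\<dots> = 0" using onC[OF closure_contains_Inf[OF Jne bJ(1)]] low[of "Inf J"] by simp
   finally show ?thesis using low[OF s] by (simp add: measure_le_0_iff)
  next
   assume "\<forall>s'\<in>J. s' \<le> s"
   then have s: "Sup J \<le> s" using Jne by (intro cSup_least) auto
   then have "vol (L \<inter> hlo i (lam * Sup J + bt)) \<le> vol (L \<inter> hlo i (lam * s + bt))" using lam by (intro monoL) simp
   moreover have "vol (L \<inter> hlo i (lam * Sup J + bt)) = vol L"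
    using onC[OF closure_contains_Sup[OF Jne bJ(2)]] high[of "Sup J"] r(2) by simp
   moreover have "vol (L \<inter> hlo i (lam * s + bt)) \<le> vol L" by (rule vol_mono) (auto intro: compact_cut cL)
   ultimately show ?thesis using high[OF s] r(2) by simp
  qed
 qed (use onJ in auto)
 then show ?thesis by (auto simp: lam_def)
qed

text \<open>A rotation taking e to a coordinate vector reduces this to \<open>marginal_axis\<close>;
  this is the purpose of \<open>E_orth\<close>.\<close>

lemma marginal_direction:
 assumes E: "E K L" and conn: "connected (interior K)" and dense: "K \<subseteq> closure (interior K)" and e: "norm e = 1"
 defines "r \<equiv> vol L / vol K"
 shows "\<exists>bt. \<forall>s. vol (L \<inter> {y. e \<bullet> y \<le> r powr (1 / CARD('k)) * s + bt}) = r * vol (K \<inter> {y. e \<bullet> y \<le> s})"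
proof -
 fix i :: 'k
 have "\<exists>f. orthogonal_transformation f \<and> f e = (axis i 1 :: (real,'k) vec)"
 proof (rule orthogonal_transformation_exists[of e "axis i 1 :: real^'k::{finite,wellorder}"])
  show "norm e = norm (axis i 1 :: real^'k::{finite,wellorder})" using e by simp
 next
  fix f :: "(real,'k) vec \<Rightarrow> (real,'k) vec"
  assume "orthogonal_transformation f" "f e = axis i 1"
  then show ?thesis by (intro exI conjI)
 qed
 then obtain f where f: "orthogonal_transformation f" "f e = (axis i 1 :: real^'k::{finite,wellorder})" by blast
 have lin: "linear f" and inj: "inj f" using f orthogonal_transformation_linear orthogonal_transformation_inj by auto
 have cont: "continuous_on S f" for S by (rule linear_continuous_on) (simp add: lin linear_linear)
 have reg: "compact K" "0 < vol K" "convex_body L" using E_reg[OF E] by auto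
 have cL: "compact L" using reg by (simp add: convex_body_def)
 have half: "f ` S \<inter> hlo i s = f ` (S \<inter> {y. e \<bullet> y \<le> s})" for S s
 proof -
  have "f y $ i = e \<bullet> y" for y
  proof -
   have "f y $ i = f e \<bullet> f y" by (simp add: f(2) inner_axis')
   also have "\<dots> = e \<bullet> y" using f(1) by (simp add: orthogonal_transformation_def)
   finally show ?thesis .
  qed
  then show ?thesis by auto
 qed
 have vf: "vol (f ` S) = vol S" if "compact S" for S
  using measure_orthogonal_image[OF f(1) lmeasurable_compact[OF that]] .
 have ch: "compact (S \<inter> {y. e \<bullet> y \<le> s})" if "compact S" for S s
  by (intro compact_Int_closed that closed_halfspace_le)
 have int: "interior (f ` K) = f ` interior K" by (rule interior_injective_linear_image[OF lin inj])
 have "\<exists>bt. \<forall>s. vol (f ` L \<inter> hlo i ((vol (f ` L) / vol (f ` K)) powr (1 / CARD('k)) * s + bt)) = (vol (f ` L) / vol (f ` K)) * vol (f ` K \<inter> hlo i s)"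
 proof (rule marginal_axis[OF E_orth[OF E f(1)]])
  show "connected (interior (f ` K))" unfolding int by (intro connected_continuous_image cont conn)
  have "f ` K \<subseteq> f ` closure (interior K)" using dense by auto
  also have "\<dots> \<subseteq> closure (f ` interior K)" by (rule closure_linear_image_subset[OF lin])
  finally show "f ` K \<subseteq> closure (interior (f ` K))" unfolding int .
 qed
 then show ?thesis unfolding half vf[OF reg(1)] vf[OF cL] vf[OF ch[OF reg(1)]] vf[OF ch[OF cL]] r_def .
qed

end

text \<open>The half-space volumes say that two measures on the line agree, and both sides are their
  first moments. This makes the offset bt a linear function of e, so the offsets of all directions
  come from one translation vector.\<close>

lemma marginal_mean:
 fixes K L :: "'a::euclidean_space set"
 assumes K: "compact K" and L: "compact L" and r: "r \<ge> 0" "vol L = r * vol K" and lam: "lam > 0"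
  and eq: "\<And>s. vol (L \<inter> {y. e \<bullet> y \<le> lam * s + bt}) = r * vol (K \<inter> {y. e \<bullet> y \<le> s})"
 shows "e \<bullet> (\<integral>y. indicator L y *\<^sub>R y \<partial>lborel) = r * (lam * (e \<bullet> (\<integral>y. indicator K y *\<^sub>R y \<partial>lborel)) + bt * vol K)"
proof -
 have [measurable]: "K \<in> sets borel" "L \<in> sets borel" using K L borel_compact by auto
 define NK where "NK = density lborel (\<lambda>y. ennreal (r * indicator K y))"
 define NL where "NL = density lborel (\<lambda>y. ennreal (indicator L y))"
 have [measurable]: "(\<lambda>y. e \<bullet> y) \<in> borel_measurable borel" by simp
 have half: "S \<inter> {y. e \<bullet> y \<le> s} \<in> lmeasurable" if "compact S" for S s
  by (intro lmeasurable_compact compact_Int_closed that closed_halfspace_le)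
 have diff: "S \<inter> {y. s < e \<bullet> y} = S - S \<inter> {y. e \<bullet> y \<le> s}" for S s by auto
 have vdiff: "emeasure lborel (S \<inter> {y. s < e \<bullet> y}) = ennreal (vol S - vol (S \<inter> {y. e \<bullet> y \<le> s}))" if S: "compact S" for S s
 proof -
  have Sb[measurable]: "S \<in> sets borel" using S borel_compact by blast
  have "emeasure lebesgue (S \<inter> {y. s < e \<bullet> y}) = ennreal (vol (S \<inter> {y. s < e \<bullet> y}))"
   by (intro emeasure_eq_measure2 fmeasurable.Diff lmeasurable_compact[OF S] half[OF S] | simp only: diff)+
  also have "vol (S \<inter> {y. s < e \<bullet> y}) = vol S - vol (S \<inter> {y. e \<bullet> y \<le> s})"
   unfolding diff by (rule measurable_measure_Diff[OF lmeasurable_compact[OF S]]) (use half[OF S] in auto)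
  finally show ?thesis by simp
 qed
 have dist: "distr NK borel (\<lambda>y. lam * (e \<bullet> y) + bt) = distr NL borel (\<lambda>y. e \<bullet> y)"
 proof (rule measure_eqI_lessThan)
  fix t :: real
  have "emeasure (distr NK borel (\<lambda>y. lam * (e \<bullet> y) + bt)) {t<..} = emeasure NK {y. t < lam * (e \<bullet> y) + bt}"
   by (subst emeasure_distr) (auto simp: NK_def intro!: arg_cong[where f="emeasure _"])
  also have "\<dots> = (\<integral>\<^sup>+y. ennreal (r * indicator K y) * indicator {y. t < lam * (e \<bullet> y) + bt} y \<partial>lborel)"
   unfolding NK_def by (subst emeasure_density) auto
  also have "\<dots> = (\<integral>\<^sup>+y. ennreal r * indicator (K \<inter> {y. (t - bt) / lam < e \<bullet> y}) y \<partial>lborel)"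
   using lam by (intro nn_integral_cong) (auto simp: indicator_def field_simps)
  also have "\<dots> = ennreal r * emeasure lborel (K \<inter> {y. (t - bt) / lam < e \<bullet> y})"
   by (subst nn_integral_cmult_indicator) auto
  also have "\<dots> = ennreal (r * (vol K - vol (K \<inter> {y. e \<bullet> y \<le> (t - bt) / lam})))"
   unfolding vdiff[OF K] using r by (simp add: ennreal_mult')
  finally have 1: "emeasure (distr NK borel (\<lambda>y. lam * (e \<bullet> y) + bt)) {t<..} = ennreal (r * (vol K - vol (K \<inter> {y. e \<bullet> y \<le> (t - bt) / lam})))" .
  have "emeasure (distr NL borel (\<lambda>y. e \<bullet> y)) {t<..} = emeasure NL {y. t < e \<bullet> y}"
   by (subst emeasure_distr) (auto simp: NL_def intro!: arg_cong[where f="emeasure _"])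
  also have "\<dots> = (\<integral>\<^sup>+y. ennreal (indicator L y) * indicator {y. t < e \<bullet> y} y \<partial>lborel)"
   unfolding NL_def by (subst emeasure_density) auto
  also have "\<dots> = (\<integral>\<^sup>+y. indicator (L \<inter> {y. t < e \<bullet> y}) y \<partial>lborel)"
   by (intro nn_integral_cong) (auto simp: indicator_def)
  also have "\<dots> = ennreal (vol L - vol (L \<inter> {y. e \<bullet> y \<le> t}))"
   by (subst nn_integral_indicator) (auto simp: vdiff[OF L])
  finally have 2: "emeasure (distr NL borel (\<lambda>y. e \<bullet> y)) {t<..} = ennreal (vol L - vol (L \<inter> {y. e \<bullet> y \<le> t}))" .
  show "emeasure (distr NK borel (\<lambda>y. lam * (e \<bullet> y) + bt)) {t<..} < \<infinity>" unfolding 1 by simp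
  show "emeasure (distr NK borel (\<lambda>y. lam * (e \<bullet> y) + bt)) {t<..} = emeasure (distr NL borel (\<lambda>y. e \<bullet> y)) {t<..}"
  proof -
   have "lam * ((t - bt) / lam) + bt = t" using lam by simp
   then show ?thesis unfolding 1 2 using eq[of "(t - bt) / lam"] r by (simp add: right_diff_distrib)
  qed
 qed simp_all
 have iK: "integrable lborel (\<lambda>y. indicator K y *\<^sub>R y)" using borel_integrable_compact[OF K, of "\<lambda>y. y"] by simp
 have iL: "integrable lborel (\<lambda>y. indicator L y *\<^sub>R y)" using borel_integrable_compact[OF L, of "\<lambda>y. y"] by simp
 have i1: "integrable lborel (\<lambda>y. indicat_real K y)" using lmeasurable_compact[OF K] K
  by (intro integrable_real_indicator) (auto simp: fmeasurable_def)
 have "e \<bullet> (\<integral>y. indicator L y *\<^sub>R y \<partial>lborel) = (\<integral>y. indicator L y * (e \<bullet> y) \<partial>lborel)"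
  by (subst integral_inner_right[symmetric, OF iL]) simp
 also have "\<dots> = (\<integral>y. e \<bullet> y \<partial>NL)"
  unfolding NL_def by (subst integral_density) auto
 also have "\<dots> = (\<integral>t. t \<partial>distr NL borel (\<lambda>y. e \<bullet> y))"
  by (subst integral_distr) (auto simp: NL_def)
 also have "\<dots> = (\<integral>y. lam * (e \<bullet> y) + bt \<partial>NK)"
  unfolding dist[symmetric] by (subst integral_distr) (auto simp: NK_def)
 also have "\<dots> = (\<integral>y. r * indicator K y * (lam * (e \<bullet> y) + bt) \<partial>lborel)"
  unfolding NK_def by (subst integral_density) (use r in auto)
 also have "\<dots> = (\<integral>y. r * (lam * (e \<bullet> (indicator K y *\<^sub>R y)) + bt * indicat_real K y) \<partial>lborel)"
  by (intro Bochner_Integration.integral_cong) (auto simp: algebra_simps)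
 also have "\<dots> = r * (lam * (\<integral>y. e \<bullet> (indicator K y *\<^sub>R y) \<partial>lborel) + bt * (\<integral>y. indicat_real K y \<partial>lborel))"
 proof -
  have "integrable lborel (\<lambda>y. e \<bullet> (indicator K y *\<^sub>R y))" by (rule integrable_inner_right) (use iK in auto)
  then show ?thesis using i1 by simp
 qed
 also have "(\<integral>y. e \<bullet> (indicator K y *\<^sub>R y) \<partial>lborel) = e \<bullet> (\<integral>y. indicator K y *\<^sub>R y \<partial>lborel)"
  by (rule integral_inner_right) (use iK in auto)
 also have "(\<integral>y. indicat_real K y \<partial>lborel) = vol K" by simp
 finally show ?thesis .
qed

text \<open>A half-space missing \<open>L\<close> has no volume in \<open>K\<close>, so
  \<open>K\<close>, lying in the closure of its interior, is contained in \<open>L\<close>. As the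
  volumes agree, L - K is null, and therefore the open set interior L - K is empty.\<close>

lemma equal_if_marginals_equal:
 fixes K L :: "'a::euclidean_space set"
 assumes K: "compact K" "K \<subseteq> closure (interior K)" and L: "convex_body L" and v: "vol L = vol K"
  and eq: "\<And>e s. norm e = 1 \<Longrightarrow> vol (L \<inter> {y. e \<bullet> y \<le> s}) = vol (K \<inter> {y. e \<bullet> y \<le> s})"
 shows "K = L"
proof
 have cL: "compact L" "convex L" "interior L \<noteq> {}" using L by (auto simp: convex_body_def)
 show "K \<subseteq> L"
 proof
  fix x assume xK: "x \<in> K"
  show "x \<in> L"
  proof (rule ccontr)
   assume "x \<notin> L"
   then obtain a b where ab: "a \<bullet> x < b" "\<And>y. y \<in> L \<Longrightarrow> b < a \<bullet> y"
    using separating_hyperplane_closed_point[of L x] cL compact_imp_closed by blast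
   obtain y where "y \<in> L" using cL interior_subset by blast
   then have "a \<noteq> 0" using ab by force
   define e where "e = a /\<^sub>R norm a"
   have e: "norm e = 1" using \<open>a \<noteq> 0\<close> by (simp add: e_def)
   define s where "s = b / norm a"
   have ex: "e \<bullet> x < s" using ab \<open>a \<noteq> 0\<close> by (simp add: e_def s_def field_simps)
   have "s < e \<bullet> y" if "y \<in> L" for y using ab(2)[OF that] \<open>a \<noteq> 0\<close> by (simp add: e_def s_def field_simps)
   then have "L \<inter> {y. e \<bullet> y \<le> s} = {}" by force
   then have 0: "vol (K \<inter> {y. e \<bullet> y \<le> s}) = 0" using eq[OF e, of s] by simp
   have op: "open {y. e \<bullet> y < s}" by (rule open_halfspace_lt)
   have "x \<in> closure (interior K)" using K xK by auto
   then have "interior K \<inter> {y. e \<bullet> y < s} \<noteq> {}"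
    using ex op by (metis (no_types, lifting) closure_iff_nhds_not_empty inf_commute mem_Collect_eq subset_refl)
   then have "0 < vol (K \<inter> {y. e \<bullet> y \<le> s})"
    using op interior_subset[of K] K by (intro vol_pos_open_subset[of "interior K \<inter> {y. e \<bullet> y < s}"])
     (auto intro!: compact_Int_closed closed_halfspace_le)
   then show False using 0 by simp
  qed
 qed
 have "vol (L - K) = 0"
  using measurable_measure_Diff[of L lebesgue K] \<open>K \<subseteq> L\<close> K cL v by (simp add: lmeasurable_compact fmeasurableD)
 then have "negligible (L - K)" using K cL by (simp add: negligible_iff_measure fmeasurable.Diff lmeasurable_compact)
 then have "negligible (interior L - K)" by (rule negligible_subset) (use interior_subset in blast)
 then have "interior L - K = {}" using open_not_negligible[of "interior L - K"] K by (auto simp: open_Diff compact_imp_closed)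
 then have "closure (interior L) \<subseteq> K" using K by (intro closure_minimal compact_imp_closed) auto
 then show "L \<subseteq> K" using cL closure_subset convex_closure_interior by blast
qed

context cut_equality
begin

theorem homothetic:
 assumes E: "E K L" and conn: "connected (interior K)" and dense: "K \<subseteq> closure (interior K)"
 shows "\<exists>c>0. \<exists>b. K = (\<lambda>x. c *\<^sub>R x + b) ` L"
proof -
 define r where "r = vol L / vol K"
 define lam where "lam = r powr (1 / CARD('k))"
 have reg: "compact K" "0 < vol K" "convex_body L" using E_reg[OF E] by auto
 have cL: "compact L" "0 < vol L" using reg convex_body_vol_pos by (auto simp: convex_body_def)
 have r: "r > 0" "vol L = r * vol K" using reg cL by (auto simp: r_def)
 have lam: "lam > 0" using r by (simp add: lam_def)
 have lamm: "lam ^ CARD('k) = r" using r by (simp add: lam_def powr_realpow[symmetric] powr_powr)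
 \<comment> \<open>Centroid of \<open>L\<close> minus lam times the centroid of \<open>K\<close>;
   \<open>marginal_mean\<close> identifies e \<bullet> b with the offset in direction e.\<close>
 define b where "b = (1 / vol L) *\<^sub>R (\<integral>y. indicator L y *\<^sub>R y \<partial>lborel) - (lam / vol K) *\<^sub>R (\<integral>y. indicator K y *\<^sub>R y \<partial>lborel)"
 have marg: "vol (L \<inter> {y. e \<bullet> y \<le> lam * s + e \<bullet> b}) = r * vol (K \<inter> {y. e \<bullet> y \<le> s})" if e: "norm e = 1" for e s
 proof -
  obtain bt where bt: "\<And>s. vol (L \<inter> {y. e \<bullet> y \<le> lam * s + bt}) = r * vol (K \<inter> {y. e \<bullet> y \<le> s})"
   using marginal_direction[OF E conn dense e] unfolding r_def lam_def by blast
  have "e \<bullet> (\<integral>y. indicator L y *\<^sub>R y \<partial>lborel) = r * (lam * (e \<bullet> (\<integral>y. indicator K y *\<^sub>R y \<partial>lborel)) + bt * vol K)"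
   by (rule marginal_mean[OF reg(1) cL(1) less_imp_le[OF r(1)] r(2) lam bt])
  then have "bt = e \<bullet> b" using r reg(2)
   by (simp add: b_def inner_diff_right field_simps)
  then show ?thesis using bt by simp
 qed
 define K' where "K' = (\<lambda>x. lam *\<^sub>R x + b) ` K"
 have "K' = L"
 proof (rule equal_if_marginals_equal[OF _ _ reg(3)])
  show "compact K'" unfolding K'_def by (intro compact_continuous_image continuous_intros reg)
  have op: "open ((\<lambda>x. b + lam *\<^sub>R x) ` interior K)" using lam by (intro open_affinity) auto
  have "(\<lambda>x. lam *\<^sub>R x + b) ` interior K \<subseteq> interior K'"
   using op interior_subset unfolding K'_def by (intro interior_maximal) (auto simp: add.commute)
  then have "closure ((\<lambda>x. lam *\<^sub>R x + b) ` interior K) \<subseteq> closure (interior K')" by (rule closure_mono)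
  moreover have "(\<lambda>x. lam *\<^sub>R x + b) ` closure (interior K) \<subseteq> closure ((\<lambda>x. lam *\<^sub>R x + b) ` interior K)"
   by (rule image_closure_subset) (auto intro!: continuous_intros closure_subset)
  ultimately show "K' \<subseteq> closure (interior K')" using dense unfolding K'_def by blast
  show "vol L = vol K'" unfolding K'_def vol_affine using lam lamm r by simp
  fix e :: "(real,'k) vec" and s assume e: "norm e = 1"
  have "K' \<inter> {y. e \<bullet> y \<le> s} = (\<lambda>x. lam *\<^sub>R x + b) ` (K \<inter> {y. e \<bullet> y \<le> (s - e \<bullet> b) / lam})"
   unfolding K'_def using lam by (auto simp: inner_add_right field_simps)
  then have "vol (K' \<inter> {y. e \<bullet> y \<le> s}) = r * vol (K \<inter> {y. e \<bullet> y \<le> (s - e \<bullet> b) / lam})"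
   using vol_affine[of lam b "K \<inter> {y. e \<bullet> y \<le> (s - e \<bullet> b) / lam}"] lam lamm by simp
  also have "\<dots> = vol (L \<inter> {y. e \<bullet> y \<le> s})" using marg[OF e, of "(s - e \<bullet> b) / lam"] lam by simp
  finally show "vol (L \<inter> {y. e \<bullet> y \<le> s}) = vol (K' \<inter> {y. e \<bullet> y \<le> s})" by simp
 qed
 then have "K = (\<lambda>x. (1 / lam) *\<^sub>R x + (- (1 / lam)) *\<^sub>R b) ` L"
  using lam unfolding K'_def by (auto simp: image_image algebra_simps)
 then show ?thesis using lam by (intro exI[of _ "1 / lam"] conjI exI[of _ "(- (1 / lam)) *\<^sub>R b"]) simp_all
qed

end

section \<open>The first-order Brunn-Minkowski inequality\<close>

lemma dsum_mono: "A \<subseteq> A' \<Longrightarrow> B \<subseteq> B' \<Longrightarrow> dsum A t B \<subseteq> dsum A' t B'"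
 unfolding dsum_def by blast

lemma vol_cut_ratio:
 assumes "compact A" "compact B" "vol B = r * vol A" "vol (B \<inter> hlo i s') = r * vol (A \<inter> hlo i s)"
 shows "vol (B \<inter> hhi i s') = r * vol (A \<inter> hhi i s)"
proof -
 have "vol (A \<inter> hhi i s) = vol A - vol (A \<inter> hlo i s)" "vol (B \<inter> hhi i s') = vol B - vol (B \<inter> hlo i s')"
  using vol_cut[OF assms(1), of i s] vol_cut[OF assms(2), of i s'] by linarith+
 then show ?thesis using assms(3,4) by (simp add: right_diff_distrib)
qed

text \<open>The two partial sums lie on different sides of the hyperplane at height s + t * s', so
  they overlap in a null set.\<close>

lemma vol_dsum_superadd:
 fixes A B :: "(real^'k) set"
 assumes A: "compact A" "A1 \<union> A2 \<subseteq> A" "compact A1" "compact A2" and B: "compact B" "B1 \<union> B2 \<subseteq> B" "compact B1" "compact B2"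
  and l: "A1 \<subseteq> hlo i s" "B1 \<subseteq> hlo i s'" "A2 \<subseteq> hhi i s" "B2 \<subseteq> hhi i s'" and t: "t > 0"
 shows "vol (dsum A1 t B1) + vol (dsum A2 t B2) \<le> vol (dsum A t B)"
proof -
 let ?D1 = "dsum A1 t B1" and ?D2 = "dsum A2 t B2"
 have c: "compact ?D1" "compact ?D2" "compact (dsum A t B)" using A B by (auto intro: dsum_compact)
 have m1: "?D1 \<in> lmeasurable" and m2: "?D2 \<in> lmeasurable" using c by (simp_all add: lmeasurable_compact)
 have sub: "?D1 \<union> ?D2 \<subseteq> dsum A t B" using A(2) B(2) by (intro Un_least dsum_mono) auto
 have "?D1 \<inter> ?D2 \<subseteq> {y. axis i 1 \<bullet> y = s + t * s'}"
 proof
  fix y assume y: "y \<in> ?D1 \<inter> ?D2"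
  then obtain a b where "a \<in> A1" "b \<in> B1" "y = a + t *\<^sub>R b" by (auto simp: dsum_def)
  then have "y $ i \<le> s + t * s'" using l t by (auto intro!: add_mono mult_left_mono)
  moreover from y obtain a b where "a \<in> A2" "b \<in> B2" "y = a + t *\<^sub>R b" by (auto simp: dsum_def)
  then have "s + t * s' \<le> y $ i" using l t by (auto intro!: add_mono mult_left_mono)
  ultimately show "y \<in> {y. axis i 1 \<bullet> y = s + t * s'}" by (simp add: inner_axis')
 qed
 then have "negligible (?D1 \<inter> ?D2)" by (rule negligible_subset[OF negligible_hyperplane, rotated]) (simp add: axis_eq_0_iff)
 then have "vol (?D1 \<inter> ?D2) = 0" by (rule negligible_imp_measure0)
 then have "vol ?D1 + vol ?D2 = vol (?D1 \<union> ?D2)" using measure_Un3[OF m1 m2] by simp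
 also have "\<dots> \<le> vol (dsum A t B)" by (rule vol_mono[OF sub]) (use c in auto)
 finally show ?thesis .
qed

text \<open>The first-order part in \<open>t\<close> of the Brunn-Minkowski bound \<open>(V powr (1/m) + t * W powr (1/m)) ^ m\<close>.\<close>

definition bmf :: "nat \<Rightarrow> real \<Rightarrow> real \<Rightarrow> real \<Rightarrow> real" where
 "bmf m t V W = V + t * (real m * V * (W / V) powr (1 / real m))"

lemma bmf_scale: "V \<noteq> 0 \<Longrightarrow> bmf m t V (r * V) = V * (1 + t * (real m * r powr (1 / real m)))"
 by (simp add: bmf_def algebra_simps)

text \<open>Minkowski's bounds for the coefficients j = 0 and j = 1 add up to \<open>bmf\<close>;
  the remaining coefficients of vol (A + t B) are nonnegative and are dropped.\<close>

lemma bm_body: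
 fixes A B :: "(real^'k::{finite,wellorder}) set"
 assumes A: "convex_body A" and B: "convex_body B" and t: "t > 0"
 shows "bmf CARD('k) t (vol A) (vol B) \<le> vol (dsum A t B)"
proof -
 let ?m = "CARD('k)"
 have m: "1 \<le> ?m" using zero_less_card_finite[where 'a='k] by linarith
 have vA: "vol A > 0" "vol B > 0" using A B convex_body_vol_pos by auto
 have "minkb A B 0 \<le> mixcoef A B 0" "minkb A B 1 \<le> mixcoef A B 1"
  by (rule minkowski_mixcoef[OF A B], use m in simp)+
 then have "bmf ?m t (vol A) (vol B) \<le> mixcoef A B 0 + t * mixcoef A B 1"
  using t vA by (simp add: bmf_def minkb_def add_mono mult_left_mono)
 also have "\<dots> = (\<Sum>j\<in>{0,1}. mixcoef A B j * t ^ j)" by simp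
 also have "\<dots> \<le> (\<Sum>j\<le>?m. mixcoef A B j * t ^ j)"
  using m t by (intro sum_mono2) (auto intro!: mult_nonneg_nonneg mixcoef_nonneg A B)
 also have "\<dots> = vol (dsum A t B)" by (rule measure_dsum_mixcoef[OF A B t, symmetric])
 finally show ?thesis .
qed

lemma convex_body_cbox: "0 < vol (cbox a b) \<Longrightarrow> convex_body (cbox a b)"
 by (rule convex_body_if_vol_pos) (auto simp: convex_box)

text \<open>Induction in the style of Hadwiger and Ohmann: a hyperplane separates two of the boxes,
  so on each side fewer boxes of positive volume remain. Cutting \<open>B\<close> in the same volume
  ratio keeps \<open>bmf\<close> additive. A single box is a convex body.\<close>

lemma bm_boxes:
 fixes B :: "(real^'k::{finite,wellorder}) set" and a b :: "'i \<Rightarrow> real^'k::{finite,wellorder}"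
 assumes "finite I" "I \<noteq> {}" "\<And>i. i \<in> I \<Longrightarrow> 0 < vol (cbox (a i) (b i))"
  and "\<And>i j. i \<in> I \<Longrightarrow> j \<in> I \<Longrightarrow> i \<noteq> j \<Longrightarrow> box (a i) (b i) \<inter> box (a j) (b j) = {}"
  and "convex_body B" "t > 0"
 shows "bmf CARD('k) t (\<Sum>i\<in>I. vol (cbox (a i) (b i))) (vol B) \<le> vol (dsum (\<Union>i\<in>I. cbox (a i) (b i)) t B)"
 using assms
proof (induction "card I" arbitrary: I a b B rule: less_induct)
 case less
 let ?m = "CARD('k)"
 define V where "V I a b = (\<Sum>i\<in>I. vol (cbox (a i) (b i)))" for I and a b :: "'i \<Rightarrow> (real,'k) vec"
 define r where "r = vol B / V I a b"
 have VI: "V I a b > 0" unfolding V_def using less.prems by (intro sum_pos) auto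
 have vB: "vol B > 0" by (rule convex_body_vol_pos[OF less.prems(5)])
 have r: "r > 0" "vol B = r * V I a b" using VI vB by (auto simp: r_def)
 have cB: "compact B" using less.prems by (simp add: convex_body_def)
 show ?case
 proof (cases "\<exists>i j. i \<in> I \<and> j \<in> I \<and> i \<noteq> j")
  case False
  then obtain i where I: "I = {i}" using less.prems by auto
  then show ?thesis
   using bm_body[OF convex_body_cbox[OF less.prems(3)[of i]] less.prems(5,6)] by simp
 next
  case True
  then obtain i0 j0 where "i0 \<in> I" "j0 \<in> I" "i0 \<noteq> j0" by auto
  moreover have "a k $ l < b k $ l" if "k \<in> I" for k l using less.prems(3)[OF that] by (rule vol_cbox_pos_imp)
  ultimately obtain i j l where ij: "i \<in> I" "j \<in> I" "i \<noteq> j" "b i $ l \<le> a j $ l"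
   using less.prems(4)[of i0 j0] unfolding disjoint_interval_cart by (metis not_less)
  define s where "s = b i $ l"
  define bl where "bl k = (\<chi> l'. if l' = l then min (b k $ l') s else b k $ l')" for k
  define ah where "ah k = (\<chi> l'. if l' = l then max (a k $ l') s else a k $ l')" for k
  have lo: "cbox (a k) (b k) \<inter> hlo l s = cbox (a k) (bl k)" for k unfolding bl_def by (rule hlo_cbox)
  have hi: "cbox (a k) (b k) \<inter> hhi l s = cbox (ah k) (b k)" for k unfolding ah_def by (rule hhi_cbox)
  \<comment> \<open>Boxes that degenerate on this side are dropped. Box j disappears from
    \<open>I1\<close> and box i from \<open>I2\<close>, so both index sets are smaller.\<close>
  define I1 where "I1 = {k\<in>I. 0 < vol (cbox (a k) (bl k))}"
  define I2 where "I2 = {k\<in>I. 0 < vol (cbox (ah k) (b k))}"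
  have sum1: "V I1 a bl = (\<Sum>k\<in>I. vol (cbox (a k) (bl k)))"
   unfolding V_def I1_def using less.prems by (intro sum.mono_neutral_left) (auto simp: order.antisym not_less measure_nonneg)
  have sum2: "V I2 ah b = (\<Sum>k\<in>I. vol (cbox (ah k) (b k)))"
   unfolding V_def I2_def using less.prems by (intro sum.mono_neutral_left) (auto simp: order.antisym not_less measure_nonneg)
  have split: "vol (cbox (a k) (bl k)) + vol (cbox (ah k) (b k)) = vol (cbox (a k) (b k))" for k
   unfolding lo[symmetric] hi[symmetric] by (rule vol_cut) simp
  have sums: "V I1 a bl + V I2 ah b = V I a b" unfolding sum1 sum2 sum.distrib[symmetric] split by (simp add: V_def)
  have i1: "cbox (a i) (bl i) = cbox (a i) (b i)"
  proof -
   have "cbox (a i) (b i) \<subseteq> hlo l s" by (auto simp: s_def mem_box_cart)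
   then show ?thesis using lo[of i] by auto
  qed
  have j2: "cbox (ah j) (b j) = cbox (a j) (b j)"
  proof -
   have "cbox (a j) (b j) \<subseteq> hhi l s" using ij(4) by (auto simp: s_def mem_box_cart intro: order_trans)
   then show ?thesis using hi[of j] by auto
  qed
  have iI1: "i \<in> I1" and jI2: "j \<in> I2" using ij less.prems(3) by (auto simp: I1_def I2_def i1 j2)
  have "j \<notin> I1" using split[of j] j2 by (auto simp: I1_def)
  then have "I1 \<subset> I" using ij by (auto simp: I1_def)
  then have card1: "card I1 < card I" by (rule psubset_card_mono[OF less.prems(1)])
  have "i \<notin> I2" using split[of i] i1 by (auto simp: I2_def)
  then have "I2 \<subset> I" using ij by (auto simp: I2_def)
  then have card2: "card I2 < card I" by (rule psubset_card_mono[OF less.prems(1)])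
  have fin: "finite I1" "finite I2" using less.prems(1) by (auto simp: I1_def I2_def)
  have pos1: "0 < V I1 a bl" unfolding V_def using fin iI1 by (intro sum_pos) (auto simp: I1_def)
  have pos2: "0 < V I2 ah b" unfolding V_def using fin jI2 by (intro sum_pos) (auto simp: I2_def)
  have "r * V I1 a bl \<le> vol B" unfolding r(2) using sums pos2 r(1) by (intro mult_left_mono) auto
  then obtain s' where s': "vol (B \<inter> hlo l s') = r * V I1 a bl" "vol (B \<inter> hhi l s') = vol B - r * V I1 a bl"
   using cut_exists[OF cB, of "r * V I1 a bl" l] pos1 r by (metis less_imp_le mult_nonneg_nonneg)
  have s2: "vol (B \<inter> hhi l s') = r * V I2 ah b" unfolding s'(2) r(2) sums[symmetric] by (simp add: algebra_simps)
  have cb: "convex_body (B \<inter> hlo l s')" "convex_body (B \<inter> hhi l s')"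
   using less.prems(5) s'(1) s2 pos1 pos2 r by (auto intro!: convex_body_cut)
  have bsub: "box (a k) (bl k) \<subseteq> box (a k) (b k)" "box (ah k) (b k) \<subseteq> box (a k) (b k)" for k
   by (auto simp: bl_def ah_def mem_box_cart split: if_splits) (metis+)?
  have IH1: "bmf ?m t (V I1 a bl) (vol (B \<inter> hlo l s')) \<le> vol (dsum (\<Union>k\<in>I1. cbox (a k) (bl k)) t (B \<inter> hlo l s'))"
   unfolding V_def
  proof (rule less.hyps[OF card1 fin(1) _ _ _ cb(1) less.prems(6)])
   fix k k' assume "k \<in> I1" "k' \<in> I1" "k \<noteq> k'"
   then show "box (a k) (bl k) \<inter> box (a k') (bl k') = {}"
    using less.prems(4)[of k k'] bsub(1)[of k] bsub(1)[of k'] by (auto simp: I1_def)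
  qed (use iI1 I1_def in auto)
  have IH2: "bmf ?m t (V I2 ah b) (vol (B \<inter> hhi l s')) \<le> vol (dsum (\<Union>k\<in>I2. cbox (ah k) (b k)) t (B \<inter> hhi l s'))"
   unfolding V_def
  proof (rule less.hyps[OF card2 fin(2) _ _ _ cb(2) less.prems(6)])
   fix k k' assume "k \<in> I2" "k' \<in> I2" "k \<noteq> k'"
   then show "box (ah k) (b k) \<inter> box (ah k') (b k') = {}"
    using less.prems(4)[of k k'] bsub(2)[of k] bsub(2)[of k'] by (auto simp: I2_def)
  qed (use jI2 I2_def in auto)
  have "bmf ?m t (V I a b) (vol B) = bmf ?m t (V I1 a bl) (vol (B \<inter> hlo l s')) + bmf ?m t (V I2 ah b) (vol (B \<inter> hhi l s'))"
   unfolding s'(1) s2 r(2) using VI pos1 pos2 by (simp add: bmf_scale distrib_right[symmetric] sums)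
  also have "\<dots> \<le> vol (dsum (\<Union>k\<in>I1. cbox (a k) (bl k)) t (B \<inter> hlo l s')) + vol (dsum (\<Union>k\<in>I2. cbox (ah k) (b k)) t (B \<inter> hhi l s'))"
   using IH1 IH2 by (rule add_mono)
  also have "\<dots> \<le> vol (dsum (\<Union>k\<in>I. cbox (a k) (b k)) t B)"
  proof (rule vol_dsum_superadd)
   have "cbox (a k) (bl k) \<subseteq> cbox (a k) (b k)" "cbox (ah k) (b k) \<subseteq> cbox (a k) (b k)" for k
    unfolding lo[symmetric] hi[symmetric] by auto
   then show "(\<Union>k\<in>I1. cbox (a k) (bl k)) \<union> (\<Union>k\<in>I2. cbox (ah k) (b k)) \<subseteq> (\<Union>k\<in>I. cbox (a k) (b k))"
    by (intro Un_least UN_mono) (auto simp: I1_def I2_def)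
   show "(\<Union>k\<in>I1. cbox (a k) (bl k)) \<subseteq> hlo l s" unfolding lo[symmetric] by auto
   show "(\<Union>k\<in>I2. cbox (ah k) (b k)) \<subseteq> hhi l s" unfolding hi[symmetric] by auto
  qed (use fin less.prems cB in \<open>auto intro!: compact_UN compact_cut\<close>)
  finally show ?thesis by (simp add: V_def)
 qed
qed

lemma bmf_mono: "0 < V \<Longrightarrow> V \<le> V' \<Longrightarrow> 0 < W \<Longrightarrow> t > 0 \<Longrightarrow> 1 \<le> m \<Longrightarrow> bmf m t V W \<le> bmf m t V' W"
proof -
 assume V: "0 < V" "V \<le> V'" and W: "0 < W" and t: "t > 0" and m: "1 \<le> m"
 have eq: "U * (W / U) powr (1 / real m) = U powr (1 - 1 / real m) * W powr (1 / real m)" if "U > 0" for U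
  using that W by (simp add: powr_divide powr_diff)
 have "V * (W / V) powr (1 / real m) \<le> V' * (W / V') powr (1 / real m)"
  unfolding eq[OF V(1)] eq[OF less_le_trans[OF V]] using V m by (intro mult_right_mono powr_mono2) auto
 then have "t * (real m * (V * (W / V) powr (1 / real m))) \<le> t * (real m * (V' * (W / V') powr (1 / real m)))"
  using t by (intro mult_left_mono) auto
 then show ?thesis using V by (simp add: bmf_def mult.assoc)
qed

text \<open>The interior carries the full volume since the frontier is null, and it is a countable
  union of nonoverlapping boxes. Finite subfamilies obey \<open>bm_boxes\<close>, and the bound is
  continuous in the volume.\<close>

theorem bm_compact:
 fixes A B :: "(real^'k::{finite,wellorder}) set"
 assumes A: "compact A" "negligible (frontier A)" "0 < vol A" and B: "convex_body B" and t: "t > 0"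
 shows "bmf CARD('k) t (vol A) (vol B) \<le> vol (dsum A t B)"
proof -
 let ?m = "CARD('k)"
 have m: "1 \<le> ?m" using zero_less_card_finite[where 'a='k] by linarith
 have vB: "vol B > 0" by (rule convex_body_vol_pos[OF B])
 have cB: "compact B" using B by (simp add: convex_body_def)
 define U where "U = interior A"
 have vU: "vol U = vol A" unfolding U_def using A by (intro measure_interior compact_imp_bounded)
 have UA: "U \<subseteq> A" "open U" unfolding U_def by (auto simp: interior_subset)
 obtain p q where pq: "U \<subseteq> cbox p q" using A UA bounded_subset_cbox_symmetric compact_imp_bounded by (metis subset_trans)
 \<comment> \<open>The covering lemma asks for a box with nonempty interior.\<close>
 define q' where "q' = (\<chi> i. max (q $ i) (p $ i + 1))"
 have "cbox p q \<subseteq> cbox p q'" by (auto simp: q'_def mem_box_cart le_max_iff_disj)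
 then have Uq: "U \<subseteq> cbox p q'" using pq by (rule order_trans[rotated])
 have boxne: "box p q' \<noteq> {}" by (simp add: interval_ne_empty_cart q'_def less_max_iff_disj)
 \<comment> \<open>This gauge confines every box with a tag in \<open>U\<close> to
   \<open>U\<close>.\<close>
 define g where "g x = (if x \<in> U then U else UNIV)" for x
 have gauge: "gauge g" using UA by (auto simp: gauge_def g_def)
 obtain \<D> where \<D>: "countable \<D>" "\<And>K. K \<in> \<D> \<Longrightarrow> interior K \<noteq> {} \<and> (\<exists>c d. K = cbox c d)"
  "pairwise (\<lambda>A B. interior A \<inter> interior B = {}) \<D>" "\<And>K. K \<in> \<D> \<Longrightarrow> \<exists>x\<in>U \<inter> K. K \<subseteq> g x" "U \<subseteq> \<Union>\<D>"
  using covering_lemma[OF Uq boxne gauge] by metis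
 have DU: "\<Union>\<D> = U" using \<D>(4,5) by (fastforce simp: g_def)
 have Dne: "\<D> \<noteq> {}" using DU A(3) vU by auto
 obtain a b where ab: "\<And>K. K \<in> \<D> \<Longrightarrow> K = cbox (a K) (b K)" using \<D>(2) by metis
 have Dpos: "0 < vol K" if "K \<in> \<D>" for K
  using \<D>(2)[OF that] by (intro vol_pos_interior) auto
 define F where "F n = from_nat_into \<D> ` {..n}" for n
 have F: "finite (F n)" "F n \<noteq> {}" "F n \<subseteq> \<D>" for n using from_nat_into[OF Dne] by (auto simp: F_def)
 have FU: "(\<Union>n. \<Union>(F n)) = U"
 proof -
  have "(\<Union>n. F n) = from_nat_into \<D> ` (\<Union>n. {..n})" unfolding F_def by (rule image_UN[symmetric])
  also have "\<dots> = \<D>" using range_from_nat_into[OF Dne \<D>(1)] by (simp add: UN_atMost_UNIV)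
  finally have "(\<Union>n. F n) = \<D>" .
  then show ?thesis unfolding DU[symmetric] by auto
 qed
 have cF: "compact (\<Union>(F n))" for n using F[of n] ab by (intro compact_Union) (auto, metis compact_cbox subsetD)
 have lim: "(\<lambda>n. vol (\<Union>(F n))) \<longlonglongrightarrow> vol A"
  unfolding vU[symmetric] FU[symmetric]
 proof (rule Lim_measure_incseq)
  show "range (\<lambda>n. \<Union>(F n)) \<subseteq> sets lebesgue" using cF by (auto intro: fmeasurableD lmeasurable_compact)
  show "incseq (\<lambda>n. \<Union>(F n))" unfolding incseq_def F_def by (auto intro!: Union_mono image_mono)
  have "U \<in> lmeasurable" using UA A by (intro lmeasurable_open) (auto intro: bounded_subset compact_imp_bounded)
  then show "emeasure lebesgue (\<Union>n. \<Union>(F n)) \<noteq> \<infinity>" unfolding FU by (auto simp: fmeasurable_def)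
 qed
 have bound: "bmf ?m t (vol (\<Union>(F n))) (vol B) \<le> vol (dsum A t B)" for n
 proof -
  have eqF: "(\<Union>K\<in>F n. cbox (a K) (b K)) = \<Union>(F n)" using ab F(3)[of n] by auto
  have eqs: "(\<Sum>K\<in>F n. vol (cbox (a K) (b K))) = (\<Sum>K\<in>F n. vol K)"
  proof (rule sum.cong[OF refl])
   fix K assume "K \<in> F n"
   then have "K = cbox (a K) (b K)" using F(3)[of n] by (intro ab) auto
   then show "vol (cbox (a K) (b K)) = vol K" by (rule arg_cong[where f=vol, OF sym])
  qed
  have pos: "0 < vol (\<Union>(F n))"
  proof -
   obtain K where K: "K \<in> F n" using F(2) by blast
   then have "interior K \<noteq> {}" using \<D>(2) F(3) by blast
   moreover have "interior K \<subseteq> \<Union>(F n)" using K interior_subset by blast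
   ultimately show ?thesis by (intro vol_pos_open_subset[OF open_interior _ _ cF])
  qed
  have le: "vol (\<Union>(F n)) \<le> (\<Sum>K\<in>F n. vol K)"
  proof -
   have "K \<in> sets lebesgue" if "K \<in> F n" for K
   proof -
    have "K \<in> \<D>" using that F(3)[of n] by auto
    then have "K = cbox (a K) (b K)" by (rule ab)
    then show ?thesis by (metis fmeasurableD lmeasurable_cbox)
   qed
   then have "vol (\<Union>K\<in>F n. K) \<le> (\<Sum>K\<in>F n. vol K)" by (intro measure_UNION_le F(1))
   then show ?thesis by simp
  qed
  have "bmf ?m t (vol (\<Union>(F n))) (vol B) \<le> bmf ?m t (\<Sum>K\<in>F n. vol (cbox (a K) (b K))) (vol B)"
   unfolding eqs by (rule bmf_mono[OF pos le vB t m])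
  also have "\<dots> \<le> vol (dsum (\<Union>K\<in>F n. cbox (a K) (b K)) t B)"
  proof (rule bm_boxes[OF F(1,2) _ _ B t])
   show "0 < vol (cbox (a K) (b K))" if "K \<in> F n" for K
   proof -
    have K: "K \<in> \<D>" using that F(3)[of n] by auto
    show ?thesis unfolding ab[OF K, symmetric] by (rule Dpos[OF K])
   qed
   fix K K' assume K: "K \<in> F n" "K' \<in> F n" "K \<noteq> K'"
   then have "interior K \<inter> interior K' = {}" using \<D>(3) F(3)[of n] by (auto simp: pairwise_def)
   then show "box (a K) (b K) \<inter> box (a K') (b K') = {}"
   proof -
    have "K \<in> \<D>" "K' \<in> \<D>" using K F(3)[of n] by auto
    then have "box (a K) (b K) = interior K" "box (a K') (b K') = interior K'"
     using ab interior_cbox by metis+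
    then show ?thesis using \<open>interior K \<inter> interior K' = {}\<close> by simp
   qed
  qed
  also have "\<dots> \<le> vol (dsum A t B)"
   unfolding eqF
  proof (rule vol_mono)
   have "\<Union>(F n) \<subseteq> A" using F(3)[of n] DU UA by auto
   then show "dsum (\<Union>(F n)) t B \<subseteq> dsum A t B" by (auto simp: dsum_def)
  qed (intro dsum_compact cF cB A)+
  finally show ?thesis .
 qed
 have "(\<lambda>n. bmf ?m t (vol (\<Union>(F n))) (vol B)) \<longlonglongrightarrow> bmf ?m t (vol A) (vol B)"
  unfolding bmf_def using A(3) vB by (intro tendsto_intros lim) auto
 then show ?thesis by (rule LIMSEQ_le_const2) (use bound in auto)
qed

section \<open>Equality in Minkowski's and in the first-order inequality\<close>

lemma dsum_linear_image: "linear f \<Longrightarrow> dsum (f ` A) t (f ` B) = f ` dsum A t B"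
 by (auto simp: dsum_def image_iff linear_add linear_scale) (metis linear_add linear_scale)+

lemma convex_body_linear_image:
 fixes f :: "'a::euclidean_space \<Rightarrow> 'a"
 assumes "linear f" "inj f" "convex_body A" shows "convex_body (f ` A)"
 using assms by (auto simp: convex_body_def convex_linear_image interior_injective_linear_image
   intro!: compact_continuous_image linear_continuous_on linear_conv_bounded_linear[THEN iffD1])

lemma vol_orthogonal_image:
 fixes f :: "real^'k::{finite,wellorder} \<Rightarrow> real^'k::{finite,wellorder}"
 assumes "orthogonal_transformation f" "compact S" shows "vol (f ` S) = vol S"
 using measure_orthogonal_image[OF assms(1) lmeasurable_compact[OF assms(2)]] .

lemma mixcoef_orthogonal_image:
 fixes A B :: "(real^'k::{finite,wellorder}) set" and f :: "real^'k::{finite,wellorder} \<Rightarrow> real^'k::{finite,wellorder}"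
 assumes A: "convex_body A" and B: "convex_body B" and f: "orthogonal_transformation f" and j: "j \<le> CARD('k)"
 shows "mixcoef (f ` A) (f ` B) j = mixcoef A B j"
proof (rule mixcoef_unique)
 fix t :: real assume t: "t > 0"
 have "compact (dsum A t B)" using A B by (auto simp: convex_body_def intro: dsum_compact)
 then have "vol (dsum (f ` A) t (f ` B)) = vol (dsum A t B)"
  unfolding dsum_linear_image[OF orthogonal_transformation_linear[OF f]] by (rule vol_orthogonal_image[OF f])
 then show "vol (dsum (f ` A) t (f ` B)) = (\<Sum>j\<le>DIM((real, 'k) vec). mixcoef A B j * t ^ j)"
  by (simp add: measure_dsum_mixcoef[OF A B t])
qed (use j in simp)

text \<open>The bound is additive under matched cuts, the coefficient is superadditive, and the
  bound holds on both halves; so equality for the pair forces equality on each half. The strict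
  inequalities on j enter through the equality case for boxes.\<close>

theorem minkowski_mixcoef_eq:
 fixes A B :: "(real^'k::{finite,wellorder}) set"
 assumes A: "convex_body A" and B: "convex_body B" and j: "0 < j" "j < CARD('k)" and eq: "mixcoef A B j = minkb A B j"
 shows "\<exists>c>0. \<exists>b. A = (\<lambda>x. c *\<^sub>R x + b) ` B"
proof -
 have jl: "j \<le> CARD('k)" using j by simp
 define E where "E A B \<longleftrightarrow> convex_body A \<and> convex_body B \<and> mixcoef A B j = minkb A B j" for A B :: "(real,'k) vec set"
 interpret cut_equality E
 proof
  fix A B :: "(real,'k) vec set"
  assume "E A B"
  then have E: "convex_body A \<and> convex_body B \<and> mixcoef A B j = minkb A B j" by (simp add: E_def)
  then have vA: "vol A > 0" "vol B > 0" using convex_body_vol_pos by auto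
  show "compact A \<and> 0 < vol A \<and> convex_body B" using E vA by (simp add: convex_body_def)
  have cA: "compact A" and cB: "compact B" using E by (auto simp: convex_body_def)
  fix i s s'
  let ?A1 = "A \<inter> hlo i s" and ?A2 = "A \<inter> hhi i s" and ?B1 = "B \<inter> hlo i s'" and ?B2 = "B \<inter> hhi i s'"
  assume pos: "0 < vol ?A1" "0 < vol ?A2" and m: "vol ?B1 * vol A = vol ?A1 * vol B"
  define r where "r = vol B / vol A"
  have r: "r > 0" "vol B = r * vol A" using vA by (auto simp: r_def)
  have m1: "vol ?B1 = r * vol ?A1" using m vA by (simp add: r_def field_simps)
  have m2: "vol ?B2 = r * vol ?A2"
   by (rule vol_cut_ratio[OF cA cB r(2) m1])
  have cb: "convex_body ?A1" "convex_body ?A2" "convex_body ?B1" "convex_body ?B2"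
   using E pos m1 m2 r by (auto intro!: convex_body_cut)
  have mb: "minkb C D j = vol C * (real (CARD('k) choose j) * r powr (real j / real CARD('k)))" if "vol D = r * vol C" "vol C > 0" for C D :: "(real,'k) vec set"
   using that by (simp add: minkb_def)
  have "minkb ?A1 ?B1 j + minkb ?A2 ?B2 j = minkb A B j"
   unfolding mb[OF m1 pos(1)] mb[OF m2 pos(2)] mb[OF r(2) vA(1)] vol_cut[OF cA, of i s, symmetric] by (simp add: algebra_simps)
  moreover have "minkb ?A1 ?B1 j \<le> mixcoef ?A1 ?B1 j"
   "minkb ?A2 ?B2 j \<le> mixcoef ?A2 ?B2 j"
   by (intro minkowski_mixcoef cb jl)+
  moreover have "mixcoef ?A1 ?B1 j + mixcoef ?A2 ?B2 j \<le> mixcoef A B j"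
   using E by (intro mixcoef_superadditive cb jl) auto
  ultimately show "E ?A1 ?B1 \<and> E ?A2 ?B2"
   unfolding E_def using E cb by linarith
 next
  fix a b c d :: "(real,'k) vec" and i l
  assume "E (cbox a b) (cbox c d)"
   "\<And>i. a $ i < b $ i" "\<And>i. c $ i < d $ i"
  then show "(d $ i - c $ i) / (b $ i - a $ i) = (d $ l - c $ l) / (b $ l - a $ l)"
   by (intro minkb_cbox(2)[OF _ _ jl]) (use j in \<open>auto simp: E_def\<close>)
 next
  fix A B :: "(real,'k) vec set" and f :: "(real,'k) vec \<Rightarrow> (real,'k) vec"
  assume "E A B" and f: "orthogonal_transformation f"
  then have E: "convex_body A \<and> convex_body B \<and> mixcoef A B j = minkb A B j" by (simp add: E_def)
  have lin: "linear f" "inj f" using f orthogonal_transformation_linear orthogonal_transformation_inj by auto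
  have "vol (f ` A) = vol A" "vol (f ` B) = vol B" using E f by (auto intro!: vol_orthogonal_image simp: convex_body_def)
  then show "E (f ` A) (f ` B)"
   using E lin by (simp add: E_def convex_body_linear_image mixcoef_orthogonal_image[OF _ _ f jl] minkb_def)
 qed
 have "connected (interior A)" using A by (simp add: convex_body_def convex_connected convex_interior)
 moreover have "A \<subseteq> closure (interior A)" using A closure_subset convex_closure_interior by (metis convex_body_def)
 ultimately show ?thesis using A B eq by (intro homothetic) (auto simp: E_def)
qed

text \<open>\<open>E\<close> says that the lower right derivative of vol (A + t B) at t = 0 does not
  exceed the first-order bound. The deficit vol (A + t B) - bmf is superadditive under matched cuts
  and nonnegative on each half, so on each half it is at most the deficit of the whole.\<close>

theorem bm_derivative_eq:
 fixes A B :: "(real^'k::{finite,wellorder}) set"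
 assumes A: "compact A" "negligible (frontier A)" "0 < vol A" "connected (interior A)" "A \<subseteq> closure (interior A)" and B: "convex_body B"
  and m: "2 \<le> CARD('k)"
  and eq: "\<And>eps. eps > 0 \<Longrightarrow> \<exists>\<^sub>F t in at_right 0. vol (dsum A t B) \<le> bmf CARD('k) t (vol A) (vol B) + t * eps"
 shows "\<exists>c>0. \<exists>b. A = (\<lambda>x. c *\<^sub>R x + b) ` B"
proof -
 let ?m = "CARD('k)"
 define E where "E A B \<longleftrightarrow> compact A \<and> negligible (frontier A) \<and> 0 < vol A \<and> convex_body B \<and>
   (\<forall>eps>0. \<exists>\<^sub>F t in at_right 0. vol (dsum A t B) \<le> bmf ?m t (vol A) (vol B) + t * eps)" for A B :: "(real^'k::{finite,wellorder}) set"
 have tpos: "\<forall>\<^sub>F t in at_right 0. 0 < (t::real)" by (simp add: eventually_at_right_less)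
 interpret cut_equality E
 proof
  fix A B :: "(real,'k) vec set"
  assume E: "E A B"
  then have vA: "vol A > 0" "vol B > 0" using convex_body_vol_pos by (auto simp: E_def)
  show "compact A \<and> 0 < vol A \<and> convex_body B" using E by (simp add: E_def)
  have cA: "compact A" and cB: "compact B" and bB: "convex_body B" and nA: "negligible (frontier A)" using E by (auto simp: convex_body_def E_def)
  fix i s s'
  let ?A1 = "A \<inter> hlo i s" and ?A2 = "A \<inter> hhi i s" and ?B1 = "B \<inter> hlo i s'" and ?B2 = "B \<inter> hhi i s'"
  assume pos: "0 < vol ?A1" "0 < vol ?A2" and m: "vol ?B1 * vol A = vol ?A1 * vol B"
  define r where "r = vol B / vol A"
  have r: "r > 0" "vol B = r * vol A" using vA by (auto simp: r_def)
  have m1: "vol ?B1 = r * vol ?A1" using m vA by (simp add: r_def field_simps)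
  have m2: "vol ?B2 = r * vol ?A2"
   by (rule vol_cut_ratio[OF cA cB r(2) m1])
  have cb: "convex_body ?B1" "convex_body ?B2"
   using bB pos m1 m2 r by (auto intro!: convex_body_cut)
  have "hlo i s = {y. axis i 1 \<bullet> y \<le> s}" "hhi i s = {y. axis i 1 \<bullet> y \<ge> s}" by (auto simp: inner_axis')
  then have fr: "negligible (frontier (hlo i s))" "negligible (frontier (hhi i s))"
   by (simp_all add: frontier_halfspace_le frontier_halfspace_ge axis_eq_0_iff negligible_hyperplane)
  have nf: "negligible (frontier ?A1)" "negligible (frontier ?A2)"
   by (rule negligible_subset[OF negligible_Un[OF nA fr(1)] frontier_Int_subset],
     rule negligible_subset[OF negligible_Un[OF nA fr(2)] frontier_Int_subset])
  have bs: "bmf ?m t (vol ?A1) (vol ?B1) + bmf ?m t (vol ?A2) (vol ?B2) = bmf ?m t (vol A) (vol B)" for t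
   unfolding m1 m2 r(2) using pos vA by (simp add: bmf_scale distrib_right[symmetric] vol_cut[OF cA])
  have b1: "bmf ?m t (vol ?A1) (vol ?B1) \<le> vol (dsum ?A1 t ?B1)"
   and b2: "bmf ?m t (vol ?A2) (vol ?B2) \<le> vol (dsum ?A2 t ?B2)"
   and sup: "vol (dsum ?A1 t ?B1) + vol (dsum ?A2 t ?B2) \<le> vol (dsum A t B)" if t: "t > 0" for t
   by (rule bm_compact[OF compact_cut(1)[OF cA] nf(1) pos(1) cb(1) t], rule bm_compact[OF compact_cut(2)[OF cA] nf(2) pos(2) cb(2) t],
     rule vol_dsum_superadd[where i=i and s=s and s'=s']) (use cA cB t in \<open>auto intro: compact_cut\<close>)
  have sub: "E A' B'" if A': "compact A'" "negligible (frontier A')" "0 < vol A'" "convex_body B'"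
   and le: "\<And>t. 0 < t \<Longrightarrow> vol (dsum A' t B') - bmf ?m t (vol A') (vol B') \<le> vol (dsum A t B) - bmf ?m t (vol A) (vol B)" for A' B'
   unfolding E_def
  proof (intro conjI allI impI A')
   fix eps :: real assume "eps > 0"
   then have "\<exists>\<^sub>F t in at_right 0. vol (dsum A t B) \<le> bmf ?m t (vol A) (vol B) + t * eps" using E by (auto simp: E_def)
   then show "\<exists>\<^sub>F t in at_right 0. vol (dsum A' t B') \<le> bmf ?m t (vol A') (vol B') + t * eps"
    by (rule frequently_rev_mp) (use tpos in \<open>rule eventually_mono, use le in fastforce\<close>)
  qed
  have "vol (dsum ?A1 t ?B1) - bmf ?m t (vol ?A1) (vol ?B1) \<le> vol (dsum A t B) - bmf ?m t (vol A) (vol B)"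
   "vol (dsum ?A2 t ?B2) - bmf ?m t (vol ?A2) (vol ?B2) \<le> vol (dsum A t B) - bmf ?m t (vol A) (vol B)" if "t > 0" for t
   using b1[OF that] b2[OF that] sup[OF that] bs[of t] by linarith+
  then have "E ?A1 ?B1" "E ?A2 ?B2" using nf pos cb cA by (auto intro!: sub compact_cut)
  then show "E ?A1 ?B1 \<and> E ?A2 ?B2" by simp
 next
  fix a b c d :: "(real,'k) vec" and i l
  assume E: "E (cbox a b) (cbox c d)" and ab: "\<And>i. a $ i < b $ i" and cd: "\<And>i. c $ i < d $ i"
  let ?P = "cbox a b" and ?R = "cbox c d"
  have body: "convex_body ?P" "convex_body ?R" using E by (auto simp: E_def intro: convex_body_cbox)
  have v: "vol ?P > 0" using E by (simp add: E_def)
  have m1: "1 \<le> ?m" using m by simp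
  have c0: "mixcoef ?P ?R 0 = vol ?P"
  proof -
   have "{S::'k set. card S = 0} = {{}}" by auto
   then show ?thesis using mixcoef_cbox[OF ab cd, of 0] by (simp add: esym_def)
  qed
  \<comment> \<open>For boxes the volume is a polynomial in t with nonnegative coefficients, so a
    single t > 0 among the frequent ones bounds its linear coefficient.\<close>
  have "mixcoef ?P ?R 1 \<le> minkb ?P ?R 1 + eps" if e: "eps > 0" for eps
  proof -
   have "\<exists>\<^sub>F t in at_right 0. vol (dsum ?P t ?R) \<le> bmf ?m t (vol ?P) (vol ?R) + t * eps"
    using E e by (auto simp: E_def)
   then have "\<exists>\<^sub>F t in at_right 0. 0 < t \<and> vol (dsum ?P t ?R) \<le> bmf ?m t (vol ?P) (vol ?R) + t * eps"
    by (rule frequently_rev_mp) (use tpos in \<open>auto elim: eventually_mono\<close>)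
   then obtain t where t: "0 < t" "vol (dsum ?P t ?R) \<le> bmf ?m t (vol ?P) (vol ?R) + t * eps"
    by (auto dest: frequently_ex)
   have "vol ?P + t * mixcoef ?P ?R 1 = (\<Sum>j\<in>{0,1}. mixcoef ?P ?R j * t ^ j)" by (simp add: c0)
   also have "\<dots> \<le> (\<Sum>j\<le>?m. mixcoef ?P ?R j * t ^ j)"
    using m1 t by (intro sum_mono2) (auto intro!: mult_nonneg_nonneg mixcoef_nonneg body)
   also have "\<dots> = vol (dsum ?P t ?R)" by (rule measure_dsum_mixcoef[OF body t(1), symmetric])
   also have "\<dots> \<le> vol ?P + t * (minkb ?P ?R 1 + eps)" using t(2) by (simp add: bmf_def minkb_def algebra_simps)
   finally have "t * mixcoef ?P ?R 1 \<le> t * (minkb ?P ?R 1 + eps)" by simp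
   then show ?thesis using t(1) by simp
  qed
  then have "mixcoef ?P ?R 1 \<le> minkb ?P ?R 1" by (rule field_le_epsilon)
  then have "mixcoef ?P ?R 1 = minkb ?P ?R 1" using minkb_cbox(1)[OF ab cd m1] by simp
  then show "(d $ i - c $ i) / (b $ i - a $ i) = (d $ l - c $ l) / (b $ l - a $ l)"
   by (intro minkb_cbox(2)[OF ab cd m1]) (use m in auto)
 next
  fix A B :: "(real,'k) vec set" and f :: "(real,'k) vec \<Rightarrow> (real,'k) vec"
  assume E: "E A B" and f: "orthogonal_transformation f"
  have lin: "linear f" "inj f" using f orthogonal_transformation_linear orthogonal_transformation_inj by auto
  have c: "compact A" "compact B" "convex_body B" using E by (auto simp: E_def convex_body_def)
  have v: "vol (f ` A) = vol A" "vol (f ` B) = vol B" using c f by (auto intro!: vol_orthogonal_image)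
  have d: "vol (dsum (f ` A) t (f ` B)) = vol (dsum A t B)" for t
   unfolding dsum_linear_image[OF lin(1)] by (rule vol_orthogonal_image[OF f dsum_compact[OF c(1,2)]])
  have "frontier (f ` A) = f ` frontier A"
   using c lin by (simp add: frontier_def interior_injective_linear_image closure_injective_linear_image inj_image_mem_iff image_set_diff)
  then have "negligible (frontier (f ` A))" using E lin
   by (auto simp: E_def intro!: negligible_differentiable_image_negligible linear_imp_differentiable_on)
  then show "E (f ` A) (f ` B)" using E c lin v d
   by (simp add: E_def convex_body_linear_image compact_continuous_image[OF linear_continuous_on[OF linear_conv_bounded_linear[THEN iffD1, OF lin(1)]]])
 qed
 show ?thesis by (rule homothetic) (use A B eq in \<open>auto simp: E_def\<close>)
qed

section \<open>Mixed volumes\<close>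

text \<open>Polarization formula for the volume as a homogeneous polynomial in the weights; the
  explicit candidate for the mixed volume.\<close>

definition polar :: "'a::euclidean_space set list \<Rightarrow> real" where
 "polar Ks = (\<Sum>S\<in>Pow {..<length Ks}. (-1) ^ (length Ks - card S) * vol (msum S (\<lambda>_. 1) (\<lambda>i. Ks ! i))) / fact (length Ks)"

lemma msum_reindex:
 assumes "inj_on g S"
 shows "msum (g ` S) c K = msum S (c \<circ> g) (K \<circ> g)"
proof (intro set_eqI iffI)
 fix z assume "z \<in> msum (g ` S) c K"
 then obtain x where "z = (\<Sum>i\<in>g ` S. c i *\<^sub>R x i)" "\<forall>i\<in>g ` S. x i \<in> K i" by (auto simp: msum_def)
 then show "z \<in> msum S (c \<circ> g) (K \<circ> g)"
  unfolding msum_def by (intro CollectI exI[of _ "x \<circ> g"]) (auto simp: sum.reindex[OF assms])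
next
 fix z assume "z \<in> msum S (c \<circ> g) (K \<circ> g)"
 then obtain x where x: "z = (\<Sum>i\<in>S. c (g i) *\<^sub>R x i)" "\<forall>i\<in>S. x i \<in> K (g i)" by (auto simp: msum_def)
 have inv: "the_inv_into S g (g i) = i" if "i \<in> S" for i using that assms by (simp add: the_inv_into_f_f)
 have "z = (\<Sum>i\<in>g ` S. c i *\<^sub>R x (the_inv_into S g i))"
  unfolding sum.reindex[OF assms] x(1) by (intro sum.cong) (auto simp: inv)
 then show "z \<in> msum (g ` S) c K"
  unfolding msum_def using x(2) inv by (intro CollectI exI[of _ "\<lambda>i. x (the_inv_into S g i)"]) auto
qed

lemma msum_cong: "(\<And>i. i \<in> I \<Longrightarrow> c i = c' i) \<Longrightarrow> (\<And>i. i \<in> I \<Longrightarrow> K i = K' i) \<Longrightarrow> msum I c K = msum I c' K'"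
 unfolding msum_def by (metis (mono_tags, lifting) sum.cong)

lemma polar_mset:
 assumes "mset Ks = mset Ks'" shows "polar Ks = polar Ks'"
proof -
 obtain p where p: "p permutes {..<length Ks'}" "permute_list p Ks' = Ks" using mset_eq_permutation[OF assms] .
 have len: "length Ks = length Ks'" using assms by (rule mset_eq_length)
 have nth: "Ks ! i = Ks' ! p i" if "i < length Ks'" for i
  using p that by (metis permute_list_nth)
 have inj: "inj p" using p(1) by (rule permutes_inj)
 have "(\<Sum>S\<in>Pow {..<length Ks'}. (-1) ^ (length Ks' - card S) * vol (msum S (\<lambda>_. 1) (\<lambda>i. Ks' ! i)))
   = (\<Sum>S\<in>Pow {..<length Ks'}. (-1) ^ (length Ks' - card (p ` S)) * vol (msum (p ` S) (\<lambda>_. 1) (\<lambda>i. Ks' ! i)))"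
 proof (rule sum.reindex_bij_betw[symmetric])
  show "bij_betw ((`) p) (Pow {..<length Ks'}) (Pow {..<length Ks'})"
   by (rule bij_betw_Pow) (use p(1) permutes_imp_bij in auto)
 qed
 also have "\<dots> = (\<Sum>S\<in>Pow {..<length Ks'}. (-1) ^ (length Ks' - card S) * vol (msum S (\<lambda>_. 1) (\<lambda>i. Ks ! i)))"
 proof (rule sum.cong[OF refl])
  fix S assume S: "S \<in> Pow {..<length Ks'}"
  have "card (p ` S) = card S" using inj by (intro card_image) (auto intro: inj_on_subset)
  moreover have "msum (p ` S) (\<lambda>_. 1) (\<lambda>i. Ks' ! i) = msum S (\<lambda>_. 1) (\<lambda>i. Ks ! i)"
   unfolding msum_reindex[OF inj_on_subset[OF inj subset_UNIV]] by (rule msum_cong) (use S nth in auto)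
  ultimately show "(-1) ^ (length Ks' - card (p ` S)) * vol (msum (p ` S) (\<lambda>_. 1) (\<lambda>i. Ks' ! i))
   = (-1) ^ (length Ks' - card S) * vol (msum S (\<lambda>_. 1) (\<lambda>i. Ks ! i))" by simp
 qed
 finally show ?thesis unfolding polar_def len by simp
qed

text \<open>A summand of the row-wise multilinear expansion of the determinant of a sum of
  matrices.\<close>

definition rowdet :: "('i \<Rightarrow> real^'k^'k) \<Rightarrow> ('k \<Rightarrow> 'i) \<Rightarrow> real" where
 "rowdet A f = det (\<chi> l. A (f l) $ l)"

lemma det_sum_rowdet:
 fixes A :: "'i \<Rightarrow> real^'k^'k"
 assumes "finite S"
 shows "det (\<Sum>i\<in>S. c i *\<^sub>R A i) = (\<Sum>f | range f \<subseteq> S. (\<Prod>l\<in>UNIV. c (f l)) * rowdet A f)"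
proof -
 have F: "{f. range f \<subseteq> S} = (PiE UNIV (\<lambda>_. S) :: ('k \<Rightarrow> 'i) set)" by (auto simp: PiE_def)
 have fin: "finite {f :: 'k \<Rightarrow> 'i. range f \<subseteq> S}" unfolding F by (rule finite_PiE) (use assms in auto)
 have "det (\<Sum>i\<in>S. c i *\<^sub>R A i) = (\<Sum>p | p permutes UNIV. of_int (sign p) * (\<Prod>l\<in>UNIV. \<Sum>i\<in>S. c i * A i $ l $ p l))"
  by (simp add: det_def sum_component)
 also have "\<dots> = (\<Sum>p | p permutes UNIV. of_int (sign p) * (\<Sum>f | range f \<subseteq> S. \<Prod>l\<in>UNIV. c (f l) * A (f l) $ l $ p l))"
  unfolding F by (subst prod_sum_PiE) (use assms in auto)
 also have "\<dots> = (\<Sum>f | range f \<subseteq> S. \<Sum>p | p permutes UNIV. of_int (sign p) * (\<Prod>l\<in>UNIV. c (f l) * A (f l) $ l $ p l))"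
  unfolding sum_distrib_left by (rule sum.swap)
 also have "\<dots> = (\<Sum>f | range f \<subseteq> S. (\<Prod>l\<in>UNIV. c (f l)) * rowdet A f)"
  by (intro sum.cong refl) (simp add: rowdet_def det_def sum_distrib_left prod.distrib mult_ac)
 finally show ?thesis .
qed

lemma alternating_sum_supersets:
 assumes R: "R \<subseteq> {..<m::nat}"
 shows "(\<Sum>S | R \<subseteq> S \<and> S \<subseteq> {..<m}. (-1) ^ (m - card S)) = (if R = {..<m} then 1 else (0::real))"
proof (cases "R = {..<m}")
 case True
 then have "{S. R \<subseteq> S \<and> S \<subseteq> {..<m}} = {{..<m}}" by auto
 then show ?thesis using True by simp
next
 case False
 have "(\<Sum>S | R \<subseteq> S \<and> S \<subseteq> {..<m}. (-1) ^ (m - card S)) = (\<Sum>S | R \<subseteq> S \<and> S \<subseteq> {..<m}. (-1) ^ m * (-1) ^ card S :: real)"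
 proof (rule sum.cong[OF refl])
  fix S assume "S \<in> {S. R \<subseteq> S \<and> S \<subseteq> {..<m}}"
  then have "card S \<le> m" using card_mono[of "{..<m}" S] by simp
  then show "(-1) ^ (m - card S) = (-1) ^ m * (-1::real) ^ card S"
   by (auto simp: power_add[symmetric] minus_one_power_iff)
 qed
 also have "\<dots> = (-1) ^ m * (\<Sum>S | R \<subseteq> S \<and> S \<subseteq> {..<m}. (-1) ^ card S)" by (simp add: sum_distrib_left)
 also have "(\<Sum>S | R \<subseteq> S \<and> S \<subseteq> {..<m}. (-1::real) ^ card S) = 0"
  by (rule sum_alternating_cancels)
    (use card_subsupersets_even_odd[of "{..<m}" R] R False in \<open>auto simp: conj_ac psubset_eq\<close>)
 finally show ?thesis using False by simp
qed

lemma card_bij_to_lessThan: "card {g. bij_betw g (UNIV::'k::finite set) {..<CARD('k)}} = fact CARD('k)"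
proof -
 obtain e where e: "bij_betw e (UNIV::'k set) {..<CARD('k)}"
  using ex_bij_betw_finite_nat[OF finite, of "UNIV::'k set"] by (auto simp: atLeast0LessThan)
 have "bij_betw (\<lambda>p. e \<circ> p) {p. p permutes (UNIV::'k set)} {g. bij_betw g (UNIV::'k set) {..<CARD('k)}}"
 proof (rule bij_betwI[where g="\<lambda>g. inv_into UNIV e \<circ> g"])
  show "(\<lambda>p. e \<circ> p) \<in> {p. p permutes UNIV} \<rightarrow> {g. bij_betw g UNIV {..<CARD('k)}}"
   using e by (auto intro: bij_betw_trans permutes_imp_bij)
  show "(\<lambda>g. inv_into UNIV e \<circ> g) \<in> {g. bij_betw g UNIV {..<CARD('k)}} \<rightarrow> {p. p permutes UNIV}"
   using bij_betw_inv_into[OF e] by (auto intro!: bij_imp_permutes intro: bij_betw_trans)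
  show "inv_into UNIV e \<circ> (e \<circ> p) = p" if "p \<in> {p. p permutes UNIV}" for p
   using bij_betw_inv_into_left[OF e] by (auto simp: fun_eq_iff)
  show "e \<circ> (inv_into UNIV e \<circ> g) = g" if "g \<in> {g. bij_betw g UNIV {..<CARD('k)}}" for g
   using that bij_betw_inv_into_right[OF e] by (auto simp: fun_eq_iff bij_betw_def)
 qed
 then have "card {p. p permutes (UNIV::'k set)} = card {g. bij_betw g (UNIV::'k set) {..<CARD('k)}}" by (rule bij_betw_same_card)
 then show ?thesis by (simp add: card_permutations)
qed

text \<open>The mixed discriminant in polarized form; its integral over the covariance matrices is
  \<open>polar\<close>.\<close>

definition polar_det :: "(nat \<Rightarrow> real^'k^'k) \<Rightarrow> nat list \<Rightarrow> real" where
 "polar_det A L = (\<Sum>S\<in>Pow {..<length L}. (-1) ^ (length L - card S) * det (\<Sum>i\<in>S. A (L ! i))) / fact (length L)"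

text \<open>Inclusion-exclusion over S keeps only the row choices g that use every list position. As
  there are as many rows as positions, these are the bijections.\<close>

lemma polar_det_rowdet:
 fixes A :: "nat \<Rightarrow> real^'k^'k"
 assumes L: "length L = CARD('k)"
 shows "polar_det A L = (\<Sum>g | bij_betw g UNIV {..<CARD('k)}. rowdet A (\<lambda>l. L ! g l)) / fact CARD('k)"
proof -
 let ?m = "CARD('k)"
 let ?G = "{g :: 'k \<Rightarrow> nat. range g \<subseteq> {..<?m}}"
 have G: "?G = (PiE UNIV (\<lambda>_. {..<?m}) :: ('k \<Rightarrow> nat) set)" by (auto simp: PiE_def)
 have finG: "finite ?G" unfolding G by (rule finite_PiE) auto
 have "(\<Sum>S\<in>Pow {..<?m}. (-1) ^ (?m - card S) * det (\<Sum>i\<in>S. A (L ! i)))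
  = (\<Sum>S\<in>Pow {..<?m}. \<Sum>g | g \<in> ?G \<and> range g \<subseteq> S. (-1) ^ (?m - card S) * rowdet A (\<lambda>l. L ! g l))"
 proof (rule sum.cong[OF refl])
  fix S assume S: "S \<in> Pow {..<?m}"
  then have fin: "finite S" using finite_subset by auto
  have "det (\<Sum>i\<in>S. A (L ! i)) = det (\<Sum>i\<in>S. 1 *\<^sub>R A (L ! i))" by simp
  also have "\<dots> = (\<Sum>g | range g \<subseteq> S. rowdet (\<lambda>i. A (L ! i)) g)" by (subst det_sum_rowdet[OF fin]) simp
  also have "\<dots> = (\<Sum>g | range g \<subseteq> S. rowdet A (\<lambda>l. L ! g l))" by (simp add: rowdet_def)
  also have "{g. range g \<subseteq> S} = {g. g \<in> ?G \<and> range g \<subseteq> S}" using S by auto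
  finally show "(-1) ^ (?m - card S) * det (\<Sum>i\<in>S. A (L ! i)) = (\<Sum>g | g \<in> ?G \<and> range g \<subseteq> S. (-1) ^ (?m - card S) * rowdet A (\<lambda>l. L ! g l))"
   by (simp add: sum_distrib_left)
 qed
 also have "\<dots> = (\<Sum>g\<in>?G. \<Sum>S | S \<in> Pow {..<?m} \<and> range g \<subseteq> S. (-1) ^ (?m - card S) * rowdet A (\<lambda>l. L ! g l))"
  by (rule sum.swap_restrict) (use finG in auto)
 also have "\<dots> = (\<Sum>g\<in>?G. (if range g = {..<?m} then 1 else 0) * rowdet A (\<lambda>l. L ! g l))"
 proof (rule sum.cong[OF refl])
  fix g assume "g \<in> ?G"
  then have g: "range g \<subseteq> {..<?m}" by simp
  have "{S. S \<in> Pow {..<?m} \<and> range g \<subseteq> S} = {S. range g \<subseteq> S \<and> S \<subseteq> {..<?m}}" by auto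
  then show "(\<Sum>S | S \<in> Pow {..<?m} \<and> range g \<subseteq> S. (-1) ^ (?m - card S) * rowdet A (\<lambda>l. L ! g l))
    = (if range g = {..<?m} then 1 else 0) * rowdet A (\<lambda>l. L ! g l)"
   by (simp only: sum_distrib_right[symmetric] alternating_sum_supersets[OF g])
 qed
 also have "\<dots> = (\<Sum>g\<in>{g\<in>?G. range g = {..<?m}}. rowdet A (\<lambda>l. L ! g l))"
  using finG by (simp add: if_distrib[of "\<lambda>x. x * _"] sum.inter_filter[symmetric] cong: if_cong)
 also have "{g\<in>?G. range g = {..<?m}} = {g. bij_betw g UNIV {..<?m}}"
 proof -
  have "inj g" if "range g = {..<?m}" for g :: "'k \<Rightarrow> nat"
   using that by (intro eq_card_imp_inj_on) auto
  then show ?thesis by (auto simp: bij_betw_def)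
 qed
 finally show ?thesis by (simp add: polar_det_def L)
qed

text \<open>For a fixed bijection g between rows and list positions, the lists L run through all row
  choices, so the sum over L is already the full determinant; averaging over the bijections gives
  the claim.\<close>

lemma det_sum_polar:
 fixes A :: "nat \<Rightarrow> real^'k^'k"
 shows "det (\<Sum>i<M. c i *\<^sub>R A i) = (\<Sum>L | set L \<subseteq> {..<M} \<and> length L = CARD('k). (\<Prod>i\<leftarrow>L. c i) * polar_det A L)"
proof -
 let ?m = "CARD('k)"
 let ?Ls = "{L. set L \<subseteq> {..<M} \<and> length L = ?m}" and ?B = "{g. bij_betw g (UNIV::'k set) {..<?m}}"
 have "card ?B = fact ?m" by (rule card_bij_to_lessThan)
 then have finB: "finite ?B" by (intro card_ge_0_finite) simp
 have inner: "(\<Sum>L\<in>?Ls. (\<Prod>i\<leftarrow>L. c i) * rowdet A (\<lambda>l. L ! g l)) = det (\<Sum>i<M. c i *\<^sub>R A i)" if g: "g \<in> ?B" for g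
 proof -
  have bg: "bij_betw g (UNIV::'k set) {..<?m}" using g by simp
  have "(\<Sum>f | range f \<subseteq> {..<M}. (\<Prod>l\<in>UNIV. c (f l)) * rowdet A f)
    = (\<Sum>L\<in>?Ls. (\<Prod>l\<in>UNIV. c (L ! g l)) * rowdet A (\<lambda>l. L ! g l))"
  proof (rule sum.reindex_bij_witness[where j="\<lambda>f. map (f \<circ> inv_into UNIV g) [0..<?m]" and i="\<lambda>L l. L ! g l"])
   fix f :: "'k \<Rightarrow> nat" assume f: "f \<in> {f. range f \<subseteq> {..<M}}"
   show eq: "(\<lambda>l. map (f \<circ> inv_into UNIV g) [0..<?m] ! g l) = f"
   proof
    fix l
    have "g l < ?m" using bij_betwE[OF bg] by auto
    then show "map (f \<circ> inv_into UNIV g) [0..<?m] ! g l = f l" using bij_betw_inv_into_left[OF bg] by simp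
   qed
   show "map (f \<circ> inv_into UNIV g) [0..<?m] \<in> ?Ls" using f by auto
   show "(\<Prod>l\<in>UNIV. c (map (f \<circ> inv_into UNIV g) [0..<?m] ! g l)) * rowdet A (\<lambda>l. map (f \<circ> inv_into UNIV g) [0..<?m] ! g l)
     = (\<Prod>l\<in>UNIV. c (f l)) * rowdet A f"
    (is "(\<Prod>l\<in>UNIV. c (?h l)) * _ = _")
   proof -
    have "?h l = f l" for l using fun_cong[OF eq] .
    then show ?thesis using eq by simp
   qed
  next
   fix L assume L: "L \<in> ?Ls"
   show "map ((\<lambda>l. L ! g l) \<circ> inv_into UNIV g) [0..<?m] = L"
    by (rule nth_equalityI) (use L bij_betw_inv_into_right[OF bg] in auto)
   show "(\<lambda>l. L ! g l) \<in> {f. range f \<subseteq> {..<M}}"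
    using L bij_betwE[OF bg] by (force simp: subset_iff)
  qed
  also have "\<dots> = (\<Sum>L\<in>?Ls. (\<Prod>i\<leftarrow>L. c i) * rowdet A (\<lambda>l. L ! g l))"
  proof (rule sum.cong[OF refl])
   fix L assume L: "L \<in> ?Ls"
   have "(\<Prod>l\<in>UNIV. c (L ! g l)) = (\<Prod>p<?m. c (L ! p))" by (rule prod.reindex_bij_betw[OF bg])
   also have "\<dots> = (\<Prod>i\<leftarrow>L. c i)" using L by (simp add: prod.list_conv_set_nth atLeast0LessThan)
   finally show "(\<Prod>l\<in>UNIV. c (L ! g l)) * rowdet A (\<lambda>l. L ! g l) = (\<Prod>i\<leftarrow>L. c i) * rowdet A (\<lambda>l. L ! g l)" by simp
  qed
  finally show ?thesis by (simp add: det_sum_rowdet)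
 qed
 have "(\<Sum>L\<in>?Ls. (\<Prod>i\<leftarrow>L. c i) * polar_det A L)
   = (\<Sum>L\<in>?Ls. \<Sum>g\<in>?B. (\<Prod>i\<leftarrow>L. c i) * rowdet A (\<lambda>l. L ! g l)) / fact ?m"
  unfolding sum_divide_distrib by (intro sum.cong refl) (simp add: polar_det_rowdet sum_distrib_left sum_divide_distrib)
 also have "(\<Sum>L\<in>?Ls. \<Sum>g\<in>?B. (\<Prod>i\<leftarrow>L. c i) * rowdet A (\<lambda>l. L ! g l)) = (\<Sum>g\<in>?B. \<Sum>L\<in>?Ls. (\<Prod>i\<leftarrow>L. c i) * rowdet A (\<lambda>l. L ! g l))"
  by (rule sum.swap)
 also have "\<dots> = (\<Sum>g\<in>?B. det (\<Sum>i<M. c i *\<^sub>R A i))" by (rule sum.cong[OF refl inner])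
 also have "\<dots> = fact ?m * det (\<Sum>i<M. c i *\<^sub>R A i)" by (simp add: card_bij_to_lessThan)
 finally show ?thesis by simp
qed

lemma msum_zero: "(\<And>i. i \<in> I \<Longrightarrow> c i = 0) \<Longrightarrow> (\<And>i. i \<in> I \<Longrightarrow> K i \<noteq> {}) \<Longrightarrow> msum I c K = {0}"
 using msum_ne[of I K c] by (auto simp: msum_def)

lemma msum_drop_zero:
 assumes "finite I" "J \<subseteq> I" "\<And>i. i \<in> I - J \<Longrightarrow> c i = 0" "\<And>i. i \<in> I \<Longrightarrow> K i \<noteq> {}"
 shows "msum I c K = msum J c K"
proof (intro set_eqI iffI)
 fix z assume "z \<in> msum I c K"
 then obtain x where x: "z = (\<Sum>i\<in>I. c i *\<^sub>R x i)" "\<forall>i\<in>I. x i \<in> K i" by (auto simp: msum_def)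
 have "(\<Sum>i\<in>I. c i *\<^sub>R x i) = (\<Sum>i\<in>J. c i *\<^sub>R x i)" using assms by (intro sum.mono_neutral_right) auto
 then show "z \<in> msum J c K" using x assms(2) by (auto simp: msum_def)
next
 fix z assume "z \<in> msum J c K"
 then obtain x where x: "z = (\<Sum>i\<in>J. c i *\<^sub>R x i)" "\<forall>i\<in>J. x i \<in> K i" by (auto simp: msum_def)
 let ?y = "\<lambda>i. if i \<in> J then x i else (SOME y. y \<in> K i)"
 have "(\<Sum>i\<in>I. c i *\<^sub>R ?y i) = (\<Sum>i\<in>J. c i *\<^sub>R ?y i)" using assms by (intro sum.mono_neutral_right) auto
 also have "\<dots> = z" unfolding x(1) by (rule sum.cong) auto
 finally show "z \<in> msum I c K" unfolding msum_def using x(2) assms(4)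
  by (intro CollectI exI[of _ ?y]) (auto simp: some_in_eq)
qed

text \<open>Extends \<open>det_integral\<close> to vanishing weights: a body of weight zero
  contributes only the origin. If all weights vanish, the sum is a point and the matrix is
  zero.\<close>

lemma vol_msum_integral:
 fixes K :: "'i \<Rightarrow> (real^'k::{finite,wellorder}) set"
 assumes I: "finite I" and K: "\<And>i. i \<in> I \<Longrightarrow> convex_body (K i)" and c: "\<And>i. i \<in> I \<Longrightarrow> 0 \<le> c i"
 shows "((\<lambda>x. det (\<Sum>i\<in>I. c i *\<^sub>R ecov (wmeas (K i) (\<lambda>_. 1)) x)) has_integral vol (msum I c K)) UNIV"
proof (cases "\<exists>i\<in>I. 0 < c i")
 case True
 define J where "J = {i\<in>I. 0 < c i}"
 have J: "J \<subseteq> I" "finite J" "J \<noteq> {}" using I True by (auto simp: J_def)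
 have z: "c i = 0" if "i \<in> I - J" for i using c[of i] that by (auto simp: J_def)
 have ne: "K i \<noteq> {}" if "i \<in> I" for i using K[OF that] interior_subset[of "K i"] by (auto simp: convex_body_def)
 interpret body_family J c K "\<lambda>i. wmeas (K i) (\<lambda>_. 1)"
  by (rule body_family.intro) (use J K in \<open>auto simp: J_def intro!: weighted_body_wmeas\<close>)
 have "gder x = (\<Sum>i\<in>I. c i *\<^sub>R ecov (wmeas (K i) (\<lambda>_. 1)) x)" for x
  unfolding gder_def by (rule sum.mono_neutral_left) (use I J z in auto)
 moreover have "msum I c K = msum J c K" by (rule msum_drop_zero[OF I J(1) z ne])
 ultimately show ?thesis using det_integral by simp
next
 case False
 then have z: "c i = 0" if "i \<in> I" for i using c[OF that] that by force
 have ne: "K i \<noteq> {}" if "i \<in> I" for i using K[OF that] interior_subset[of "K i"] by (auto simp: convex_body_def)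
 have "det (0 :: ((real,'k) vec,'k) vec) = 0" by (rule det_zero_row(1)[of undefined]) (simp add: row_def vec_eq_iff)
 then show ?thesis using z by (simp add: msum_zero[OF z ne])
qed

text \<open>\<open>det_sum_polar\<close> holds pointwise for the covariances, and integration turns
  the determinants on both sides into volumes.\<close>

theorem vol_msum_polar:
 fixes K :: "nat \<Rightarrow> (real^'k::{finite,wellorder}) set"
 assumes K: "\<And>i. i < M \<Longrightarrow> convex_body (K i)" and c: "\<And>i. i < M \<Longrightarrow> 0 \<le> c i"
 shows "vol (msum {..<M} c K) = (\<Sum>L | set L \<subseteq> {..<M} \<and> length L = CARD('k). (\<Prod>i\<leftarrow>L. c i) * polar (map K L))"
proof -
 let ?A = "\<lambda>x i. ecov (wmeas (K i) (\<lambda>_. 1)) x"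
 have pol: "((\<lambda>x. polar_det (?A x) L) has_integral polar (map K L)) UNIV" if L: "set L \<subseteq> {..<M}" for L
 proof -
  have "((\<lambda>x. det (\<Sum>i\<in>S. ?A x (L ! i))) has_integral vol (msum S (\<lambda>_. 1) (\<lambda>i. map K L ! i))) UNIV" if S: "S \<in> Pow {..<length L}" for S
  proof -
   have Li: "L ! i < M" if "i \<in> S" for i using S that L nth_mem[of i L] by (meson PowD lessThan_iff subsetD)
   have "((\<lambda>x. det (\<Sum>i\<in>S. 1 *\<^sub>R ecov (wmeas (K (L ! i)) (\<lambda>_. 1)) x)) has_integral vol (msum S (\<lambda>_. 1) (\<lambda>i. K (L ! i)))) UNIV"
    by (rule vol_msum_integral) (use S Li K in \<open>auto intro: finite_subset\<close>)
   moreover have "msum S (\<lambda>_. 1) (\<lambda>i. K (L ! i)) = msum S (\<lambda>_. 1) (\<lambda>i. map K L ! i)"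
    by (rule msum_cong) (use S in auto)
   ultimately show ?thesis by simp
  qed
  then show ?thesis
   unfolding polar_det_def polar_def divide_inverse length_map
   by (intro has_integral_mult_left has_integral_sum has_integral_mult_right) auto
 qed
 have "((\<lambda>x. \<Sum>L | set L \<subseteq> {..<M} \<and> length L = CARD('k). (\<Prod>i\<leftarrow>L. c i) * polar_det (?A x) L) has_integral
   (\<Sum>L | set L \<subseteq> {..<M} \<and> length L = CARD('k). (\<Prod>i\<leftarrow>L. c i) * polar (map K L))) UNIV"
  by (intro has_integral_sum has_integral_mult_right pol finite_lists_length_eq) auto
 moreover have "((\<lambda>x. \<Sum>L | set L \<subseteq> {..<M} \<and> length L = CARD('k). (\<Prod>i\<leftarrow>L. c i) * polar_det (?A x) L) has_integral
   vol (msum {..<M} c K)) UNIV"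
  unfolding det_sum_polar[symmetric] by (rule vol_msum_integral) (use K c in auto)
 ultimately show ?thesis by (rule has_integral_unique[rotated])
qed

section \<open>Transfer between Cartesian vectors and the product space\<close>

typedef 'n idx = "UNIV :: 'n option set" ..

lemma bij_Rep_idx: "bij Rep_idx"
 using type_definition.Rep_range[OF type_definition_idx] by (auto simp: bij_def inj_def Rep_idx_inject)

instance idx :: (finite) finite
proof
 have "inj (Rep_idx :: 'a idx \<Rightarrow> 'a option)" using bij_Rep_idx by (rule bij_is_inj)
 then show "finite (UNIV :: 'a idx set)" by (rule finite_imageD[rotated]) simp
qed

lemma card_idx: "CARD('n::finite idx) = CARD('n) + 1"
 using bij_betw_same_card[OF bij_Rep_idx[where 'a='n]] by (simp add: card_UNIV_option)

text \<open>The change of variables theorems of the library need a well-ordered index type; any order will do.\<close>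

instantiation idx :: (finite) wellorder
begin

definition "idx_num = (SOME f :: 'a idx \<Rightarrow> nat. inj f)"
definition "(i :: 'a idx) \<le> j \<longleftrightarrow> idx_num i \<le> idx_num j"
definition "(i :: 'a idx) < j \<longleftrightarrow> idx_num i < idx_num j"

lemma inj_idx_num: "inj (idx_num :: 'a idx \<Rightarrow> nat)"
proof -
 obtain f :: "'a idx \<Rightarrow> nat" and n where "inj f" using finite_imp_inj_to_nat_seg[OF finite[of "UNIV :: 'a idx set"]] by auto
 then show ?thesis unfolding idx_num_def by (rule someI[of inj])
qed

instance
proof
 fix P and a :: "'a idx"
 assume step: "\<And>x :: 'a idx. (\<And>y. y < x \<Longrightarrow> P y) \<Longrightarrow> P x"
 show "P a"
 proof (induction a rule: measure_induct_rule[of idx_num])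
  case (less x)
  show ?case by (rule step, rule less) (simp add: less_idx_def)
 qed
next
 fix x y :: "'a idx"
 show "x \<le> y \<Longrightarrow> y \<le> x \<Longrightarrow> x = y" by (rule injD[OF inj_idx_num]) (simp add: less_eq_idx_def)
qed (simp_all add: less_eq_idx_def less_idx_def less_le_not_le linear)

end

text \<open>Linear isometry sending the last coordinate to the component with index
  \<open>Abs_idx None\<close>; \<open>prj\<close> is its inverse.\<close>

definition emb :: "(real^'n) \<times> real \<Rightarrow> real^('n idx)" where
 "emb x = (\<chi> i. case Rep_idx i of None \<Rightarrow> snd x | Some j \<Rightarrow> fst x $ j)"

definition prj :: "real^('n idx) \<Rightarrow> (real^'n) \<times> real" where
 "prj w = (\<chi> j. w $ Abs_idx (Some j), w $ Abs_idx None)"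

lemma Rep_Abs_idx [simp]: "Rep_idx (Abs_idx x) = x" by (simp add: Abs_idx_inverse)

lemma emb_nth [simp]: "emb x $ Abs_idx (Some j) = fst x $ j" "emb x $ Abs_idx None = snd x"
 by (simp_all add: emb_def)

lemma prj_emb [simp]: "prj (emb x) = x" by (simp add: prj_def prod_eq_iff vec_eq_iff)

lemma emb_prj [simp]: "emb (prj w) = w"
proof -
 have "emb (prj w) $ i = w $ i" for i
  by (cases i) (simp add: emb_def prj_def split: option.split)
 then show ?thesis by (simp add: vec_eq_iff)
qed

lemma bij_emb: "bij emb" by (rule bij_betw_byWitness[where f'=prj]) auto

lemma inj_emb: "inj emb" using bij_emb by (rule bij_is_inj)

lemma linear_emb: "linear (emb :: (real^'n) \<times> real \<Rightarrow> _)"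
 by (rule linearI) (auto simp: emb_def vec_eq_iff split: option.split)

lemma linear_prj: "linear (prj :: real^('n::finite idx) \<Rightarrow> _)"
 by (rule linearI) (auto simp: prj_def vec_eq_iff prod_eq_iff)

lemma sum_idx:
 fixes f :: "'n::finite idx \<Rightarrow> 'b::comm_monoid_add"
 shows "(\<Sum>i\<in>UNIV. f i) = (\<Sum>j\<in>UNIV. f (Abs_idx (Some j))) + f (Abs_idx None)"
proof -
 have "bij Abs_idx" by (rule bij_betw_byWitness[where f'=Rep_idx]) (auto simp: Rep_idx_inverse)
 then have "(\<Sum>i\<in>UNIV. f i) = (\<Sum>x\<in>UNIV. f (Abs_idx x))" by (rule sum.reindex_bij_betw[symmetric])
 also have "\<dots> = (\<Sum>x\<in>insert None (range Some). f (Abs_idx x))" by (simp add: UNIV_option_conv)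
 also have "\<dots> = f (Abs_idx None) + (\<Sum>x\<in>range Some. f (Abs_idx x))" by (rule sum.insert) auto
 also have "(\<Sum>x\<in>range Some. f (Abs_idx x)) = (\<Sum>j\<in>UNIV. f (Abs_idx (Some j)))"
  by (simp add: sum.reindex)
 finally show ?thesis by (simp add: add.commute)
qed

lemma emb_inner [simp]: "emb x \<bullet> emb y = x \<bullet> y"
 by (simp add: inner_vec_def sum_idx inner_prod_def)

lemma prj_inner [simp]: "prj v \<bullet> prj w = v \<bullet> w"
 using emb_inner[of "prj v" "prj w"] by simp

lemma norm_emb [simp]: "norm (emb x) = norm x" by (simp add: norm_eq_sqrt_inner)

text \<open>Matching the bases identifies boxes with boxes, from which \<open>distr_emb\<close>
  identifies the Lebesgue measures.\<close>

lemma emb_Basis: "bij_betw emb (Basis :: ((real^'n) \<times> real) set) Basis"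
proof (rule bij_betwI)
 have *: "emb b \<in> Basis" if b: "b \<in> (Basis :: ((real^'n) \<times> real) set)" for b
 proof -
  consider j where "b = (axis j 1, 0)" | "b = (0, 1)" using b by (auto simp: Basis_prod_def Basis_vec_def)
  then show ?thesis
  proof cases
   case 1
   then have "emb b $ i = axis (Abs_idx (Some j)) 1 $ i" for i
    by (cases i) (auto simp: emb_def axis_def Abs_idx_inject split: option.split)
   then have "emb b = axis (Abs_idx (Some j)) 1" by (simp add: vec_eq_iff)
   then show ?thesis by (auto simp: Basis_vec_def)
  next
   case 2
   then have "emb b $ i = axis (Abs_idx None) 1 $ i" for i
    by (cases i) (auto simp: emb_def axis_def Abs_idx_inject split: option.split)
   then have "emb b = axis (Abs_idx None) 1" by (simp add: vec_eq_iff)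
   then show ?thesis by (auto simp: Basis_vec_def)
  qed
 qed
 then show "emb \<in> (Basis :: ((real^'n) \<times> real) set) \<rightarrow> Basis" by auto
 show "prj \<in> Basis \<rightarrow> (Basis :: ((real^'n) \<times> real) set)"
 proof
  fix w :: "real^('n idx)" assume "w \<in> Basis"
  then obtain i where w: "w = axis i 1" by (auto simp: Basis_vec_def)
  show "prj w \<in> Basis"
  proof (cases "Rep_idx i")
   case None
   then have "i = Abs_idx None" by (metis Rep_idx_inverse)
   then have "prj w = (0, 1)" by (simp add: w prj_def axis_def vec_eq_iff Abs_idx_inject)
   then show ?thesis by (simp add: Basis_prod_def)
  next
   case (Some j)
   then have "i = Abs_idx (Some j)" by (metis Rep_idx_inverse)
   then have "prj w = (axis j 1, 0)" by (auto simp: w prj_def axis_def vec_eq_iff Abs_idx_inject)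
   then show ?thesis by (auto simp: Basis_prod_def Basis_vec_def)
  qed
 qed
qed auto

lemma continuous_on_emb [continuous_intros]: "continuous_on S f \<Longrightarrow> continuous_on S (\<lambda>x. emb (f x))"
 using linear_continuous_on[OF linear_conv_bounded_linear[THEN iffD1, OF linear_emb], of "f ` S"]
 by (rule continuous_on_compose2) auto

lemma continuous_on_prj [continuous_intros]:
 fixes f :: "'a::topological_space \<Rightarrow> real^('n::finite idx)"
 shows "continuous_on S f \<Longrightarrow> continuous_on S (\<lambda>x. prj (f x))"
 using linear_continuous_on[OF linear_conv_bounded_linear[THEN iffD1, OF linear_prj], of "f ` S"]
 by (rule continuous_on_compose2) auto

lemma emb_measurable [measurable]: "emb \<in> borel_measurable borel"
 by (intro borel_measurable_continuous_onI continuous_intros)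

lemma prj_measurable [measurable]: "prj \<in> borel_measurable borel"
 by (intro borel_measurable_continuous_onI continuous_intros)

lemma distr_emb: "distr lborel borel (emb :: (real^'n) \<times> real \<Rightarrow> _) = lborel"
proof (rule lborel_eqI[symmetric])
 fix l u :: "real^('n idx)" assume le: "\<And>b. b \<in> Basis \<Longrightarrow> l \<bullet> b \<le> u \<bullet> b"
 have eb: "emb b \<in> Basis" if "b \<in> Basis" for b :: "(real^'n) \<times> real" using that emb_Basis by (auto simp: bij_betw_def)
 have pb: "prj w \<bullet> b = w \<bullet> emb b" for w and b :: "(real^'n) \<times> real" using emb_inner[of "prj w" b] by simp
 have "emb -` box l u = box (prj l) (prj u)"
 proof -
  have "emb x \<in> box l u \<longleftrightarrow> x \<in> box (prj l) (prj u)" for x :: "(real^'n) \<times> real"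
  proof -
   have "emb x \<in> box l u \<longleftrightarrow> (\<forall>w\<in>emb ` Basis. l \<bullet> w < emb x \<bullet> w \<and> emb x \<bullet> w < u \<bullet> w)"
    unfolding bij_betw_imp_surj_on[OF emb_Basis] by (simp add: box_def)
   also have "\<dots> \<longleftrightarrow> x \<in> box (prj l) (prj u)" by (simp add: box_def pb)
   finally show ?thesis .
  qed
  then show ?thesis by auto
 qed
 then have "emeasure (distr lborel borel (emb :: (real^'n) \<times> real \<Rightarrow> _)) (box l u) = emeasure lborel (box (prj l) (prj u))"
  by (simp add: emeasure_distr)
 also have "\<dots> = ennreal (\<Prod>b\<in>Basis. (prj u - prj l) \<bullet> b)"
  by (rule emeasure_lborel_box) (simp add: pb le eb)
 also have "(\<Prod>b\<in>Basis. (prj u - prj l) \<bullet> b) = (\<Prod>b\<in>Basis. (u - l) \<bullet> emb b)"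
  by (simp add: pb inner_diff_left)
 also have "\<dots> = (\<Prod>b\<in>Basis. (u - l) \<bullet> b)" by (rule prod.reindex_bij_betw[OF emb_Basis])
 finally show "emeasure (distr lborel borel (emb :: (real^'n) \<times> real \<Rightarrow> _)) (box l u) = ennreal (\<Prod>b\<in>Basis. (u - l) \<bullet> b)" .
qed simp

lemma emb_image_vimage: "emb ` S = prj -` S"
 by (auto simp: image_iff) (metis emb_prj)

lemma emb_image_borel: "S \<in> sets borel \<Longrightarrow> emb ` S \<in> sets borel"
 using measurable_sets[OF prj_measurable, of S] by (simp add: emb_image_vimage)

lemma emeasure_emb_image: "S \<in> sets borel \<Longrightarrow> emeasure lborel (emb ` S) = emeasure lborel S"
 by (subst distr_emb[symmetric])
   (simp add: emeasure_distr emb_image_borel inj_vimage_image_eq[OF inj_emb])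

lemma vol_emb: "compact S \<Longrightarrow> vol (emb ` S) = vol S"
 by (simp add: emeasure_emb_image measure_def emeasure_completion compact_imp_closed borel_closed
   closed_injective_linear_image inj_emb linear_emb)

lemma compact_emb: "compact S \<Longrightarrow> compact (emb ` S)"
 by (intro compact_continuous_image continuous_intros)

lemma interior_emb: "interior (emb ` S) = emb ` interior S"
 by (rule interior_bijective_linear_image[OF linear_emb bij_emb])

lemma closure_emb: "closure (emb ` S) = emb ` closure S"
 by (rule closure_injective_linear_image[OF linear_emb inj_emb, symmetric])

lemma frontier_emb: "frontier (emb ` S) = emb ` frontier S"
 by (simp add: frontier_def interior_emb closure_emb image_set_diff inj_emb)

lemma convex_body_emb: "convex_body A \<Longrightarrow> convex_body (emb ` A)"
 by (simp add: convex_body_def convex_linear_image linear_emb interior_emb compact_emb)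

lemma dsum_emb: "dsum (emb ` A) t (emb ` B) = emb ` dsum A t B"
 by (rule dsum_linear_image[OF linear_emb])

lemma msum_emb: "msum I c (\<lambda>i. emb ` K i) = emb ` msum I c K"
proof (intro set_eqI iffI)
 fix z assume "z \<in> msum I c (\<lambda>i. emb ` K i)"
 then obtain x where x: "z = (\<Sum>i\<in>I. c i *\<^sub>R x i)" "\<forall>i\<in>I. x i \<in> emb ` K i" by (auto simp: msum_def)
 have "z = emb (\<Sum>i\<in>I. c i *\<^sub>R prj (x i))"
  by (simp add: x(1) linear_sum[OF linear_emb] linear_scale[OF linear_emb])
 moreover have "\<forall>i\<in>I. prj (x i) \<in> K i" using x(2) by auto
 ultimately show "z \<in> emb ` msum I c K" by (auto simp: msum_def)
next
 fix z assume "z \<in> emb ` msum I c K"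
 then obtain x where x: "z = emb (\<Sum>i\<in>I. c i *\<^sub>R x i)" "\<forall>i\<in>I. x i \<in> K i" by (auto simp: msum_def)
 then have "z = (\<Sum>i\<in>I. c i *\<^sub>R emb (x i))" by (simp add: linear_sum[OF linear_emb] linear_scale[OF linear_emb])
 then show "z \<in> msum I c (\<lambda>i. emb ` K i)" using x(2) by (auto simp: msum_def)
qed

lemma homothetic_emb:
 assumes "\<exists>c>0. \<exists>b. emb ` A = (\<lambda>x. c *\<^sub>R x + b) ` emb ` B"
 shows "\<exists>c>0. \<exists>b. A = (\<lambda>x. c *\<^sub>R x + b) ` B"
proof -
 from assms obtain c b where cb: "c > 0" "emb ` A = (\<lambda>x. c *\<^sub>R x + b) ` emb ` B" by auto
 have "c *\<^sub>R emb x + b = emb (c *\<^sub>R x + prj b)" for x by (simp add: linear_add[OF linear_emb] linear_scale[OF linear_emb])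
 then have "emb ` A = emb ` (\<lambda>x. c *\<^sub>R x + prj b) ` B" using cb(2) by (simp add: image_image)
 then have "A = (\<lambda>x. c *\<^sub>R x + prj b) ` B" by (simp add: inj_image_eq_iff[OF inj_emb])
 then show ?thesis using cb(1) by blast
qed

lemma mixcoef_emb: "compact A \<Longrightarrow> compact B \<Longrightarrow> mixcoef (emb ` A) (emb ` B) = mixcoef A B"
 for A :: "((real^'n) \<times> real) set"
proof -
 assume "compact A" "compact B"
 then have "vol (dsum (emb ` A) t (emb ` B)) = vol (dsum A t B)" for t
  by (simp add: dsum_emb vol_emb dsum_compact)
 then show ?thesis by (simp add: mixcoef_def card_idx)
qed

lemma minkb_emb: "compact A \<Longrightarrow> compact B \<Longrightarrow> minkb (emb ` A) (emb ` B) j = minkb A B j"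
 for A :: "((real^'n) \<times> real) set"
 by (simp add: minkb_def vol_emb card_idx)

lemma convex_body_compact: "convex_body A \<Longrightarrow> compact A" by (simp add: convex_body_def)

lemma vol_dsum_mixcoef:
 fixes A B :: "((real^'n) \<times> real) set"
 assumes "convex_body A" "convex_body B" "t > 0"
 shows "vol (dsum A t B) = (\<Sum>j\<le>CARD('n) + 1. mixcoef A B j * t ^ j)"
 using measure_dsum_mixcoef[OF convex_body_emb[OF assms(1)] convex_body_emb[OF assms(2)] assms(3)] assms
 by (simp add: mixcoef_emb convex_body_compact dsum_emb vol_emb dsum_compact card_idx)

lemma minkowski_inequality:
 fixes A B :: "((real^'n) \<times> real) set"
 assumes "convex_body A" "convex_body B" "j \<le> CARD('n) + 1"
 shows "minkb A B j \<le> mixcoef A B j"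
 using minkowski_mixcoef[OF convex_body_emb[OF assms(1)] convex_body_emb[OF assms(2)], of j] assms
 by (simp add: mixcoef_emb minkb_emb convex_body_compact card_idx)

lemma minkowski_equality:
 fixes A B :: "((real^'n) \<times> real) set"
 assumes "convex_body A" "convex_body B" "0 < j" "j < CARD('n) + 1" "mixcoef A B j = minkb A B j"
 shows "\<exists>c>0. \<exists>b. A = (\<lambda>x. c *\<^sub>R x + b) ` B"
 by (rule homothetic_emb, rule minkowski_mixcoef_eq[OF convex_body_emb[OF assms(1)] convex_body_emb[OF assms(2)] assms(3)])
   (use assms in \<open>simp_all add: mixcoef_emb minkb_emb convex_body_compact card_idx\<close>)

lemma negligible_emb: "compact A \<Longrightarrow> negligible (frontier A) \<Longrightarrow> negligible (frontier (emb ` A))"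
 for A :: "((real^'n) \<times> real) set"
proof -
 assume A: "compact A" "negligible (frontier A)"
 have c: "compact (frontier A)" using A(1) by (rule compact_frontier)
 have "emeasure lborel (emb ` frontier A) = 0"
  using A c by (simp add: emeasure_emb_image borel_compact negligible_iff_emeasure0 emeasure_completion)
 then show ?thesis
  using c by (simp add: negligible_iff_emeasure0 frontier_emb emeasure_completion borel_compact compact_emb)
qed

lemma brunn_minkowski_first_order:
 fixes A B :: "((real^'n) \<times> real) set"
 assumes A: "compact A" "negligible (frontier A)" "0 < vol A" and B: "convex_body B" and t: "t > 0"
 shows "bmf (CARD('n) + 1) t (vol A) (vol B) \<le> vol (dsum A t B)"
 using bm_compact[OF compact_emb[OF A(1)] negligible_emb[OF A(1,2)] _ convex_body_emb[OF B] t] assms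
 by (simp add: vol_emb convex_body_compact card_idx dsum_emb dsum_compact)

lemma brunn_minkowski_first_order_eq:
 fixes A B :: "((real^'n) \<times> real) set"
 assumes A: "compact A" "negligible (frontier A)" "0 < vol A" "connected (interior A)" "A \<subseteq> closure (interior A)" and B: "convex_body B"
  and eq: "\<And>eps. eps > 0 \<Longrightarrow> \<exists>\<^sub>F t in at_right 0. vol (dsum A t B) \<le> bmf (CARD('n) + 1) t (vol A) (vol B) + t * eps"
 shows "\<exists>c>0. \<exists>b. A = (\<lambda>x. c *\<^sub>R x + b) ` B"
proof (rule homothetic_emb, rule bm_derivative_eq[OF compact_emb[OF A(1)] negligible_emb[OF A(1,2)] _ _ _ convex_body_emb[OF B]])
 show "connected (interior (emb ` A))" unfolding interior_emb
  by (rule connected_continuous_image) (use A in \<open>auto intro!: continuous_intros\<close>)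
 show "emb ` A \<subseteq> closure (interior (emb ` A))" unfolding interior_emb closure_emb using A(5) by blast
 show "0 < vol (emb ` A)" using A by (simp add: vol_emb)
 have "CARD('n) \<noteq> 0" by simp
 then show "2 \<le> CARD('n idx)" by (simp add: card_idx)
qed (use assms in \<open>simp add: vol_emb convex_body_compact card_idx dsum_emb dsum_compact\<close>)

lemma polar_emb:
 assumes "\<And>K. K \<in> set Ks \<Longrightarrow> convex_body K"
 shows "polar (map ((`) emb) Ks) = polar (Ks :: ((real^'n) \<times> real) set list)"
proof -
 have "vol (msum S (\<lambda>_. 1) (\<lambda>i. map ((`) emb) Ks ! i)) = vol (msum S (\<lambda>_. 1) (\<lambda>i. Ks ! i))" if S: "S \<in> Pow {..<length Ks}" for S
 proof -
  have "msum S (\<lambda>_. 1) (\<lambda>i. map ((`) emb) Ks ! i) = emb ` msum S (\<lambda>_. 1) (\<lambda>i. Ks ! i)"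
   unfolding msum_emb[symmetric] by (rule msum_cong) (use S in auto)
  moreover have "compact (msum S (\<lambda>_. 1) (\<lambda>i. Ks ! i))"
  proof (rule msum_compact)
   show "finite S" using S by (auto intro: finite_subset)
  qed (use S assms nth_mem in \<open>auto simp: subset_iff intro: convex_body_compact\<close>)
  ultimately show ?thesis by (simp add: vol_emb)
 qed
 then show ?thesis by (simp add: polar_def)
qed

lemma vol_msum_polarization:
 fixes K :: "nat \<Rightarrow> ((real^'n) \<times> real) set"
 assumes K: "\<And>i. i < M \<Longrightarrow> convex_body (K i)" and c: "\<And>i. i < M \<Longrightarrow> 0 \<le> c i"
 shows "vol (msum {..<M} c K) = (\<Sum>L | set L \<subseteq> {..<M} \<and> length L = CARD('n) + 1. (\<Prod>i\<leftarrow>L. c i) * polar (map K L))"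
proof -
 have "vol (msum {..<M} c K) = vol (msum {..<M} c (\<lambda>i. emb ` K i))"
  unfolding msum_emb by (rule vol_emb[symmetric], rule msum_compact) (use K in \<open>auto intro: convex_body_compact\<close>)
 also have "\<dots> = (\<Sum>L | set L \<subseteq> {..<M} \<and> length L = CARD('n idx). (\<Prod>i\<leftarrow>L. c i) * polar (map (\<lambda>i. emb ` K i) L))"
  by (rule vol_msum_polar) (use assms in \<open>auto intro: convex_body_emb\<close>)
 also have "\<dots> = (\<Sum>L | set L \<subseteq> {..<M} \<and> length L = CARD('n) + 1. (\<Prod>i\<leftarrow>L. c i) * polar (map K L))"
 proof (rule sum.cong)
  fix L assume "L \<in> {L. set L \<subseteq> {..<M} \<and> length L = CARD('n) + 1}"
  then have "polar (map ((`) emb) (map K L)) = polar (map K L)" by (intro polar_emb) (use K in auto)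
  then show "(\<Prod>i\<leftarrow>L. c i) * polar (map (\<lambda>i. emb ` K i) L) = (\<Prod>i\<leftarrow>L. c i) * polar (map K L)" by (simp add: comp_def)
 qed (simp add: card_idx)
 finally show ?thesis .
qed

section \<open>Hypersurfaces in the half-space and their enclosed bodies\<close>

lemma inner_e_last [simp]: "x \<bullet> e_last = snd x"
 by (simp add: e_last_def inner_prod_def)

lemma upper_half_space_eq: "upper_half_space = {x. snd x > 0}"
 by (simp add: upper_half_space_def)

lemma upper_half_space_halfspace: "upper_half_space = {x. e_last \<bullet> x > 0}"
 by (simp add: upper_half_space_def inner_commute)

lemma e_last_nonzero: "e_last \<noteq> 0"
 by (simp add: e_last_def prod_eq_iff)

lemma closure_upper_half_space: "closure upper_half_space = {x. snd x \<ge> 0}"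
 unfolding upper_half_space_halfspace closure_halfspace_gt[OF e_last_nonzero] by (simp add: inner_commute[of e_last])

lemma wall_eq: "wall = {x. snd x = 0}"
 unfolding wall_def upper_half_space_halfspace frontier_halfspace_gt[OF disjI1, OF e_last_nonzero]
 by (simp add: inner_commute[of e_last])

lemma Ck_on_subset: "Ck_on k U f \<Longrightarrow> V \<subseteq> U \<Longrightarrow> Ck_on k V f"
 by (induction k arbitrary: f) (auto intro: continuous_on_subset)

lemma smooth_on_subset: "smooth_on U f \<Longrightarrow> V \<subseteq> U \<Longrightarrow> smooth_on V f"
 by (auto simp: smooth_on_def intro: Ck_on_subset)

text \<open>Turns the open side of a boundary chart into a chart without boundary, so that its
  images count as interior points of the manifold.\<close>

lemma local_param_interior:
 assumes lp: "local_param \<Sigma> psi U a"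
 shows "local_param \<Sigma> psi (U \<inter> {u. 0 < a \<bullet> u}) 0"
proof -
 let ?V = "U \<inter> {u. 0 < a \<bullet> u}"
 have U: "open U" "openin (top_of_set \<Sigma>) (psi ` chart_domain U a)" using lp by (auto simp: local_param_def)
 obtain phi where phi: "homeomorphism (chart_domain U a) (psi ` chart_domain U a) psi phi" using lp by (auto simp: local_param_def)
 have oV: "open ?V" using U(1) open_halfspace_gt[of 0 a] by (intro open_Int) auto
 have sub: "?V \<subseteq> chart_domain U a" by (auto simp: chart_domain_def)
 have cd: "chart_domain ?V 0 = ?V" by (auto simp: chart_domain_def)
 have "openin (top_of_set (chart_domain U a)) ?V" unfolding openin_open using oV sub by (intro exI[of _ ?V]) auto
 then have "openin (top_of_set (psi ` chart_domain U a)) (psi ` ?V)"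
  by (rule homeomorphism_imp_open_map[OF phi])
 then have "openin (top_of_set \<Sigma>) (psi ` ?V)" using U(2) by (rule openin_trans)
 moreover have "homeomorphism ?V (psi ` ?V) psi phi" by (rule homeomorphism_of_subsets[OF phi sub]) (use sub in auto)
 ultimately show ?thesis
  using lp oV unfolding local_param_def cd by (auto intro: smooth_on_subset)
qed

text \<open>A boundary point psi u is approached from the interior along psi (u + t a) with t >
  0.\<close>

lemma mfd_boundary_closure: "mfd_boundary \<Sigma> \<subseteq> closure (mfd_interior \<Sigma>)"
proof
 fix p assume "p \<in> mfd_boundary \<Sigma>"
 then obtain psi U a u where lp: "local_param \<Sigma> psi U a" and a: "a \<noteq> 0" and u: "u \<in> U" "a \<bullet> u = 0" and p: "p = psi u"
  by (auto simp: mfd_boundary_def)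
 have U: "open U" and cont: "continuous_on U psi"
  using lp unfolding local_param_def smooth_on_def by (auto dest: spec[of _ "0::nat"])
 have aa: "a \<bullet> a > 0" using a by simp
 have lim: "((\<lambda>t. u + t *\<^sub>R a) \<longlongrightarrow> u + 0 *\<^sub>R a) (at_right 0)" by (intro tendsto_intros)
 then have lim': "((\<lambda>t. u + t *\<^sub>R a) \<longlongrightarrow> u) (at_right 0)" by simp
 have "isCont psi u" using cont U u continuous_on_eq_continuous_at by blast
 then have lim2: "((\<lambda>t. psi (u + t *\<^sub>R a)) \<longlongrightarrow> psi u) (at_right 0)" using lim' by (rule isCont_tendsto_compose)
 have "\<forall>\<^sub>F t in at_right 0. u + t *\<^sub>R a \<in> U" using topological_tendstoD[OF lim' U u(1)] .
 then have ev: "\<forall>\<^sub>F t in at_right 0. psi (u + t *\<^sub>R a) \<in> mfd_interior \<Sigma>"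
  using eventually_at_right_less[of "0::real"]
 proof eventually_elim
  case (elim t)
  then have "u + t *\<^sub>R a \<in> U \<inter> {u. 0 < a \<bullet> u}" using u aa by (simp add: inner_add_right)
  then show ?case using local_param_interior[OF lp] by (auto simp: mfd_interior_def)
 qed
 show "p \<in> closure (mfd_interior \<Sigma>)"
 proof (rule Lim_in_closed_set[OF closed_closure _ _ lim2[folded p]])
  show "\<forall>\<^sub>F t in at_right 0. psi (u + t *\<^sub>R a) \<in> closure (mfd_interior \<Sigma>)"
   using ev by eventually_elim (use closure_subset in blast)
 qed simp
qed

text \<open>The open lower half-space is connected, unbounded and disjoint from the hypersurface and
  the wall, so no bounded component of the complement reaches into it.\<close>

lemma enclosed_domain_upper:
 assumes "hypersurface_in_half_space \<Sigma>"
 shows "enclosed_domain \<Sigma> \<subseteq> upper_half_space"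
proof
 fix x assume x: "x \<in> enclosed_domain \<Sigma>"
 let ?L = "{x :: (real^'a) \<times> real. snd x < 0}"
 have S: "snd y \<ge> 0" if "y \<in> \<Sigma> \<union> wall" for y
 proof -
  have "\<Sigma> \<subseteq> upper_half_space \<union> wall" using assms unfolding hypersurface_in_half_space_def by blast
  then show ?thesis using that by (auto simp: upper_half_space_eq wall_eq)
 qed
 have xw: "x \<notin> \<Sigma> \<union> wall" "bounded (connected_component_set (- (\<Sigma> \<union> wall)) x)" using x by (auto simp: enclosed_domain_def inside_def)
 have "\<not> snd x < 0"
 proof
  assume neg: "snd x < 0"
  have "?L = {x. e_last \<bullet> x < 0}" by (simp add: inner_commute[of e_last])
  then have "convex ?L" by (simp add: convex_halfspace_lt)
  then have "?L \<subseteq> connected_component_set (- (\<Sigma> \<union> wall)) x"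
   using S neg by (intro connected_component_maximal convex_connected) force+
  then have "bounded ?L" using xw(2) bounded_subset by blast
  then obtain B where B: "\<And>y. snd y < 0 \<Longrightarrow> norm (y :: (real^'a) \<times> real) \<le> B" unfolding bounded_iff by blast
  have "norm ((0, - (\<bar>B\<bar> + 1)) :: (real^'a) \<times> real) \<le> B" by (rule B) auto
  then show False by (simp add: norm_prod_def)
 qed
 moreover have "snd x \<noteq> 0" using xw by (simp add: wall_eq)
 ultimately show "x \<in> upper_half_space" by (simp add: upper_half_space_eq)
qed

lemma enclosed_body_upper:
 assumes "hypersurface_in_half_space \<Sigma>" "x \<in> enclosed_body \<Sigma>" shows "snd x \<ge> 0"
 using closure_mono[OF enclosed_domain_upper[OF assms(1)]] assms(2) by (auto simp: enclosed_body_def closure_upper_half_space)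

text \<open>Interior points are limits of x - t \<nu> x, which the outward normal places in the
  enclosed domain; boundary points are limits of interior points.\<close>

lemma hypersurface_subset_enclosed_body:
 assumes h: "hypersurface_in_half_space \<Sigma>" and n: "is_outward_normal \<Sigma> \<nu>"
 shows "\<Sigma> \<subseteq> enclosed_body \<Sigma>"
proof -
 have "mfd_interior \<Sigma> \<subseteq> enclosed_body \<Sigma>"
 proof
  fix x assume x: "x \<in> mfd_interior \<Sigma>"
  have ev: "\<forall>\<^sub>F t in at_right 0. x - t *\<^sub>R \<nu> x \<in> enclosed_body \<Sigma>"
  proof -
   have "\<forall>\<^sub>F t in at_right 0. x - t *\<^sub>R \<nu> x \<in> enclosed_domain \<Sigma> \<and> x + t *\<^sub>R \<nu> x \<notin> enclosed_body \<Sigma>"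
    using n x unfolding is_outward_normal_def by blast
   then show ?thesis by eventually_elim (auto simp: enclosed_body_def intro: closure_subset[THEN subsetD])
  qed
  have "((\<lambda>t. x - t *\<^sub>R \<nu> x) \<longlongrightarrow> x - 0 *\<^sub>R \<nu> x) (at_right 0)" by (intro tendsto_intros)
  then have "((\<lambda>t. x - t *\<^sub>R \<nu> x) \<longlongrightarrow> x) (at_right 0)" by simp
  then show "x \<in> enclosed_body \<Sigma>"
   by (rule Lim_in_closed_set[rotated 3]) (use ev in \<open>auto simp: enclosed_body_def\<close>)
 qed
 then have "closure (mfd_interior \<Sigma>) \<subseteq> enclosed_body \<Sigma>"
  by (rule closure_minimal) (simp add: enclosed_body_def)
 then show ?thesis using h mfd_boundary_closure[of \<Sigma>] \<open>mfd_interior \<Sigma> \<subseteq> enclosed_body \<Sigma>\<close>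
  unfolding hypersurface_in_half_space_def by blast
qed

text \<open>Here the nonempty manifold boundary enters: it lies on the wall and belongs to the
  body.\<close>

lemma enclosed_body_touches:
 assumes "capillary_hypersurface \<theta> \<Sigma>"
 shows "\<exists>x\<in>enclosed_body \<Sigma>. snd x = 0"
proof -
 have h: "hypersurface_in_half_space \<Sigma>" using assms by (simp add: capillary_hypersurface_def)
 obtain \<nu> where "is_outward_normal \<Sigma> \<nu>" using assms by (auto simp: capillary_hypersurface_def)
 from hypersurface_subset_enclosed_body[OF h this] show ?thesis
  using h unfolding hypersurface_in_half_space_def wall_eq by blast
qed

lemma capillary_convex_bodyD:
 assumes "K \<in> capillary_convex_bodies \<theta>"
 shows "convex_body K" "\<And>x. x \<in> K \<Longrightarrow> snd x \<ge> 0" "\<exists>x\<in>K. snd x = 0"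
proof -
 from assms obtain \<Sigma> where \<Sigma>: "K = enclosed_body \<Sigma>" "capillary_hypersurface \<theta> \<Sigma>" "convex_body K"
  unfolding capillary_convex_bodies_def convex_body_def by blast
 then show "convex_body K" "\<And>x. x \<in> K \<Longrightarrow> snd x \<ge> 0" "\<exists>x\<in>K. snd x = 0"
  using enclosed_body_upper[of \<Sigma>] enclosed_body_touches[OF \<Sigma>(2)] by (simp_all add: capillary_hypersurface_def)
qed

text \<open>Both sets have minimal height 0. A homothety multiplies the minimal height by c and adds
  snd b, so snd b = 0.\<close>

lemma homothety_in_wall:
 assumes K: "\<And>x. x \<in> K \<Longrightarrow> snd x \<ge> 0" "\<exists>x\<in>K. snd x = 0"
  and L: "\<And>x. x \<in> L \<Longrightarrow> snd x \<ge> 0" "\<exists>x\<in>L. snd x = 0"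
  and eq: "\<exists>c>0. \<exists>b. K = (\<lambda>x. c *\<^sub>R x + b) ` L"
 shows "\<exists>c>0. \<exists>b\<in>wall. K = (\<lambda>x. c *\<^sub>R x + b) ` L"
proof -
 obtain c b where cb: "c > 0" "K = (\<lambda>x. c *\<^sub>R x + b) ` L" using eq by blast
 obtain x where x: "x \<in> L" "snd x = 0" using L(2) by blast
 have "c *\<^sub>R x + b \<in> K" using cb x by blast
 then have 1: "snd b \<ge> 0" using K(1)[of "c *\<^sub>R x + b"] x by simp
 obtain y where y: "y \<in> L" "snd (c *\<^sub>R y + b) = 0" using K(2) cb by blast
 then have "c * snd y + snd b = 0" by simp
 moreover have "c * snd y \<ge> 0" using L(1)[OF y(1)] cb(1) by simp
 ultimately have "snd b = 0" using 1 by linarith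
 then have "b \<in> wall" by (simp add: wall_eq)
 then show ?thesis using cb by blast
qed

section \<open>Mixed volumes of capillary convex bodies\<close>

lemma Vol_eq_vol: "compact S \<Longrightarrow> Vol S = vol S"
 by (simp add: measure_def emeasure_completion borel_compact)

lemma minkowski_combination_msum: "minkowski_combination m c K = msum {..<m} c K"
 by (simp add: minkowski_combination_def msum_def Ball_def)

text \<open>Existence of a functional with the defining properties, without which the choice in
  \<open>mixed_volume\<close> would say nothing.\<close>

theorem is_mixed_volume_polar: "is_mixed_volume \<theta> polar"
 unfolding is_mixed_volume_def
proof (intro conjI allI impI)
 fix m and K :: "nat \<Rightarrow> ((real^'a) \<times> real) set" and c :: "nat \<Rightarrow> real" assume a: "\<forall>i<m. K i \<in> capillary_convex_bodies \<theta> \<and> 0 \<le> c i"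
 then have K: "convex_body (K i)" if "i < m" for i using that capillary_convex_bodyD by blast
 have "compact (msum {..<m} c K)" by (rule msum_compact) (use K in \<open>auto intro: convex_body_compact\<close>)
 then show "Vol (minkowski_combination m c K) = (\<Sum>I | set I \<subseteq> {..<m} \<and> length I = CARD('a) + 1. (\<Prod>i\<leftarrow>I. c i) * polar (map K I))"
  unfolding minkowski_combination_msum using vol_msum_polarization[of m K c] K a by (simp add: Vol_eq_vol)
qed (rule polar_mset)

lemma is_mixed_volume_mixed_volume: "is_mixed_volume \<theta> (mixed_volume \<theta>)"
 unfolding mixed_volume_def by (rule someI[of "is_mixed_volume \<theta>", OF is_mixed_volume_polar])

lemma msum_two: "msum {..<2::nat} (\<lambda>i. if i = 0 then 1 else t) (\<lambda>i. if i = 0 then K else L) = dsum K t L"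
proof (intro set_eqI iffI)
 have two: "{..<2::nat} = {0, Suc 0}" by auto
 show "z \<in> dsum K t L" if "z \<in> msum {..<2::nat} (\<lambda>i. if i = 0 then 1 else t) (\<lambda>i. if i = 0 then K else L)" for z
  using that by (auto simp: msum_def two dsum_def split: if_splits)
 show "z \<in> msum {..<2::nat} (\<lambda>i. if i = 0 then 1 else t) (\<lambda>i. if i = 0 then K else L)" if "z \<in> dsum K t L" for z
 proof -
  from that obtain x y where "z = x + t *\<^sub>R y" "x \<in> K" "y \<in> L" by (auto simp: dsum_def)
  then show ?thesis unfolding msum_def two by (intro CollectI exI[of _ "\<lambda>i. if i = 0 then x else y"]) auto
 qed
qed

lemma mset_binary_list:
 assumes "set I \<subseteq> {..<2::nat}"
 shows "mset I = mset (replicate (length I - length (filter (\<lambda>i. i = 1) I)) 0 @ replicate (length (filter (\<lambda>i. i = 1) I)) 1)"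
 using assms
proof (induction I)
 case (Cons i I)
 have "length (filter (\<lambda>i. i = 1) I) \<le> length I" by simp
 moreover have "i = 0 \<or> i = 1" using Cons.prems by auto
 ultimately show ?case using Cons by (auto simp: Suc_diff_le)
qed simp

text \<open>A list over {0, 1} corresponds to the set of positions of its ones; these sets are then
  grouped by cardinality.\<close>

lemma sum_binary_lists:
 fixes f :: "nat \<Rightarrow> real"
 shows "(\<Sum>I | set I \<subseteq> {..<2::nat} \<and> length I = m. f (length (filter (\<lambda>i. i = 1) I))) = (\<Sum>j\<le>m. real (m choose j) * f j)"
proof -
 have "(\<Sum>I | set I \<subseteq> {..<2::nat} \<and> length I = m. f (length (filter (\<lambda>i. i = 1) I))) = (\<Sum>S\<in>Pow {..<m}. f (card S))"
 proof (rule sum.reindex_bij_witness[where j="\<lambda>I. {p. p < m \<and> I ! p = 1}" and i="\<lambda>S. map (\<lambda>p. if p \<in> S then 1 else 0) [0..<m]"])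
  fix I :: "nat list" assume I: "I \<in> {I. set I \<subseteq> {..<2} \<and> length I = m}"
  have "I ! p = 0 \<or> I ! p = 1" if "p < m" for p
   using I nth_mem[of p I] that by (auto simp: subset_iff less_2_cases_iff)
  then show "map (\<lambda>p. if p \<in> {p. p < m \<and> I ! p = 1} then 1 else 0) [0..<m] = I"
   using I by (intro nth_equalityI) auto
  show "f (card {p. p < m \<and> I ! p = 1}) = f (length (filter (\<lambda>i. i = 1) I))"
   using I by (simp add: length_filter_conv_card)
 next
  fix S assume "S \<in> Pow {..<m}"
  then show "{p. p < m \<and> map (\<lambda>p. if p \<in> S then 1 else 0) [0..<m] ! p = (1::nat)} = S" by (auto split: if_splits)
 qed auto
 also have "\<dots> = (\<Sum>j\<le>m. \<Sum>S | S \<in> Pow {..<m} \<and> card S = j. f (card S))"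
  by (rule sum.group[symmetric]) (auto intro: card_mono[of "{..<m}", simplified])
 also have "\<dots> = (\<Sum>j\<le>m. real (m choose j) * f j)"
  by (intro sum.cong refl) (simp add: n_subsets[of "{..<m}", simplified])
 finally show ?thesis .
qed

text \<open>By symmetry the defining expansion for \<open>K\<close> and \<open>L\<close> with
  weights 1 and t groups into a polynomial in t, whose coefficients are compared with those of vol
  (K + t L).\<close>

lemma mixed_volume_mixcoef:
 fixes K L :: "((real^'n) \<times> real) set"
 assumes K: "K \<in> capillary_convex_bodies \<theta>" and L: "L \<in> capillary_convex_bodies \<theta>" and j: "j \<le> CARD('n) + 1"
 shows "real (CARD('n) + 1 choose j) * mixed_volume \<theta> (replicate (CARD('n) + 1 - j) K @ replicate j L) = mixcoef K L j"
proof -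
 let ?m = "CARD('n) + 1" and ?V = "mixed_volume \<theta> :: ((real^'n) \<times> real) set list \<Rightarrow> real"
 let ?W = "\<lambda>j. ?V (replicate (?m - j) K @ replicate j L)" and ?K = "\<lambda>i::nat. if i = 0 then K else L"
 note V = is_mixed_volume_mixed_volume[of \<theta>, where 'a='n, unfolded is_mixed_volume_def]
 have sym: "?V (map ?K I) = ?W (length (filter (\<lambda>i. i = 1) I))" if I: "set I \<subseteq> {..<2}" "length I = ?m" for I
 proof (rule V[THEN conjunct1, rule_format])
  show "set (map ?K I) \<subseteq> capillary_convex_bodies \<theta>" using K L by auto
  show "mset (map ?K I) = mset (replicate (?m - length (filter (\<lambda>i. i = 1) I)) K @ replicate (length (filter (\<lambda>i. i = 1) I)) L)"
   using arg_cong[OF mset_binary_list[OF I(1)], of "image_mset ?K"] I by simp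
 qed (use I in simp)
 have "(\<Sum>j\<le>?m. (real (?m choose j) * ?W j) * t ^ j) = (\<Sum>j\<le>?m. mixcoef K L j * t ^ j)" if t: "t > 0" for t
 proof -
  let ?c = "\<lambda>i::nat. if i = 0 then 1 else t"
  have prod: "(\<Prod>i\<leftarrow>I. ?c i) = t ^ length (filter (\<lambda>i. i = 1) I)" if "set I \<subseteq> {..<2}" for I
   using that by (induction I) auto
  have "(\<Sum>j\<le>?m. (real (?m choose j) * ?W j) * t ^ j) = (\<Sum>j\<le>?m. real (?m choose j) * (t ^ j * ?W j))"
   by (simp add: mult_ac)
  also have "\<dots> = (\<Sum>I | set I \<subseteq> {..<2::nat} \<and> length I = ?m. t ^ length (filter (\<lambda>i. i = 1) I) * ?W (length (filter (\<lambda>i. i = 1) I)))"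
   by (rule sum_binary_lists[symmetric])
  also have "\<dots> = (\<Sum>I | set I \<subseteq> {..<2::nat} \<and> length I = ?m. (\<Prod>i\<leftarrow>I. ?c i) * ?V (map ?K I))"
   by (intro sum.cong refl) (simp only: mem_Collect_eq prod sym)
  also have "\<dots> = Vol (minkowski_combination 2 ?c ?K)"
   by (rule V[THEN conjunct2, rule_format, symmetric]) (use K L t in auto)
  also have "\<dots> = vol (dsum K t L)"
   unfolding minkowski_combination_msum msum_two using capillary_convex_bodyD(1) K L
   by (intro Vol_eq_vol dsum_compact convex_body_compact) auto
  also have "\<dots> = (\<Sum>j\<le>?m. mixcoef K L j * t ^ j)"
   using capillary_convex_bodyD(1) K L t by (intro vol_dsum_mixcoef) auto
  finally show ?thesis .
 qed
 from coeffs_unique_pos[OF this j] show ?thesis .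
qed

lemma powr_ratio_split:
 fixes V W :: real
 assumes "V > 0" "W > 0" "m > 0" "k + j = m"
 shows "V * (W / V) powr (j / m) = V powr (k / m) * W powr (j / m)"
proof -
 have "k / m = 1 - j / m" using assms by (simp add: field_simps)
 then have "V powr (k / m) = V powr (1 - j / m)" by simp
 also have "\<dots> = V / V powr (j / m)" using assms by (simp add: powr_diff)
 finally show ?thesis using assms by (simp add: powr_divide)
qed

lemma dsum_homothetic:
 assumes "convex L" "c > 0" "t > 0"
 shows "dsum ((\<lambda>x. c *\<^sub>R x + b) ` L) t L = (\<lambda>x. (c + t) *\<^sub>R x + b) ` L"
proof (intro set_eqI iffI)
 fix z assume "z \<in> dsum ((\<lambda>x. c *\<^sub>R x + b) ` L) t L"
 then obtain x y where xy: "x \<in> L" "y \<in> L" "z = c *\<^sub>R x + b + t *\<^sub>R y" by (auto simp: dsum_def)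
 let ?w = "(c / (c + t)) *\<^sub>R x + (t / (c + t)) *\<^sub>R y"
 have ct: "c + t \<noteq> 0" using assms by simp
 have "?w \<in> L" using assms xy ct by (intro convexD) (auto simp: add_divide_distrib[symmetric])
 moreover have "z = (c + t) *\<^sub>R ?w + b" using xy ct by (simp add: scaleR_add_right)
 ultimately show "z \<in> (\<lambda>x. (c + t) *\<^sub>R x + b) ` L" by blast
next
 fix z assume "z \<in> (\<lambda>x. (c + t) *\<^sub>R x + b) ` L"
 then obtain x where "x \<in> L" "z = c *\<^sub>R x + b + t *\<^sub>R x" by (auto simp: algebra_simps)
 then show "z \<in> dsum ((\<lambda>x. c *\<^sub>R x + b) ` L) t L" by (auto simp: dsum_def)
qed

text \<open>By convexity K + t L = (c + t) L + b, so the volume is a power of c + t times vol L and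
  the binomial theorem gives the coefficients.\<close>

lemma mixcoef_homothetic:
 fixes L :: "((real^'n) \<times> real) set"
 assumes L: "convex_body L" and c: "c > 0" and K: "convex_body K" "K = (\<lambda>x. c *\<^sub>R x + b) ` L" and j: "j \<le> CARD('n) + 1"
 shows "mixcoef K L j = real (CARD('n) + 1 choose j) * c ^ (CARD('n) + 1 - j) * vol L"
proof (rule coeffs_unique_pos[OF _ j, where b="\<lambda>j. real (CARD('n) + 1 choose j) * c ^ (CARD('n) + 1 - j) * vol L"])
 fix t :: real assume t: "t > 0"
 have "(\<Sum>j\<le>CARD('n) + 1. mixcoef K L j * t ^ j) = vol (dsum K t L)" by (rule vol_dsum_mixcoef[OF K(1) L t, symmetric])
 also have "\<dots> = (t + c) ^ (CARD('n) + 1) * vol L"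
  unfolding K(2) using L c t by (subst dsum_homothetic) (simp_all add: convex_body_def vol_affine add.commute[of c])
 also have "\<dots> = (\<Sum>j\<le>CARD('n) + 1. real (CARD('n) + 1 choose j) * c ^ (CARD('n) + 1 - j) * vol L * t ^ j)"
  unfolding binomial_ring sum_distrib_right by (intro sum.cong refl) (simp add: mult_ac)
 finally show "(\<Sum>j\<le>CARD('n) + 1. mixcoef K L j * t ^ j) = (\<Sum>j\<le>CARD('n) + 1. real (CARD('n) + 1 choose j) * c ^ (CARD('n) + 1 - j) * vol L * t ^ j)" .
qed

text \<open>The k + 1 copies of \<open>L\<close> select the coefficient j = k + 1, and k < CARD('n)
  puts this j strictly between 0 and the dimension, as the equality case demands.\<close>

theorem mixed_volume_inequality:
 fixes K L :: "((real^'n) \<times> real) set"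
 assumes K: "K \<in> capillary_convex_bodies \<theta>" and L: "L \<in> capillary_convex_bodies \<theta>" and k: "k < CARD('n)"
 defines "V \<equiv> mixed_volume \<theta> (replicate (CARD('n) - k) K @ replicate (k + 1) L)"
  and "R \<equiv> Vol K powr (real (CARD('n) - k) / (real CARD('n) + 1)) * Vol L powr (real (k + 1) / (real CARD('n) + 1))"
 shows "V \<ge> R" and "V = R \<longleftrightarrow> (\<exists>c>0. \<exists>b\<in>wall. K = (\<lambda>x. c *\<^sub>R x + b) ` L)"
proof -
 let ?m = "CARD('n) + 1"
 note KD = capillary_convex_bodyD[OF K] and LD = capillary_convex_bodyD[OF L]
 have vK: "vol K > 0" "vol L > 0" using KD(1) LD(1) convex_body_vol_pos by auto
 have vol: "Vol K = vol K" "Vol L = vol L" using KD(1) LD(1) by (auto intro: Vol_eq_vol convex_body_compact)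
 have "?m - (k + 1) = CARD('n) - k" by simp
 then have mv: "real (?m choose (k + 1)) * V = mixcoef K L (k + 1)" using mixed_volume_mixcoef[OF K L, of "k + 1"] k by (simp add: V_def)
 have "vol K * (vol L / vol K) powr (real (k + 1) / (real CARD('n) + 1)) = R"
  unfolding R_def vol by (rule powr_ratio_split) (use vK k in \<open>auto simp: of_nat_diff\<close>)
 then have mb: "minkb K L (k + 1) = real (?m choose (k + 1)) * R"
  by (simp add: minkb_def mult_ac add.commute)
 have ch: "real (?m choose (k + 1)) > 0" using k by (simp add: zero_less_binomial_iff del: binomial_Suc_Suc)
 have "minkb K L (k + 1) \<le> mixcoef K L (k + 1)" by (rule minkowski_inequality[OF KD(1) LD(1)]) (use k in simp)
 then show "R \<le> V" unfolding mb mv[symmetric] using ch mult_le_cancel_left_pos by blast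
 show "V = R \<longleftrightarrow> (\<exists>c>0. \<exists>b\<in>wall. K = (\<lambda>x. c *\<^sub>R x + b) ` L)"
 proof
  assume "V = R"
  then have "mixcoef K L (k + 1) = minkb K L (k + 1)" unfolding mb mv[symmetric] by simp
  then have "\<exists>c>0. \<exists>b. K = (\<lambda>x. c *\<^sub>R x + b) ` L" by (intro minkowski_equality[OF KD(1) LD(1), of "k + 1"]) (use k in auto)
  then show "\<exists>c>0. \<exists>b\<in>wall. K = (\<lambda>x. c *\<^sub>R x + b) ` L" by (intro homothety_in_wall KD LD)
 next
  assume "\<exists>c>0. \<exists>b\<in>wall. K = (\<lambda>x. c *\<^sub>R x + b) ` L"
  then obtain c b where c: "c > 0" and Kc: "K = (\<lambda>x. c *\<^sub>R x + b) ` L" by blast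
  have "vol K = c ^ ?m * vol L" unfolding Kc vol_affine using c by simp
  then have VK: "vol K = c powr (real CARD('n) + 1) * vol L" using c by (simp add: powr_realpow[symmetric] powr_add)
  have "R = c powr real (CARD('n) - k) * (vol L powr (real (CARD('n) - k) / (real CARD('n) + 1)) * vol L powr (real (k + 1) / (real CARD('n) + 1)))"
   unfolding R_def vol VK using c vK by (simp add: powr_mult powr_powr)
  also have "vol L powr (real (CARD('n) - k) / (real CARD('n) + 1)) * vol L powr (real (k + 1) / (real CARD('n) + 1)) = vol L"
  proof -
   have "real (CARD('n) - k) / (real CARD('n) + 1) + real (k + 1) / (real CARD('n) + 1) = 1"
    using k by (simp add: add_divide_distrib[symmetric] of_nat_diff)
   then show ?thesis using vK by (simp only: powr_add[symmetric]) simp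
  qed
  also have "c powr real (CARD('n) - k) = c ^ (CARD('n) - k)" using c by (rule powr_realpow)
  finally have R: "R = c ^ (CARD('n) - k) * vol L" .
  have "mixcoef K L (k + 1) = real (?m choose (k + 1)) * c ^ (?m - (k + 1)) * vol L"
   by (rule mixcoef_homothetic[OF LD(1) c KD(1) Kc]) (use k in simp)
  then have "real (?m choose (k + 1)) * V = real (?m choose (k + 1)) * R" using mv R by simp
  then show "V = R" using ch mult_cancel_left[of "real (?m choose (k + 1))" V R] by linarith
 qed
qed

section \<open>Star-shaped capillary hypersurfaces\<close>

text \<open>\<open>rho\<close> is a mere function here; its regularity is recovered from compactness
  in \<open>continuous_on_rad\<close>. The condition x \<bullet> \<nu> x > 0 says that rays cross
  the hypersurface transversally.\<close>

locale star_hypersurface =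
 fixes \<Sigma> :: "((real^'n) \<times> real) set" and rho :: "(real^'n) \<times> real \<Rightarrow> real" and \<nu> :: "(real^'n) \<times> real \<Rightarrow> (real^'n) \<times> real"
 assumes hyp: "hypersurface_in_half_space \<Sigma>" and normal: "is_outward_normal \<Sigma> \<nu>"
  and rho_pos: "\<And>z. norm z = 1 \<Longrightarrow> snd z \<ge> 0 \<Longrightarrow> rho z > 0"
  and Sigma_eq: "\<Sigma> = (\<lambda>z. rho z *\<^sub>R z) ` {z. norm z = 1 \<and> snd z \<ge> 0}"
  and nu_pos: "\<And>x. x \<in> \<Sigma> \<Longrightarrow> x \<bullet> \<nu> x > 0"
begin

definition Q :: "((real^'n) \<times> real) set" where "Q = {x. snd x \<ge> 0 \<and> x \<noteq> 0}"
text \<open>The point where the ray through x meets the hypersurface; \<open>gau\<close> is then the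
  gauge (Minkowski functional) of the enclosed body.\<close>

definition "rad x = rho (x /\<^sub>R norm x) *\<^sub>R (x /\<^sub>R norm x)"
definition "gau x = norm x / norm (rad x)"
abbreviation "K \<equiv> enclosed_body \<Sigma>"
abbreviation "D \<equiv> enclosed_domain \<Sigma>"

lemma compact_Sigma: "compact \<Sigma>" using hyp by (simp add: hypersurface_in_half_space_def)

lemma Q_dir: "x \<in> Q \<Longrightarrow> norm (x /\<^sub>R norm x) = 1 \<and> snd (x /\<^sub>R norm x) \<ge> 0"
 by (simp add: Q_def)

lemma rad_mem: "x \<in> Q \<Longrightarrow> rad x \<in> \<Sigma>"
 using Q_dir unfolding rad_def Sigma_eq by blast

lemma Sigma_Q: "\<Sigma> \<subseteq> Q"
proof
 fix x assume "x \<in> \<Sigma>"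
 then obtain z where z: "norm z = 1" "snd z \<ge> 0" "x = rho z *\<^sub>R z" unfolding Sigma_eq by blast
 then show "x \<in> Q" using rho_pos[OF z(1,2)] by (auto simp: Q_def)
qed

lemma rad_scale: "s > 0 \<Longrightarrow> rad (s *\<^sub>R x) = rad x"
 by (simp add: rad_def field_simps)

lemma rad_Sigma: assumes "x \<in> \<Sigma>" shows "rad x = x"
proof -
 obtain z where z: "norm z = 1" "snd z \<ge> 0" "x = rho z *\<^sub>R z" using assms by (auto simp: Sigma_eq)
 then show ?thesis using rho_pos[OF z(1,2)] by (simp add: rad_scale) (simp add: rad_def)
qed

lemma rad_ne: "x \<in> Q \<Longrightarrow> rad x \<noteq> 0"
 using rad_mem[of x] Sigma_Q unfolding Q_def by blast

lemma gau_pos: "x \<in> Q \<Longrightarrow> gau x > 0"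
 using rad_ne by (simp add: gau_def Q_def)

lemma gau_rad: assumes "x \<in> Q" shows "gau x *\<^sub>R rad x = x"
proof -
 have "norm (rad x) = rho (x /\<^sub>R norm x)" using Q_dir[OF assms] rho_pos[of "x /\<^sub>R norm x"] by (simp add: rad_def)
 moreover have "x \<noteq> 0" using assms by (simp add: Q_def)
 moreover have "rho (x /\<^sub>R norm x) > 0" using Q_dir[OF assms] rho_pos by blast
 ultimately show ?thesis by (simp add: gau_def rad_def)
qed

lemma gau_scale: "s > 0 \<Longrightarrow> gau (s *\<^sub>R x) = s * gau x"
 by (simp add: gau_def rad_scale)

lemma gau_Sigma: "x \<in> \<Sigma> \<Longrightarrow> gau x = 1"
 using Sigma_Q by (auto simp: gau_def rad_Sigma Q_def)

lemma Q_scale: "s > 0 \<Longrightarrow> x \<in> Q \<Longrightarrow> s *\<^sub>R x \<in> Q"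
 by (auto simp: Q_def)

lemma rad_polar: "x \<in> \<Sigma> \<Longrightarrow> s > 0 \<Longrightarrow> rad (s *\<^sub>R x) = x"
 by (simp add: rad_scale rad_Sigma)

lemma gau_polar: "x \<in> \<Sigma> \<Longrightarrow> s > 0 \<Longrightarrow> gau (s *\<^sub>R x) = s"
 by (simp add: gau_scale gau_Sigma)

lemma polar_unique: "x \<in> \<Sigma> \<Longrightarrow> y \<in> \<Sigma> \<Longrightarrow> s > 0 \<Longrightarrow> t > 0 \<Longrightarrow> s *\<^sub>R x = t *\<^sub>R y \<Longrightarrow> x = y \<and> s = t"
 using rad_polar gau_polar by metis

text \<open>Projection to the unit sphere is continuous and injective on the compact
  \<open>\<Sigma>\<close>, so its inverse is continuous; \<open>rad\<close> is this inverse applied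
  to the direction of x.\<close>

lemma continuous_on_rad: "continuous_on Q rad"
proof -
 let ?f = "\<lambda>x :: (real^'n) \<times> real. x /\<^sub>R norm x" and ?g = "\<lambda>z. rho z *\<^sub>R z"
 have "continuous_on (?f ` \<Sigma>) ?g"
 proof (rule continuous_on_inv[OF _ compact_Sigma])
  show "continuous_on \<Sigma> ?f" using Sigma_Q by (intro continuous_intros) (auto simp: Q_def)
  show "\<forall>x\<in>\<Sigma>. rho (?f x) *\<^sub>R ?f x = x" using rad_Sigma by (simp add: rad_def)
 qed
 moreover have "continuous_on Q ?f" by (intro continuous_intros) (auto simp: Q_def)
 moreover have "?f ` Q \<subseteq> ?f ` \<Sigma>"
 proof
  fix z assume "z \<in> ?f ` Q"
  then obtain x where x: "x \<in> Q" "z = ?f x" by blast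
  have pos: "rho (x /\<^sub>R norm x) > 0" using rho_pos[of "x /\<^sub>R norm x"] Q_dir[OF x(1)] by blast
  have unit: "norm (x /\<^sub>R norm x) = 1" using Q_dir[OF x(1)] by blast
  have "norm (rho z *\<^sub>R z) = rho z" if "norm z = 1" "rho z > 0" for z using that by simp
  from this[OF unit pos] have "norm (rad x) = rho (x /\<^sub>R norm x)" unfolding rad_def .
  then have "?f (rad x) = ?f x" using pos x(1) by (simp add: rad_def Q_def) (simp add: mult.assoc[symmetric] mult.commute)
  then have "z = ?f (rad x)" using x(2) by (rule trans[OF _ sym, rotated])
  then show "z \<in> ?f ` \<Sigma>" using rad_mem[OF x(1)] by (rule image_eqI)
 qed
 ultimately have "continuous_on Q (\<lambda>x. ?g (?f x))" by (rule continuous_on_compose2)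
 then show ?thesis by (simp add: rad_def[abs_def])
qed

lemma continuous_on_gau: "continuous_on Q gau"
 unfolding gau_def[abs_def] using rad_ne by (intro continuous_intros continuous_on_rad) auto

lemma closed_insert_Q: "closed {x :: (real^'n) \<times> real. snd x \<ge> 0}"
 by (intro closed_Collect_le continuous_intros)

lemma Sigma_ne: "\<Sigma> \<noteq> {}"
proof -
 have "(0, 1) \<in> {z :: (real^'n) \<times> real. norm z = 1 \<and> snd z \<ge> 0}" by simp
 then show ?thesis unfolding Sigma_eq by blast
qed

text \<open>Explicit candidate for the enclosed domain; the compact cone \<open>cbody\<close> will
  be its closure.\<close>

definition "domain0 = {x. snd x > 0 \<and> gau x < 1}"

lemma upper_Q: "snd x > 0 \<Longrightarrow> x \<in> Q" by (auto simp: Q_def)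

lemma domain0_open: "open domain0"
proof -
 have o: "open {x :: (real^'n) \<times> real. snd x > 0}" by (intro open_Collect_less continuous_intros)
 have "continuous_on {x. snd x > 0} gau" using continuous_on_gau by (rule continuous_on_subset) (auto intro: upper_Q)
 then have "open (gau -` {..<1} \<inter> {x. snd x > 0})" using o by (simp add: continuous_on_open_vimage)
 moreover have "gau -` {..<1} \<inter> {x. snd x > 0} = domain0" by (auto simp: domain0_def)
 ultimately show ?thesis by simp
qed

definition "cbody = (\<lambda>(s, y). s *\<^sub>R y) ` ({0..1::real} \<times> \<Sigma>)"

lemma compact_cbody: "compact cbody"
 unfolding cbody_def split_def
 by (intro compact_continuous_image compact_Times compact_Sigma continuous_intros) auto

text \<open>The origin is listed apart because it has no direction, so its \<open>gau\<close>
  carries no meaning.\<close>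

lemma cbody_iff: "x \<in> cbody \<longleftrightarrow> snd x \<ge> 0 \<and> (x = 0 \<or> gau x \<le> 1)"
proof
 assume "x \<in> cbody"
 then obtain s y where sy: "x = s *\<^sub>R y" "0 \<le> s" "s \<le> 1" "y \<in> \<Sigma>" by (auto simp: cbody_def)
 then have "snd y \<ge> 0" using Sigma_Q by (auto simp: Q_def)
 then show "snd x \<ge> 0 \<and> (x = 0 \<or> gau x \<le> 1)" using sy gau_polar[OF sy(4)] by (cases "s = 0") auto
next
 assume a: "snd x \<ge> 0 \<and> (x = 0 \<or> gau x \<le> 1)"
 show "x \<in> cbody"
 proof (cases "x = 0")
  case True
  obtain y where "y \<in> \<Sigma>" using Sigma_ne by blast
  then show ?thesis using True by (force simp: cbody_def)
 next
  case False
  then have x: "x \<in> Q" using a by (simp add: Q_def)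
  have "(gau x, rad x) \<in> {0..1} \<times> \<Sigma>" using gau_pos[OF x] rad_mem[OF x] a False by auto
  then show ?thesis unfolding cbody_def using gau_rad[OF x] by force
 qed
qed

lemma domain0_cbody: "domain0 \<subseteq> cbody"
 by (auto simp: domain0_def cbody_iff)

lemma cbody_minus_domain0: "cbody - domain0 \<subseteq> \<Sigma> \<union> wall"
proof
 fix x assume x: "x \<in> cbody - domain0"
 show "x \<in> \<Sigma> \<union> wall"
 proof (cases "snd x = 0")
  case False
  then have "x \<in> Q" "gau x = 1" using x by (auto simp: cbody_iff domain0_def Q_def)
  then show ?thesis using gau_rad[of x] rad_mem[of x] by simp
 qed (simp add: wall_eq)
qed

text \<open>A component meeting \<open>domain0\<close> cannot leave it, since the frontier of
  \<open>domain0\<close> lies in the hypersurface and the wall; so it is bounded. Conversely, a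
  point above the wall with gauge greater than 1 escapes to infinity along its ray, so its component
  is unbounded.\<close>

lemma enclosed_domain_eq: "D = domain0"
proof
 show "domain0 \<subseteq> D"
 proof
  fix x assume x: "x \<in> domain0"
  have nx: "x \<notin> \<Sigma> \<union> wall" using x gau_Sigma[of x] by (auto simp: domain0_def wall_eq)
  let ?C = "connected_component_set (- (\<Sigma> \<union> wall)) x"
  have "frontier domain0 \<subseteq> \<Sigma> \<union> wall"
  proof -
   have "closure domain0 \<subseteq> cbody" using domain0_cbody compact_cbody compact_imp_closed by (intro closure_minimal)
   then show ?thesis using cbody_minus_domain0 domain0_open by (auto simp: frontier_def interior_open)
  qed
  moreover have "?C \<subseteq> - (\<Sigma> \<union> wall)" by (rule connected_component_subset)
  ultimately have "?C \<inter> frontier domain0 = {}" by blast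
  moreover have "x \<in> ?C \<inter> domain0" using x nx by (simp add: connected_component_refl_eq)
  ultimately have "?C \<subseteq> domain0" using connected_Int_frontier[of ?C domain0] connected_connected_component by blast
  then have "bounded ?C" using domain0_cbody compact_cbody bounded_subset compact_imp_bounded by (metis subset_trans)
  then show "x \<in> D" using nx by (simp add: enclosed_domain_def inside_def)
 qed
 show "D \<subseteq> domain0"
 proof
  fix x assume x: "x \<in> D"
  have sx: "snd x > 0" using enclosed_domain_upper[OF hyp] x by (auto simp: upper_half_space_eq)
  then have xQ: "x \<in> Q" by (rule upper_Q)
  have nx: "x \<notin> \<Sigma> \<union> wall" "bounded (connected_component_set (- (\<Sigma> \<union> wall)) x)" using x by (auto simp: enclosed_domain_def inside_def)
  have "\<not> gau x \<ge> 1"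
  proof
   assume g: "gau x \<ge> 1"
   have g1: "gau x > 1"
   proof (rule ccontr)
    assume "\<not> gau x > 1"
    then have "gau x = 1" using g by simp
    then have "x \<in> \<Sigma>" using gau_rad[OF xQ] rad_mem[OF xQ] by simp
    then show False using nx by blast
   qed
   let ?R = "(\<lambda>s. s *\<^sub>R x) ` {1..}"
   have "connected ?R" by (intro connected_continuous_image continuous_intros) simp
   moreover have "x \<in> ?R" by (rule image_eqI[of _ _ 1]) auto
   moreover have "?R \<subseteq> - (\<Sigma> \<union> wall)"
   proof
    fix y assume "y \<in> ?R"
    then obtain s where s: "s \<ge> 1" "y = s *\<^sub>R x" by auto
    have "1 * 1 < s * gau x" using s g1 by (intro mult_le_less_imp_less) auto
    then have "gau y > 1" using s by (simp add: gau_scale)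
    moreover have "snd y \<noteq> 0" using s sx by simp
    ultimately show "y \<in> - (\<Sigma> \<union> wall)" using gau_Sigma[of y] by (auto simp: wall_eq)
   qed
   ultimately have "?R \<subseteq> connected_component_set (- (\<Sigma> \<union> wall)) x" by (intro connected_component_maximal)
   then have "bounded ?R" using nx(2) bounded_subset by blast
   then obtain B where B: "\<And>y. y \<in> ?R \<Longrightarrow> norm y \<le> B" unfolding bounded_iff by blast
   have x0: "norm x > 0" using xQ by (simp add: Q_def)
   have "norm (((\<bar>B\<bar> + 1) / norm x + 1) *\<^sub>R x) \<le> B" by (rule B) auto
   moreover have "norm (((\<bar>B\<bar> + 1) / norm x + 1) *\<^sub>R x) = \<bar>B\<bar> + 1 + norm x"
    using x0 by (simp add: field_simps)
   ultimately show False using x0 by linarith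
  qed
  then show "x \<in> domain0" using sx by (simp add: domain0_def)
 qed
qed

lemma enclosed_body_eq: "K = cbody"
proof
 show "K \<subseteq> cbody" unfolding enclosed_body_def enclosed_domain_eq
  using domain0_cbody compact_cbody compact_imp_closed by (intro closure_minimal)
 have 1: "s *\<^sub>R y \<in> K" if s: "0 \<le> s" "s \<le> 1" and y: "y \<in> mfd_interior \<Sigma>" for s y
 proof -
  have y2: "snd y > 0" "y \<in> \<Sigma>" using y hyp by (auto simp: hypersurface_in_half_space_def upper_half_space_eq)
  have "(\<lambda>r. r *\<^sub>R y) ` {0<..<1} \<subseteq> D" unfolding enclosed_domain_eq domain0_def using y2 by (auto simp: gau_polar)
  then have "(\<lambda>r. r *\<^sub>R y) ` closure {0<..<1} \<subseteq> K"
   unfolding enclosed_body_def by (intro image_closure_subset continuous_intros) (use closure_subset in auto)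
  then have "(\<lambda>r. r *\<^sub>R y) ` {0..1} \<subseteq> K" by simp
  then show ?thesis using s by (meson atLeastAtMost_iff image_eqI subsetD)
 qed
 show "cbody \<subseteq> K"
 proof
  fix x assume "x \<in> cbody"
  then obtain s y where sy: "x = s *\<^sub>R y" "0 \<le> s" "s \<le> 1" "y \<in> \<Sigma>" by (auto simp: cbody_def)
  have "(\<lambda>y. s *\<^sub>R y) ` closure (mfd_interior \<Sigma>) \<subseteq> K"
   by (rule image_closure_subset) (use 1 sy in \<open>auto simp: enclosed_body_def intro!: continuous_intros\<close>)
  moreover have "y \<in> closure (mfd_interior \<Sigma>)"
   using sy(4) hyp mfd_boundary_closure[of \<Sigma>] closure_subset[of "mfd_interior \<Sigma>"]
   unfolding hypersurface_in_half_space_def by blast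
  ultimately show "x \<in> K" using sy(1) by blast
 qed
qed

lemma compact_K: "compact K" unfolding enclosed_body_eq by (rule compact_cbody)

lemma K_iff: "x \<in> K \<longleftrightarrow> snd x \<ge> 0 \<and> (x = 0 \<or> gau x \<le> 1)"
 unfolding enclosed_body_eq by (rule cbody_iff)

lemma D_interior: "D \<subseteq> interior K"
 using closure_subset[of D] domain0_open by (intro interior_maximal) (auto simp: enclosed_domain_eq enclosed_body_def)

lemma K_dense: "K \<subseteq> closure (interior K)"
 using closure_mono[OF D_interior] by (simp add: enclosed_body_def)

text \<open>Every ray from the origin meets the hypersurface at most once.\<close>

lemma negligible_Sigma: "negligible \<Sigma>"
proof (rule starlike_negligible[of \<Sigma> 0])
 show "closed \<Sigma>" using compact_Sigma by (rule compact_imp_closed)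
 fix c x assume a: "0 \<le> c" "0 + x \<in> \<Sigma>" "0 + c *\<^sub>R x \<in> \<Sigma>"
 then have "c > 0" using Sigma_Q by (cases "c = 0") (auto simp: Q_def)
 then show "c = 1" using gau_polar[of x c] gau_Sigma[of "c *\<^sub>R x"] a by simp
qed

lemma negligible_frontier_K: "negligible (frontier K)"
proof (rule negligible_subset)
 have "wall = {x :: (real^'n) \<times> real. e_last \<bullet> x = 0}" by (simp add: wall_eq inner_commute[of e_last])
 then have "negligible (wall :: ((real^'n) \<times> real) set)"
  using negligible_hyperplane[of "e_last :: (real^'n) \<times> real" 0] e_last_nonzero by simp
 then show "negligible (\<Sigma> \<union> wall)" using negligible_Sigma by (simp add: negligible_Un)
 show "frontier K \<subseteq> \<Sigma> \<union> wall"
 proof -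
  have "closure K = cbody" using compact_K by (simp add: compact_imp_closed enclosed_body_eq)
  then have "frontier K \<subseteq> cbody - domain0" using D_interior by (auto simp: frontier_def enclosed_domain_eq)
  then show ?thesis using cbody_minus_domain0 by (rule subset_trans)
 qed
qed

lemma rmin: obtains r where "r > 0" "\<And>x. x \<in> \<Sigma> \<Longrightarrow> r \<le> norm x"
proof -
 obtain x0 where x0: "x0 \<in> \<Sigma>" "\<And>x. x \<in> \<Sigma> \<Longrightarrow> norm x0 \<le> norm x"
  using continuous_attains_inf[OF compact_Sigma Sigma_ne, of norm] continuous_on_norm_id by blast
 show ?thesis by (rule that[of "norm x0"]) (use x0 Sigma_Q in \<open>auto simp: Q_def\<close>)
qed

text \<open>In polar coordinates the domain is a continuous image of the product of an interval and
  the open half-space.\<close>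

lemma D_connected: "connected D"
proof -
 let ?U = "{x :: (real^'n) \<times> real. snd x > 0}" and ?f = "\<lambda>(s, x). s *\<^sub>R rad x"
 have "?U = {x. e_last \<bullet> x > 0}" by (simp add: inner_commute[of e_last])
 then have "connected ({0<..<1::real} \<times> ?U)" by (intro connected_Times) (simp_all add: convex_halfspace_gt convex_connected)
 moreover have "continuous_on ({0<..<1} \<times> ?U) ?f"
  unfolding split_def by (intro continuous_intros continuous_on_compose2[OF continuous_on_rad]) (auto intro: upper_Q)
 moreover have "?f ` ({0<..<1} \<times> ?U) = D"
 proof (intro set_eqI iffI)
  fix y assume "y \<in> ?f ` ({0<..<1} \<times> ?U)"
  then obtain s x where sx: "0 < s" "s < 1" "snd x > 0" "y = s *\<^sub>R rad x" by auto
  then have "0 < gau x * snd (rad x)" using gau_rad[OF upper_Q[OF sx(3)]] by (metis snd_scaleR real_scaleR_def)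
  then have "snd (rad x) > 0" using gau_pos[OF upper_Q[OF sx(3)]] by (simp add: zero_less_mult_iff)
  then show "y \<in> D" using sx rad_mem[OF upper_Q[OF sx(3)]] by (simp add: enclosed_domain_eq domain0_def gau_polar)
 next
  fix y assume "y \<in> D"
  then have y: "snd y > 0" "gau y < 1" by (auto simp: enclosed_domain_eq domain0_def)
  then have "y = ?f (gau y, y)" "(gau y, y) \<in> {0<..<1} \<times> ?U" using gau_rad gau_pos upper_Q by auto
  then show "y \<in> ?f ` ({0<..<1} \<times> ?U)" by blast
 qed
 ultimately show ?thesis using connected_continuous_image by metis
qed

lemma connected_interior_K: "connected (interior K)"
 using connected_intermediate_closure[OF D_connected D_interior] interior_subset[of K]
 by (simp add: enclosed_body_def)

lemma vol_K_pos: "vol K > 0"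
proof (rule vol_pos_interior)
 obtain r where r: "r > 0" "\<And>x. x \<in> \<Sigma> \<Longrightarrow> r \<le> norm x" using rmin by blast
 let ?x = "(0, r / 2) :: (real^'n) \<times> real"
 have xQ: "?x \<in> Q" using r(1) by (auto simp: Q_def zero_prod_def)
 have "norm ?x < norm (rad ?x)" using r(1) r(2)[OF rad_mem[OF xQ]] by simp
 then have "gau ?x < 1" unfolding gau_def using rad_ne[OF xQ] by (subst divide_less_eq_1_pos) auto
 then have "?x \<in> D" using r(1) by (simp add: enclosed_domain_eq domain0_def)
 then show "interior K \<noteq> {}" using D_interior by blast
qed (use compact_K in \<open>simp_all add: lmeasurable_compact\<close>)

end

section \<open>Tangency estimates for charts and for the hypersurface\<close>

lemma local_param_has_derivative:
 assumes "local_param \<Sigma> psi U a" "u \<in> U"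
 shows "(psi has_derivative frechet_derivative psi (at u)) (at u)"
proof -
 have "Ck_on (Suc 0) U psi" using assms(1) by (simp only: local_param_def smooth_on_def)
 then show ?thesis using assms(2) by (simp add: frechet_derivative_works[symmetric])
qed

lemma local_param_continuous_derivative:
 assumes "local_param \<Sigma> psi U a"
 shows "continuous_on U (\<lambda>u. frechet_derivative psi (at u) v)"
proof -
 have "Ck_on (Suc 0) U psi" using assms(1) by (simp only: local_param_def smooth_on_def)
 then show ?thesis by simp
qed

text \<open>Smoothness provides continuity of the derivative in the base point for each fixed
  vector. A finite basis turns this into closeness of the linear maps, eta being shared equally
  among the basis vectors.\<close>

lemma local_param_derivative_close:
 assumes lp: "local_param \<Sigma> psi U a" and u0: "u0 \<in> U" and eta: "eta > 0"
 obtains r where "r > 0" "ball u0 r \<subseteq> U"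
  "\<And>u v. u \<in> ball u0 r \<Longrightarrow> norm (frechet_derivative psi (at u) v - frechet_derivative psi (at u0) v) \<le> eta * norm v"
proof -
 let ?D = "\<lambda>u. frechet_derivative psi (at u)"
 have U: "open U" using lp by (simp add: local_param_def)
 let ?N = "real (card (Basis :: (real^'a) set))"
 have N: "?N > 0" by (simp add: card_gt_0_iff)
 have "\<forall>b\<in>(Basis :: (real^'a) set). \<exists>r>0. \<forall>u\<in>U. dist u u0 < r \<longrightarrow> dist (?D u b) (?D u0 b) < eta / ?N"
 proof
  fix b :: "real^'a" assume "b \<in> Basis"
  have "eta / ?N > 0" using eta N by simp
  then show "\<exists>r>0. \<forall>u\<in>U. dist u u0 < r \<longrightarrow> dist (?D u b) (?D u0 b) < eta / ?N"
   using local_param_continuous_derivative[OF lp, of b, unfolded continuous_on_iff, rule_format, OF u0] by blast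
 qed
 then obtain r where r: "\<And>b. b \<in> (Basis :: (real^'a) set) \<Longrightarrow> r b > 0"
  "\<And>b u. b \<in> (Basis :: (real^'a) set) \<Longrightarrow> u \<in> U \<Longrightarrow> dist u u0 < r b \<Longrightarrow> dist (?D u b) (?D u0 b) < eta / ?N"
  by metis
 obtain r0 where r0: "r0 > 0" "ball u0 r0 \<subseteq> U" using U u0 open_contains_ball by metis
 define R where "R = Min (insert r0 (r ` Basis))"
 have fin: "finite (insert r0 (r ` Basis))" by simp
 have R: "R > 0" "R \<le> r0" unfolding R_def using r(1) r0(1) by auto
 have R3: "R \<le> r b" if "b \<in> Basis" for b unfolding R_def by (rule Min_le[OF fin]) (use that in blast)
 show ?thesis
 proof (rule that[OF R(1)])
  show "ball u0 R \<subseteq> U" using r0(2) R(2) by (meson subset_ball subset_trans)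
  fix u v assume u: "u \<in> ball u0 R"
  then have uU: "u \<in> U" using \<open>ball u0 R \<subseteq> U\<close> by blast
  have lin: "linear (?D u)" "linear (?D u0)"
   using local_param_has_derivative[OF lp] uU u0 has_derivative_linear by blast+
  have "?D u v - ?D u0 v = (\<Sum>b\<in>Basis. (v \<bullet> b) *\<^sub>R (?D u b - ?D u0 b))"
  proof -
   have v: "v = (\<Sum>b\<in>Basis. (v \<bullet> b) *\<^sub>R b)" by (rule euclidean_representation[symmetric])
   have "?D w v = (\<Sum>b\<in>Basis. (v \<bullet> b) *\<^sub>R ?D w b)" if "linear (?D w)" for w
    using that by (subst v) (simp add: linear_sum linear_scale)
   then show ?thesis using lin by (simp add: sum_subtractf scaleR_diff_right)
  qed
  also have "norm \<dots> \<le> (\<Sum>b\<in>(Basis :: (real^'a) set). norm v * (eta / ?N))"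
  proof (rule sum_norm_le)
   fix b :: "real^'a" assume b: "b \<in> Basis"
   have "dist u u0 < r b" using u R3[OF b] by (simp add: dist_commute)
   then have "norm (?D u b - ?D u0 b) \<le> eta / ?N" using r(2)[OF b uU] by (simp add: dist_norm)
   moreover have "\<bar>v \<bullet> b\<bar> \<le> norm v" using b by (rule Basis_le_norm)
   ultimately show "norm ((v \<bullet> b) *\<^sub>R (?D u b - ?D u0 b)) \<le> norm v * (eta / ?N)"
    unfolding norm_scaleR by (intro mult_mono) auto
  qed
  also have "\<dots> = eta * norm v" using N by simp
  finally show "norm (?D u v - ?D u0 v) \<le> eta * norm v" .
 qed
qed

abbreviation "tangential \<nu> eps p x \<equiv> \<bar>(p - x) \<bullet> \<nu> x\<bar> \<le> eps * norm (p - x)"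

text \<open>Near u0 the chart differs from its derivative at u0 by a map with Lipschitz constant
  eta. So a chord psi w - psi u is tangent at psi u up to 2 * eta * |w - u|, while its length is at
  least c / 2 * |w - u|. Both endpoints vary, which makes the estimate uniform in the base
  point.\<close>

lemma tangent_local:
 assumes \<nu>: "is_outward_normal \<Sigma> \<nu>" and lp: "local_param \<Sigma> psi U a" and u0: "u0 \<in> chart_domain U a" and eps: "eps > 0"
 shows "\<exists>dlt>0. \<forall>p\<in>\<Sigma>. \<forall>x\<in>\<Sigma>. dist p (psi u0) < dlt \<longrightarrow> dist x (psi u0) < dlt \<longrightarrow> tangential \<nu> eps p x"
proof -
 let ?D = "\<lambda>u. frechet_derivative psi (at u)" and ?C = "chart_domain U a"
 have u0U: "u0 \<in> U" using u0 by (simp add: chart_domain_def)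
 have CU: "?C \<subseteq> U" by (auto simp: chart_domain_def)
 have lin0: "linear (?D u0)" using local_param_has_derivative[OF lp u0U] has_derivative_linear by blast
 have "inj (?D u0)" using lp u0U by (auto simp: local_param_def)
 then obtain c where c: "c > 0" "\<And>v. c * norm v \<le> norm (?D u0 v)" using linear_inj_bounded_below_pos[OF lin0] by metis
 \<comment> \<open>The bound c / 2 secures the length of the chord; eps * c / 4 makes 2 * eta at
   most eps times c / 2.\<close>
 define eta where "eta = min (c / 2) (eps * c / 4)"
 have eta: "eta > 0" "eta \<le> c / 2" "eta \<le> eps * c / 4" using c eps by (auto simp: eta_def)
 obtain r where r: "r > 0" "ball u0 r \<subseteq> U"
  "\<And>u v. u \<in> ball u0 r \<Longrightarrow> norm (?D u v - ?D u0 v) \<le> eta * norm v" using local_param_derivative_close[OF lp u0U eta(1)] by metis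
 let ?f = "\<lambda>w. psi w - ?D u0 w"
 have fb: "norm (?f w - ?f u) \<le> eta * norm (w - u)" if "w \<in> ball u0 r" "u \<in> ball u0 r" for u w
 proof (rule differentiable_bound[OF convex_ball[of u0 r] _ _ that])
  fix x assume x: "x \<in> ball u0 r"
  have "(psi has_derivative ?D x) (at x within ball u0 r)"
   by (rule has_derivative_at_withinI, rule local_param_has_derivative[OF lp]) (use r x in blast)
  moreover have "(?D u0 has_derivative ?D u0) (at x within ball u0 r)"
   by (rule linear_imp_has_derivative[OF lin0])
  ultimately show "(?f has_derivative (\<lambda>v. ?D x v - ?D u0 v)) (at x within ball u0 r)" by (rule has_derivative_diff)
  show "onorm (\<lambda>v. ?D x v - ?D u0 v) \<le> eta" by (rule onorm_le) (rule r(3)[OF x])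
 qed
 have key: "\<bar>(psi w - psi u) \<bullet> \<nu> (psi u)\<bar> \<le> eps * norm (psi w - psi u)" if w: "w \<in> ball u0 r \<inter> ?C" and u: "u \<in> ball u0 r \<inter> ?C" for u w
 proof -
  have linu: "linear (?D u)" using local_param_has_derivative[OF lp, of u] has_derivative_linear u CU by blast
  have e: "psi w - psi u = (?f w - ?f u) + ?D u0 (w - u)" by (simp add: linear_diff[OF lin0])
  have "c * norm (w - u) \<le> norm (?D u0 (w - u))" by (rule c(2))
  also have "\<dots> = norm ((psi w - psi u) - (?f w - ?f u))" unfolding e by simp
  also have "\<dots> \<le> norm (psi w - psi u) + norm (?f w - ?f u)" by (rule norm_triangle_ineq4)
  also have "\<dots> \<le> norm (psi w - psi u) + c / 2 * norm (w - u)"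
   using fb[of w u] w u eta(2) mult_right_mono[OF eta(2), of "norm (w - u)"] by auto
  finally have low: "c / 2 * norm (w - u) \<le> norm (psi w - psi u)" by (simp add: field_simps)
  have x: "psi u \<in> \<Sigma>" using lp u unfolding local_param_def openin_euclidean_subtopology_iff by blast
  have perp: "?D u (w - u) \<bullet> \<nu> (psi u) = 0" using \<nu> lp u unfolding is_outward_normal_def by blast
  have unit: "norm (\<nu> (psi u)) = 1" using \<nu> x by (simp add: is_outward_normal_def)
  have "(psi w - psi u) \<bullet> \<nu> (psi u) = (?f w - ?f u) \<bullet> \<nu> (psi u) - (?D u (w - u) - ?D u0 (w - u)) \<bullet> \<nu> (psi u)"
   unfolding inner_diff_left[of "?D u (w - u)"] perp by (simp add: e inner_add_left)
  also have "\<bar>\<dots>\<bar> \<le> norm (?f w - ?f u) + norm (?D u (w - u) - ?D u0 (w - u))"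
  proof -
   have "\<bar>z \<bullet> \<nu> (psi u)\<bar> \<le> norm z" for z using Cauchy_Schwarz_ineq2[of z "\<nu> (psi u)"] unit by simp
   then show ?thesis by (smt (verit))
  qed
  also have "\<dots> \<le> eta * norm (w - u) + eta * norm (w - u)" using fb[of w u] r(3)[of u "w - u"] u w by (intro add_mono) auto
  also have "\<dots> \<le> eps * (c / 2 * norm (w - u))"
   using mult_right_mono[OF eta(3), of "norm (w - u)"] by (simp add: algebra_simps)
  also have "\<dots> \<le> eps * norm (psi w - psi u)" using low eps by (intro mult_left_mono) auto
  finally show ?thesis .
 qed
 obtain phi where phi: "homeomorphism ?C (psi ` ?C) psi phi" using lp by (auto simp: local_param_def)
 have "openin (top_of_set ?C) (ball u0 r \<inter> ?C)" by (auto simp: openin_open)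
 then have "openin (top_of_set (psi ` ?C)) (psi ` (ball u0 r \<inter> ?C))" by (rule homeomorphism_imp_open_map[OF phi])
 moreover have "openin (top_of_set \<Sigma>) (psi ` ?C)" using lp by (simp add: local_param_def)
 ultimately have "openin (top_of_set \<Sigma>) (psi ` (ball u0 r \<inter> ?C))" by (rule openin_trans)
 moreover have "psi u0 \<in> psi ` (ball u0 r \<inter> ?C)" using u0 r(1) by auto
 ultimately obtain dlt where dlt: "dlt > 0" "\<And>p. p \<in> \<Sigma> \<Longrightarrow> dist p (psi u0) < dlt \<Longrightarrow> p \<in> psi ` (ball u0 r \<inter> ?C)"
  unfolding openin_euclidean_subtopology_iff by meson
 have "tangential \<nu> eps p x" if px: "p \<in> \<Sigma>" "x \<in> \<Sigma>" "dist p (psi u0) < dlt" "dist x (psi u0) < dlt" for p x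
 proof -
  obtain w u where "w \<in> ball u0 r \<inter> ?C" "p = psi w" "u \<in> ball u0 r \<inter> ?C" "x = psi u" using dlt(2)[OF px(1,3)] dlt(2)[OF px(2,4)] by (meson imageE)
  then show ?thesis using key by blast
 qed
 then show ?thesis using dlt(1) by blast
qed

lemma hypersurface_chart:
 assumes "hypersurface_in_half_space \<Sigma>" "x \<in> \<Sigma>"
 obtains psi U a u where "local_param \<Sigma> psi U a" "u \<in> chart_domain U a" "x = psi u"
proof -
 have "x \<in> mfd_interior \<Sigma> \<or> x \<in> mfd_boundary \<Sigma>" using assms unfolding hypersurface_in_half_space_def by blast
 then show ?thesis
 proof
  assume "x \<in> mfd_interior \<Sigma>"
  then obtain psi U u where "local_param \<Sigma> psi U 0" "u \<in> U" "x = psi u" by (auto simp: mfd_interior_def)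
  then show ?thesis using that[of psi U 0 u] by (simp add: chart_domain_def)
 next
  assume "x \<in> mfd_boundary \<Sigma>"
  then obtain psi U a u where "local_param \<Sigma> psi U a" "u \<in> U" "a \<bullet> u = 0" "x = psi u" by (auto simp: mfd_boundary_def)
  then show ?thesis using that[of psi U a u] by (simp add: chart_domain_def)
 qed
qed

text \<open>Lebesgue number of the covering of the compact hypersurface by the balls from
  \<open>tangent_local\<close>.\<close>

lemma tangent_uniform:
 assumes h: "hypersurface_in_half_space \<Sigma>" and \<nu>: "is_outward_normal \<Sigma> \<nu>" and eps: "eps > 0"
 obtains dlt where "dlt > 0" "\<And>p x. p \<in> \<Sigma> \<Longrightarrow> x \<in> \<Sigma> \<Longrightarrow> dist p x < dlt \<Longrightarrow> tangential \<nu> eps p x"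
proof -
 let ?G = "{ball x0 dlt |x0 dlt. dlt > 0 \<and> (\<forall>p\<in>\<Sigma>. \<forall>x\<in>\<Sigma>. dist p x0 < dlt \<longrightarrow> dist x x0 < dlt \<longrightarrow> tangential \<nu> eps p x)}"
 have "\<Sigma> \<subseteq> \<Union>?G"
 proof
  fix x0 assume "x0 \<in> \<Sigma>"
  then obtain psi U a u where "local_param \<Sigma> psi U a" "u \<in> chart_domain U a" "x0 = psi u" using hypersurface_chart[OF h] by metis
  then obtain dlt where "dlt > 0" "\<forall>p\<in>\<Sigma>. \<forall>x\<in>\<Sigma>. dist p x0 < dlt \<longrightarrow> dist x x0 < dlt \<longrightarrow> tangential \<nu> eps p x"
   using tangent_local[OF \<nu> _ _ eps] by blast
  then have "ball x0 dlt \<in> ?G" "x0 \<in> ball x0 dlt" by (blast, simp)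
  then show "x0 \<in> \<Union>?G" by (rule UnionI)
 qed
 moreover have "compact \<Sigma>" using h by (simp add: hypersurface_in_half_space_def)
 ultimately obtain e where e: "e > 0" "\<And>x. x \<in> \<Sigma> \<Longrightarrow> \<exists>G\<in>?G. ball x e \<subseteq> G"
  using Heine_Borel_lemma[of \<Sigma> ?G] by (smt (verit) mem_Collect_eq open_ball)
 show ?thesis
 proof (rule that[OF e(1)])
  fix p x assume a: "p \<in> \<Sigma>" "x \<in> \<Sigma>" "dist p x < e"
  obtain G where G: "G \<in> ?G" "ball x e \<subseteq> G" using e(2)[OF a(2)] by blast
  then obtain x0 dlt where G0: "G = ball x0 dlt"
   "\<forall>p\<in>\<Sigma>. \<forall>x\<in>\<Sigma>. dist p x0 < dlt \<longrightarrow> dist x x0 < dlt \<longrightarrow> tangential \<nu> eps p x" by blast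
  have "p \<in> ball x e" "x \<in> ball x e" using a e(1) by (auto simp: dist_commute)
  then have "p \<in> ball x0 dlt" "x \<in> ball x0 dlt" using G(2) G0(1) by blast+
  then have "dist p x0 < dlt" "dist x x0 < dlt" by (simp_all add: dist_commute)
  then show "tangential \<nu> eps p x" using G0(2) a by blast
 qed
qed

context star_hypersurface
begin

lemma nu_unit: "x \<in> \<Sigma> \<Longrightarrow> norm (\<nu> x) = 1" using normal by (simp add: is_outward_normal_def)

lemma continuous_on_nu: "continuous_on \<Sigma> \<nu>" using normal by (simp add: is_outward_normal_def)

lemma support_bound: obtains c0 where "c0 > 0" "\<And>x. x \<in> \<Sigma> \<Longrightarrow> c0 \<le> x \<bullet> \<nu> x"
proof -
 have "continuous_on \<Sigma> (\<lambda>x. x \<bullet> \<nu> x)" by (intro continuous_intros continuous_on_nu)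
 then obtain x0 where "x0 \<in> \<Sigma>" "\<And>x. x \<in> \<Sigma> \<Longrightarrow> x0 \<bullet> \<nu> x0 \<le> x \<bullet> \<nu> x"
  using continuous_attains_inf[OF compact_Sigma Sigma_ne] by blast
 then show ?thesis using that nu_pos by blast
qed

text \<open>Let w = g x - s p. Its normal component at x is (g - s) (x \<bullet> \<nu> x) up to a
  small multiple of |p - x|, and x \<bullet> \<nu> x \<ge> c0; this bounds g - s. Then g (x - p) = w
  - (g - s) p bounds p - x.\<close>

lemma radial_lipschitz:
 obtains C dlt where "C > 0" "dlt > 0"
  "\<And>x p g s. x \<in> \<Sigma> \<Longrightarrow> p \<in> \<Sigma> \<Longrightarrow> dist p x < dlt \<Longrightarrow> 1 / 2 \<le> g \<Longrightarrow> 0 \<le> s \<Longrightarrow> s \<le> 1 \<Longrightarrow> norm (p - x) \<le> C * norm (g *\<^sub>R x - s *\<^sub>R p)"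
proof -
 obtain c0 where c0: "c0 > 0" "\<And>x. x \<in> \<Sigma> \<Longrightarrow> c0 \<le> x \<bullet> \<nu> x" using support_bound by blast
 obtain R where R: "R > 0" "\<And>x. x \<in> \<Sigma> \<Longrightarrow> norm x \<le> R"
  using compact_imp_bounded[OF compact_Sigma] bounded_pos by blast
 \<comment> \<open>Chosen so that the error contributes norm (p - x) / 4, to be absorbed by the half
   coming from g \<ge> 1 / 2; the quarter that remains explains the factor 4 in the
   constant.\<close>
 define eps where "eps = c0 / (4 * R)"
 have eps: "eps > 0" "eps * (R / c0) = 1 / 4" using c0 R by (auto simp: eps_def)
 obtain dlt where dlt: "dlt > 0" "\<And>p x. p \<in> \<Sigma> \<Longrightarrow> x \<in> \<Sigma> \<Longrightarrow> dist p x < dlt \<Longrightarrow> tangential \<nu> eps p x"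
  using tangent_uniform[OF hyp normal eps(1)] by blast
 show ?thesis
 proof (rule that[of "4 * (1 + R / c0)" dlt])
  fix x p and g s :: real
  assume a: "x \<in> \<Sigma>" "p \<in> \<Sigma>" "dist p x < dlt" "1 / 2 \<le> g" "0 \<le> s" "s \<le> 1"
  define w where "w = g *\<^sub>R x - s *\<^sub>R p"
  have "w \<bullet> \<nu> x = (g - s) * (x \<bullet> \<nu> x) - s * ((p - x) \<bullet> \<nu> x)"
   by (simp add: w_def algebra_simps inner_diff_left)
  moreover have "\<bar>w \<bullet> \<nu> x\<bar> \<le> norm w" using Cauchy_Schwarz_ineq2[of w "\<nu> x"] nu_unit[OF a(1)] by simp
  moreover have "\<bar>s * ((p - x) \<bullet> \<nu> x)\<bar> \<le> 1 * (eps * norm (p - x))"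
   unfolding abs_mult using dlt(2)[OF a(2,1,3)] a by (intro mult_mono) auto
  moreover have "\<bar>(g - s) * (x \<bullet> \<nu> x)\<bar> \<ge> \<bar>g - s\<bar> * c0"
   unfolding abs_mult using c0 c0(2)[OF a(1)] by (intro mult_left_mono) auto
  ultimately have "\<bar>g - s\<bar> * c0 \<le> norm w + eps * norm (p - x)" by linarith
  then have gs: "\<bar>g - s\<bar> \<le> (norm w + eps * norm (p - x)) / c0" using c0(1) by (simp add: field_simps)
  have "g *\<^sub>R (x - p) = w - (g - s) *\<^sub>R p" by (simp add: w_def algebra_simps)
  then have "norm (g *\<^sub>R (x - p)) \<le> norm w + norm ((g - s) *\<^sub>R p)" using norm_triangle_ineq4[of w "(g - s) *\<^sub>R p"] by simp
  also have "norm ((g - s) *\<^sub>R p) \<le> (norm w + eps * norm (p - x)) / c0 * R"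
   unfolding norm_scaleR using gs R(2)[OF a(2)] by (intro mult_mono) auto
  also have "\<dots> = norm w * (R / c0) + (eps * (R / c0)) * norm (p - x)" by (simp add: add_divide_distrib algebra_simps)
  also have "\<dots> = norm w * (R / c0) + norm (p - x) / 4" unfolding eps(2) by simp
  finally have "norm (g *\<^sub>R (x - p)) \<le> norm w + (norm w * (R / c0) + norm (p - x) / 4)" by simp
  moreover have "norm (g *\<^sub>R (x - p)) \<ge> 1 / 2 * norm (p - x)"
  proof -
   have "\<bar>g\<bar> * norm (x - p) \<ge> 1 / 2 * norm (x - p)" using a by (intro mult_right_mono) auto
   then show ?thesis by (simp add: norm_minus_commute)
  qed
  ultimately have "norm (p - x) \<le> 4 * (norm w + norm w * (R / c0))" by argo
  also have "\<dots> = 4 * (1 + R / c0) * norm w" by (simp add: algebra_simps)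
  finally show "norm (p - x) \<le> 4 * (1 + R / c0) * norm (g *\<^sub>R x - s *\<^sub>R p)" by (simp add: w_def)
 qed (use c0 R dlt in \<open>auto intro!: add_pos_pos\<close>)
qed

text \<open>Substitute for a supporting hyperplane, as \<open>K\<close> may fail to be convex. For k
  = s p with p in \<open>\<Sigma>\<close> and s \<le> 1, the normal component of k - x is s times
  that of p - x minus (1 - s) (x \<bullet> \<nu> x). The last term has the favourable sign, and the
  first one is small by tangency and \<open>radial_lipschitz\<close>.\<close>

lemma one_sided_tangent:
 assumes eps: "eps > 0"
 obtains eta where "eta > 0"
  "\<And>x g k. x \<in> \<Sigma> \<Longrightarrow> 1 / 2 \<le> g \<Longrightarrow> k \<in> K \<Longrightarrow> norm (g *\<^sub>R x - k) \<le> eta \<Longrightarrow> (k - x) \<bullet> \<nu> x \<le> eps * norm (g *\<^sub>R x - k)"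
proof -
 obtain C dlt1 where C: "C > 0" "dlt1 > 0"
  "\<And>x p g s. x \<in> \<Sigma> \<Longrightarrow> p \<in> \<Sigma> \<Longrightarrow> dist p x < dlt1 \<Longrightarrow> 1 / 2 \<le> g \<Longrightarrow> 0 \<le> s \<Longrightarrow> s \<le> 1 \<Longrightarrow> norm (p - x) \<le> C * norm (g *\<^sub>R x - s *\<^sub>R p)"
  by (rule radial_lipschitz) blast
 have "eps / C > 0" using eps C by simp
 then obtain dlt2 where dlt2: "dlt2 > 0" "\<And>p x. p \<in> \<Sigma> \<Longrightarrow> x \<in> \<Sigma> \<Longrightarrow> dist p x < dlt2 \<Longrightarrow> tangential \<nu> (eps / C) p x"
  using tangent_uniform[OF hyp normal] by blast
 obtain r where r: "r > 0" "\<And>x. x \<in> \<Sigma> \<Longrightarrow> r \<le> norm x" using rmin by blast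
 obtain R where R: "R > 0" "\<And>x. x \<in> K \<Longrightarrow> norm x \<le> R"
  using compact_imp_bounded[OF compact_K] bounded_pos by blast
 \<comment> \<open>A compact region away from the origin that contains both g x and k;
   \<open>rad\<close> is uniformly continuous on it.\<close>
 define A where "A = {x :: (real^'n) \<times> real. snd x \<ge> 0} \<inter> {x. r / 4 \<le> norm x} \<inter> cball 0 (R + 1)"
 have "closed {x :: (real^'n) \<times> real. r / 4 \<le> norm x}" by (intro closed_Collect_le continuous_intros)
 then have cA: "compact A" unfolding A_def using closed_insert_Q by (intro closed_Int_compact closed_Int) auto
 have AQ: "A \<subseteq> Q" using r(1) by (auto simp: A_def Q_def)
 have "uniformly_continuous_on A rad" by (rule compact_uniformly_continuous[OF continuous_on_subset[OF continuous_on_rad AQ] cA])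
 then obtain d where d: "d > 0" "\<And>x y. x \<in> A \<Longrightarrow> y \<in> A \<Longrightarrow> dist y x < d \<Longrightarrow> dist (rad y) (rad x) < min dlt1 dlt2"
  unfolding uniformly_continuous_on_def using C(2) dlt2(1) by (metis min_less_iff_conj)
 define eta where "eta = min (min 1 (r / 4)) (d / 2)"
 have eta: "eta > 0" "eta \<le> 1" "eta \<le> r / 4" "eta < d" using r(1) d(1) by (auto simp: eta_def)
 show ?thesis
 proof (rule that[OF eta(1)])
  fix x g k assume a: "x \<in> \<Sigma>" "1 / 2 \<le> (g::real)" "k \<in> K" "norm (g *\<^sub>R x - k) \<le> eta"
  have snds: "snd x \<ge> 0" "snd k \<ge> 0" using a Sigma_Q K_iff by (auto simp: Q_def)
  have n1: "norm (g *\<^sub>R x) \<ge> r / 2"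
  proof -
   have "1 / 2 * r \<le> \<bar>g\<bar> * norm x" using a r(2)[OF a(1)] r(1) by (intro mult_mono) auto
   then show ?thesis by simp
  qed
  have n2: "norm (g *\<^sub>R x) \<le> norm k + norm (g *\<^sub>R x - k)" by (rule norm_triangle_sub)
  have gA: "g *\<^sub>R x \<in> A" using n1 n2 R(2)[OF a(3)] a eta snds r(1) unfolding A_def by auto
  have kA: "k \<in> A" using n1 n2 R(2)[OF a(3)] a eta snds r(1) unfolding A_def by auto
  then have kQ: "k \<in> Q" using AQ by blast
  define p s where "p = rad k" and "s = gau k"
  have p: "p \<in> \<Sigma>" "k = s *\<^sub>R p" using rad_mem[OF kQ] gau_rad[OF kQ] by (auto simp: p_def s_def)
  have s: "0 \<le> s" "s \<le> 1" using gau_pos[OF kQ] a(3) kQ by (auto simp: K_iff Q_def s_def)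
  have "dist (rad k) (rad (g *\<^sub>R x)) < min dlt1 dlt2"
   by (rule d(2)[OF gA kA]) (use a(4) eta(4) in \<open>simp add: dist_norm norm_minus_commute\<close>)
  then have px: "dist p x < dlt1" "dist p x < dlt2" using a by (auto simp: p_def rad_polar)
  have "(k - x) \<bullet> \<nu> x = s * ((p - x) \<bullet> \<nu> x) - (1 - s) * (x \<bullet> \<nu> x)"
   by (simp add: p(2) algebra_simps inner_diff_left)
  also have "\<dots> \<le> s * ((p - x) \<bullet> \<nu> x)" using s nu_pos[OF a(1)] by simp
  also have "\<dots> \<le> s * (eps / C * norm (p - x))" using dlt2(2)[OF p(1) a(1) px(2)] s by (intro mult_left_mono) auto
  also have "\<dots> \<le> 1 * (eps / C * norm (p - x))" using s eps C by (intro mult_right_mono) auto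
  also have "\<dots> \<le> 1 * (eps / C * (C * norm (g *\<^sub>R x - s *\<^sub>R p)))"
   using C(3)[OF a(1) p(1) px(1) a(2) s] eps C(1) by (intro mult_left_mono) auto
  also have "\<dots> = eps * norm (g *\<^sub>R x - k)" using C(1) p(2) by simp
  finally show "(k - x) \<bullet> \<nu> x \<le> eps * norm (g *\<^sub>R x - k)" .
 qed
qed

end

section \<open>Support functions and the gauge on K + t L\<close>

lemma support_fun_upper: "compact L \<Longrightarrow> y \<in> L \<Longrightarrow> y \<bullet> z \<le> support_fun L z"
 unfolding support_fun_def
 by (rule cSUP_upper) (auto intro!: bounded_imp_bdd_above compact_imp_bounded compact_continuous_image continuous_intros)

lemma support_fun_least: "L \<noteq> {} \<Longrightarrow> (\<And>y. y \<in> L \<Longrightarrow> y \<bullet> z \<le> M) \<Longrightarrow> support_fun L z \<le> M"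
 unfolding support_fun_def by (rule cSUP_least)

lemma support_fun_abs_le:
 assumes "compact L" "L \<noteq> {}" "\<And>y. y \<in> L \<Longrightarrow> norm y \<le> R"
 shows "\<bar>support_fun L z\<bar> \<le> R * norm z"
proof -
 have b: "\<bar>y \<bullet> z\<bar> \<le> R * norm z" if "y \<in> L" for y
  using Cauchy_Schwarz_ineq2[of y z] mult_right_mono[OF assms(3)[OF that], of "norm z"] by simp
 obtain y where y: "y \<in> L" using assms(2) by blast
 have "support_fun L z \<le> R * norm z" by (rule support_fun_least[OF assms(2)]) (use b in \<open>auto simp: abs_le_iff\<close>)
 moreover have "- (R * norm z) \<le> support_fun L z" using support_fun_upper[OF assms(1) y, of z] b[OF y] by linarith
 ultimately show ?thesis by linarith
qed

lemma continuous_on_support_fun: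
 assumes "compact L" "L \<noteq> {}" shows "continuous_on S (support_fun L)"
proof -
 obtain R where R: "R > 0" "\<And>y. y \<in> L \<Longrightarrow> norm y \<le> R" using compact_imp_bounded[OF assms(1)] bounded_pos by blast
 have lip: "support_fun L z - support_fun L w \<le> R * dist z w" for z w
 proof -
  have "support_fun L z \<le> support_fun L w + R * dist z w"
  proof (rule support_fun_least[OF assms(2)])
   fix y assume y: "y \<in> L"
   have "y \<bullet> (z - w) \<le> norm y * norm (z - w)" by (rule norm_cauchy_schwarz)
   also have "\<dots> \<le> R * norm (z - w)" using R(2)[OF y] by (rule mult_right_mono) simp
   finally show "y \<bullet> z \<le> support_fun L w + R * dist z w"
    using support_fun_upper[OF assms(1) y, of w] by (simp add: inner_diff_right dist_norm)
  qed
  then show ?thesis by simp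
 qed
 show ?thesis
 proof (rule lipschitz_on_continuous_on[of R], rule lipschitz_onI)
  show "dist (support_fun L z) (support_fun L w) \<le> R * dist z w" for z w
   using lip[of z w] lip[of w z] by (simp add: dist_real_def dist_commute abs_le_iff)
 qed (use R in simp)
qed

context star_hypersurface
begin

text \<open>The slope at \<open>t = 0\<close> of the gauge on the boundary of \<open>K + t L\<close>.\<close>

definition "slopeG L x = support_fun L (\<nu> (rad x)) / (rad x \<bullet> \<nu> (rad x))"

lemma slopeG_scale: "s > 0 \<Longrightarrow> slopeG L (s *\<^sub>R x) = slopeG L x"
 by (simp add: slopeG_def rad_scale)

lemma slopeG_bound:
 assumes "compact L" "L \<noteq> {}" obtains B where "B > 0" "\<And>x. x \<in> Q \<Longrightarrow> \<bar>slopeG L x\<bar> \<le> B"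
proof -
 obtain c0 where c0: "c0 > 0" "\<And>x. x \<in> \<Sigma> \<Longrightarrow> c0 \<le> x \<bullet> \<nu> x" using support_bound by blast
 obtain R where R: "R > 0" "\<And>y. y \<in> L \<Longrightarrow> norm y \<le> R" using compact_imp_bounded[OF assms(1)] bounded_pos by blast
 show ?thesis
 proof (rule that[of "R / c0"])
  fix x assume "x \<in> Q"
  then have x: "rad x \<in> \<Sigma>" by (rule rad_mem)
  show "\<bar>slopeG L x\<bar> \<le> R / c0"
   unfolding slopeG_def abs_divide using c0(1) c0(2)[OF x] support_fun_abs_le[OF assms R(2), of "\<nu> (rad x)"] nu_unit[OF x]
   by (intro frac_le) auto
 qed (use c0 R in simp)
qed

lemma continuous_on_slopeG:
 assumes "compact L" "L \<noteq> {}" shows "continuous_on Q (slopeG L)"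
proof -
 have n: "continuous_on Q (\<lambda>x. \<nu> (rad x))"
  by (rule continuous_on_compose2[OF continuous_on_nu continuous_on_rad]) (auto intro: rad_mem)
 have "continuous_on Q (\<lambda>x. support_fun L (\<nu> (rad x)))"
  by (rule continuous_on_compose2[OF continuous_on_support_fun[OF assms, of UNIV] n]) auto
 then show ?thesis
  unfolding slopeG_def[abs_def] using nu_pos rad_mem by (intro continuous_intros n continuous_on_rad) (auto simp: less_imp_neq[symmetric] dest!: rad_mem nu_pos)
qed

text \<open>Write x = k + t y = gau x * x0 with x0 in \<open>\<Sigma>\<close>. Pairing x - x0 with
  the normal at x0 expresses (gau x - 1) (x0 \<bullet> \<nu> x0) as the normal component of k - x0,
  at most t * eps * c0 by \<open>one_sided_tangent\<close>, plus t times that of y, at most t times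
  the support function.\<close>

lemma gauge_estimate:
 assumes L: "compact L" "L \<noteq> {}" "\<And>y. y \<in> L \<Longrightarrow> snd y \<ge> 0" and eps: "eps > 0"
 shows "\<forall>\<^sub>F t in at_right 0. \<forall>x\<in>dsum K t L. snd x \<ge> 0 \<and> (x = 0 \<or> gau x \<le> 1 + t * (slopeG L x + eps))"
proof -
 obtain c0 where c0: "c0 > 0" "\<And>x. x \<in> \<Sigma> \<Longrightarrow> c0 \<le> x \<bullet> \<nu> x" using support_bound by blast
 obtain R where R: "R > 0" "\<And>y. y \<in> L \<Longrightarrow> norm y \<le> R" using compact_imp_bounded[OF L(1)] bounded_pos by blast
 obtain B where B: "B > 0" "\<And>x. x \<in> Q \<Longrightarrow> \<bar>slopeG L x\<bar> \<le> B" using slopeG_bound[OF L(1,2)] by blast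
 have "eps * c0 / R > 0" using eps c0 R by simp
 then obtain eta where eta: "eta > 0"
  "\<And>x g k. x \<in> \<Sigma> \<Longrightarrow> 1 / 2 \<le> g \<Longrightarrow> k \<in> K \<Longrightarrow> norm (g *\<^sub>R x - k) \<le> eta \<Longrightarrow> (k - x) \<bullet> \<nu> x \<le> eps * c0 / R * norm (g *\<^sub>R x - k)"
  using one_sided_tangent by blast
 \<comment> \<open>The bound 1 / (2 * B) disposes of points of gauge below 1 / 2; the bound eta / R
   keeps k within eta of x.\<close>
 define t0 where "t0 = min (1 / (2 * B)) (eta / R)"
 have t0: "t0 > 0" using B eta R by (simp add: t0_def)
 have "snd x \<ge> 0 \<and> (x = 0 \<or> gau x \<le> 1 + t * (slopeG L x + eps))" if t: "0 < t" "t < t0" and x: "x \<in> dsum K t L" for t x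
 proof -
  obtain k y where ky: "k \<in> K" "y \<in> L" "x = k + t *\<^sub>R y" using x by (auto simp: dsum_def)
  have sx: "snd x \<ge> 0" using ky L(3)[OF ky(2)] t by (simp add: K_iff)
  moreover have "gau x \<le> 1 + t * (slopeG L x + eps)" if "x \<noteq> 0"
  proof -
   have xQ: "x \<in> Q" using that sx by (simp add: Q_def)
   define x0 where "x0 = rad x"
   have x0: "x0 \<in> \<Sigma>" using rad_mem[OF xQ] by (simp add: x0_def)
   show ?thesis
   proof (cases "gau x < 1 / 2")
    case True
    have "t * (- B) \<ge> - (1 / 2)" using t B by (simp add: t0_def field_simps)
    moreover have "t * (slopeG L x + eps) \<ge> t * (- B)" using t B(2)[OF xQ] eps by (intro mult_left_mono) auto
    ultimately show ?thesis using True by linarith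
   next
    case False
    have gx: "gau x *\<^sub>R x0 = x" using gau_rad[OF xQ] by (simp add: x0_def)
    have nt: "norm (gau x *\<^sub>R x0 - k) \<le> t * R" unfolding gx unfolding ky(3) using t R(2)[OF ky(2)] by (simp add: mult_left_mono)
    have "t * R < eta" using t R by (simp add: t0_def field_simps)
    then have "(k - x0) \<bullet> \<nu> x0 \<le> eps * c0 / R * norm (gau x *\<^sub>R x0 - k)"
     using nt False by (intro eta(2)[OF x0 _ ky(1)]) auto
    also have "\<dots> \<le> eps * c0 / R * (t * R)" using nt eps c0 R by (intro mult_left_mono) auto
    also have "\<dots> = t * (eps * c0)" using R by simp
    finally have 1: "(k - x0) \<bullet> \<nu> x0 \<le> t * (eps * c0)" .
    have "(gau x - 1) * (x0 \<bullet> \<nu> x0) = (gau x *\<^sub>R x0 - x0) \<bullet> \<nu> x0" by (simp add: algebra_simps inner_diff_left)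
    also have "\<dots> = (k - x0) \<bullet> \<nu> x0 + t * (y \<bullet> \<nu> x0)" unfolding gx by (simp add: ky(3) inner_diff_left inner_add_left)
    also have "\<dots> \<le> t * (eps * c0) + t * support_fun L (\<nu> x0)"
     using 1 support_fun_upper[OF L(1) ky(2)] t by (intro add_mono mult_left_mono) auto
    also have "\<dots> \<le> t * (eps * (x0 \<bullet> \<nu> x0)) + t * support_fun L (\<nu> x0)"
     using c0(2)[OF x0] eps t by simp
    finally have "gau x - 1 \<le> (t * (eps * (x0 \<bullet> \<nu> x0)) + t * support_fun L (\<nu> x0)) / (x0 \<bullet> \<nu> x0)"
     using nu_pos[OF x0] by (simp add: pos_le_divide_eq)
    also have "\<dots> = t * (slopeG L x + eps)"
     using nu_pos[OF x0] by (simp add: slopeG_def x0_def[symmetric] field_simps)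
    finally show ?thesis by simp
   qed
  qed
  ultimately show ?thesis by blast
 qed
 then show ?thesis unfolding eventually_at_right_field using t0 by blast
qed

end

text \<open>The left-hand side has derivative m * c at t = 0, and h > 0 leaves room above
  it.\<close>

lemma eventually_power_linear_le:
 fixes c h :: real
 assumes "h > 0"
 shows "\<forall>\<^sub>F t in at_right 0. (1 + t * c) ^ m \<le> 1 + t * (real m * c + h)"
proof -
 have "((\<lambda>t. (1 + t * c) ^ m) has_real_derivative (real m * c)) (at 0)"
  by (auto intro!: derivative_eq_intros)
 then have "((\<lambda>t. ((1 + t * c) ^ m - 1) / t) \<longlongrightarrow> real m * c) (at_right 0)"
  unfolding has_field_derivative_iff by (auto intro: filterlim_mono[OF _ order_refl at_le])
 then have "\<forall>\<^sub>F t in at_right 0. ((1 + t * c) ^ m - 1) / t < real m * c + h"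
  by (rule order_tendstoD) (use assms in simp)
 then show ?thesis using eventually_at_right_less[of "0::real"]
  by eventually_elim (simp add: field_simps)
qed

context star_hypersurface
begin

text \<open>The null set {0} is removed so that \<open>rad\<close> and \<open>gau\<close> are
  continuous on the whole set.\<close>

definition "A0 = K - {0}"

lemma A0_Q: "A0 \<subseteq> Q" by (auto simp: A0_def K_iff Q_def)

lemma A0_borel [measurable]: "A0 \<in> sets borel"
 unfolding A0_def using borel_compact[OF compact_K] by (rule sets.Diff) simp

lemma A0_iff: "x \<in> A0 \<longleftrightarrow> x \<in> Q \<and> gau x \<le> 1"
 by (auto simp: A0_def K_iff Q_def)

lemma A0_lmeasurable: "A0 \<in> lmeasurable"
 by (rule bounded_set_imp_lmeasurable)
   (use A0_borel in \<open>auto simp: A0_def intro: bounded_subset[OF compact_imp_bounded[OF compact_K]]\<close>)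

lemma vol_A0: "measure lborel A0 = vol K"
proof -
 have "vol (K - {0}) = vol K"
  by (rule measure_Diff_null_set) (auto simp: compact_K lmeasurable_compact fmeasurableD)
 then have "vol A0 = vol K" by (simp only: A0_def)
 then show ?thesis using A0_borel by simp
qed

lemma borel_slopeG:
 assumes "compact L" "L \<noteq> {}" shows "(\<lambda>x. indicator A0 x * slopeG L x) \<in> borel_measurable borel"
 using borel_measurable_continuous_on_indicator[OF A0_borel continuous_on_subset[OF continuous_on_slopeG[OF assms] A0_Q]] by simp

lemma integrable_bounded_A0:
 fixes f :: "_ \<Rightarrow> real"
 assumes "(\<lambda>x. indicator A0 x * f x) \<in> borel_measurable borel" "\<And>x. x \<in> A0 \<Longrightarrow> \<bar>f x\<bar> \<le> B"
 shows "integrable lborel (\<lambda>x. indicator A0 x * f x)"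
proof (rule Bochner_Integration.integrable_bound)
 have "emeasure lborel A0 < \<infinity>" using A0_lmeasurable by (simp add: fmeasurable_def)
 then show "integrable lborel (\<lambda>x. indicator A0 x * B)" by (intro integrable_mult_left integrable_real_indicator) auto
 have "norm (indicator A0 x * f x) \<le> norm (indicator A0 x * B)" for x
  using assms(2)[of x] by (auto simp: indicator_def)
 then show "AE x in lborel. norm (indicator A0 x * f x) \<le> norm (indicator A0 x * B)" by simp
qed (use assms(1) in simp)

text \<open>\<open>slopeG\<close> is constant along rays. With \<open>K\<close> sliced into
  truncated cones \<open>C i\<close> on which it varies by at most h, \<open>gauge_estimate\<close>
  places K + t L, up to the origin, in the union of the dilates of the \<open>C i\<close> by lam i
  t. To first order in t the volumes of these dilates add up to vol K plus a Riemann sum for the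
  integral of the slope.\<close>

lemma vol_limsup:
 assumes L: "compact L" "L \<noteq> {}" "\<And>y. y \<in> L \<Longrightarrow> snd y \<ge> 0" and eps: "eps > 0"
 shows "\<forall>\<^sub>F t in at_right 0. vol (dsum K t L) \<le> vol K + t * (real (CARD('n) + 1) * (LINT x|lborel. indicator A0 x * slopeG L x) + eps)"
proof -
 let ?m = "CARD('n) + 1" and ?H = "slopeG L"
 obtain B where B: "B > 0" "\<And>x. x \<in> Q \<Longrightarrow> \<bar>?H x\<bar> \<le> B" using slopeG_bound[OF L(1,2)] by blast
 \<comment> \<open>With m the dimension, the errors add up to (2 m + 1) h vol K: m h vol K from the
   step function, m h vol K from the gauge estimate and h vol K from linearizing the power.\<close>
 define h where "h = eps / (real (2 * ?m + 1) * vol K)"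
 have h: "h > 0" using eps vol_K_pos by (simp add: h_def)
 \<comment> \<open>The slopes lie in an interval of length 2 * B, which is divided into steps of
   length h.\<close>
 define N where "N = nat \<lfloor>2 * B / h\<rfloor>"
 define bt where "bt i = - B + (real i + 1) * h" for i
 define C where "C i = {x \<in> A0. - B + real i * h \<le> ?H x \<and> ?H x < bt i}" for i
 have cell: "\<exists>i\<le>N. - B + real i * h \<le> ?H x \<and> ?H x < bt i" if "x \<in> Q" for x
 proof (intro exI conjI)
  let ?i = "nat \<lfloor>(?H x + B) / h\<rfloor>"
  have b: "0 \<le> ?H x + B" "?H x + B \<le> 2 * B" using B(2)[OF that] by (auto simp: abs_le_iff)
  show "?i \<le> N" unfolding N_def using b h by (intro nat_mono floor_mono divide_right_mono) auto
  have "real ?i = real_of_int \<lfloor>(?H x + B) / h\<rfloor>" using b h by simp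
  then have "real ?i \<le> (?H x + B) / h" "(?H x + B) / h < real ?i + 1" by linarith+
  then show "- B + real ?i * h \<le> ?H x" "?H x < bt ?i" using h by (auto simp: bt_def field_simps)
 qed
 have Cb: "C i \<in> sets borel" for i
 proof -
  have "C i = A0 \<inter> ({x. - B + real i * h \<le> indicator A0 x * ?H x} \<inter> {x. indicator A0 x * ?H x < bt i})" by (auto simp: C_def)
  moreover have "{x. - B + real i * h \<le> indicator A0 x * ?H x} \<in> sets borel" "{x. indicator A0 x * ?H x < bt i} \<in> sets borel"
   using borel_slopeG[OF L(1,2)] by measurable
  ultimately show ?thesis by simp
 qed
 have bK: "bounded K" using compact_K by (rule compact_imp_bounded)
 have bC: "bounded (C i)" for i using bK by (rule bounded_subset) (auto simp: C_def A0_def)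
 have lC: "C i \<in> lmeasurable" for i by (rule bounded_set_imp_lmeasurable[OF bC]) (use Cb in simp)
 have fC: "emeasure lborel (C i) < \<infinity>" for i using lC[of i] Cb by (simp add: fmeasurable_def)
 have disj: "i = j" if "x \<in> C i" "x \<in> C j" for x i j
 proof -
  have "- B + real i * h < - B + (real j + 1) * h" "- B + real j * h < - B + (real i + 1) * h" using that by (auto simp: C_def bt_def)
  then have "real i < real j + 1" "real j < real i + 1" using h by auto
  then show ?thesis by linarith
 qed
 define lam where "lam i t = 1 + t * (bt i + h)" for i t
 have ev1: "\<forall>\<^sub>F t in at_right 0. \<forall>i\<in>{..N}. lam i t > 0"
 proof (rule eventually_ball_finite[OF finite_atMost], rule ballI)
  fix i
  have "((\<lambda>t. 1 + t * (bt i + h)) \<longlongrightarrow> 1 + 0 * (bt i + h)) (at_right 0)" by (intro tendsto_intros)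
  then show "\<forall>\<^sub>F t in at_right 0. lam i t > 0" unfolding lam_def by (rule order_tendstoD) simp
 qed
 have ev2: "\<forall>\<^sub>F t in at_right 0. \<forall>i\<in>{..N}. lam i t ^ ?m \<le> 1 + t * (real ?m * (bt i + h) + h)"
  unfolding lam_def by (intro eventually_ball_finite ballI eventually_power_linear_le h) auto
 have step: "(\<Sum>i\<le>N. bt i * vol (C i)) \<le> (LINT x|lborel. indicator A0 x * ?H x) + h * vol K"
 proof -
  have "(\<Sum>i\<le>N. bt i * vol (C i)) = (\<Sum>i\<le>N. (LINT x|lborel. (bt i * indicator (C i) x)))"
   using Cb by simp
  also have "\<dots> = (LINT x|lborel. (\<Sum>i\<le>N. bt i * indicator (C i) x))"
   by (rule Bochner_Integration.integral_sum[symmetric]) (use Cb fC in \<open>auto intro!: integrable_mult_right integrable_real_indicator\<close>)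
  also have "\<dots> \<le> (LINT x|lborel. (indicator A0 x * ?H x + indicator A0 x * h))"
  proof (rule integral_mono)
   show "integrable lborel (\<lambda>x. \<Sum>i\<le>N. bt i * indicator (C i) x)"
    by (rule Bochner_Integration.integrable_sum) (use Cb fC in \<open>auto intro!: integrable_mult_right integrable_real_indicator\<close>)
   show "integrable lborel (\<lambda>x. indicator A0 x * ?H x + indicator A0 x * h)"
    by (intro Bochner_Integration.integrable_add integrable_bounded_A0[of _ B] integrable_bounded_A0[of _ h] borel_slopeG L)
      (use B(2) A0_Q h in auto)
   fix x
   show "(\<Sum>i\<le>N. bt i * indicator (C i) x) \<le> indicator A0 x * ?H x + indicator A0 x * h"
   proof (cases "x \<in> A0")
    case False
    then show ?thesis by (simp add: C_def)
   next
    case True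
    then obtain i where i: "i \<le> N" "x \<in> C i" using cell[of x] A0_Q by (auto simp: C_def)
    have "(\<Sum>j\<le>N. bt j * indicator (C j) x) = (\<Sum>j\<le>N. if j = i then bt i else 0)"
    proof (intro sum.cong refl)
     fix j show "bt j * indicator (C j) x = (if j = i then bt i else 0)"
      using i(2) disj[of x i j] by (cases "j = i") (auto simp: indicator_def)
    qed
    also have "\<dots> = bt i" using i by simp
    also have "\<dots> \<le> ?H x + h" using i by (auto simp: C_def bt_def algebra_simps)
    finally show ?thesis using True by simp
   qed
  qed
  also have "\<dots> = (LINT x|lborel. indicator A0 x * ?H x) + (LINT x|lborel. indicator A0 x * h)"
   by (intro Bochner_Integration.integral_add integrable_bounded_A0[of _ B] integrable_bounded_A0[of _ h] borel_slopeG L)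
     (use B(2) A0_Q h in auto)
  also have "(LINT x|lborel. indicator A0 x * h) = h * vol K" by (simp add: vol_A0)
  finally show ?thesis .
 qed
 have sumC: "(\<Sum>i\<le>N. vol (C i)) = vol K"
 proof -
  have "(\<Sum>i\<le>N. vol (C i)) = vol (\<Union>i\<in>{..N}. C i)"
   by (rule measure_finite_Union[symmetric]) (use Cb lC disj in \<open>auto simp: disjoint_family_on_def fmeasurable_def less_top\<close>)
  also have "(\<Union>i\<in>{..N}. C i) = A0" using cell A0_Q by (fastforce simp: C_def)
  finally show ?thesis using vol_A0 by simp
 qed
 have "\<forall>\<^sub>F t in at_right 0. \<forall>x\<in>dsum K t L. snd x \<ge> 0 \<and> (x = 0 \<or> gau x \<le> 1 + t * (?H x + h))"
  by (rule gauge_estimate[OF L h])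
 then show ?thesis using ev1 ev2 eventually_at_right_less[of "0::real"]
 proof eventually_elim
  case (elim t)
  define S where "S i = (\<lambda>x. lam i t *\<^sub>R x + 0) ` C i" for i
  have lS: "S i \<in> lmeasurable" if "i \<le> N" for i
  proof (rule bounded_set_imp_lmeasurable)
   show "bounded (S i)" unfolding S_def using bounded_scaling[OF bC] by simp
   have pos: "lam i t > 0" using elim(2) that by auto
   have "S i = (\<lambda>x. (1 / lam i t) *\<^sub>R x) -` C i \<inter> space borel"
    using pos by (auto simp: S_def image_iff intro!: bexI[of _ "(1 / lam i t) *\<^sub>R _"])
   also have "\<dots> \<in> sets borel" by (rule measurable_sets[OF _ Cb]) measurable
   finally show "S i \<in> sets lebesgue" by simp
  qed
  have vS: "vol (S i) = lam i t ^ ?m * vol (C i)" if "i \<le> N" for i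
   unfolding S_def vol_affine using elim(2)[rule_format, of i] that by simp
  have sub: "dsum K t L \<subseteq> {0} \<union> (\<Union>i\<in>{..N}. S i)"
  proof
   fix x assume x: "x \<in> dsum K t L"
   show "x \<in> {0} \<union> (\<Union>i\<in>{..N}. S i)"
   proof (cases "x = 0")
    case False
    then have xQ: "x \<in> Q" and g: "gau x \<le> 1 + t * (?H x + h)" using elim(1) x by (auto simp: Q_def)
    obtain i where i: "i \<le> N" "- B + real i * h \<le> ?H x" "?H x < bt i" using cell[OF xQ] by blast
    have pos: "lam i t > 0" using elim(2) i by auto
    have "1 + t * (?H x + h) \<le> lam i t" unfolding lam_def using i elim(4) by simp
    then have "gau x \<le> lam i t" using g by linarith
    then have "(1 / lam i t) * gau x \<le> 1" using pos by (simp add: field_simps)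
    then have "(1 / lam i t) *\<^sub>R x \<in> C i"
     using pos i xQ by (simp add: C_def A0_iff Q_scale gau_scale slopeG_scale del: scaleR_cancel_left)
    moreover have "x = lam i t *\<^sub>R ((1 / lam i t) *\<^sub>R x) + 0" using pos by simp
    ultimately have "x \<in> S i" unfolding S_def by blast
    then show ?thesis using i(1) by blast
   qed simp
  qed
  have lU: "(\<Union>i\<in>{..N}. S i) \<in> lmeasurable" using lS by (intro fmeasurable.finite_UN) auto
  have lU': "{0} \<union> (\<Union>i\<in>{..N}. S i) \<in> lmeasurable" by (rule fmeasurable.Un[OF _ lU]) (simp add: lmeasurable_compact)
  have "vol (dsum K t L) \<le> vol ({0} \<union> (\<Union>i\<in>{..N}. S i))"
   by (rule measure_mono_fmeasurable[OF sub _ lU'])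
     (use lmeasurable_compact[OF dsum_compact[OF compact_K L(1)]] in \<open>auto intro: fmeasurableD\<close>)
  also have "\<dots> \<le> vol {0 :: (real^'n) \<times> real} + vol (\<Union>i\<in>{..N}. S i)" by (rule measure_Un_le) (use lU in auto)
  also have "\<dots> \<le> 0 + (\<Sum>i\<le>N. vol (S i))"
   by (intro add_mono measure_UNION_le) (use lS in \<open>auto intro: fmeasurableD\<close>)
  also have "\<dots> = (\<Sum>i\<le>N. lam i t ^ ?m * vol (C i))" using vS by simp
  also have "\<dots> \<le> (\<Sum>i\<le>N. (1 + t * (real ?m * (bt i + h) + h)) * vol (C i))"
   using elim(3) by (intro sum_mono mult_right_mono) auto
  also have "\<dots> = (\<Sum>i\<le>N. vol (C i)) + t * (real ?m * (\<Sum>i\<le>N. bt i * vol (C i)) + (real ?m + 1) * h * (\<Sum>i\<le>N. vol (C i)))"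
   by (simp add: sum_distrib_left sum.distrib[symmetric]) (simp add: algebra_simps)
  also have "\<dots> \<le> vol K + t * (real ?m * ((LINT x|lborel. indicator A0 x * ?H x) + h * vol K) + (real ?m + 1) * h * vol K)"
   unfolding sumC using step elim(4) by (intro add_left_mono mult_left_mono add_right_mono) auto
  also have "\<dots> = vol K + t * (real ?m * (LINT x|lborel. indicator A0 x * ?H x) + h * (real (2 * ?m + 1) * vol K))"
   by (simp add: algebra_simps)
  also have "h * (real (2 * ?m + 1) * vol K) = eps" using vol_K_pos by (simp add: h_def del: of_nat_add of_nat_mult of_nat_Suc)
  finally show ?case .
 qed
qed

end

section \<open>Jacobian of the polar-coordinate map\<close>

abbreviation "idx_some j \<equiv> Abs_idx (Some j)"
abbreviation "idx_none \<equiv> Abs_idx None"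

lemma idx_some_inject [simp]: "idx_some i = idx_some j \<longleftrightarrow> i = j" by (simp add: Abs_idx_inject)
lemma idx_some_none [simp]: "idx_some i \<noteq> idx_none" "idx_none \<noteq> idx_some i" by (simp_all add: Abs_idx_inject)

lemma range_idx_some: "range idx_some = UNIV - {idx_none}"
proof (intro set_eqI iffI)
 fix i :: "'a idx" assume "i \<in> UNIV - {idx_none}"
 then have "Rep_idx i \<noteq> None" using Rep_idx_inverse[of i] by (metis DiffD2 singletonI)
 then obtain j where "Rep_idx i = Some j" by blast
 then have "i = idx_some j" using Rep_idx_inverse[of i] by simp
 then show "i \<in> range idx_some" by blast
qed auto

text \<open>Row \<open>idx_none\<close> can be nonzero only on the diagonal, so only permutations
  fixing \<open>idx_none\<close> contribute, and these are the permutations of the remaining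
  indices.\<close>

lemma det_idx_block:
 fixes A :: "real^('n::finite idx)^('n idx)"
 assumes z: "\<And>j. A $ idx_none $ idx_some j = 0"
 shows "det A = A $ idx_none $ idx_none * det (\<chi> i j. A $ idx_some i $ idx_some j)"
proof -
 let ?S = "idx_some :: 'n \<Rightarrow> 'n idx" and ?N = "idx_none :: 'n idx"
 let ?t = "\<lambda>p. of_int (sign p) * (\<Prod>i\<in>UNIV. A $ i $ p i)"
 have bS: "bij_betw ?S UNIV (range ?S)" by (simp add: bij_betw_def inj_def)
 have UN: "(UNIV :: 'n idx set) = insert ?N (range ?S)" unfolding range_idx_some by auto
 have "det A = (\<Sum>p\<in>{p. p permutes range ?S}. ?t p)"
  unfolding det_def
 proof (rule sum.mono_neutral_right)
  show "finite {p. p permutes (UNIV :: 'n idx set)}" by (rule finite_permutations) simp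
  show "{p. p permutes range ?S} \<subseteq> {p. p permutes UNIV}" by (auto intro: permutes_subset)
  show "\<forall>p\<in>{p. p permutes UNIV} - {p. p permutes range ?S}. ?t p = 0"
  proof
   fix p assume p: "p \<in> {p. p permutes UNIV} - {p. p permutes range ?S}"
   have "p ?N \<noteq> ?N"
   proof
    assume "p ?N = ?N"
    have "p permutes range ?S"
    proof (rule permutes_superset)
     show "p permutes UNIV" using p by blast
     show "p x = x" if "x \<in> UNIV - range ?S" for x using that \<open>p ?N = ?N\<close> by (auto simp: range_idx_some)
    qed
    then show False using p by blast
   qed
   then have "p ?N \<in> range ?S" unfolding range_idx_some by simp
   then have "A $ ?N $ p ?N = 0" using z by auto
   then have "(\<Prod>i\<in>UNIV. A $ i $ p i) = 0" by (intro prod_zero) auto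
   then show "?t p = 0" by simp
  qed
 qed
 also have "\<dots> = (\<Sum>q\<in>{q. q permutes UNIV}. ?t (map_permutation UNIV ?S q))"
 proof (rule sum.reindex_bij_betw[symmetric])
  have "map_permutation UNIV ?S = (\<lambda>\<pi> x. if x \<in> range ?S then ?S (\<pi> (inv_into UNIV ?S x)) else x)"
   by (simp add: map_permutation_def restrict_id_def fun_eq_iff)
  then show "bij_betw (map_permutation UNIV ?S) {q. q permutes UNIV} {p. p permutes range ?S}"
   using bij_betw_permutations[OF bS] by simp
 qed
 also have "\<dots> = (\<Sum>q\<in>{q. q permutes (UNIV :: 'n set)}. A $ ?N $ ?N * (of_int (sign q) * (\<Prod>i\<in>UNIV. (\<chi> i j. A $ ?S i $ ?S j) $ i $ q i)))"
 proof (rule sum.cong[OF refl])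
  fix q :: "'n \<Rightarrow> 'n" assume q: "q \<in> {q. q permutes UNIV}"
  have sg: "sign (map_permutation UNIV ?S q) = sign q"
   by (rule sign_map_permutation) (use q in \<open>auto simp: inj_def\<close>)
  have "map_permutation UNIV ?S q permutes range ?S" using map_permutation_permutes[OF bS] q by blast
  then have N: "map_permutation UNIV ?S q ?N = ?N" by (rule permutes_not_in) (auto simp: range_idx_some)
  have S: "map_permutation UNIV ?S q (?S i) = ?S (q i)" for i by (rule map_permutation_apply) (auto simp: inj_def)
  have "(\<Prod>i\<in>UNIV. A $ i $ map_permutation UNIV ?S q i) = (\<Prod>i\<in>insert ?N (range ?S). A $ i $ map_permutation UNIV ?S q i)"
   using UN by simp
  also have "\<dots> = A $ ?N $ ?N * (\<Prod>i\<in>range ?S. A $ i $ map_permutation UNIV ?S q i)"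
   by (subst prod.insert) (auto simp: range_idx_some N)
  also have "(\<Prod>i\<in>range ?S. A $ i $ map_permutation UNIV ?S q i) = (\<Prod>i\<in>UNIV. A $ ?S i $ ?S (q i))"
   by (subst prod.reindex) (auto simp: S inj_def)
  finally show "?t (map_permutation UNIV ?S q) = A $ ?N $ ?N * (of_int (sign q) * (\<Prod>i\<in>UNIV. (\<chi> i j. A $ ?S i $ ?S j) $ i $ q i))"
   by (simp add: sg)
 qed
 also have "\<dots> = A $ ?N $ ?N * det (\<chi> i j. A $ ?S i $ ?S j)" unfolding det_def by (rule sum_distrib_left[symmetric])
 finally show ?thesis .
qed

lemma prj_axis [simp]: "prj (axis (idx_some j) r) = (axis j r, 0)" "prj (axis idx_none r) = (0, r)"
 by (auto simp: prj_def axis_def vec_eq_iff)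

lemma linear_emb_prj:
 fixes f :: "(real^'n) \<times> real \<Rightarrow> (real^'n) \<times> real"
 shows "linear f \<Longrightarrow> linear (\<lambda>w :: real^('n idx). emb (f (prj w)))"
 using linear_compose[OF linear_prj linear_compose[of f emb, OF _ linear_emb]] by (simp add: o_def)

lemma det_gram:
 fixes f :: "(real^'n) \<times> real \<Rightarrow> (real^'n) \<times> real"
 shows "(det (matrix (\<lambda>w. emb (f (prj w)))))\<^sup>2 = det (\<chi> i j. f (prj (axis i 1)) \<bullet> f (prj (axis j 1)))"
proof -
 let ?M = "matrix (\<lambda>w. emb (f (prj w)))"
 have "transpose ?M ** ?M = (\<chi> i j. f (prj (axis i 1)) \<bullet> f (prj (axis j 1)))"
 proof -
  have "(transpose ?M ** ?M) $ i $ j = emb (f (prj (axis i 1))) \<bullet> emb (f (prj (axis j 1)))" for i j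
   unfolding inner_vec_def by (simp add: matrix_matrix_mult_def transpose_def matrix_def)
  then show ?thesis by (simp add: vec_eq_iff)
 qed
 then have "det (transpose ?M ** ?M) = det (\<chi> i j. f (prj (axis i 1)) \<bullet> f (prj (axis j 1)))" by simp
 then show ?thesis by (simp add: det_mul power2_eq_square)
qed

text \<open>The matrix is that of the derivative of (u, s) \<mapsto> s psi u, with f the derivative
  of psi and p = psi u. Since p is f a plus (p \<bullet> \<nu>) \<nu>, the map factors as G \<circ>
  T: G adds the unit normal to f and has the same Gram determinant, and T is block triangular with
  diagonal entries s and p \<bullet> \<nu>.\<close>

lemma radial_jacobian:
 fixes f :: "real^'n \<Rightarrow> (real^'n) \<times> real"
 assumes f: "linear f" "inj f" and \<nu>: "norm \<nu> = 1" "\<And>v. f v \<bullet> \<nu> = 0"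
 shows "\<bar>det (matrix (\<lambda>w. emb (s *\<^sub>R f (fst (prj w)) + snd (prj w) *\<^sub>R p)))\<bar>
   = \<bar>s\<bar> ^ CARD('n) * \<bar>p \<bullet> \<nu>\<bar> * sqrt (det (\<chi> i j. f (axis i 1) \<bullet> f (axis j 1)))"
proof -
 let ?c = "p \<bullet> \<nu>" and ?g = "\<chi> i j. f (axis i 1) \<bullet> f (axis j 1)"
 have \<nu>\<nu>: "\<nu> \<bullet> \<nu> = 1" using \<nu>(1) by (simp add: norm_eq_sqrt_inner)
 have \<nu>0: "\<nu> \<noteq> 0" using \<nu>(1) by auto
 have "range f = {x. \<nu> \<bullet> x = 0}"
 proof (rule subspace_dim_equal)
  show "subspace (range f)" using f(1) by (simp add: linear_subspace_image subspace_UNIV)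
  show "subspace {x. \<nu> \<bullet> x = 0}" by (rule subspace_hyperplane)
  show "range f \<subseteq> {x. \<nu> \<bullet> x = 0}" using \<nu>(2) by (auto simp: inner_commute)
  have "dim (range f) = DIM(real^'n)" using dim_image_eq[OF f(1), of UNIV] f(2) by simp
  then show "dim {x. \<nu> \<bullet> x = 0} \<le> dim (range f)" using dim_hyperplane[OF \<nu>0] by simp
 qed
 moreover have "p - ?c *\<^sub>R \<nu> \<in> {x. \<nu> \<bullet> x = 0}" by (simp add: inner_diff_right \<nu>\<nu> inner_commute)
 ultimately obtain a where "p - ?c *\<^sub>R \<nu> = f a" by blast
 then have a: "p = f a + ?c *\<^sub>R \<nu>" by (simp add: algebra_simps)
 define G where "G x = f (fst x) + snd x *\<^sub>R \<nu>" for x :: "(real^'n) \<times> real"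
 define T where "T x = (s *\<^sub>R fst x + snd x *\<^sub>R a, snd x * ?c)" for x :: "(real^'n) \<times> real"
 have lG: "linear G" unfolding G_def by (rule linearI) (auto simp: linear_add[OF f(1)] linear_scale[OF f(1)] algebra_simps)
 have lT: "linear T" unfolding T_def by (rule linearI) (auto simp: algebra_simps)
 have GT: "s *\<^sub>R f (fst x) + snd x *\<^sub>R p = G (T x)" for x
  unfolding G_def T_def fst_conv snd_conv linear_add[OF f(1)] linear_scale[OF f(1)]
  by (subst a) (simp add: scaleR_add_right)
 let ?MG = "matrix (\<lambda>w. emb (G (prj w)))" and ?MT = "matrix (\<lambda>w. emb (T (prj w)))"
 have "(\<lambda>w. emb (s *\<^sub>R f (fst (prj w)) + snd (prj w) *\<^sub>R p)) = (\<lambda>w. emb (G (prj w))) \<circ> (\<lambda>w. emb (T (prj w)))"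
  by (simp add: GT o_def)
 then have "matrix (\<lambda>w. emb (s *\<^sub>R f (fst (prj w)) + snd (prj w) *\<^sub>R p)) = ?MG ** ?MT"
  using matrix_compose[OF linear_emb_prj[OF lT] linear_emb_prj[OF lG]] by simp
 then have 1: "\<bar>det (matrix (\<lambda>w. emb (s *\<^sub>R f (fst (prj w)) + snd (prj w) *\<^sub>R p)))\<bar> = \<bar>det ?MG\<bar> * \<bar>det ?MT\<bar>"
  by (simp add: det_mul abs_mult)
 have \<nu>f: "\<nu> \<bullet> f v = 0" for v using \<nu>(2)[of v] by (simp add: inner_commute)
 have "(det ?MG)\<^sup>2 = det ?g"
  unfolding det_gram by (subst det_idx_block) (simp_all add: G_def \<nu>\<nu> \<nu>f linear_0[OF f(1)])
 then have 2: "\<bar>det ?MG\<bar> = sqrt (det ?g)" using real_sqrt_abs[of "det ?MG"] by simp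
 have "det ?MT = ?c * s ^ CARD('n)"
 proof -
  have "det ?MT = ?MT $ idx_none $ idx_none * det (\<chi> i j. ?MT $ idx_some i $ idx_some j)"
   by (rule det_idx_block) (simp add: matrix_def T_def)
  also have "?MT $ idx_none $ idx_none = ?c" by (simp add: matrix_def T_def)
  also have "det (\<chi> i j. ?MT $ idx_some i $ idx_some j) = (\<Prod>i\<in>UNIV. (\<chi> i j. ?MT $ idx_some i $ idx_some j) $ i $ i)"
   by (rule det_diagonal) (simp add: matrix_def T_def, simp add: axis_def)
  also have "\<dots> = s ^ CARD('n)" by (simp add: matrix_def T_def)
  finally show ?thesis .
 qed
 then have 3: "\<bar>det ?MT\<bar> = \<bar>s\<bar> ^ CARD('n) * \<bar>?c\<bar>" by (simp add: abs_mult power_abs)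
 show ?thesis unfolding 1 2 3 by simp
qed

section \<open>The area measure as a cone measure\<close>

lemma nn_integral_emb:
 fixes F :: "(real^'n) \<times> real \<Rightarrow> real"
 assumes "F \<in> borel_measurable borel"
 shows "(\<integral>\<^sup>+y. ennreal (F (prj y)) \<partial>lborel) = (\<integral>\<^sup>+x. ennreal (F x) \<partial>lborel)"
 using assms by (subst distr_emb[symmetric], subst nn_integral_distr) (auto intro!: measurable_compose[OF prj_measurable])

text \<open>Carried over from Cartesian vectors by conjugation with \<open>emb\<close>; the
  integrand is wrapped as a vector of length one because the underlying theorem treats vector-valued
  functions.\<close>

lemma nn_integral_change_of_variables:
 fixes Phi :: "(real^'n) \<times> real \<Rightarrow> (real^'n) \<times> real" and h k :: "(real^'n) \<times> real \<Rightarrow> real"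
 assumes W: "W \<in> sets borel" and der: "\<And>x. x \<in> W \<Longrightarrow> (Phi has_derivative Phi' x) (at x)" and inj: "inj_on Phi W"
  and im: "Phi ` W = B" and h: "integrable lborel (\<lambda>x. indicator B x * h x)" "\<And>x. x \<in> B \<Longrightarrow> 0 \<le> h x"
  and k: "\<And>x. x \<in> W \<Longrightarrow> k x = \<bar>det (matrix (\<lambda>w. emb (Phi' x (prj w))))\<bar> * h (Phi x)"
   "(\<lambda>x. indicator W x * k x) \<in> borel_measurable borel"
 shows "(\<integral>\<^sup>+x. ennreal (indicator W x * k x) \<partial>lborel) = (\<integral>\<^sup>+x. ennreal (indicator B x * h x) \<partial>lborel)"
proof -
 let ?\<Psi> = "\<lambda>w. emb (Phi (prj w))" and ?\<Psi>' = "\<lambda>w v. emb (Phi' (prj w) (prj v))"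
 let ?f = "\<lambda>y. vec (h (prj y)) :: real^1"
 have hb: "(\<lambda>x. indicator B x * h x) \<in> borel_measurable borel" using borel_measurable_integrable[OF h(1)] by simp
 have ind: "indicator (emb ` A) y = (indicator A (prj y) :: real)" for A :: "((real^'n) \<times> real) set" and y
  by (simp add: indicator_def emb_image_vimage)
 have W': "emb ` W \<in> sets lebesgue" using emb_image_borel[OF W] by simp
 have der': "(?\<Psi> has_derivative ?\<Psi>' w) (at w within emb ` W)" if w: "w \<in> emb ` W" for w
 proof -
  have "(prj has_derivative prj) (at w within emb ` W)" by (rule linear_imp_has_derivative[OF linear_prj])
  moreover have "(Phi has_derivative Phi' (prj w)) (at (prj w))" using w by (intro der) auto
  ultimately have "((\<lambda>w. Phi (prj w)) has_derivative (\<lambda>v. Phi' (prj w) (prj v))) (at w within emb ` W)"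
   by (rule has_derivative_compose)
  then show ?thesis
   by (rule bounded_linear.has_derivative[OF linear_conv_bounded_linear[THEN iffD1, OF linear_emb]])
 qed
 have inj': "inj_on ?\<Psi> (emb ` W)"
  using inj by (auto simp: inj_on_def dest: injD[OF inj_emb])
 have im': "?\<Psi> ` emb ` W = emb ` B" unfolding im[symmetric] image_image by simp
 have "(\<lambda>y. h (prj y)) absolutely_integrable_on emb ` B"
 proof -
  have "integrable lborel (\<lambda>y. indicator B (prj y) * h (prj y))"
   using h(1) hb by (subst distr_emb[symmetric], subst integrable_distr_eq) (auto intro!: measurable_compose[OF prj_measurable])
  then have "integrable lebesgue (\<lambda>y. indicator B (prj y) * h (prj y))"
   by (subst integrable_completion) (auto dest: borel_measurable_integrable)
  then show ?thesis by (simp add: set_integrable_def ind)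
 qed
 then have f: "?f absolutely_integrable_on ?\<Psi> ` emb ` W" by (simp add: absolutely_integrable_on_1_iff im')
 define b where "b = integral (emb ` B) (\<lambda>y. h (prj y))"
 have fb: "integral (?\<Psi> ` emb ` W) ?f = vec b" by (simp add: integral_on_1_eq im' b_def)
 from has_absolute_integral_change_of_variables[OF W' der' inj', of ?f "vec b"] f fb
 have g: "(\<lambda>x. \<bar>det (matrix (?\<Psi>' x))\<bar> *\<^sub>R ?f (?\<Psi> x)) absolutely_integrable_on emb ` W"
  "integral (emb ` W) (\<lambda>x. \<bar>det (matrix (?\<Psi>' x))\<bar> *\<^sub>R ?f (?\<Psi> x)) = vec b" by blast+
 have g1: "(\<lambda>x. \<bar>det (matrix (?\<Psi>' x))\<bar> * h (Phi (prj x))) absolutely_integrable_on emb ` W"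
  using g(1) by (simp add: absolutely_integrable_on_1_iff)
 have g2: "integral (emb ` W) (\<lambda>x. \<bar>det (matrix (?\<Psi>' x))\<bar> * h (Phi (prj x))) = b"
  using g(2) by (simp add: integral_on_1_eq vec_eq_iff)
 have "((\<lambda>x. \<bar>det (matrix (?\<Psi>' x))\<bar> * h (Phi (prj x))) has_integral b) (emb ` W)"
  using g1 g2 by (simp add: absolutely_integrable_on_def has_integral_integrable_integral)
 then have gi: "((\<lambda>x. k (prj x)) has_integral b) (emb ` W)"
  by (rule has_integral_eq[rotated]) (auto simp: k(1))
 have hi: "((\<lambda>y. h (prj y)) has_integral b) (emb ` B)"
  using f by (simp add: b_def absolutely_integrable_on_1_iff im' absolutely_integrable_on_def integrable_integral)
 have k0: "0 \<le> k x" if "x \<in> W" for x using k(1)[OF that] h(2)[of "Phi x"] im that by auto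
 have "(\<integral>\<^sup>+x. ennreal (indicator W x * k x) \<partial>lborel) = (\<integral>\<^sup>+y. ennreal (indicator W (prj y) * k (prj y)) \<partial>lborel)"
  by (rule nn_integral_emb[symmetric, OF k(2)])
 also have "\<dots> = ennreal b"
  using nn_integral_has_integral_lebesgue[OF _ gi] k0 unfolding ind by (metis (no_types, lifting) imageE prj_emb)
 also have "\<dots> = (\<integral>\<^sup>+y. ennreal (indicator B (prj y) * h (prj y)) \<partial>lborel)"
  using nn_integral_has_integral_lebesgue[OF _ hi] h(2) unfolding ind by (metis (no_types, lifting) imageE prj_emb)
 also have "\<dots> = (\<integral>\<^sup>+x. ennreal (indicator B x * h x) \<partial>lborel)" by (rule nn_integral_emb[OF hb])
 finally show ?thesis .
qed

text \<open>The radial part of the cone measure has total mass one, so integrating it out leaves the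
  area.\<close>

lemma nn_integral_power_unit: "(\<integral>\<^sup>+s. ennreal (indicator {0<..1} s * (real (m + 1) * s ^ m)) \<partial>lborel) = 1" if "m > 0"
proof -
 have "(\<integral>\<^sup>+s. ennreal (real (m + 1) * s ^ m) * indicator {0..1} s \<partial>lborel) = ennreal (1 ^ (m + 1) - 0 ^ (m + 1))"
  by (rule nn_integral_FTC_Icc[where F="\<lambda>s. s ^ (m + 1)"]) (auto intro!: DERIV_pow[where n="m + 1", simplified])
 moreover have "ennreal (indicator {0<..1} s * (real (m + 1) * s ^ m)) = ennreal (real (m + 1) * s ^ m) * indicator {0..1} s" for s :: real
  using that by (auto simp: indicator_def)
 ultimately show ?thesis by simp
qed

abbreviation "area_density psi u \<equiv> sqrt (det (first_fundamental_form psi u))"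

lemma continuous_on_area_density:
 assumes "local_param \<Sigma> psi U a" shows "continuous_on U (area_density psi)"
 unfolding first_fundamental_form_def det_def vec_lambda_beta
 by (intro continuous_intros local_param_continuous_derivative[OF assms])

lemma chart_domain_borel: "local_param \<Sigma> psi U a \<Longrightarrow> chart_domain U a \<in> sets borel"
proof -
 assume "local_param \<Sigma> psi U a"
 then have "open U" by (simp add: local_param_def)
 moreover have "closed {u. 0 \<le> a \<bullet> u}" by (intro closed_Collect_le continuous_intros)
 moreover have "chart_domain U a = U \<inter> {u. 0 \<le> a \<bullet> u}" by (auto simp: chart_domain_def)
 ultimately show ?thesis by (simp add: borel_open borel_closed)
qed

lemma chart_vimage_borel:
 assumes lp: "local_param \<Sigma> psi U a" and S: "S \<in> sets borel"
 shows "{u \<in> chart_domain U a. psi u \<in> S} \<in> sets borel"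
proof -
 have "continuous_on U psi"
  using lp unfolding local_param_def smooth_on_def by (auto dest: spec[of _ "0::nat"])
 then have "continuous_on (chart_domain U a) psi" by (rule continuous_on_subset) (auto simp: chart_domain_def)
 then have "psi \<in> borel_measurable (restrict_space borel (chart_domain U a))" by (rule borel_measurable_continuous_on_restrict)
 from measurable_sets[OF this S] have "psi -` S \<inter> chart_domain U a \<in> sets (restrict_space borel (chart_domain U a))"
  by (simp add: space_restrict_space)
 then have "psi -` S \<inter> chart_domain U a \<in> sets borel" by (simp add: sets_restrict_space_iff chart_domain_borel[OF lp])
 then show ?thesis by (simp add: vimage_def Int_def conj_commute)
qed

context star_hypersurface
begin

text \<open>The solid cone over an area element at y has volume (y \<bullet> \<nu> y) / (CARD('n) +
  1) times the area. Weighting volume by the reciprocal factor makes radial projection push it to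
  the area.\<close>

definition "cone_density x = real (CARD('n) + 1) / (rad x \<bullet> \<nu> (rad x))"

lemma cone_density_pos: "x \<in> Q \<Longrightarrow> cone_density x > 0"
 using nu_pos[OF rad_mem] by (simp add: cone_density_def)

lemma continuous_on_cone_density: "continuous_on Q cone_density"
proof -
 have n: "continuous_on Q (\<lambda>x. \<nu> (rad x))"
  by (rule continuous_on_compose2[OF continuous_on_nu continuous_on_rad]) (auto intro: rad_mem)
 show ?thesis unfolding cone_density_def[abs_def]
  by (intro continuous_intros n continuous_on_rad) (auto dest!: rad_mem nu_pos)
qed

lemma cone_density_bound: obtains B where "\<And>x. x \<in> Q \<Longrightarrow> \<bar>cone_density x\<bar> \<le> B"
proof -
 obtain c0 where c0: "c0 > 0" "\<And>x. x \<in> \<Sigma> \<Longrightarrow> c0 \<le> x \<bullet> \<nu> x" using support_bound by blast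
 show ?thesis
 proof (rule that)
  fix x assume "x \<in> Q"
  then have "c0 \<le> rad x \<bullet> \<nu> (rad x)" using c0(2)[OF rad_mem] by blast
  then show "\<bar>cone_density x\<bar> \<le> real (CARD('n) + 1) / c0"
   unfolding cone_density_def abs_divide using c0(1) by (intro frac_le) auto
 qed
qed

lemma borel_cone_density: "(\<lambda>x. indicator A0 x * cone_density x) \<in> borel_measurable borel"
 using borel_measurable_continuous_on_indicator[OF A0_borel continuous_on_subset[OF continuous_on_cone_density A0_Q]] by simp

lemma rad_measurable: "rad \<in> borel_measurable (restrict_space borel A0)"
 by (rule borel_measurable_continuous_on_restrict[OF continuous_on_subset[OF continuous_on_rad A0_Q]])

lemma rad_vimage_borel: "S \<in> sets borel \<Longrightarrow> {x \<in> A0. rad x \<in> S} \<in> sets borel"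
proof -
 assume S: "S \<in> sets borel"
 have "rad -` S \<inter> A0 \<in> sets (restrict_space borel A0)"
  using measurable_sets[OF rad_measurable S] by (simp add: space_restrict_space)
 then have "rad -` S \<inter> A0 \<in> sets borel" by (simp add: sets_restrict_space_iff)
 then show ?thesis by (simp add: vimage_def Int_def conj_commute)
qed

text \<open>Polar coordinates (u, s) \<mapsto> s psi u map \<open>W\<close> bijectively onto the
  cone over S. The factor psi u \<bullet> \<nu> of the Jacobian cancels against the denominator of
  \<open>cone_density\<close>, and what remains in s integrates to 1.\<close>

lemma chart_area:
 assumes lp: "local_param \<Sigma> psi U a" and S: "S \<in> sets borel" "S \<subseteq> psi ` chart_domain U a"
 shows "(\<integral>\<^sup>+u. ennreal (indicator {u \<in> chart_domain U a. psi u \<in> S} u * area_density psi u) \<partial>lborel)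
  = (\<integral>\<^sup>+x. ennreal (indicator {x \<in> A0. rad x \<in> S} x * cone_density x) \<partial>lborel)"
proof -
 let ?n = "CARD('n)" and ?D = "\<lambda>u. frechet_derivative psi (at u)"
 define X where "X = {u \<in> chart_domain U a. psi u \<in> S}"
 define B where "B = {x \<in> A0. rad x \<in> S}"
 define W where "W = X \<times> {0<..1::real}"
 define Phi where "Phi x = snd x *\<^sub>R psi (fst x)" for x
 define Phi' where "Phi' x h = snd x *\<^sub>R ?D (fst x) (fst h) + snd h *\<^sub>R psi (fst x)" for x h
 have SS: "S \<subseteq> \<Sigma>" using S(2) lp unfolding local_param_def openin_euclidean_subtopology_iff by blast
 have XU: "X \<subseteq> U" by (auto simp: X_def chart_domain_def)
 have Xb: "X \<in> sets borel" unfolding X_def by (rule chart_vimage_borel[OF lp S(1)])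
 have Bb: "B \<in> sets borel" unfolding B_def by (rule rad_vimage_borel[OF S(1)])
 have Wb: "W \<in> sets borel" unfolding W_def using Xb by (simp add: borel_prod[symmetric])
 have injpsi: "inj_on psi (chart_domain U a)"
  using lp by (auto simp: local_param_def homeomorphism_def intro: inj_on_inverseI)
 have im: "Phi ` W = B"
 proof
  show "Phi ` W \<subseteq> B"
  proof
   fix x assume "x \<in> Phi ` W"
   then obtain u s where us: "u \<in> X" "0 < s" "s \<le> 1" "x = s *\<^sub>R psi u" by (auto simp: W_def Phi_def)
   then have "psi u \<in> S" "psi u \<in> \<Sigma>" using SS by (auto simp: X_def)
   moreover have "psi u \<in> Q" using calculation Sigma_Q by blast
   ultimately show "x \<in> B" using us by (simp add: B_def A0_iff rad_polar gau_polar Q_scale)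
  qed
  show "B \<subseteq> Phi ` W"
  proof
   fix x assume x: "x \<in> B"
   then have xQ: "x \<in> Q" "gau x \<le> 1" "rad x \<in> S" by (auto simp: B_def A0_iff)
   obtain u where u: "u \<in> chart_domain U a" "rad x = psi u" using S(2) xQ(3) by blast
   have "(u, gau x) \<in> W" using u xQ gau_pos[OF xQ(1)] by (auto simp: W_def X_def)
   moreover have "Phi (u, gau x) = x" using gau_rad[OF xQ(1)] u by (simp add: Phi_def)
   ultimately show "x \<in> Phi ` W" by (metis image_eqI)
  qed
 qed
 have inj: "inj_on Phi W"
 proof (rule inj_onI)
  fix x y assume xy: "x \<in> W" "y \<in> W" "Phi x = Phi y"
  then have "psi (fst x) \<in> \<Sigma>" "psi (fst y) \<in> \<Sigma>" "snd x > 0" "snd y > 0" using SS by (auto simp: W_def X_def)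
  then have "psi (fst x) = psi (fst y) \<and> snd x = snd y" using xy(3) by (intro polar_unique) (auto simp: Phi_def)
  moreover have "fst x \<in> chart_domain U a" "fst y \<in> chart_domain U a" using xy by (auto simp: W_def X_def)
  ultimately show "x = y" using injpsi by (auto simp: inj_on_def prod_eq_iff)
 qed
 have der: "(Phi has_derivative Phi' x) (at x)" if x: "x \<in> W" for x
 proof -
  have u: "fst x \<in> U" using x XU by (auto simp: W_def)
  have "((\<lambda>x. psi (fst x)) has_derivative (\<lambda>h. ?D (fst x) (fst h))) (at x)"
   using has_derivative_compose[OF has_derivative_fst[OF has_derivative_ident, where F="at x"] local_param_has_derivative[OF lp u]] by simp
  from has_derivative_scaleR[OF has_derivative_snd[OF has_derivative_ident] this]
  show ?thesis unfolding Phi_def[abs_def] Phi'_def[abs_def] by simp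
 qed
 obtain C where C: "\<And>x. x \<in> Q \<Longrightarrow> \<bar>cone_density x\<bar> \<le> C" using cone_density_bound by blast
 have BA: "B \<subseteq> A0" by (auto simp: B_def)
 have hint: "integrable lborel (\<lambda>x. indicator B x * cone_density x)"
 proof -
  have "integrable lborel (\<lambda>x. indicator B x *\<^sub>R (indicator A0 x * cone_density x))"
   by (rule integrable_mult_indicator[OF _ integrable_bounded_A0[OF borel_cone_density, of C]]) (use Bb C A0_Q in auto)
  moreover have "(\<lambda>x. indicator B x *\<^sub>R (indicator A0 x * cone_density x)) = (\<lambda>x. indicator B x * cone_density x)"
   using BA by (auto simp: indicator_def fun_eq_iff)
  ultimately show ?thesis by simp
 qed
 define k where "k x = area_density psi (fst x) * (real (?n + 1) * snd x ^ ?n)" for x :: "(real^'n) \<times> real"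
 let ?J = "\<lambda>u s p. \<bar>det (matrix (\<lambda>w. emb (s *\<^sub>R ?D u (fst (prj w)) + snd (prj w) *\<^sub>R p)))\<bar>"
 let ?I = "\<integral>\<^sup>+x. ennreal (indicator W x * k x) \<partial>lborel"
 have jac: "?J u s p = \<bar>s\<bar> ^ ?n * \<bar>p \<bullet> \<nu> (psi u)\<bar> * area_density psi u"
  and uS: "psi u \<in> \<Sigma>" if u: "u \<in> X" for u s p
 proof -
  have u': "u \<in> U" "u \<in> chart_domain U a" and uS: "psi u \<in> \<Sigma>" using u XU SS by (auto simp: X_def)
  show "psi u \<in> \<Sigma>" by (rule uS)
  show "?J u s p = \<bar>s\<bar> ^ ?n * \<bar>p \<bullet> \<nu> (psi u)\<bar> * area_density psi u"
   unfolding first_fundamental_form_def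
  proof (rule radial_jacobian)
   show "linear (?D u)" using local_param_has_derivative[OF lp u'(1)] by (rule has_derivative_linear)
   show "inj (?D u)" using lp u'(1) by (simp add: local_param_def)
   show "norm (\<nu> (psi u)) = 1" using nu_unit uS by blast
   show "?D u v \<bullet> \<nu> (psi u) = 0" for v using normal lp u'(2) unfolding is_outward_normal_def by blast
  qed
 qed
 have keq: "k x = \<bar>det (matrix (\<lambda>w. emb (Phi' x (prj w))))\<bar> * cone_density (Phi x)" if x: "x \<in> W" for x
 proof -
  have u: "fst x \<in> X" and s: "0 < snd x" using x by (auto simp: W_def)
  have "rad (Phi x) = psi (fst x)" using uS[OF u] s by (simp add: Phi_def rad_polar)
  then have "cone_density (Phi x) = real (?n + 1) / (psi (fst x) \<bullet> \<nu> (psi (fst x)))" by (simp add: cone_density_def)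
  then show ?thesis unfolding Phi'_def jac[OF u] k_def using nu_pos[OF uS[OF u]] s by simp
 qed
 have Jb: "(\<lambda>u. indicator X u * area_density psi u) \<in> borel_measurable borel"
  using borel_measurable_continuous_on_indicator[OF Xb continuous_on_subset[OF continuous_on_area_density[OF lp] XU]] by simp
 have split: "indicator W x * k x = (indicator X (fst x) * area_density psi (fst x)) * (indicator {0<..1} (snd x) * (real (?n + 1) * snd x ^ ?n))" for x
  by (cases x) (auto simp: W_def k_def indicator_def)
 have pm: "(\<lambda>s. indicator {0<..1} s * (real (?n + 1) * s ^ ?n) :: real) \<in> borel_measurable borel" by measurable
 have kb: "(\<lambda>x. indicator W x * k x) \<in> borel_measurable borel"
  unfolding split borel_prod[symmetric]
  by (intro borel_measurable_times measurable_compose[OF measurable_fst Jb] measurable_compose[OF measurable_snd pm])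
 have c0: "0 \<le> cone_density x" if "x \<in> B" for x
  using cone_density_pos[of x] that BA A0_Q by (meson less_imp_le subsetD)
 have "?I = (\<integral>\<^sup>+x. ennreal (indicator B x * cone_density x) \<partial>lborel)"
  by (rule nn_integral_change_of_variables[OF Wb der inj im hint c0 keq kb])
 moreover have "?I = (\<integral>\<^sup>+u. ennreal (indicator X u * area_density psi u) \<partial>lborel)"
 proof -
  let ?F = "\<lambda>u. ennreal (indicator X u * area_density psi u)" and ?P = "\<lambda>s::real. ennreal (indicator {0<..1} s * (real (?n + 1) * s ^ ?n))"
  \<comment> \<open>The area density is the absolute Jacobian at s = 1 and p = \<nu>, hence
    nonnegative.\<close>
  have J0: "0 \<le> indicator X u * area_density psi u" for u
  proof (cases "u \<in> X")
   case True
   have "\<nu> (psi u) \<bullet> \<nu> (psi u) = 1" using nu_unit[OF uS[OF True]] by (simp add: norm_eq_sqrt_inner)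
   then have "area_density psi u = ?J u 1 (\<nu> (psi u))"
    using jac[OF True, of 1 "\<nu> (psi u)"] by simp
   then have "0 \<le> area_density psi u" by (rule ssubst) (rule abs_ge_zero)
   then show ?thesis by simp
  qed simp
  have "?I = (\<integral>\<^sup>+x. ?F (fst x) * ?P (snd x) \<partial>(lborel \<Otimes>\<^sub>M lborel))"
   unfolding lborel_prod split by (intro nn_integral_cong ennreal_mult J0) (simp add: indicator_def)
  also have "\<dots> = (\<integral>\<^sup>+u. \<integral>\<^sup>+s. ?F u * ?P s \<partial>lborel \<partial>lborel)"
   using Jb pm by (subst lborel.nn_integral_fst[symmetric]) (auto intro!: borel_measurable_times_ennreal measurable_compose[OF measurable_fst] measurable_compose[OF measurable_snd])
  also have "\<dots> = (\<integral>\<^sup>+u. ?F u * (\<integral>\<^sup>+s. ?P s \<partial>lborel) \<partial>lborel)"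
   using pm by (intro nn_integral_cong nn_integral_cmult) auto
  also have "\<dots> = (\<integral>\<^sup>+u. ?F u \<partial>lborel)" using nn_integral_power_unit[of ?n] by simp
  finally show ?thesis .
 qed
 ultimately show ?thesis unfolding X_def B_def by simp
qed

end

section \<open>Identification of the area measure with a pushforward\<close>

context
 fixes A :: "'a::euclidean_space set" and T :: "'b::euclidean_space set" and f :: "'a \<Rightarrow> real" and g :: "'a \<Rightarrow> 'b"
 assumes A: "A \<in> sets borel" and f: "continuous_on A f" and g: "continuous_on A g" "g ` A \<subseteq> T"
begin

abbreviation (input) "pushforward \<equiv> distr (density (restrict_space lborel A) (\<lambda>x. ennreal (f x))) (restrict_space borel T) g"

lemma restrict_map_measurable: "g \<in> measurable (restrict_space lborel A) (restrict_space borel T)"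
proof -
 have "g \<in> measurable (restrict_space borel A) borel" by (rule borel_measurable_continuous_on_restrict[OF g(1)])
 then have "g \<in> measurable (restrict_space borel A) (restrict_space borel T)"
  using g(2) by (intro measurable_restrict_space2) (auto simp: space_restrict_space)
 moreover have "sets (restrict_space lborel A) = sets (restrict_space borel A)" by (rule sets_restrict_space_cong) simp
 ultimately show ?thesis by (simp cong: measurable_cong_sets)
qed

lemma restrict_density_measurable: "f \<in> borel_measurable (restrict_space lborel A)"
proof -
 have "sets (restrict_space lborel A) = sets (restrict_space borel A)" by (rule sets_restrict_space_cong) simp
 then show ?thesis using borel_measurable_continuous_on_restrict[OF f] by (simp cong: measurable_cong_sets)
qed

lemma emeasure_pushforward_density:
 assumes S: "S \<in> sets (restrict_space borel T)"
 shows "emeasure pushforward S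
  = (\<integral>\<^sup>+x. ennreal (indicator {x \<in> A. g x \<in> S} x * f x) \<partial>lborel)"
proof -
 let ?R = "restrict_space lborel A"
 have gS: "g -` S \<inter> A \<in> sets ?R" using measurable_sets[OF restrict_map_measurable S] by (simp add: space_restrict_space)
 have "emeasure pushforward S = emeasure (density ?R (\<lambda>x. ennreal (f x))) (g -` S \<inter> A)"
  using restrict_map_measurable S by (subst emeasure_distr) (auto simp: space_restrict_space)
 also have "\<dots> = (\<integral>\<^sup>+x. ennreal (f x) * indicator (g -` S \<inter> A) x \<partial>?R)"
  by (rule emeasure_density[OF _ gS]) (use restrict_density_measurable in measurable)
 also have "\<dots> = (\<integral>\<^sup>+x. ennreal (f x) * indicator (g -` S \<inter> A) x * indicator A x \<partial>lborel)"
  by (rule nn_integral_restrict_space) (use A in simp)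
 also have "\<dots> = (\<integral>\<^sup>+x. ennreal (indicator {x \<in> A. g x \<in> S} x * f x) \<partial>lborel)"
  by (rule nn_integral_cong) (auto simp: indicator_def)
 finally show ?thesis .
qed

lemma integral_pushforward_density:
 fixes h :: "'b \<Rightarrow> real"
 assumes h: "continuous_on T h" and f0: "\<And>x. x \<in> A \<Longrightarrow> 0 \<le> f x"
 shows "(LINT y|pushforward. h y)
  = (LINT x|lborel. indicator A x * (f x * h (g x)))"
proof -
 let ?R = "restrict_space lborel A"
 have hT: "h \<in> borel_measurable (restrict_space borel T)" by (rule borel_measurable_continuous_on_restrict[OF h])
 have "(LINT y|pushforward. h y) = (LINT x|density ?R (\<lambda>x. ennreal (f x)). h (g x))"
  using restrict_map_measurable hT by (intro integral_distr) auto
 also have "\<dots> = (LINT x|?R. f x *\<^sub>R h (g x))"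
  using restrict_density_measurable measurable_compose[OF restrict_map_measurable hT] f0
  by (intro integral_density) (auto intro!: AE_I2 simp: space_restrict_space)
 also have "\<dots> = (LINT x|lborel. indicator A x *\<^sub>R (f x *\<^sub>R h (g x)))"
  using A by (intro integral_restrict_space) simp
 finally show ?thesis by simp
qed

end

context star_hypersurface
begin

definition "cone_measure = distr (density (restrict_space lborel A0) (\<lambda>x. ennreal (cone_density x))) (restrict_space borel \<Sigma>) rad"

lemmas cone_data = A0_borel continuous_on_subset[OF continuous_on_cone_density A0_Q] continuous_on_subset[OF continuous_on_rad A0_Q]

lemma rad_A0: "rad ` A0 \<subseteq> \<Sigma>" using rad_mem A0_Q by blast

lemma Sigma_borel: "\<Sigma> \<in> sets borel" using compact_Sigma by (rule borel_compact)

lemma sets_restrict_Sigma: "S \<in> sets (restrict_space borel \<Sigma>) \<longleftrightarrow> S \<in> sets borel \<and> S \<subseteq> \<Sigma>"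
 using Sigma_borel by (auto simp: sets_restrict_space_iff)

abbreviation (input) "borel\<^sub>\<Sigma> \<equiv> sets (restrict_space borel \<Sigma>)"

lemma chart_image_sets:
 assumes "local_param \<Sigma> psi U a" shows "psi ` chart_domain U a \<in> borel\<^sub>\<Sigma>"
proof -
 obtain T where "open T" "psi ` chart_domain U a = \<Sigma> \<inter> T" using assms by (auto simp: local_param_def openin_open)
 then show ?thesis unfolding sets_restrict_Sigma using Sigma_borel by auto
qed

text \<open>Every chart measure is the restriction of one global measure to the image of the chart.
  This is the compatibility that makes the supremum in \<open>area_measure\<close>
  computable.\<close>

lemma local_area_cone_measure:
 assumes lp: "local_param \<Sigma> psi U a" and S: "S \<in> borel\<^sub>\<Sigma>"
 shows "emeasure (local_area \<Sigma> psi U a) S = emeasure cone_measure (S \<inter> psi ` chart_domain U a)"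
proof -
 let ?O = "psi ` chart_domain U a"
 have SO: "S \<inter> ?O \<in> borel\<^sub>\<Sigma>" using S chart_image_sets[OF lp] by (rule sets.Int)
 have cU: "chart_domain U a \<subseteq> U" by (auto simp: chart_domain_def)
 have "continuous_on U psi"
  using lp unfolding local_param_def smooth_on_def by (auto dest: spec[of _ "0::nat"])
 then have c: "continuous_on (chart_domain U a) psi" using cU by (rule continuous_on_subset)
 have O: "?O \<subseteq> \<Sigma>" using chart_image_sets[OF lp] by (simp add: sets_restrict_Sigma)
 have "emeasure (local_area \<Sigma> psi U a) S = (\<integral>\<^sup>+u. ennreal (indicator {u \<in> chart_domain U a. psi u \<in> S} u * area_density psi u) \<partial>lborel)"
  unfolding local_area_def
  by (rule emeasure_pushforward_density[OF chart_domain_borel[OF lp] continuous_on_subset[OF continuous_on_area_density[OF lp] cU] c O S])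
 also have "{u \<in> chart_domain U a. psi u \<in> S} = {u \<in> chart_domain U a. psi u \<in> S \<inter> ?O}" by auto
 also have "(\<integral>\<^sup>+u. ennreal (indicator {u \<in> chart_domain U a. psi u \<in> S \<inter> ?O} u * area_density psi u) \<partial>lborel)
   = (\<integral>\<^sup>+x. ennreal (indicator {x \<in> A0. rad x \<in> S \<inter> ?O} x * cone_density x) \<partial>lborel)"
  by (rule chart_area[OF lp]) (use SO in \<open>auto simp: sets_restrict_Sigma\<close>)
 also have "\<dots> = emeasure cone_measure (S \<inter> ?O)"
  unfolding cone_measure_def by (rule emeasure_pushforward_density[OF cone_data rad_A0 SO, symmetric])
 finally show ?thesis .
qed

lemma sets_cone_measure: "sets cone_measure = borel\<^sub>\<Sigma>"
 by (simp add: cone_measure_def)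

lemma area_measure_le: "emeasure (area_measure \<Sigma>) S \<le> emeasure cone_measure S"
proof -
 have "area_measure \<Sigma> \<le> cone_measure"
  unfolding area_measure_def
 proof (rule SUP_least, clarify)
  fix psi U a assume lp: "local_param \<Sigma> psi U a"
  have "emeasure cone_measure (S \<inter> psi ` chart_domain U a) \<le> emeasure cone_measure S" if "S \<in> borel\<^sub>\<Sigma>" for S
   by (rule emeasure_mono) (use that in \<open>auto simp: sets_cone_measure\<close>)
  then have "emeasure (local_area \<Sigma> psi U a) S \<le> emeasure cone_measure S" if "S \<in> borel\<^sub>\<Sigma>" for S
   using local_area_cone_measure[OF lp that] that by simp
  moreover have "sets (local_area \<Sigma> psi U a) = borel\<^sub>\<Sigma>" by (simp add: local_area_def)
  ultimately show "local_area \<Sigma> psi U a \<le> cone_measure" using le_measure[of "local_area \<Sigma> psi U a" cone_measure] by (simp add: sets_cone_measure)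
 qed
 then show ?thesis
  using le_measure[of "area_measure \<Sigma>" cone_measure] sets_area_measure[of \<Sigma>]
  by (cases "S \<in> sets (area_measure \<Sigma>)") (auto simp: sets_cone_measure emeasure_notin_sets)
qed

lemma local_area_le:
 assumes lp: "local_param \<Sigma> psi U a" and S: "S \<in> borel\<^sub>\<Sigma>"
 shows "emeasure (local_area \<Sigma> psi U a) S \<le> emeasure (area_measure \<Sigma>) S"
proof -
 have "local_area \<Sigma> psi U a \<le> area_measure \<Sigma>"
  unfolding area_measure_def by (rule SUP_upper2[of "(psi, U, a)"]) (use lp in auto)
 then show ?thesis using S le_measure[of "local_area \<Sigma> psi U a" "area_measure \<Sigma>"] sets_area_measure[of \<Sigma>]
  by (auto simp: local_area_def)
qed

text \<open>On one chart the cone measure equals the chart measure, which lies below the supremum.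
  The induction makes the chart images disjoint, because these lower bounds add up only over
  disjoint sets.\<close>

lemma cone_measure_le_area:
 assumes F: "finite F" "\<And>psi U a. (psi, U, a) \<in> F \<Longrightarrow> local_param \<Sigma> psi U a" and S: "S \<in> borel\<^sub>\<Sigma>"
 shows "emeasure cone_measure (S \<inter> (\<Union>(psi, U, a)\<in>F. psi ` chart_domain U a))
  \<le> emeasure (area_measure \<Sigma>) (S \<inter> (\<Union>(psi, U, a)\<in>F. psi ` chart_domain U a))"
 using F S
proof (induction F arbitrary: S rule: finite_induct)
 case (insert c F)
 obtain psi U a where c: "c = (psi, U, a)" by (cases c) auto
 have lp: "local_param \<Sigma> psi U a" by (rule insert.prems(1)) (simp add: c)
 let ?O = "psi ` chart_domain U a" and ?V = "\<Union>(psi, U, a)\<in>F. psi ` chart_domain U a"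
 have O: "?O \<in> borel\<^sub>\<Sigma>" by (rule chart_image_sets[OF lp])
 have V: "?V \<in> borel\<^sub>\<Sigma>"
  by (rule sets.finite_UN[OF insert.hyps(1)]) (use insert.prems(1) chart_image_sets in auto)
 have SO: "S \<inter> ?O \<in> borel\<^sub>\<Sigma>" "(S - ?O) \<inter> ?V \<in> borel\<^sub>\<Sigma>"
  using insert.prems(2) O V by auto
 have e: "S \<inter> (\<Union>(psi, U, a)\<in>insert c F. psi ` chart_domain U a) = (S \<inter> ?O) \<union> ((S - ?O) \<inter> ?V)" by (auto simp: c)
 have sets: "sets (area_measure \<Sigma>) = borel\<^sub>\<Sigma>" by (rule sets_area_measure)
 have "emeasure cone_measure ((S \<inter> ?O) \<union> ((S - ?O) \<inter> ?V)) = emeasure cone_measure (S \<inter> ?O) + emeasure cone_measure ((S - ?O) \<inter> ?V)"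
  by (rule plus_emeasure[symmetric]) (use SO in \<open>auto simp: sets_cone_measure\<close>)
 also have "emeasure cone_measure (S \<inter> ?O) = emeasure (local_area \<Sigma> psi U a) (S \<inter> ?O)"
  using local_area_cone_measure[OF lp SO(1)] by (simp add: Int_assoc)
 also have "emeasure (local_area \<Sigma> psi U a) (S \<inter> ?O) + emeasure cone_measure ((S - ?O) \<inter> ?V)
   \<le> emeasure (area_measure \<Sigma>) (S \<inter> ?O) + emeasure (area_measure \<Sigma>) ((S - ?O) \<inter> ?V)"
 proof (rule add_mono[OF local_area_le[OF lp SO(1)]])
  show "emeasure cone_measure ((S - ?O) \<inter> ?V) \<le> emeasure (area_measure \<Sigma>) ((S - ?O) \<inter> ?V)"
   by (rule insert.IH) (use insert.prems O in auto)
 qed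
 also have "\<dots> = emeasure (area_measure \<Sigma>) ((S \<inter> ?O) \<union> ((S - ?O) \<inter> ?V))"
  by (rule plus_emeasure) (use SO in \<open>auto simp: sets\<close>)
 finally show ?case unfolding e .
qed simp

text \<open>\<open>cone_measure\<close> bounds all chart measures from above. For the reverse
  inequality, compactness gives finitely many charts that cover the hypersurface.\<close>

theorem area_measure_eq: "area_measure \<Sigma> = cone_measure"
proof (rule measure_eqI)
 show sets: "sets (area_measure \<Sigma>) = sets cone_measure" by (simp add: sets_area_measure sets_cone_measure)
 fix S assume "S \<in> sets (area_measure \<Sigma>)"
 then have S: "S \<in> borel\<^sub>\<Sigma>" by (simp add: sets_area_measure)
 define C where "C = {(psi, U, a). local_param \<Sigma> psi U a}"
 define I :: "(real^'n \<Rightarrow> (real^'n) \<times> real) \<times> (real^'n) set \<times> (real^'n) \<Rightarrow> ((real^'n) \<times> real) set"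
  where "I = (\<lambda>(psi, U, a). psi ` chart_domain U a)"
 have "\<forall>c\<in>C. \<exists>T. open T \<and> I c = \<Sigma> \<inter> T"
  by (auto simp: C_def I_def local_param_def openin_open)
 from bchoice[OF this] obtain T where T: "\<forall>c\<in>C. open (T c) \<and> I c = \<Sigma> \<inter> T c" ..
 have "\<Sigma> \<subseteq> (\<Union>c\<in>C. T c)"
 proof
  fix x assume x: "x \<in> \<Sigma>"
  then obtain psi U a u where c: "local_param \<Sigma> psi U a" "u \<in> chart_domain U a" "x = psi u" using hypersurface_chart[OF hyp] by metis
  then have m: "(psi, U, a) \<in> C" and "x \<in> I (psi, U, a)" by (auto simp: C_def I_def)
  then have "x \<in> T (psi, U, a)" using T by blast
  then show "x \<in> (\<Union>c\<in>C. T c)" using m by blast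
 qed
 moreover have "open (T c)" if "c \<in> C" for c using T that by blast
 ultimately obtain F where F: "F \<subseteq> C" "finite F" "\<Sigma> \<subseteq> (\<Union>c\<in>F. T c)" using compactE_image[OF compact_Sigma, of C T] by blast
 have "\<Sigma> \<subseteq> (\<Union>c\<in>F. I c)" using F T by blast
 then have SF: "S \<inter> (\<Union>c\<in>F. I c) = S" using S unfolding sets_restrict_Sigma by blast
 have lpF: "local_param \<Sigma> psi U a" if "(psi, U, a) \<in> F" for psi U a using subsetD[OF F(1) that] by (simp add: C_def)
 have "emeasure cone_measure S \<le> emeasure (area_measure \<Sigma>) S"
  using cone_measure_le_area[OF F(2) lpF S] unfolding I_def[symmetric] SF .
 then show "emeasure (area_measure \<Sigma>) S = emeasure cone_measure S" using area_measure_le by (rule antisym[rotated])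
qed

lemma integral_area_measure:
 assumes "continuous_on \<Sigma> h"
 shows "(LINT x|area_measure \<Sigma>. h x) = (LINT x|lborel. indicator A0 x * (cone_density x * h (rad x)))"
 unfolding area_measure_eq cone_measure_def
 by (rule integral_pushforward_density[OF cone_data rad_A0 assms]) (use cone_density_pos A0_Q less_imp_le in blast)

text \<open>Cone density times support function is a multiple of the slope, so the anisotropic area
  is exactly the first-order coefficient in \<open>vol_limsup\<close>.\<close>

lemma integral_support_fun:
 assumes "compact L" "L \<noteq> {}"
 shows "(LINT x|area_measure \<Sigma>. support_fun L (\<nu> x)) = real (CARD('n) + 1) * (LINT x|lborel. indicator A0 x * slopeG L x)"
proof -
 have "continuous_on \<Sigma> (\<lambda>x. support_fun L (\<nu> x))"
  by (rule continuous_on_compose2[OF continuous_on_support_fun[OF assms, of UNIV] continuous_on_nu]) auto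
 from integral_area_measure[OF this] have "(LINT x|area_measure \<Sigma>. support_fun L (\<nu> x))
  = (LINT x|lborel. indicator A0 x * (cone_density x * support_fun L (\<nu> (rad x))))" .
 also have "\<dots> = (LINT x|lborel. real (CARD('n) + 1) * (indicator A0 x * slopeG L x))"
  by (rule Bochner_Integration.integral_cong) (auto simp: cone_density_def slopeG_def)
 finally show ?thesis by simp
qed

end

section \<open>The anisotropic area: inequality and equality case\<close>

context star_hypersurface
begin

abbreviation "anisotropic_area L \<equiv> LINT x|area_measure \<Sigma>. support_fun L (\<nu> x)"

lemma vol_derivative_upper:
 assumes L: "convex_body L" "\<And>y. y \<in> L \<Longrightarrow> snd y \<ge> 0" and eps: "eps > 0"
 shows "\<forall>\<^sub>F t in at_right 0. vol (dsum K t L) \<le> vol K + t * (anisotropic_area L + eps)"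
proof -
 have "compact L" "L \<noteq> {}" using L(1) interior_subset[of L] by (auto simp: convex_body_def)
 then show ?thesis using vol_limsup[OF _ _ L(2) eps] integral_support_fun by simp
qed

text \<open>The volume of K + t L lies between the first-order Brunn-Minkowski bound and the upper
  derivative estimate; comparing both at one small t gives the inequality up to eps.\<close>

lemma anisotropic_area_ge:
 assumes L: "convex_body L" "\<And>y. y \<in> L \<Longrightarrow> snd y \<ge> 0"
 shows "real (CARD('n) + 1) * (vol K * (vol L / vol K) powr (1 / real (CARD('n) + 1))) \<le> anisotropic_area L"
proof (rule field_le_epsilon)
 fix eps :: real assume eps: "eps > 0"
 have ev: "\<forall>\<^sub>F t in at_right 0. vol (dsum K t L) \<le> vol K + t * (anisotropic_area L + eps)"
  by (rule vol_derivative_upper[OF L eps])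
 from eventually_happens[OF eventually_conj[OF ev eventually_at_right_less]]
 obtain t where t: "vol (dsum K t L) \<le> vol K + t * (anisotropic_area L + eps)" "0 < t" by (auto simp: trivial_limit_at_right_real)
 have "bmf (CARD('n) + 1) t (vol K) (vol L) \<le> vol (dsum K t L)"
  by (rule brunn_minkowski_first_order[OF compact_K negligible_frontier_K vol_K_pos L(1) t(2)])
 with t(1) have "t * (real (CARD('n) + 1) * (vol K * (vol L / vol K) powr (1 / real (CARD('n) + 1)))) \<le> t * (anisotropic_area L + eps)"
  unfolding bmf_def mult.assoc by linarith
 then show "real (CARD('n) + 1) * (vol K * (vol L / vol K) powr (1 / real (CARD('n) + 1))) \<le> anisotropic_area L + eps"
  using t(2) mult_le_cancel_left_pos by blast
qed

text \<open>Under equality the upper derivative estimate matches \<open>bmf\<close> to first order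
  in t, which is the hypothesis of \<open>brunn_minkowski_first_order_eq\<close>.\<close>

lemma anisotropic_area_eq_imp_homothetic:
 assumes L: "convex_body L" "\<And>y. y \<in> L \<Longrightarrow> snd y \<ge> 0"
  and eq: "anisotropic_area L = real (CARD('n) + 1) * (vol K * (vol L / vol K) powr (1 / real (CARD('n) + 1)))"
 shows "\<exists>c>0. \<exists>b. K = (\<lambda>x. c *\<^sub>R x + b) ` L"
proof (rule brunn_minkowski_first_order_eq[OF compact_K negligible_frontier_K vol_K_pos connected_interior_K K_dense L(1)])
 fix eps :: real assume eps: "eps > 0"
 have "\<forall>\<^sub>F t in at_right 0. vol (dsum K t L) \<le> vol K + t * (anisotropic_area L + eps)"
  by (rule vol_derivative_upper[OF L eps])
 then have "\<forall>\<^sub>F t in at_right 0. vol (dsum K t L) \<le> bmf (CARD('n) + 1) t (vol K) (vol L) + t * eps"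
  by eventually_elim (simp add: bmf_def eq algebra_simps)
 then show "\<exists>\<^sub>F t in at_right 0. vol (dsum K t L) \<le> bmf (CARD('n) + 1) t (vol K) (vol L) + t * eps"
  by (rule eventually_frequently[rotated]) (simp add: trivial_limit_at_right_real)
qed

lemma Sigma_subset_K: "\<Sigma> \<subseteq> K"
 using Sigma_Q by (auto simp: K_iff Q_def gau_Sigma)

text \<open>For convex \<open>K\<close> the estimate of \<open>one_sided_tangent\<close> with g = 1
  holds on the segment from x to k near x. It is homogeneous in the segment parameter s, so it holds
  for k as well, and eps is arbitrary.\<close>

lemma tangent_supports:
 assumes K: "convex K" and x: "x \<in> \<Sigma>" and k: "k \<in> K"
 shows "(k - x) \<bullet> \<nu> x \<le> 0"
proof (rule field_le_epsilon)
 fix e :: real assume e: "e > 0"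
 define eps where "eps = e / (norm (k - x) + 1)"
 have n: "norm (k - x) + 1 > 0" by (simp add: add_nonneg_pos)
 have eps: "eps > 0" using e n by (simp add: eps_def)
 obtain eta where eta: "eta > 0"
  "\<And>x g k. x \<in> \<Sigma> \<Longrightarrow> 1 / 2 \<le> g \<Longrightarrow> k \<in> K \<Longrightarrow> norm (g *\<^sub>R x - k) \<le> eta \<Longrightarrow> (k - x) \<bullet> \<nu> x \<le> eps * norm (g *\<^sub>R x - k)"
  using one_sided_tangent[OF eps] by blast
 define s where "s = min 1 (eta / (norm (k - x) + 1))"
 have s: "0 < s" "s \<le> 1" "s * norm (k - x) \<le> eta"
 proof -
  have "s * norm (k - x) \<le> eta / (norm (k - x) + 1) * (norm (k - x) + 1)" unfolding s_def using eta(1) n by (intro mult_mono) auto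
  then show "s * norm (k - x) \<le> eta" using n by simp
 qed (use eta(1) n in \<open>auto simp: s_def\<close>)
 let ?q = "(1 - s) *\<^sub>R x + s *\<^sub>R k"
 have q: "?q \<in> K" using convexD_alt[OF K _ k, of x s] Sigma_subset_K x s by auto
 have d: "?q - x = s *\<^sub>R (k - x)" by (simp add: algebra_simps)
 have nq: "norm (1 *\<^sub>R x - ?q) = s * norm (k - x)"
  using s(1) d norm_minus_commute[of x ?q] by simp
 have "(?q - x) \<bullet> \<nu> x \<le> eps * norm (1 *\<^sub>R x - ?q)"
  by (rule eta(2)[OF x _ q]) (use s nq in auto)
 then have "s * ((k - x) \<bullet> \<nu> x) \<le> s * (eps * norm (k - x))" unfolding d nq by (simp add: mult_ac)
 then have "(k - x) \<bullet> \<nu> x \<le> eps * norm (k - x)" using s(1) by simp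
 also have "\<dots> \<le> eps * (norm (k - x) + 1)" using eps by simp
 also have "\<dots> = e" using n by (simp add: eps_def)
 finally show "(k - x) \<bullet> \<nu> x \<le> 0 + e" by simp
qed

text \<open>The tangent hyperplane at x supports \<open>K\<close>, so the support function of
  \<open>K\<close> at \<nu> x is x \<bullet> \<nu> x; undoing the homothety gives that of
  \<open>L\<close>.\<close>

lemma support_fun_homothetic:
 assumes K: "convex K" "K = (\<lambda>x. c *\<^sub>R x + b) ` L" and L: "compact L" and c: "c > 0" and x: "x \<in> \<Sigma>"
 shows "support_fun L (\<nu> x) = (x \<bullet> \<nu> x - b \<bullet> \<nu> x) / c"
proof (rule antisym)
 obtain y where y: "y \<in> L" "x = c *\<^sub>R y + b" using Sigma_subset_K x K(2) by blast
 show "support_fun L (\<nu> x) \<le> (x \<bullet> \<nu> x - b \<bullet> \<nu> x) / c"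
 proof (rule support_fun_least)
  fix z assume "z \<in> L"
  then have "c *\<^sub>R z + b \<in> K" using K(2) by blast
  from tangent_supports[OF K(1) x this] show "z \<bullet> \<nu> x \<le> (x \<bullet> \<nu> x - b \<bullet> \<nu> x) / c"
   using c by (simp add: inner_diff_left inner_add_left pos_le_divide_eq mult.commute)
 qed (use y in blast)
 have "y \<bullet> \<nu> x = (x \<bullet> \<nu> x - b \<bullet> \<nu> x) / c" using y(2) c by (simp add: inner_add_left)
 then show "(x \<bullet> \<nu> x - b \<bullet> \<nu> x) / c \<le> support_fun L (\<nu> x)" using support_fun_upper[OF L y(1), of "\<nu> x"] by simp
qed

text \<open>By the cone decomposition the term x \<bullet> \<nu> x integrates to (CARD('n) + 1) *
  vol K. What is left is the flux of the constant field b through the hypersurface.\<close>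

lemma anisotropic_area_homothetic_eq:
 assumes K: "convex K" "K = (\<lambda>x. c *\<^sub>R x + b) ` L" and L: "compact L" and c: "c > 0"
 shows "anisotropic_area L = (real (CARD('n) + 1) * vol K - (LINT x|lborel. indicator A0 x * (cone_density x * (b \<bullet> \<nu> (rad x))))) / c"
proof -
 let ?F = "\<lambda>x. cone_density x * (b \<bullet> \<nu> (rad x))"
 have "L \<noteq> {}" using K(2) vol_K_pos by auto
 then have "continuous_on \<Sigma> (\<lambda>x. support_fun L (\<nu> x))"
  by (intro continuous_on_compose2[OF continuous_on_support_fun[OF L, of UNIV] continuous_on_nu]) auto
 from integral_area_measure[OF this]
 have "anisotropic_area L = (LINT x|lborel. indicator A0 x * (cone_density x * support_fun L (\<nu> (rad x))))" .
 also have "\<dots> = (LINT x|lborel. (indicator A0 x * real (CARD('n) + 1) - indicator A0 x * ?F x) / c)"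
 proof (rule Bochner_Integration.integral_cong[OF refl])
  fix x
  show "indicator A0 x * (cone_density x * support_fun L (\<nu> (rad x))) = (indicator A0 x * real (CARD('n) + 1) - indicator A0 x * ?F x) / c"
  proof (cases "x \<in> A0")
   case True
   then have r: "rad x \<in> \<Sigma>" using rad_A0 by blast
   have "cone_density x * (rad x \<bullet> \<nu> (rad x)) = real (CARD('n) + 1)" using nu_pos[OF r] by (simp add: cone_density_def)
   then show ?thesis using True by (simp add: support_fun_homothetic[OF K L c r] right_diff_distrib)
  qed simp
 qed
 also have "\<dots> = ((LINT x|lborel. indicator A0 x * real (CARD('n) + 1)) - (LINT x|lborel. indicator A0 x * ?F x)) / c"
 proof -
  obtain C where C: "\<And>x. x \<in> Q \<Longrightarrow> \<bar>cone_density x\<bar> \<le> C" using cone_density_bound by blast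
  have "continuous_on Q (\<lambda>x. \<nu> (rad x))"
   by (rule continuous_on_compose2[OF continuous_on_nu continuous_on_rad]) (auto intro: rad_mem)
  then have "continuous_on Q ?F" by (intro continuous_intros continuous_on_cone_density)
  then have Fb: "(\<lambda>x. indicator A0 x * ?F x) \<in> borel_measurable borel"
   using borel_measurable_continuous_on_indicator[OF A0_borel continuous_on_subset[OF _ A0_Q], of ?F] by simp
  have "\<bar>?F x\<bar> \<le> C * norm b" if "x \<in> A0" for x
  proof -
   have "x \<in> Q" using that A0_Q by blast
   then show ?thesis
    unfolding abs_mult using C[of x] Cauchy_Schwarz_ineq2[of b "\<nu> (rad x)"] nu_unit[OF rad_mem, of x] abs_ge_zero[of "cone_density x"]
    by (intro mult_mono) auto
  qed
  then have "integrable lborel (\<lambda>x. indicator A0 x * ?F x)" by (rule integrable_bounded_A0[OF Fb])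
  moreover have "integrable lborel (\<lambda>x. indicator A0 x * real (CARD('n) + 1))"
   by (rule integrable_bounded_A0[of _ "real (CARD('n) + 1)"]) auto
  ultimately show ?thesis by simp
 qed
 also have "(LINT x|lborel. indicator A0 x * real (CARD('n) + 1)) = real (CARD('n) + 1) * vol K"
  by (simp add: vol_A0)
 finally show ?thesis .
qed

text \<open>It remains to see that the flux of b vanishes. The inequality already proved, applied to
  translates of \<open>L\<close> along b, says that tau times the flux is nonpositive, both for tau
  = 1 and for tau = -1. As b is parallel to the wall, the translates stay in the closed upper
  half-space.\<close>

lemma homothetic_imp_anisotropic_area_eq:
 assumes L: "convex_body L" "\<And>y. y \<in> L \<Longrightarrow> snd y \<ge> 0" and c: "c > 0" and b: "snd b = 0" and K: "K = (\<lambda>x. c *\<^sub>R x + b) ` L"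
 shows "anisotropic_area L = real (CARD('n) + 1) * (vol K * (vol L / vol K) powr (1 / real (CARD('n) + 1)))"
proof -
 let ?m = "CARD('n) + 1"
 let ?bt = "\<lambda>b. LINT x|lborel. indicator A0 x * (cone_density x * (b \<bullet> \<nu> (rad x)))"
 have aff: "(\<lambda>x. c *\<^sub>R x + b) ` A = (+) b ` ((\<lambda>x. c *\<^sub>R x) ` A)" for A by (auto simp: image_image add.commute)
 have convK: "convex K" unfolding K aff using L(1) by (intro convex_translation convex_scaling) (simp add: convex_body_def)
 have ratio: "vol K * (vol M / vol K) powr (1 / real ?m) = vol K / c" if "vol K = c ^ ?m * vol M" "vol M > 0" for M :: "((real^'n) \<times> real) set"
 proof -
  have "vol M / vol K = (1 / c) ^ ?m" using that c by (simp add: power_one_over field_simps)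
  also have "\<dots> = (1 / c) powr real ?m" using c by (simp only: powr_realpow zero_less_divide_iff zero_less_one simp_thms)
  finally have "(vol M / vol K) powr (1 / real ?m) = (1 / c) powr (real ?m * (1 / real ?m))" by (simp only: powr_powr)
  also have "\<dots> = 1 / c" using c by simp
  finally show ?thesis by simp
 qed
 have area: "real ?m * vol K \<le> real ?m * vol K - tau * ?bt b" for tau
 proof -
  \<comment> \<open>This is the translate of \<open>L\<close> by ((1 - tau) / c) b.\<close>
  define M where "M = (\<lambda>x. (1 / c) *\<^sub>R x + (- (tau / c)) *\<^sub>R b) ` K"
  have "c *\<^sub>R ((1 / c) *\<^sub>R x + (- (tau / c)) *\<^sub>R b) + tau *\<^sub>R b = x" for x :: "(real^'n) \<times> real"
   using c by (simp add: scaleR_diff_right)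
  then have KM: "K = (\<lambda>x. c *\<^sub>R x + tau *\<^sub>R b) ` M" unfolding M_def image_image by (simp only: image_ident)
  have Maff: "M = (+) ((- (tau / c)) *\<^sub>R b) ` ((\<lambda>x. (1 / c) *\<^sub>R x) ` K)" unfolding M_def by (auto simp: image_image add.commute)
  have cM: "compact M" unfolding M_def using compact_K by (intro compact_continuous_image continuous_intros)
  have iK: "interior K \<noteq> {}" using vol_K_pos K_dense by auto
  have "linear (\<lambda>x :: (real^'n) \<times> real. (1 / c) *\<^sub>R x)" "inj (\<lambda>x :: (real^'n) \<times> real. (1 / c) *\<^sub>R x)"
   using c by (auto simp: inj_def linear_scale_self)
  then have "interior M \<noteq> {}"
   unfolding Maff interior_translation using iK by (simp add: interior_injective_linear_image)
  then have Mb: "convex_body M" using cM convK unfolding convex_body_def Maff by (simp add: convex_translation convex_scaling)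
  have M0: "snd y \<ge> 0" if "y \<in> M" for y using that b c by (auto simp: M_def K_iff)
  have vM: "vol K = c ^ ?m * vol M" unfolding KM vol_affine using c by simp
  have "real ?m * (vol K / c) \<le> anisotropic_area M"
   using anisotropic_area_ge[OF Mb M0] unfolding ratio[OF vM convex_body_vol_pos[OF Mb]] .
  also have "\<dots> = (real ?m * vol K - ?bt (tau *\<^sub>R b)) / c" by (rule anisotropic_area_homothetic_eq[OF convK KM cM c])
  also have "?bt (tau *\<^sub>R b) = (LINT x|lborel. tau * (indicator A0 x * (cone_density x * (b \<bullet> \<nu> (rad x)))))"
   by (rule Bochner_Integration.integral_cong) (auto simp: mult_ac)
  also have "\<dots> = tau * ?bt b" by simp
  finally show ?thesis using c by (simp add: divide_le_cancel)
 qed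
 have "?bt b = 0" using area[of 1] area[of "-1"] by simp
 moreover have "compact L" using L(1) by (simp add: convex_body_def)
 ultimately have "anisotropic_area L = real ?m * vol K / c" using anisotropic_area_homothetic_eq[OF convK K _ c] by simp
 moreover have "vol K = c ^ ?m * vol L" unfolding K vol_affine using c by simp
 ultimately show ?thesis using ratio[OF _ convex_body_vol_pos[OF L(1)]] by simp
qed

end

section \<open>Assembly of the two inequalities\<close>

lemma star_shaped_hypersurface_locale:
 assumes "capillary_hypersurface \<theta> \<Sigma>" "star_shaped_hypersurface \<Sigma>"
 obtains rho where "star_hypersurface \<Sigma> rho (outward_normal \<Sigma>)"
proof -
 have S: "sphere 0 1 \<inter> closure upper_half_space = {z :: (real^'a) \<times> real. norm z = 1 \<and> snd z \<ge> 0}"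
  by (auto simp: closure_upper_half_space)
 obtain rho where rho: "\<forall>z \<in> {z. norm z = 1 \<and> snd z \<ge> 0}. rho z > 0" "\<Sigma> = (\<lambda>z. rho z *\<^sub>R z) ` {z. norm z = 1 \<and> snd z \<ge> 0}"
  using assms(2) unfolding star_shaped_hypersurface_def S by blast
 have "is_outward_normal \<Sigma> (outward_normal \<Sigma>)"
 proof -
  have "\<exists>\<nu>. is_outward_normal \<Sigma> \<nu>" using assms(1) by (simp add: capillary_hypersurface_def)
  then show ?thesis unfolding outward_normal_def by (rule someI_ex)
 qed
 then have "star_hypersurface \<Sigma> rho (outward_normal \<Sigma>)"
  using rho \<open>is_outward_normal \<Sigma> (outward_normal \<Sigma>)\<close>
 proof unfold_locales
  show "hypersurface_in_half_space \<Sigma>" using assms(1) by (simp add: capillary_hypersurface_def)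
  show "0 < x \<bullet> outward_normal \<Sigma> x" if "x \<in> \<Sigma>" for x using assms(2) that unfolding star_shaped_hypersurface_def by blast
  show "0 < rho z" if "norm z = 1" "snd z \<ge> 0" for z using rho(1) that by blast
 qed
 then show ?thesis by (rule that)
qed

theorem anisotropic_capillary_isoperimetric:
 fixes \<Sigma> L :: "((real^'n) \<times> real) set"
 assumes \<Sigma>: "capillary_hypersurface \<theta> \<Sigma>" "star_shaped_hypersurface \<Sigma>" and K: "K = enclosed_body \<Sigma>" and L: "L \<in> capillary_convex_bodies \<theta>'"
 defines "I \<equiv> LINT x|area_measure \<Sigma>. support_fun L (outward_normal \<Sigma> x)"
  and "R \<equiv> (real CARD('n) + 1) * Vol K powr (real CARD('n) / (real CARD('n) + 1)) * Vol L powr (1 / (real CARD('n) + 1))"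
 shows "I \<ge> R" and "I = R \<longleftrightarrow> (\<exists>c>0. \<exists>b\<in>wall. K = (\<lambda>x. c *\<^sub>R x + b) ` L)"
proof -
 obtain rho where "star_hypersurface \<Sigma> rho (outward_normal \<Sigma>)" using star_shaped_hypersurface_locale[OF \<Sigma>] by blast
 then interpret star_hypersurface \<Sigma> rho "outward_normal \<Sigma>" .
 note LD = capillary_convex_bodyD[OF L]
 have "Vol K = vol K" "Vol L = vol L" using K compact_K LD(1) by (auto intro: Vol_eq_vol convex_body_compact)
 then have R: "R = real (CARD('n) + 1) * (vol (enclosed_body \<Sigma>) * (vol L / vol (enclosed_body \<Sigma>)) powr (1 / real (CARD('n) + 1)))"
  using powr_ratio_split[of "vol K" "vol L" "real CARD('n) + 1" "real CARD('n)" 1] vol_K_pos convex_body_vol_pos[OF LD(1)] K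
  by (simp add: R_def add.commute mult.assoc)
 show "I \<ge> R" using anisotropic_area_ge[OF LD(1,2)] unfolding R I_def .
 show "I = R \<longleftrightarrow> (\<exists>c>0. \<exists>b\<in>wall. K = (\<lambda>x. c *\<^sub>R x + b) ` L)"
 proof
  assume "I = R"
  from anisotropic_area_eq_imp_homothetic[OF LD(1,2) this[unfolded R I_def]]
  show "\<exists>c>0. \<exists>b\<in>wall. K = (\<lambda>x. c *\<^sub>R x + b) ` L"
   unfolding K using enclosed_body_upper[OF hyp] enclosed_body_touches[OF \<Sigma>(1)] LD(2,3) by (intro homothety_in_wall)
 next
  assume "\<exists>c>0. \<exists>b\<in>wall. K = (\<lambda>x. c *\<^sub>R x + b) ` L"
  then obtain c b where "c > 0" "snd b = 0" "enclosed_body \<Sigma> = (\<lambda>x. c *\<^sub>R x + b) ` L" unfolding wall_eq K by blast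
  then show "I = R" unfolding R I_def by (intro homothetic_imp_anisotropic_area_eq[OF LD(1,2)])
 qed
qed

theorem corollary1p5:
 assumes "CARD('n::finite) \<ge> 2"
 shows
  "(\<forall>\<theta> (\<Sigma> :: ((real^'n) \<times> real) set) K L.
    0 < \<theta> \<longrightarrow> \<theta> < pi \<longrightarrow> capillary_hypersurface \<theta> \<Sigma> \<longrightarrow> star_shaped_hypersurface \<Sigma> \<longrightarrow>
    K = enclosed_body \<Sigma> \<longrightarrow> L \<in> capillary_convex_bodies \<theta> \<longrightarrow>
     (LINT x|area_measure \<Sigma>. support_fun L (outward_normal \<Sigma> x))
      \<ge> (real CARD('n) + 1) * Vol K powr (real CARD('n) / (real CARD('n) + 1))
        * Vol L powr (1 / (real CARD('n) + 1)) \<and>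
     ((LINT x|area_measure \<Sigma>. support_fun L (outward_normal \<Sigma> x))
      = (real CARD('n) + 1) * Vol K powr (real CARD('n) / (real CARD('n) + 1))
        * Vol L powr (1 / (real CARD('n) + 1))
      \<longleftrightarrow> (\<exists>c>0. \<exists>b\<in>wall. K = (\<lambda>x. c *\<^sub>R x + b) ` L))) \<and>
   (\<forall>\<theta> (K :: ((real^'n) \<times> real) set) L k.
    0 < \<theta> \<longrightarrow> \<theta> \<le> pi / 2 \<longrightarrow> K \<in> capillary_convex_bodies \<theta> \<longrightarrow>
    L \<in> capillary_convex_bodies \<theta> \<longrightarrow> k < CARD('n) \<longrightarrow>
     mixed_volume \<theta> (replicate (CARD('n) - k) K @ replicate (k + 1) L)
      \<ge> Vol K powr (real (CARD('n) - k) / (real CARD('n) + 1))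
        * Vol L powr (real (k + 1) / (real CARD('n) + 1)) \<and>
     (mixed_volume \<theta> (replicate (CARD('n) - k) K @ replicate (k + 1) L)
      = Vol K powr (real (CARD('n) - k) / (real CARD('n) + 1))
        * Vol L powr (real (k + 1) / (real CARD('n) + 1))
      \<longleftrightarrow> (\<exists>c>0. \<exists>b\<in>wall. K = (\<lambda>x. c *\<^sub>R x + b) ` L)))"
 using anisotropic_capillary_isoperimetric mixed_volume_inequality by (intro conjI allI impI)

end
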